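(* Let $p$ be a prime, let $G=\mathbb{Z}/p$, and let $X$ be a finite-dimensional $G$-CW-complex. Then: (1) If $H_\bullet(X;\mathbb{Z}/p)\cong H_\bullet(S^n;\mathbb{Z}/p)$ for some $n$, then either $X^G=\emptyset$ or $H_\bullet(X^G;\mathbb{Z}/p)\cong H_\bullet(S^m;\mathbb{Z}/p)$ for some $m$. (2) If $H_\bullet(X;\mathbb{Z}/p)\cong H_\bullet(\mathrm{pt};\mathbb{Z}/p)$, then $H_\bullet(X^G;\mathbb{Z}/p)\cong H_\bullet(\mathrm{pt};\mathbb{Z}/p)$.
   Context: A $G$-CW-complex ($G$ a finite group) is a CW-complex $X$ with a cellular $G$-action such that if $g\in G$ fixes a cell $\sigma$ (i.e. $g\sigma=\sigma$), then $g$ fixes $\sigma$ pointwise; $X^G$ is the fixed point set, a subcomplex of $X$. Isomorphisms are of graded abelian groups, and $\mathrm{pt}$ is the one-point space. *)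

theory Defs
  imports
    "HOL-Homology.Homology"
    "HOL-Algebra.Group_Action"
    "HOL-Computational_Algebra.Primes"
begin

section \<open>Singular homology with coefficients in an abelian group\<close>

text \<open>
  The distribution only has integral singular homology. A singular chain with coefficients in
  an abelian group \<open>A\<close> (written multiplicatively, as a HOL-Algebra structure) is a finitely
  supported family of elements of \<open>A\<close> indexed by the singular simplices.
\<close>

definition coeff_chain_group ::
    "nat \<Rightarrow> 'a topology \<Rightarrow> 'c monoid \<Rightarrow> (((nat \<Rightarrow> real) \<Rightarrow> 'a) \<Rightarrow> 'c) monoid"
  where "coeff_chain_group k X A = sum_group (singular_simplex_set k X) (\<lambda>_. A)"

text \<open>
  The coefficient of \<open>\<tau>\<close> in the boundary of \<open>c = \<Sum> c\<^sub>\<sigma> \<sigma>\<close> is the sum of \<open>(-1)\<^sup>j c\<^sub>\<sigma>\<close> over all \<open>\<sigma>\<close> in the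
  support of \<open>c\<close> and all \<open>j \<le> k\<close> such that \<open>\<tau>\<close> is the \<open>j\<close>-th face of \<open>\<sigma>\<close>. As for
  \<^const>\<open>chain_boundary\<close>, the boundary of a 0-chain is the neutral 0-chain, which makes every
  0-chain a cycle.
\<close>

definition coeff_boundary ::
    "nat \<Rightarrow> 'a topology \<Rightarrow> 'c monoid \<Rightarrow> (((nat \<Rightarrow> real) \<Rightarrow> 'a) \<Rightarrow> 'c) \<Rightarrow> (((nat \<Rightarrow> real) \<Rightarrow> 'a) \<Rightarrow> 'c)"
  where "coeff_boundary k X A c =
    (if k = 0 then \<one>\<^bsub>coeff_chain_group 0 X A\<^esub>
     else (\<lambda>\<tau> \<in> singular_simplex_set (k - 1) X.
       finprod A (\<lambda>(\<sigma>, j). c \<sigma> [^]\<^bsub>A\<^esub> ((- 1) ^ j :: int))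
         {(\<sigma>, j). singular_simplex k X \<sigma> \<and> c \<sigma> \<noteq> \<one>\<^bsub>A\<^esub> \<and> j \<le> k \<and> singular_face k j \<sigma> = \<tau>}))"

definition coeff_homology_group ::
    "nat \<Rightarrow> 'a topology \<Rightarrow> 'c monoid \<Rightarrow> (((nat \<Rightarrow> real) \<Rightarrow> 'a) \<Rightarrow> 'c) set monoid"
  where "coeff_homology_group k X A =
    subgroup_generated (coeff_chain_group k X A)
      (kernel (coeff_chain_group k X A) (coeff_chain_group (k - 1) X A) (coeff_boundary k X A))
    Mod (coeff_boundary (Suc k) X A ` carrier (coeff_chain_group (Suc k) X A))"

definition isomorphic_graded_homology :: "'a topology \<Rightarrow> 'b topology \<Rightarrow> 'c monoid \<Rightarrow> bool"
  where "isomorphic_graded_homology X Y A \<longleftrightarrow>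
    (\<forall>k. coeff_homology_group k X A \<cong> coeff_homology_group k Y A)"

definition point_space :: "unit topology"
  where "point_space = discrete_topology {()}"


section \<open>CW-complexes\<close>

definition unit_disc :: "nat \<Rightarrow> (nat \<Rightarrow> real) topology"
  where "unit_disc n = subtopology (Euclidean_space n) {x. (\<Sum>i<n. (x i)\<^sup>2) \<le> 1}"

definition disc_interior :: "nat \<Rightarrow> (nat \<Rightarrow> real) set"
  where "disc_interior n = {x \<in> topspace (unit_disc n). (\<Sum>i<n. (x i)\<^sup>2) < 1}"

definition disc_boundary :: "nat \<Rightarrow> (nat \<Rightarrow> real) set"
  where "disc_boundary n = {x \<in> topspace (unit_disc n). (\<Sum>i<n. (x i)\<^sup>2) = 1}"

text \<open>
  A CW-structure on \<open>X\<close> in the sense of Whitehead is given by the sets \<open>E n\<close> of its open \<open>n\<close>-cells.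
  Cells are subsets of the space; characteristic maps are required to exist but are not part of
  the structure. The second conjunct of \<open>characteristic_map\<close> includes closure-finiteness.
\<close>

definition characteristic_map ::
    "'a topology \<Rightarrow> (nat \<Rightarrow> 'a set set) \<Rightarrow> nat \<Rightarrow> 'a set \<Rightarrow> ((nat \<Rightarrow> real) \<Rightarrow> 'a) \<Rightarrow> bool"
  where "characteristic_map X E n e \<Phi> \<longleftrightarrow>
    continuous_map (unit_disc n) X \<Phi> \<and>
    (\<exists>F. finite F \<and> F \<subseteq> (\<Union>m<n. E m) \<and> \<Phi> ` disc_boundary n \<subseteq> \<Union>F) \<and>
    homeomorphic_map (subtopology (unit_disc n) (disc_interior n)) (subtopology X e) \<Phi>"

definition CW_complex :: "'a topology \<Rightarrow> (nat \<Rightarrow> 'a set set) \<Rightarrow> bool"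
  where "CW_complex X E \<longleftrightarrow>
    Hausdorff_space X \<and>
    (\<Union>n. \<Union>(E n)) = topspace X \<and>
    (\<forall>m n d e. d \<in> E m \<longrightarrow> e \<in> E n \<longrightarrow> (m, d) \<noteq> (n, e) \<longrightarrow> d \<inter> e = {}) \<and>
    (\<forall>n. \<forall>e \<in> E n. \<exists>\<Phi>. characteristic_map X E n e \<Phi>) \<and>
    (\<forall>A \<subseteq> topspace X.
      (\<forall>n. \<forall>e \<in> E n. closedin X (A \<inter> X closure_of e)) \<longrightarrow> closedin X A)"

definition finite_dimensional :: "(nat \<Rightarrow> 'a set set) \<Rightarrow> bool"
  where "finite_dimensional E \<longleftrightarrow> (\<exists>N. \<forall>n > N. E n = {})"

definition skeleton :: "(nat \<Rightarrow> 'a set set) \<Rightarrow> nat \<Rightarrow> 'a set"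
  where "skeleton E n = (\<Union>m \<le> n. \<Union>(E m))"

definition cellular_map ::
    "'a topology \<Rightarrow> (nat \<Rightarrow> 'a set set) \<Rightarrow> 'b topology \<Rightarrow> (nat \<Rightarrow> 'b set set) \<Rightarrow> ('a \<Rightarrow> 'b) \<Rightarrow> bool"
  where "cellular_map X E Y D f \<longleftrightarrow>
    continuous_map X Y f \<and> (\<forall>n. f ` skeleton E n \<subseteq> skeleton D n)"


section \<open>\<open>G\<close>-CW-complexes\<close>

text \<open>
  Since both \<open>g\<close> and its inverse act by cellular maps, \<open>g\<close> permutes the open \<open>n\<close>-cells for every
  \<open>n\<close>: they are the connected components of the difference of consecutive skeleta.
\<close>

definition G_CW_complex ::
    "'g monoid \<Rightarrow> 'a topology \<Rightarrow> (nat \<Rightarrow> 'a set set) \<Rightarrow> ('g \<Rightarrow> 'a \<Rightarrow> 'a) \<Rightarrow> bool"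
  where "G_CW_complex G X E \<phi> \<longleftrightarrow>
    finite (carrier G) \<and>
    CW_complex X E \<and>
    group_action G (topspace X) \<phi> \<and>
    (\<forall>g \<in> carrier G. cellular_map X E X E (\<phi> g)) \<and>
    (\<forall>g \<in> carrier G. \<forall>n. \<forall>e \<in> E n. \<phi> g ` e = e \<longrightarrow> (\<forall>x \<in> e. \<phi> g x = x))"

definition fixed_points :: "'g monoid \<Rightarrow> 'a topology \<Rightarrow> ('g \<Rightarrow> 'a \<Rightarrow> 'a) \<Rightarrow> 'a set"
  where "fixed_points G X \<phi> = {x \<in> topspace X. \<forall>g \<in> carrier G. \<phi> g x = x}"

end

theory Submission
  imports
    Defs
    "HOL-Library.Extended_Nat"
    "HOL-Analysis.Abstract_Topological_Spaces"
    "HOL-Analysis.Sum_Topology"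
    "HOL-Number_Theory.Residues"
begin

text \<open>
  Smith theory, carried out with singular chains modulo \<open>p\<close>. Let \<open>g\<close> generate \<open>\<int>/p\<close>, let \<open>C\<close> and \<open>F\<close> be the
  chains of \<open>X\<close> and of its fixed point set, and put \<open>\<tau> = 1 - g\<close>, \<open>\<sigma> = 1 + g + \<dots> + g^(p - 1)\<close>. A simplex not
  lying in the fixed point set has a free orbit, so on \<open>C / F\<close> the kernel of \<open>\<tau>\<close> is the image of \<open>\<sigma>\<close>
  and conversely. For each of the two operators \<open>\<rho>\<close>, with the other one denoted \<open>\<rho>'\<close>, the exact sequence
  \<open>0 \<rightarrow> F \<oplus> \<rho>' C \<rightarrow> C \<rightarrow> \<rho> C \<rightarrow> 0\<close> gives
  \<open>|H\<^sub>k(F)| |H\<^sub>k(\<rho> C)| \<le> |H\<^sub>k(C)| |H\<^bsub>k+1\<^esub>(\<rho>' C)|\<close>. Attaching the free cells of \<open>X\<close> dimension by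
  dimension shows that \<open>H\<^sub>k(\<rho> C)\<close> vanishes for large \<open>k\<close>, and Floyd's inequality
  \<open>\<Prod>|H\<^sub>k(F)| \<le> \<Prod>|H\<^sub>k(C)|\<close> follows. Hence the reduced homology of a nonempty fixed point set has
  order \<open>1\<close> if \<open>X\<close> is a mod \<open>p\<close> point, and order \<open>1\<close> or \<open>p\<close> if \<open>X\<close> is a mod \<open>p\<close> sphere.

  In the cases to be excluded, \<open>H(C / F)\<close> is a single group of order \<open>p\<close>, on which \<open>g\<close> acts trivially by
  Fermat's theorem. Then \<open>\<tau>\<close> and \<open>\<sigma>\<close> vanish on it, and the exact sequences force it to be trivial.
\<close>

section \<open>Smith theory of chain complexes\<close>


text \<open>Quotient complexes are not formed. Every chain group is a subgroup of the integral
  chains, chains modulo p being integral chains modulo \<open>P\<close> = p C, and H(B / A) enters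
  only through its order, the order of relative cycles modulo relative boundaries. Orders replace
  dimensions in Floyd's inequality. They suffice at the end, since an abelian group of exponent p
  and of order 1, p or p^2 is determined by its order.

  The obstacle is the vanishing of H_k(\<rho> C) for large k. Singular chains live in all degrees,
  so the dimension of X has to enter through geometry: excision and a radial retraction reduce the
  attachment of free n-cells to a disjoint union of open cells relative to the same cells without
  their centres. There \<sigma> C is a copy of the chains of one cell per orbit, whose relative
  homology vanishes in large degrees.

  The cases to be excluded are an empty fixed point set in a mod p point and a mod p acyclic one in
  a mod p sphere. A congruence of Euler characteristics modulo p would exclude them as well; the
  long exact sequences already at hand do it directly.\<close>

definition ab_subgroup :: "'b::ab_group_add set \<Rightarrow> bool"
  where "ab_subgroup A \<longleftrightarrow> 0 \<in> A \<and> (\<forall>x\<in>A. \<forall>y\<in>A. x - y \<in> A)"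

lemma ab_subgroup_0: "ab_subgroup A \<Longrightarrow> 0 \<in> A"
  by (simp add: ab_subgroup_def)

lemma ab_subgroup_diff: "ab_subgroup A \<Longrightarrow> x \<in> A \<Longrightarrow> y \<in> A \<Longrightarrow> x - y \<in> A"
  by (simp add: ab_subgroup_def)

lemma ab_subgroup_minus: "ab_subgroup A \<Longrightarrow> x \<in> A \<Longrightarrow> - x \<in> A"
  using ab_subgroup_diff[of A 0 x] by (simp add: ab_subgroup_0)

lemma ab_subgroup_add: "ab_subgroup A \<Longrightarrow> x \<in> A \<Longrightarrow> y \<in> A \<Longrightarrow> x + y \<in> A"
  using ab_subgroup_diff[of A x "- y"] by (simp add: ab_subgroup_minus)

lemma ab_subgroup_sum: "ab_subgroup A \<Longrightarrow> (\<And>i. i \<in> I \<Longrightarrow> f i \<in> A) \<Longrightarrow> sum f I \<in> A"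
  by (induction I rule: infinite_finite_induct) (auto simp: ab_subgroup_0 ab_subgroup_add)

lemma ab_subgroup_diff_iff: "ab_subgroup A \<Longrightarrow> x - y \<in> A \<Longrightarrow> x \<in> A \<longleftrightarrow> y \<in> A"
  using ab_subgroup_diff[of A x "x - y"] ab_subgroup_add[of A "x - y" y] by auto

lemma ab_subgroup_diff_commute: "ab_subgroup A \<Longrightarrow> x - y \<in> A \<longleftrightarrow> y - x \<in> A"
  using ab_subgroup_minus[of A "x - y"] ab_subgroup_minus[of A "y - x"] by auto

lemma ab_subgroup_diff_trans:
  "ab_subgroup A \<Longrightarrow> x - y \<in> A \<Longrightarrow> y - z \<in> A \<Longrightarrow> x - z \<in> A"
  using ab_subgroup_add[of A "x - y" "y - z"] by simp

text \<open>The value \<infinity> lets Floyd's inequality be stated before any homology group is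
  known to be finite.\<close>

definition ecard :: "'c set \<Rightarrow> enat"
  where "ecard A = (if finite A then enat (card A) else \<infinity>)"

lemma ecard_inj_le:
  assumes "inj_on f A" "f ` A \<subseteq> B"
  shows "ecard A \<le> ecard B"
  using assms by (auto simp: ecard_def card_inj_on_le inj_on_finite)

lemma ecard_bij:
  assumes "bij_betw f A B"
  shows "ecard A = ecard B"
  using bij_betw_finite[OF assms] bij_betw_same_card[OF assms] by (simp add: ecard_def)

lemma ecard_Times:
  assumes "A \<noteq> {}" "B \<noteq> {}"
  shows "ecard (A \<times> B) = ecard A * ecard B"
  using assms by (auto simp: ecard_def finite_cartesian_product_iff card_cartesian_product
      imult_is_infinity zero_enat_def)

definition ab_coset :: "'b::ab_group_add set \<Rightarrow> 'b \<Rightarrow> 'b set"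
  where "ab_coset S t = {x. x - t \<in> S}"

text \<open>The set \<open>S\<close> need not be contained in \<open>T\<close>; the order is that of \<open>T / (S \<inter> T)\<close>.\<close>

definition quotient_order :: "'b::ab_group_add set \<Rightarrow> 'b set \<Rightarrow> enat"
  where "quotient_order T S = ecard (ab_coset S ` T)"

lemma ab_coset_eq_iff:
  assumes "ab_subgroup S"
  shows "ab_coset S s = ab_coset S t \<longleftrightarrow> s - t \<in> S"
proof
  assume eq: "ab_coset S s = ab_coset S t"
  have "s \<in> ab_coset S s" using ab_subgroup_0[OF assms] by (simp add: ab_coset_def)
  then have "s \<in> ab_coset S t" by (simp only: eq)
  then show "s - t \<in> S" by (simp add: ab_coset_def)
next
  assume "s - t \<in> S"
  then show "ab_coset S s = ab_coset S t"
    using ab_subgroup_diff_trans[OF assms] ab_subgroup_diff_commute[OF assms]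
    unfolding ab_coset_def by blast
qed

text \<open>The map f may come from arbitrary choices, for example of preimages under a boundary or
  under r. Composed with a choice of representatives it embeds T / S into the cosets of S', because
  only differences of its values are compared.\<close>

lemma quotient_order_le:
  assumes S: "ab_subgroup S" and S': "ab_subgroup S'"
    and f: "\<And>t. t \<in> T \<Longrightarrow> f t \<in> T'"
    and inj: "\<And>s t. s \<in> T \<Longrightarrow> t \<in> T \<Longrightarrow> f s - f t \<in> S' \<Longrightarrow> s - t \<in> S"
  shows "quotient_order T S \<le> quotient_order T' S'"
proof -
  define c where "c = inv_into T (ab_coset S)"
  have c: "c a \<in> T" "ab_coset S (c a) = a" if "a \<in> ab_coset S ` T" for a
    using inv_into_into[OF that] f_inv_into_f[OF that] by (simp_all add: c_def)
  have "inj_on (\<lambda>a. ab_coset S' (f (c a))) (ab_coset S ` T)"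
  proof (rule inj_onI)
    fix a b assume ab: "a \<in> ab_coset S ` T" "b \<in> ab_coset S ` T"
      "ab_coset S' (f (c a)) = ab_coset S' (f (c b))"
    have "c a - c b \<in> S"
      using inj[OF c(1)[OF ab(1)] c(1)[OF ab(2)]] ab(3) by (simp add: ab_coset_eq_iff[OF S'])
    then have "ab_coset S (c a) = ab_coset S (c b)" by (simp add: ab_coset_eq_iff[OF S])
    then show "a = b" using c ab by simp
  qed
  moreover have "(\<lambda>a. ab_coset S' (f (c a))) ` (ab_coset S ` T) \<subseteq> ab_coset S' ` T'"
    using f[OF c(1)] by auto
  ultimately show ?thesis unfolding quotient_order_def by (rule ecard_inj_le)
qed

text \<open>If c chooses representatives of T / M and d representatives of M / S, the sums of their
  values represent each class of T / S exactly once.\<close>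

lemma quotient_order_mult:
  assumes S: "ab_subgroup S" and M: "ab_subgroup M" and T: "ab_subgroup T"
    and "S \<subseteq> M" "M \<subseteq> T"
  shows "quotient_order T S = quotient_order T M * quotient_order M S"
proof -
  let ?q = "ab_coset S" and ?m = "ab_coset M"
  define c where "c = inv_into T ?m"
  define d where "d = inv_into M ?q"
  have c: "c a \<in> T" "?m (c a) = a" if "a \<in> ?m ` T" for a
    using inv_into_into[OF that] f_inv_into_f[OF that] by (simp_all add: c_def)
  have d: "d a \<in> M" "?q (d a) = a" if "a \<in> ?q ` M" for a
    using inv_into_into[OF that] f_inv_into_f[OF that] by (simp_all add: d_def)
  have "bij_betw (\<lambda>x. ?q (c (fst x) + d (snd x))) (?m ` T \<times> ?q ` M) (?q ` T)"
  proof (rule bij_betwI')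
    fix x y assume xy: "x \<in> ?m ` T \<times> ?q ` M" "y \<in> ?m ` T \<times> ?q ` M"
    obtain a b a' b' where ab: "x = (a, b)" "y = (a', b')" by fastforce
    have mem: "a \<in> ?m ` T" "a' \<in> ?m ` T" "b \<in> ?q ` M" "b' \<in> ?q ` M" using xy ab by auto
    have "a = a' \<and> b = b'" if "?q (c a + d b) = ?q (c a' + d b')"
    proof -
      have s: "(c a + d b) - (c a' + d b') \<in> S" using that by (simp add: ab_coset_eq_iff[OF S])
      have "d b - d b' \<in> M" using ab_subgroup_diff[OF M] d(1) mem by simp
      then have "((c a + d b) - (c a' + d b')) - (d b - d b') \<in> M"
        using ab_subgroup_diff[OF M] s \<open>S \<subseteq> M\<close> by blast
      then have "c a - c a' \<in> M" by (simp add: algebra_simps)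
      then have "?m (c a) = ?m (c a')" by (simp add: ab_coset_eq_iff[OF M])
      then have "a = a'" using c mem by simp
      then have "d b - d b' \<in> S" using s by simp
      then have "?q (d b) = ?q (d b')" by (simp add: ab_coset_eq_iff[OF S])
      then show ?thesis using d mem \<open>a = a'\<close> by simp
    qed
    then show "(?q (c (fst x) + d (snd x)) = ?q (c (fst y) + d (snd y))) = (x = y)"
      by (auto simp: ab)
  next
    fix x assume "x \<in> ?m ` T \<times> ?q ` M"
    then have "fst x \<in> ?m ` T" "snd x \<in> ?q ` M" by auto
    then have "c (fst x) \<in> T" "d (snd x) \<in> T" using c(1) d(1) \<open>M \<subseteq> T\<close> by blast+
    then show "?q (c (fst x) + d (snd x)) \<in> ?q ` T" using ab_subgroup_add[OF T] by simp
  next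
    fix z assume "z \<in> ?q ` T"
    then obtain t where t: "t \<in> T" "z = ?q t" by blast
    define u where "u = t - c (?m t)"
    have 1: "?m t \<in> ?m ` T" using t by blast
    have "?m t = ?m (c (?m t))" using c(2)[OF 1] by simp
    then have "u \<in> M" using ab_coset_eq_iff[OF M] by (simp add: u_def)
    then have 2: "?q u \<in> ?q ` M" by blast
    have "d (?q u) - u \<in> S" using d(2)[OF 2] by (simp add: ab_coset_eq_iff[OF S, symmetric])
    then have "(c (?m t) + d (?q u)) - t \<in> S" by (simp add: u_def algebra_simps)
    then have "z = ?q (c (?m t) + d (?q u))" using t by (simp add: ab_coset_eq_iff[OF S, symmetric])
    then show "\<exists>x\<in>?m ` T \<times> ?q ` M. z = ?q (c (fst x) + d (snd x))"
      by (intro bexI[of _ "(?m t, ?q u)"]) (use 1 2 in auto)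
  qed
  moreover have "?m ` T \<noteq> {}" "?q ` M \<noteq> {}" using ab_subgroup_0[OF T] ab_subgroup_0[OF M] by auto
  ultimately show ?thesis unfolding quotient_order_def
    by (simp add: ecard_bij[symmetric] ecard_Times)
qed

lemma quotient_order_pos:
  assumes "ab_subgroup T"
  shows "quotient_order T S \<ge> 1"
proof -
  have "ab_coset S ` T \<noteq> {}" using ab_subgroup_0[OF assms] by blast
  then have "card (ab_coset S ` T) \<ge> 1" if "finite (ab_coset S ` T)"
    using that by (simp add: Suc_le_eq card_gt_0_iff)
  then show ?thesis by (simp add: quotient_order_def ecard_def one_enat_def)
qed

lemma ecard_eq_1_iff: "ecard A = 1 \<longleftrightarrow> (\<exists>a. A = {a})"
  by (auto simp: ecard_def one_enat_def card_1_singleton_iff)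

lemma quotient_order_1_iff:
  assumes T: "ab_subgroup T" and S: "ab_subgroup S"
  shows "quotient_order T S = 1 \<longleftrightarrow> T \<subseteq> S"
proof -
  have "(\<exists>a. ab_coset S ` T = {a}) \<longleftrightarrow> T \<subseteq> S"
  proof
    assume "\<exists>a. ab_coset S ` T = {a}"
    then have "ab_coset S t = ab_coset S 0" if "t \<in> T" for t
      using that ab_subgroup_0[OF T] by (metis imageI singletonD)
    then show "T \<subseteq> S" by (auto simp: ab_coset_eq_iff[OF S])
  next
    assume "T \<subseteq> S"
    then have "ab_coset S t = ab_coset S 0" if "t \<in> T" for t
      using that by (auto simp: ab_coset_eq_iff[OF S])
    then have "ab_coset S ` T \<subseteq> {ab_coset S 0}" by blast
    moreover have "ab_coset S ` T \<noteq> {}" using ab_subgroup_0[OF T] by blast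
    ultimately have "ab_coset S ` T = {ab_coset S 0}" by (simp add: subset_singleton_iff)
    then show "\<exists>a. ab_coset S ` T = {a}" by blast
  qed
  then show ?thesis by (simp add: quotient_order_def ecard_eq_1_iff)
qed

section \<open>Relative cycles and boundaries of a pair of complexes\<close>

type_synonym 'b family = "nat \<Rightarrow> 'b set"

text \<open>For a complex pair, \<open>rel_cycles\<close> and \<open>rel_boundaries\<close> are the
  preimages in B of the cycles and boundaries of B / A. In degree 0 truncated subtraction gives k -
  1 = 0; this is harmless because \<open>complex_pair\<close> has bd 0 = 0, so that every element of
  B 0 is a relative cycle.\<close>

definition rel_cycles :: "(nat \<Rightarrow> 'b::ab_group_add \<Rightarrow> 'b) \<Rightarrow> 'b family \<Rightarrow> 'b family \<Rightarrow> nat \<Rightarrow> 'b set"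
  where "rel_cycles bd B A k = {x \<in> B k. bd k x \<in> A (k - 1)}"

definition rel_boundaries :: "(nat \<Rightarrow> 'b::ab_group_add \<Rightarrow> 'b) \<Rightarrow> 'b family \<Rightarrow> 'b family \<Rightarrow> nat \<Rightarrow> 'b set"
  where "rel_boundaries bd B A k = {x. \<exists>y\<in>B (Suc k). x - bd (Suc k) y \<in> A k}"

definition homology_order :: "(nat \<Rightarrow> 'b::ab_group_add \<Rightarrow> 'b) \<Rightarrow> 'b family \<Rightarrow> 'b family \<Rightarrow> nat \<Rightarrow> enat"
  where "homology_order bd B A k = quotient_order (rel_cycles bd B A k) (rel_boundaries bd B A k)"

definition acyclic_at :: "(nat \<Rightarrow> 'b::ab_group_add \<Rightarrow> 'b) \<Rightarrow> 'b family \<Rightarrow> 'b family \<Rightarrow> nat \<Rightarrow> bool"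
  where "acyclic_at bd B A k \<longleftrightarrow> rel_cycles bd B A k \<subseteq> rel_boundaries bd B A k"

text \<open>The preimage in C of r(C / D). The homology of \<open>image_plus C D r\<close> relative
  to D is what the overview calls the homology of \<rho> C.\<close>

definition image_plus :: "'b::ab_group_add family \<Rightarrow> 'b family \<Rightarrow> (nat \<Rightarrow> 'b \<Rightarrow> 'b) \<Rightarrow> 'b family"
  where "image_plus C D r k = {x. \<exists>c\<in>C k. x - r k c \<in> D k}"

lemma acyclic_atD:
  assumes "acyclic_at bd B A k" "x \<in> B k" "bd k x \<in> A (k - 1)"
  obtains y where "y \<in> B (Suc k)" "x - bd (Suc k) y \<in> A k"
  using assms unfolding acyclic_at_def rel_cycles_def rel_boundaries_def by blast

lemma acyclic_atI:
  assumes "\<And>x. x \<in> B k \<Longrightarrow> bd k x \<in> A (k - 1) \<Longrightarrow> \<exists>y\<in>B (Suc k). x - bd (Suc k) y \<in> A k"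
  shows "acyclic_at bd B A k"
  using assms unfolding acyclic_at_def rel_cycles_def rel_boundaries_def by blast

text \<open>Subgroup families \<open>D \<subseteq> C\<close> of a chain complex \<open>bd\<close>; the quotient \<open>C / D\<close> is the complex of interest.\<close>

locale complex_pair =
  fixes bd :: "nat \<Rightarrow> 'b::ab_group_add \<Rightarrow> 'b" and C D :: "'b family"
  assumes sub_C: "ab_subgroup (C k)" and sub_D: "ab_subgroup (D k)"
    and D_le_C: "D k \<subseteq> C k"
    and bd_diff: "bd k (x - y) = bd k x - bd k y"
    and bd_0: "bd 0 x = 0"
    and bd_C: "x \<in> C k \<Longrightarrow> bd k x \<in> C (k - 1)"
    and bd_D: "x \<in> D k \<Longrightarrow> bd k x \<in> D (k - 1)"
    and bd_bd: "x \<in> C (Suc k) \<Longrightarrow> bd k (bd (Suc k) x) = 0"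
begin

lemmas C_simps = ab_subgroup_0[OF sub_C] ab_subgroup_diff[OF sub_C] ab_subgroup_add[OF sub_C]
  ab_subgroup_minus[OF sub_C]
lemmas D_simps = ab_subgroup_0[OF sub_D] ab_subgroup_diff[OF sub_D] ab_subgroup_add[OF sub_D]
  ab_subgroup_minus[OF sub_D]

lemma D_C: "x \<in> D k \<Longrightarrow> x \<in> C k"
  using D_le_C by blast

lemma bd_zero [simp]: "bd k 0 = 0"
  using bd_diff[of k 0 0] by simp

lemma bd_add: "bd k (x + y) = bd k x + bd k y"
  using bd_diff[of k x "0 - y"] bd_diff[of k 0 y] by simp

lemma bd_Suc_C: "x \<in> C (Suc k) \<Longrightarrow> bd (Suc k) x \<in> C k"
  using bd_C by fastforce

lemma bd_Suc_D: "x \<in> D (Suc k) \<Longrightarrow> bd (Suc k) x \<in> D k"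
  using bd_D by fastforce

lemma sub_rel_cycles: "ab_subgroup (rel_cycles bd C D k)"
  by (auto simp: ab_subgroup_def rel_cycles_def bd_diff C_simps D_simps)

lemma sub_rel_boundaries: "ab_subgroup (rel_boundaries bd C D k)"
  unfolding ab_subgroup_def
proof (intro conjI ballI)
  show "0 \<in> rel_boundaries bd C D k"
    unfolding rel_boundaries_def using C_simps(1)[of "Suc k"] D_simps(1)[of k] by force
next
  fix x y assume "x \<in> rel_boundaries bd C D k" "y \<in> rel_boundaries bd C D k"
  then obtain u v where "u \<in> C (Suc k)" "v \<in> C (Suc k)" "x - bd (Suc k) u \<in> D k" "y - bd (Suc k) v \<in> D k"
    unfolding rel_boundaries_def by blast
  then have "u - v \<in> C (Suc k)" "(x - bd (Suc k) u) - (y - bd (Suc k) v) \<in> D k"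
    by (simp_all add: C_simps D_simps)
  then show "x - y \<in> rel_boundaries bd C D k"
    unfolding rel_boundaries_def by (intro CollectI bexI[of _ "u - v"]) (simp_all add: bd_diff algebra_simps)
qed

lemma rel_boundaries_le_rel_cycles: "rel_boundaries bd C D k \<subseteq> rel_cycles bd C D k"
proof
  fix x assume "x \<in> rel_boundaries bd C D k"
  then obtain y where y: "y \<in> C (Suc k)" "x - bd (Suc k) y \<in> D k"
    unfolding rel_boundaries_def by blast
  have x: "x = (x - bd (Suc k) y) + bd (Suc k) y" by simp
  have "x \<in> C k" using y bd_Suc_C D_C C_simps x by metis
  moreover have "bd k x \<in> D (k - 1)"
    using bd_D[OF y(2)] by (simp add: bd_diff bd_bd[OF y(1)])
  ultimately show "x \<in> rel_cycles bd C D k" by (simp add: rel_cycles_def)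
qed

lemma D_rel_boundaries: "x \<in> D k \<Longrightarrow> x \<in> rel_boundaries bd C D k"
  unfolding rel_boundaries_def using C_simps(1)[of "Suc k"] by (intro CollectI bexI[of _ 0]) simp_all

lemma homology_order_eq_1_iff: "homology_order bd C D k = 1 \<longleftrightarrow> acyclic_at bd C D k"
  by (simp add: homology_order_def acyclic_at_def quotient_order_1_iff sub_rel_cycles sub_rel_boundaries)

lemma homology_order_pos: "homology_order bd C D k \<ge> 1"
  by (simp add: homology_order_def quotient_order_pos sub_rel_cycles)

end

section \<open>Long exact sequences of a Smith pair\<close>

text \<open>
  Smith's situation: \<open>r\<close> and \<open>r'\<close> are \<open>1 - g\<close> and \<open>1 + g + \<dots> + g^(p - 1)\<close> in either order, and
  the last two assumptions express that \<open>C / D\<close> is a complex of free modules over the group ring.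
\<close>

locale smith_pair = complex_pair bd C D
  for bd :: "nat \<Rightarrow> 'b::ab_group_add \<Rightarrow> 'b" and C D :: "'b family" +
  fixes r r' :: "nat \<Rightarrow> 'b \<Rightarrow> 'b"
  assumes r_diff: "r k (x - y) = r k x - r k y" and r'_diff: "r' k (x - y) = r' k x - r' k y"
    and r_C: "x \<in> C k \<Longrightarrow> r k x \<in> C k" and r'_C: "x \<in> C k \<Longrightarrow> r' k x \<in> C k"
    and r_D: "x \<in> D k \<Longrightarrow> r k x \<in> D k" and r'_D: "x \<in> D k \<Longrightarrow> r' k x \<in> D k"
    and bd_r: "x \<in> C k \<Longrightarrow> bd k (r k x) = r (k - 1) (bd k x)"
    and bd_r': "x \<in> C k \<Longrightarrow> bd k (r' k x) = r' (k - 1) (bd k x)"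
    and exact_r: "x \<in> C k \<Longrightarrow> r k x \<in> D k \<longleftrightarrow> x \<in> image_plus C D r' k"
    and exact_r': "x \<in> C k \<Longrightarrow> r' k x \<in> D k \<longleftrightarrow> x \<in> image_plus C D r k"
begin

lemma swap: "smith_pair bd C D r' r"
  by unfold_locales (use r_diff r'_diff r_C r'_C r_D r'_D bd_r bd_r' exact_r exact_r' in auto)

lemma r_add: "r k (x + y) = r k x + r k y"
  using r_diff[of k x "0 - y"] r_diff[of k 0 y] r_diff[of k 0 0] by simp

lemma image_plus_C: "x \<in> image_plus C D r k \<Longrightarrow> x \<in> C k"
  unfolding image_plus_def using r_C D_C C_simps(3)[of "x - _" k] by fastforce

lemma D_image_plus: "x \<in> D k \<Longrightarrow> x \<in> image_plus C D r k"
  unfolding image_plus_def using C_simps(1)[of k] r_diff[of k 0 0] by force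

lemma r_image_plus: "x \<in> C k \<Longrightarrow> r k x \<in> image_plus C D r k"
  unfolding image_plus_def using D_simps(1)[of k] by force

lemma sub_image_plus: "ab_subgroup (image_plus C D r k)"
  unfolding ab_subgroup_def
proof (intro conjI ballI)
  show "0 \<in> image_plus C D r k" by (simp add: D_image_plus D_simps)
next
  fix x y assume "x \<in> image_plus C D r k" "y \<in> image_plus C D r k"
  then obtain u v where "u \<in> C k" "v \<in> C k" "x - r k u \<in> D k" "y - r k v \<in> D k"
    unfolding image_plus_def by blast
  then have "u - v \<in> C k" "(x - r k u) - (y - r k v) \<in> D k"
    by (simp_all add: C_simps D_simps)
  then show "x - y \<in> image_plus C D r k"
    unfolding image_plus_def by (intro CollectI bexI[of _ "u - v"]) (simp_all add: r_diff algebra_simps)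
qed

lemma bd_image_plus: "x \<in> image_plus C D r k \<Longrightarrow> bd k x \<in> image_plus C D r (k - 1)"
proof -
  assume "x \<in> image_plus C D r k"
  then obtain c where c: "c \<in> C k" "x - r k c \<in> D k" unfolding image_plus_def by blast
  from bd_D[OF c(2)] show ?thesis
    unfolding image_plus_def by (intro CollectI bexI[OF _ bd_C[OF c(1)]]) (simp add: bd_diff bd_r[OF c(1)])
qed

lemma image_pair: "complex_pair bd (image_plus C D r) D"
  by unfold_locales
    (auto simp: sub_image_plus sub_D D_image_plus bd_diff bd_0 bd_image_plus bd_D bd_bd image_plus_C
      simp del: One_nat_def)

lemma coimage_pair: "complex_pair bd C (image_plus C D r)"
  by unfold_locales
    (auto simp: sub_image_plus sub_C D_image_plus bd_diff bd_0 bd_image_plus bd_C bd_bd image_plus_C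
      simp del: One_nat_def)

text \<open>Up to \<open>D\<close>, the complex \<open>r C\<close> is isomorphic to \<open>C / r' C\<close> via \<open>r\<close>.\<close>

lemma acyclic_image_up:
  assumes ac: "acyclic_at bd C D k"
    and prev: "k = 0 \<or> acyclic_at bd (image_plus C D r') D (k - 1)"
  shows "acyclic_at bd (image_plus C D r) D k"
proof (rule acyclic_atI)
  interpret s: smith_pair bd C D r' r by (rule swap)
  fix x assume x: "x \<in> image_plus C D r k" "bd k x \<in> D (k - 1)"
  obtain c where c: "c \<in> C k" "x - r k c \<in> D k" using x(1) unfolding image_plus_def by blast
  have "bd k x - bd k (x - r k c) \<in> D (k - 1)" using x(2) bd_D[OF c(2)] D_simps by blast
  then have "r (k - 1) (bd k c) \<in> D (k - 1)" by (simp add: bd_diff bd_r[OF c(1)])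
  then have bc: "bd k c \<in> image_plus C D r' (k - 1)" using exact_r[OF bd_C[OF c(1)]] by blast
  \<comment> \<open>Acyclicity of r'(C / D) one degree below makes the cycle bd k c bound there.
    Then c - e is a relative cycle with the same image under r modulo D. In degree 0 the boundary is
    0 and e = 0 works.\<close>
  obtain e where e: "e \<in> image_plus C D r' k" "bd k c - bd k e \<in> D (k - 1)"
  proof (cases "k = 0")
    case True
    then show ?thesis using that[of 0] s.D_image_plus[OF D_simps(1)] by (simp add: bd_0 D_simps)
  next
    case False
    then obtain j where k: "k = Suc j" using not0_implies_Suc by blast
    have "bd (k - 1) (bd k c) \<in> D (k - 1 - 1)" using bd_bd c k by (simp add: D_simps)
    with prev False bc obtain e where "e \<in> image_plus C D r' (Suc (k - 1))" "bd k c - bd (Suc (k - 1)) e \<in> D (k - 1)"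
      by (auto elim: acyclic_atD)
    then show ?thesis using that k by simp
  qed
  have eC: "e \<in> C k" using e(1) s.image_plus_C by blast
  obtain y where y: "y \<in> C (Suc k)" "c - e - bd (Suc k) y \<in> D k"
  proof (rule acyclic_atD[OF ac])
    show "c - e \<in> C k" using c eC C_simps(2) by blast
    show "bd k (c - e) \<in> D (k - 1)" using e by (simp add: bd_diff)
  qed (use that in blast)
  have "r k (c - e - bd (Suc k) y) \<in> D k" using r_D y by blast
  moreover have "r k e \<in> D k" using exact_r[OF eC] e by blast
  ultimately have "(x - r k c) + (r k (c - e - bd (Suc k) y) + r k e) \<in> D k"
    using c(2) D_simps(3) by blast
  then have "x - bd (Suc k) (r (Suc k) y) \<in> D k"
    by (simp add: r_diff bd_r[OF y(1)])
  then show "\<exists>y\<in>image_plus C D r (Suc k). x - bd (Suc k) y \<in> D k"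
    using r_image_plus[OF y(1)] by blast
qed

text \<open>The same exact sequence, read from the top: x bounds some c in C / D, and r c is a cycle
  of r(C / D) one degree higher. Bounding r c there allows c to be changed by a boundary so that it
  falls into the image of r'.\<close>

lemma acyclic_image_down:
  assumes ac: "acyclic_at bd C D k"
    and nxt: "acyclic_at bd (image_plus C D r) D (Suc k)"
  shows "acyclic_at bd (image_plus C D r') D k"
proof (rule acyclic_atI)
  interpret s: smith_pair bd C D r' r by (rule swap)
  fix x assume x: "x \<in> image_plus C D r' k" "bd k x \<in> D (k - 1)"
  obtain c where c: "c \<in> C (Suc k)" "x - bd (Suc k) c \<in> D k"
    using acyclic_atD[OF ac s.image_plus_C[OF x(1)] x(2)] by blast
  have "x - (x - bd (Suc k) c) \<in> image_plus C D r' k"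
    using x(1) s.D_image_plus[OF c(2)] ab_subgroup_diff[OF s.sub_image_plus] by blast
  then have rb: "r k (bd (Suc k) c) \<in> D k" using exact_r[OF bd_Suc_C[OF c(1)]] by simp
  obtain z where z: "z \<in> image_plus C D r (Suc (Suc k))" "r (Suc k) c - bd (Suc (Suc k)) z \<in> D (Suc k)"
  proof (rule acyclic_atD[OF nxt])
    show "r (Suc k) c \<in> image_plus C D r (Suc k)" by (rule r_image_plus[OF c(1)])
    show "bd (Suc k) (r (Suc k) c) \<in> D (Suc k - 1)" using rb by (simp add: bd_r[OF c(1)])
  qed (use that in blast)
  obtain w where w: "w \<in> C (Suc (Suc k))" "z - r (Suc (Suc k)) w \<in> D (Suc (Suc k))"
    using z(1) unfolding image_plus_def by blast
  have "(r (Suc k) c - bd (Suc (Suc k)) z) + bd (Suc (Suc k)) (z - r (Suc (Suc k)) w) \<in> D (Suc k)"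
    using z(2) bd_Suc_D[OF w(2)] D_simps by blast
  then have "r (Suc k) (c - bd (Suc (Suc k)) w) \<in> D (Suc k)"
    using bd_r[OF w(1)] by (simp add: bd_diff r_diff)
  then have "c - bd (Suc (Suc k)) w \<in> image_plus C D r' (Suc k)"
    using exact_r[OF C_simps(2)[OF c(1) bd_Suc_C[OF w(1)]]] by simp
  moreover have "bd (Suc k) (c - bd (Suc (Suc k)) w) = bd (Suc k) c"
    by (simp add: bd_diff bd_bd[OF w(1)])
  ultimately show "\<exists>y\<in>image_plus C D r' (Suc k). x - bd (Suc k) y \<in> D k"
    using c(2) by (intro bexI[of _ "c - bd (Suc (Suc k)) w"]) simp_all
qed

end

text \<open>Both images are treated at once, since \<open>acyclic_image_up\<close> obtains each of
  them in degree k from the other one in degree k - 1.\<close>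

lemma (in smith_pair) acyclic_image:
  assumes "\<And>k. acyclic_at bd C D k"
  shows "acyclic_at bd (image_plus C D r) D k" "acyclic_at bd (image_plus C D r') D k"
proof -
  interpret s: smith_pair bd C D r' r by (rule swap)
  have "acyclic_at bd (image_plus C D r) D k \<and> acyclic_at bd (image_plus C D r') D k"
  proof (induction k)
    case 0
    then show ?case using acyclic_image_up[OF assms] s.acyclic_image_up[OF assms] by blast
  next
    case (Suc k)
    then show ?case using acyclic_image_up[OF assms, of "Suc k"] s.acyclic_image_up[OF assms, of "Suc k"] by simp
  qed
  then show "acyclic_at bd (image_plus C D r) D k" "acyclic_at bd (image_plus C D r') D k" by auto
qed

text \<open>Assumption \<open>triv\<close> holds if the homology has order \<open>p\<close>, since then the group acts trivially on it.\<close>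

lemma (in smith_pair) acyclic_image_middle:
  assumes triv: "\<And>x. x \<in> rel_cycles bd C D n \<Longrightarrow> r n x \<in> rel_boundaries bd C D n"
    and below: "n = 0 \<or> acyclic_at bd (image_plus C D r') D (n - 1)"
    and above: "acyclic_at bd (image_plus C D r') D (Suc n)"
  shows "acyclic_at bd (image_plus C D r) D n"
proof (rule acyclic_atI)
  interpret s: smith_pair bd C D r' r by (rule swap)
  fix x assume x: "x \<in> image_plus C D r n" "bd n x \<in> D (n - 1)"
  obtain c where c: "c \<in> C n" "x - r n c \<in> D n" using x(1) unfolding image_plus_def by blast
  have "bd n x - bd n (x - r n c) \<in> D (n - 1)" using x(2) bd_D[OF c(2)] D_simps by blast
  then have "r (n - 1) (bd n c) \<in> D (n - 1)" by (simp add: bd_diff bd_r[OF c(1)])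
  then have bc: "bd n c \<in> image_plus C D r' (n - 1)" using exact_r[OF bd_C[OF c(1)]] by blast
  obtain e where e: "e \<in> image_plus C D r' n" "bd n c - bd n e \<in> D (n - 1)"
  proof (cases "n = 0")
    case True
    then show ?thesis using that[of 0] s.D_image_plus[OF D_simps(1)] by (simp add: bd_0 D_simps)
  next
    case False
    then obtain j where k: "n = Suc j" using not0_implies_Suc by blast
    have "bd (n - 1) (bd n c) \<in> D (n - 1 - 1)" using bd_bd c k by (simp add: D_simps)
    with below False bc obtain e where "e \<in> image_plus C D r' (Suc (n - 1))" "bd n c - bd (Suc (n - 1)) e \<in> D (n - 1)"
      by (auto elim: acyclic_atD)
    then show ?thesis using that k by simp
  qed
  have eC: "e \<in> C n" using e(1) s.image_plus_C by blast
  have re: "r n e \<in> D n" using exact_r[OF eC] e by blast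
  \<comment> \<open>This relative cycle may fail to bound in C / D, but by \<open>triv\<close> its
    image under r does.\<close>
  have "c - e \<in> rel_cycles bd C D n" using c eC e by (simp add: rel_cycles_def C_simps bd_diff)
  then obtain y where y: "y \<in> C (Suc n)" "r n (c - e) - bd (Suc n) y \<in> D n"
    using triv unfolding rel_boundaries_def by blast
  have "(x - r n c) + (r n e + (r n (c - e) - bd (Suc n) y)) \<in> D n"
    using c(2) re y(2) D_simps(3) by blast
  then have xy: "x - bd (Suc n) y \<in> D n" by (simp add: r_diff)
  \<comment> \<open>So far y lies only in C. Its boundary is in the image of r, so r' y is a cycle
    of r'(C / D) in degree n + 1; as that cycle bounds, y can be changed by a boundary into an
    element of the image of r.\<close>
  have "x - (x - bd (Suc n) y) \<in> image_plus C D r n"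
    using x(1) D_image_plus[OF xy] ab_subgroup_diff[OF sub_image_plus] by blast
  then have rb: "r' n (bd (Suc n) y) \<in> D n" using exact_r'[OF bd_Suc_C[OF y(1)]] by simp
  obtain z where z: "z \<in> image_plus C D r' (Suc (Suc n))" "r' (Suc n) y - bd (Suc (Suc n)) z \<in> D (Suc n)"
  proof (rule acyclic_atD[OF above])
    show "r' (Suc n) y \<in> image_plus C D r' (Suc n)" by (rule s.r_image_plus[OF y(1)])
    show "bd (Suc n) (r' (Suc n) y) \<in> D (Suc n - 1)" using rb by (simp add: bd_r'[OF y(1)])
  qed (use that in blast)
  obtain w where w: "w \<in> C (Suc (Suc n))" "z - r' (Suc (Suc n)) w \<in> D (Suc (Suc n))"
    using z(1) unfolding image_plus_def by blast
  have "(r' (Suc n) y - bd (Suc (Suc n)) z) + bd (Suc (Suc n)) (z - r' (Suc (Suc n)) w) \<in> D (Suc n)"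
    using z(2) bd_Suc_D[OF w(2)] D_simps by blast
  then have "r' (Suc n) (y - bd (Suc (Suc n)) w) \<in> D (Suc n)"
    using bd_r'[OF w(1)] by (simp add: bd_diff r'_diff)
  then have "y - bd (Suc (Suc n)) w \<in> image_plus C D r (Suc n)"
    using exact_r'[OF C_simps(2)[OF y(1) bd_Suc_C[OF w(1)]]] by simp
  moreover have "bd (Suc n) (y - bd (Suc (Suc n)) w) = bd (Suc n) y"
    by (simp add: bd_diff bd_bd[OF w(1)])
  ultimately show "\<exists>y\<in>image_plus C D r (Suc n). x - bd (Suc n) y \<in> D n"
    using xy by (intro bexI[of _ "y - bd (Suc (Suc n)) w"]) simp_all
qed

text \<open>The exact sequence 0 \<rightarrow> r'C \<rightarrow> C \<rightarrow> rC \<rightarrow> 0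
  modulo D, with vanishing homology at both ends: first r x is bounded, then the remaining cycle in
  the image of r'.\<close>

lemma (in smith_pair) acyclic_from_images:
  assumes "acyclic_at bd (image_plus C D r) D n" "acyclic_at bd (image_plus C D r') D n"
  shows "acyclic_at bd C D n"
proof (rule acyclic_atI)
  interpret s: smith_pair bd C D r' r by (rule swap)
  fix x assume x: "x \<in> C n" "bd n x \<in> D (n - 1)"
  obtain y where y: "y \<in> image_plus C D r (Suc n)" "r n x - bd (Suc n) y \<in> D n"
  proof (rule acyclic_atD[OF assms(1) r_image_plus[OF x(1)]])
    show "bd n (r n x) \<in> D (n - 1)" using r_D[OF x(2)] by (simp add: bd_r[OF x(1)])
  qed (use that in blast)
  obtain c where c: "c \<in> C (Suc n)" "y - r (Suc n) c \<in> D (Suc n)"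
    using y(1) unfolding image_plus_def by blast
  have "(r n x - bd (Suc n) y) + bd (Suc n) (y - r (Suc n) c) \<in> D n"
    using y(2) bd_Suc_D[OF c(2)] D_simps by blast
  then have "r n (x - bd (Suc n) c) \<in> D n" using bd_r[OF c(1)] by (simp add: bd_diff r_diff)
  then have xc: "x - bd (Suc n) c \<in> image_plus C D r' n"
    using exact_r[OF C_simps(2)[OF x(1) bd_Suc_C[OF c(1)]]] by simp
  obtain z where z: "z \<in> image_plus C D r' (Suc n)" "x - bd (Suc n) c - bd (Suc n) z \<in> D n"
  proof (rule acyclic_atD[OF assms(2) xc])
    show "bd n (x - bd (Suc n) c) \<in> D (n - 1)" using x(2) by (simp add: bd_diff bd_bd[OF c(1)])
  qed (use that in blast)
  then have "x - bd (Suc n) (c + z) \<in> D n" by (simp add: bd_add algebra_simps)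
  then show "\<exists>y\<in>C (Suc n). x - bd (Suc n) y \<in> D n"
    using c(1) s.image_plus_C[OF z(1)] C_simps(3) by blast
qed

text \<open>Acyclicity of both images climbs from degree 0 to n - 1 and descends from K to n + 1. It
  crosses degree n because r and r' vanish on the homology there. Applied to a complex whose only
  homology group has order p, this yields the contradiction that excludes the unwanted
  cases.\<close>

lemma (in smith_pair) not_concentrated:
  assumes other: "\<And>k. k \<noteq> n \<Longrightarrow> acyclic_at bd C D k"
    and high: "\<And>k. k \<ge> K \<Longrightarrow> acyclic_at bd (image_plus C D r) D k \<and> acyclic_at bd (image_plus C D r') D k"
    and triv: "\<And>x. x \<in> rel_cycles bd C D n \<Longrightarrow>
                 r n x \<in> rel_boundaries bd C D n \<and> r' n x \<in> rel_boundaries bd C D n"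
  shows "acyclic_at bd C D n"
proof -
  interpret s: smith_pair bd C D r' r by (rule swap)
  let ?P = "\<lambda>k. acyclic_at bd (image_plus C D r) D k \<and> acyclic_at bd (image_plus C D r') D k"
  have below: "?P k" if "k < n" for k
    using that
  proof (induction k)
    case 0
    then show ?case using acyclic_image_up[of 0] s.acyclic_image_up[of 0] other[of 0] by simp
  next
    case (Suc k)
    then show ?case
      using acyclic_image_up[of "Suc k"] s.acyclic_image_up[of "Suc k"] other[of "Suc k"] by simp
  qed
  have above: "n < k \<Longrightarrow> ?P k" for k
  proof (induction "K - k" arbitrary: k)
    case 0
    then show ?case using high by simp
  next
    case (Suc m)
    then have "?P (Suc k)" by (metis Suc_diff_Suc diff_Suc_Suc less_SucI old.nat.inject zero_less_Suc zero_less_diff)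
    then show ?case using acyclic_image_down[of k] s.acyclic_image_down[of k] other[of k] Suc by simp
  qed
  have "?P n"
    using acyclic_image_middle[of n] s.acyclic_image_middle[of n] triv above[of "Suc n"] below[of "n - 1"]
    by (cases "n = 0") auto
  then show ?thesis using acyclic_from_images by blast
qed


text \<open>
  Floyd's inequality. For chains modulo \<open>p\<close> one takes \<open>P = p C\<close> and for \<open>D\<close> the chains of the
  fixed point set, which \<open>r\<close> annihilates.
\<close>

locale floyd_pair = smith_pair bd C D r r'
  for bd :: "nat \<Rightarrow> 'b::ab_group_add \<Rightarrow> 'b" and C D r r' +
  fixes P :: "'b family"
  assumes sub_P: "ab_subgroup (P k)" and P_le_D: "P k \<subseteq> D k" and bd_P: "x \<in> P k \<Longrightarrow> bd k x \<in> P (k - 1)"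
    and r_D_P: "x \<in> D k \<Longrightarrow> r k x \<in> P k" and r'_D_P: "x \<in> D k \<Longrightarrow> r' k x \<in> P k"
    and r_r': "x \<in> C k \<Longrightarrow> r k (r' k x) \<in> P k" and r'_r: "x \<in> C k \<Longrightarrow> r' k (r k x) \<in> P k"
begin

lemma floyd_swap: "floyd_pair bd C D r' r P"
  by (rule floyd_pair.intro[OF swap], unfold_locales)
    (auto simp: sub_P bd_P r_D_P r'_D_P r_r' r'_r P_le_D[THEN subsetD] simp del: One_nat_def)

lemmas P_simps = ab_subgroup_0[OF sub_P] ab_subgroup_diff[OF sub_P] ab_subgroup_add[OF sub_P]
  ab_subgroup_minus[OF sub_P]

lemma P_D: "x \<in> P k \<Longrightarrow> x \<in> D k"
  using P_le_D by blast

lemma pair_C_P: "complex_pair bd C P"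
  by unfold_locales (auto simp: sub_P sub_C P_D D_C bd_diff bd_0 bd_C bd_P bd_bd simp del: One_nat_def)

lemma pair_D_P: "complex_pair bd D P"
  by unfold_locales (auto simp: sub_P sub_D P_D D_C bd_diff bd_0 bd_D bd_P bd_bd simp del: One_nat_def)

lemma pair_image_P: "complex_pair bd (image_plus C D r) P"
  by unfold_locales
    (auto simp: sub_P sub_image_plus P_D D_image_plus bd_diff bd_0 bd_image_plus bd_P bd_bd image_plus_C
      simp del: One_nat_def)

text \<open>Modulo P the sum of D and of the image of r is direct: if r c lies in D, exactness gives
  c = r' e + d with d in D, and both r (r' e) and r d lie in P.\<close>

lemma image_Int_D:
  assumes c: "c \<in> C k" and "r k c \<in> D k"
  shows "r k c \<in> P k"
proof -
  obtain e where e: "e \<in> C k" "c - r' k e \<in> D k"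
    using assms exact_r[OF c] unfolding image_plus_def by blast
  have "r k (c - r' k e) + r k (r' k e) \<in> P k" using r_D_P[OF e(2)] r_r'[OF e(1)] P_simps(3) by blast
  then show ?thesis by (simp add: r_diff)
qed

text \<open>One half of the splitting of H(D + rC, P) that \<open>image_Int_D\<close> provides.
  \<open>M\<close> consists of the cycles that come from D up to boundaries; H(D, P) embeds into its
  classes, and the cosets of \<open>M\<close> receive H(rC + D, D).\<close>

lemma homology_order_image:
  "homology_order bd D P k * homology_order bd (image_plus C D r) D k \<le> homology_order bd (image_plus C D r) P k"
proof -
  interpret E: complex_pair bd "image_plus C D r" P by (rule pair_image_P)
  interpret ED: complex_pair bd "image_plus C D r" D by (rule image_pair)
  interpret DP: complex_pair bd D P by (rule pair_D_P)
  define M where "M = {x. \<exists>z\<in>rel_cycles bd D P k. x - z \<in> rel_boundaries bd (image_plus C D r) P k}"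
  have M: "ab_subgroup M"
    unfolding ab_subgroup_def
  proof (intro conjI ballI)
    show "0 \<in> M" unfolding M_def
      using ab_subgroup_0[OF DP.sub_rel_cycles] ab_subgroup_0[OF E.sub_rel_boundaries]
      by (intro CollectI bexI[of _ 0]) simp_all
  next
    fix x y assume "x \<in> M" "y \<in> M"
    then obtain u v where uv: "u \<in> rel_cycles bd D P k" "v \<in> rel_cycles bd D P k"
      "x - u \<in> rel_boundaries bd (image_plus C D r) P k" "y - v \<in> rel_boundaries bd (image_plus C D r) P k"
      unfolding M_def by blast
    then have "(x - u) - (y - v) \<in> rel_boundaries bd (image_plus C D r) P k"
      using ab_subgroup_diff[OF E.sub_rel_boundaries] by blast
    then have "(x - y) - (u - v) \<in> rel_boundaries bd (image_plus C D r) P k" by (simp add: algebra_simps)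
    then show "x - y \<in> M" using uv ab_subgroup_diff[OF DP.sub_rel_cycles] unfolding M_def by blast
  qed
  have BM: "rel_boundaries bd (image_plus C D r) P k \<subseteq> M"
    unfolding M_def using ab_subgroup_0[OF DP.sub_rel_cycles, of k]
    by (intro subsetI CollectI bexI[of _ 0]) simp_all
  have DM: "rel_cycles bd D P k \<subseteq> M"
  proof
    fix x assume "x \<in> rel_cycles bd D P k"
    then show "x \<in> M" unfolding M_def using ab_subgroup_0[OF E.sub_rel_boundaries, of k]
      by (intro CollectI bexI[of _ x]) simp_all
  qed
  have DZ: "x \<in> rel_cycles bd (image_plus C D r) P k" if "x \<in> rel_cycles bd D P k" for x
    using that D_image_plus unfolding rel_cycles_def by blast
  have MZ: "M \<subseteq> rel_cycles bd (image_plus C D r) P k"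
  proof
    fix x assume "x \<in> M"
    then obtain z where z: "z \<in> rel_cycles bd D P k" "x - z \<in> rel_boundaries bd (image_plus C D r) P k"
      unfolding M_def by blast
    then have "x - z \<in> rel_cycles bd (image_plus C D r) P k" using E.rel_boundaries_le_rel_cycles by blast
    then show "x \<in> rel_cycles bd (image_plus C D r) P k"
      using ab_subgroup_diff_iff[OF E.sub_rel_cycles] DZ[OF z(1)] by blast
  qed
  have Bd: "rel_boundaries bd (image_plus C D r) P k \<subseteq> rel_boundaries bd (image_plus C D r) D k"
    unfolding rel_boundaries_def using P_D by blast
  have MB: "M \<subseteq> rel_boundaries bd (image_plus C D r) D k"
  proof
    fix x assume "x \<in> M"
    then obtain z where z: "z \<in> rel_cycles bd D P k" "x - z \<in> rel_boundaries bd (image_plus C D r) P k"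
      unfolding M_def by blast
    then have "x - z \<in> rel_boundaries bd (image_plus C D r) D k" using Bd by blast
    moreover have "z \<in> rel_boundaries bd (image_plus C D r) D k"
      using z(1) ED.D_rel_boundaries by (simp add: rel_cycles_def)
    ultimately show "x \<in> rel_boundaries bd (image_plus C D r) D k"
      using ab_subgroup_diff_iff[OF ED.sub_rel_boundaries] by blast
  qed
  have 1: "homology_order bd D P k \<le> quotient_order M (rel_boundaries bd (image_plus C D r) P k)"
    unfolding homology_order_def
  proof (rule quotient_order_le[OF DP.sub_rel_boundaries E.sub_rel_boundaries, where f = id])
    show "id t \<in> M" if "t \<in> rel_cycles bd D P k" for t using that DM by auto
    fix s t assume st: "s \<in> rel_cycles bd D P k" "t \<in> rel_cycles bd D P k"
      "id s - id t \<in> rel_boundaries bd (image_plus C D r) P k"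
    then obtain e where e: "e \<in> image_plus C D r (Suc k)" "s - t - bd (Suc k) e \<in> P k"
      unfolding rel_boundaries_def by auto
    obtain c where c: "c \<in> C (Suc k)" "e - r (Suc k) c \<in> D (Suc k)" using e(1) unfolding image_plus_def by blast
    \<comment> \<open>The chain e splits into a D-part and an r-part. The boundary of the r-part
      lies in D, hence in P, so s - t bounds the D-part modulo P.\<close>
    have be: "bd (Suc k) e = bd (Suc k) (e - r (Suc k) c) + r k (bd (Suc k) c)"
      using bd_r[OF c(1)] by (simp add: bd_diff)
    have "s - t \<in> D k" using st D_simps unfolding rel_cycles_def by simp
    then have "(s - t) - (s - t - bd (Suc k) e) - bd (Suc k) (e - r (Suc k) c) \<in> D k"
      using P_D[OF e(2)] bd_Suc_D[OF c(2)] D_simps(2) by blast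
    then have "r k (bd (Suc k) c) \<in> D k" by (simp add: be)
    then have "r k (bd (Suc k) c) \<in> P k" using image_Int_D bd_Suc_C c by blast
    then have "(s - t - bd (Suc k) e) + r k (bd (Suc k) c) \<in> P k" using e(2) P_simps(3) by blast
    then have "s - t - bd (Suc k) (e - r (Suc k) c) \<in> P k" by (simp add: be algebra_simps)
    then show "s - t \<in> rel_boundaries bd D P k" unfolding rel_boundaries_def using c(2) by blast
  qed
  have "\<exists>c\<in>C k. x - r k c \<in> D k" if "x \<in> rel_cycles bd (image_plus C D r) D k" for x
    using that unfolding rel_cycles_def image_plus_def by blast
  then obtain c where c: "\<And>x. x \<in> rel_cycles bd (image_plus C D r) D k \<Longrightarrow> c x \<in> C k \<and> x - r k (c x) \<in> D k"
    by metis
  have 2: "homology_order bd (image_plus C D r) D k \<le> quotient_order (rel_cycles bd (image_plus C D r) P k) M"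
    unfolding homology_order_def
  \<comment> \<open>The representative r (c x) of the class of x modulo D is even a cycle modulo P,
    by \<open>image_Int_D\<close> applied to its boundary.\<close>
  proof (rule quotient_order_le[OF ED.sub_rel_boundaries M, where f = "\<lambda>x. r k (c x)"])
    fix x assume x: "x \<in> rel_cycles bd (image_plus C D r) D k"
    have "bd k x - bd k (x - r k (c x)) \<in> D (k - 1)"
      using x bd_D c D_simps(2) unfolding rel_cycles_def by blast
    then have "r (k - 1) (bd k (c x)) \<in> D (k - 1)" using c[OF x] by (simp add: bd_diff bd_r)
    then have "r (k - 1) (bd k (c x)) \<in> P (k - 1)" using image_Int_D[OF bd_C] c[OF x] by blast
    then show "r k (c x) \<in> rel_cycles bd (image_plus C D r) P k"
      using c[OF x] by (simp add: rel_cycles_def r_image_plus bd_r)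
  next
    fix s t assume st: "s \<in> rel_cycles bd (image_plus C D r) D k" "t \<in> rel_cycles bd (image_plus C D r) D k"
      "r k (c s) - r k (c t) \<in> M"
    have "D k \<subseteq> rel_boundaries bd (image_plus C D r) D k"
      using ED.D_rel_boundaries by blast
    moreover have "(s - r k (c s)) - (t - r k (c t)) \<in> D k" using c st D_simps(2) by blast
    ultimately have "((s - r k (c s)) - (t - r k (c t))) + (r k (c s) - r k (c t))
        \<in> rel_boundaries bd (image_plus C D r) D k"
      using st(3) MB ab_subgroup_add[OF ED.sub_rel_boundaries] by blast
    then show "s - t \<in> rel_boundaries bd (image_plus C D r) D k" by (simp add: algebra_simps)
  qed
  have "homology_order bd (image_plus C D r) P k =
      quotient_order (rel_cycles bd (image_plus C D r) P k) M * quotient_order M (rel_boundaries bd (image_plus C D r) P k)"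
    unfolding homology_order_def
    by (rule quotient_order_mult[OF E.sub_rel_boundaries M E.sub_rel_cycles BM MZ])
  then show ?thesis using mult_mono[OF 1 2] by (simp add: mult.commute)
qed

text \<open>Exactness for P \<subseteq> rC + D \<subseteq> C. The kernel of H_k(rC + D, P)
  \<rightarrow> H_k(C, P), given by \<open>M\<close>, is controlled by H_{k+1}(C, rC + D), and r'
  embeds the latter into H_{k+1}(r'C + D, D), since up to D it has kernel rC + D.\<close>

lemma homology_order_image_le:
  "homology_order bd (image_plus C D r) P k
    \<le> homology_order bd C P k * homology_order bd (image_plus C D r') D (Suc k)"
proof -
  interpret s: smith_pair bd C D r' r by (rule swap)
  interpret E: complex_pair bd "image_plus C D r" P by (rule pair_image_P)
  interpret C: complex_pair bd C P by (rule pair_C_P)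
  interpret CE: complex_pair bd C "image_plus C D r" by (rule coimage_pair)
  interpret E'D: complex_pair bd "image_plus C D r'" D by (rule s.image_pair)
  let ?Z = "rel_cycles bd (image_plus C D r) P k" and ?B = "rel_boundaries bd (image_plus C D r) P k"
  define M where "M = ?Z \<inter> rel_boundaries bd C P k"
  have M: "ab_subgroup M" unfolding M_def ab_subgroup_def
    using ab_subgroup_0[OF E.sub_rel_cycles] ab_subgroup_0[OF C.sub_rel_boundaries]
      ab_subgroup_diff[OF E.sub_rel_cycles] ab_subgroup_diff[OF C.sub_rel_boundaries] by blast
  have BM: "?B \<subseteq> M" unfolding M_def
    using E.rel_boundaries_le_rel_cycles image_plus_C unfolding rel_boundaries_def by blast
  have 1: "quotient_order ?Z M \<le> homology_order bd C P k"
    unfolding homology_order_def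
  proof (rule quotient_order_le[OF M C.sub_rel_boundaries, where f = id])
    show "id t \<in> rel_cycles bd C P k" if "t \<in> ?Z" for t
      using that image_plus_C unfolding rel_cycles_def by auto
    show "s - t \<in> M" if "s \<in> ?Z" "t \<in> ?Z" "id s - id t \<in> rel_boundaries bd C P k" for s t
      using that ab_subgroup_diff[OF E.sub_rel_cycles] by (auto simp: M_def)
  qed
  have "\<exists>c\<in>C (Suc k). x - bd (Suc k) c \<in> P k" if "x \<in> M" for x
    using that unfolding M_def rel_boundaries_def by blast
  then obtain c where c: "\<And>x. x \<in> M \<Longrightarrow> c x \<in> C (Suc k) \<and> x - bd (Suc k) (c x) \<in> P k" by metis
  have 2: "quotient_order M ?B \<le> homology_order bd C (image_plus C D r) (Suc k)"
    unfolding homology_order_def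
  proof (rule quotient_order_le[OF E.sub_rel_boundaries CE.sub_rel_boundaries, where f = c])
    fix x assume x: "x \<in> M"
    then have "x \<in> image_plus C D r k" unfolding M_def rel_cycles_def by blast
    then have "x - (x - bd (Suc k) (c x)) \<in> image_plus C D r k"
      using c[OF x] P_D D_image_plus ab_subgroup_diff[OF sub_image_plus] by blast
    then show "c x \<in> rel_cycles bd C (image_plus C D r) (Suc k)"
      using c[OF x] unfolding rel_cycles_def by simp
  next
    fix s t assume st: "s \<in> M" "t \<in> M" "c s - c t \<in> rel_boundaries bd C (image_plus C D r) (Suc k)"
    then obtain y where y: "y \<in> C (Suc (Suc k))" "c s - c t - bd (Suc (Suc k)) y \<in> image_plus C D r (Suc k)"
      unfolding rel_boundaries_def by blast
    have st': "(s - bd (Suc k) (c s)) - (t - bd (Suc k) (c t)) \<in> P k"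
      using c[OF st(1)] c[OF st(2)] by (simp add: P_simps)
    have eq: "bd (Suc k) (c s - c t - bd (Suc (Suc k)) y) = bd (Suc k) (c s) - bd (Suc k) (c t)"
      by (simp add: bd_diff bd_bd[OF y(1)])
    have "(s - bd (Suc k) (c s)) - (t - bd (Suc k) (c t)) = s - t - bd (Suc k) (c s - c t - bd (Suc (Suc k)) y)"
      by (simp only: eq) (simp add: algebra_simps)
    with st' have "s - t - bd (Suc k) (c s - c t - bd (Suc (Suc k)) y) \<in> P k" by (simp only:)
    then show "s - t \<in> ?B" unfolding rel_boundaries_def using y(2) by blast
  qed
  have 3: "homology_order bd C (image_plus C D r) (Suc k) \<le> homology_order bd (image_plus C D r') D (Suc k)"
    unfolding homology_order_def
  proof (rule quotient_order_le[OF CE.sub_rel_boundaries E'D.sub_rel_boundaries, where f = "r' (Suc k)"])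
    fix x assume "x \<in> rel_cycles bd C (image_plus C D r) (Suc k)"
    then have x: "x \<in> C (Suc k)" "bd (Suc k) x \<in> image_plus C D r k" unfolding rel_cycles_def by auto
    have "r' k (bd (Suc k) x) \<in> D k" using exact_r'[OF bd_Suc_C[OF x(1)]] x(2) by blast
    then show "r' (Suc k) x \<in> rel_cycles bd (image_plus C D r') D (Suc k)"
      using s.r_image_plus[OF x(1)] bd_r'[OF x(1)] unfolding rel_cycles_def by simp
  next
    fix s t assume st: "s \<in> rel_cycles bd C (image_plus C D r) (Suc k)"
      "t \<in> rel_cycles bd C (image_plus C D r) (Suc k)"
      "r' (Suc k) s - r' (Suc k) t \<in> rel_boundaries bd (image_plus C D r') D (Suc k)"
    have stC: "s - t \<in> C (Suc k)" using st C_simps(2) unfolding rel_cycles_def by blast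
    obtain y where y: "y \<in> image_plus C D r' (Suc (Suc k))"
      "r' (Suc k) (s - t) - bd (Suc (Suc k)) y \<in> D (Suc k)"
      using st(3) unfolding rel_boundaries_def by (auto simp: r'_diff)
    obtain e where e: "e \<in> C (Suc (Suc k))" "y - r' (Suc (Suc k)) e \<in> D (Suc (Suc k))"
      using y(1) unfolding image_plus_def by blast
    have "(r' (Suc k) (s - t) - bd (Suc (Suc k)) y) + bd (Suc (Suc k)) (y - r' (Suc (Suc k)) e) \<in> D (Suc k)"
      using y(2) bd_Suc_D[OF e(2)] D_simps(3) by blast
    then have "r' (Suc k) (s - t - bd (Suc (Suc k)) e) \<in> D (Suc k)"
      using bd_r'[OF e(1)] by (simp add: bd_diff r'_diff)
    then have "s - t - bd (Suc (Suc k)) e \<in> image_plus C D r (Suc k)"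
      using exact_r'[OF C_simps(2)[OF stC bd_Suc_C[OF e(1)]]] by blast
    then show "s - t \<in> rel_boundaries bd C (image_plus C D r) (Suc k)"
      unfolding rel_boundaries_def using e(1) by blast
  qed
  have "M \<subseteq> ?Z" unfolding M_def by blast
  then have "homology_order bd (image_plus C D r) P k = quotient_order ?Z M * quotient_order M ?B"
    unfolding homology_order_def
    by (rule quotient_order_mult[OF E.sub_rel_boundaries M E.sub_rel_cycles BM])
  then show ?thesis using mult_mono[OF 1 order_trans[OF 2 3]] by simp
qed

lemma floyd_step:
  "homology_order bd D P k * homology_order bd (image_plus C D r) D k
    \<le> homology_order bd C P k * homology_order bd (image_plus C D r') D (Suc k)"
  using homology_order_image homology_order_image_le order_trans by blast

text \<open>Downward induction from K, where both images are acyclic. Each application of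
  \<open>floyd_step\<close> exchanges r and r', so the two estimates are proved together. The order
  of the image homology left over in degree 0 is at least 1 and is dropped.\<close>

lemma floyd_inequality:
  assumes "\<And>k. k \<ge> K \<Longrightarrow> acyclic_at bd (image_plus C D r) D k \<and> acyclic_at bd (image_plus C D r') D k"
  shows "(\<Prod>k<K. homology_order bd D P k) \<le> (\<Prod>k<K. homology_order bd C P k)"
proof -
  interpret f: floyd_pair bd C D r' r P by (rule floyd_swap)
  interpret E: complex_pair bd "image_plus C D r" D by (rule image_pair)
  interpret E': complex_pair bd "image_plus C D r'" D by (rule f.image_pair)
  let ?a = "homology_order bd D P" and ?b = "homology_order bd C P"
  have "(\<Prod>k\<in>{K-m..<K}. ?a k) * homology_order bd (image_plus C D r) D (K - m) \<le> (\<Prod>k\<in>{K-m..<K}. ?b k) \<and>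
        (\<Prod>k\<in>{K-m..<K}. ?a k) * homology_order bd (image_plus C D r') D (K - m) \<le> (\<Prod>k\<in>{K-m..<K}. ?b k)"
    if "m \<le> K" for m
    using that
  proof (induction m)
    case 0
    then show ?case using assms[of K] E.homology_order_eq_1_iff[of K] E'.homology_order_eq_1_iff[of K] by simp
  next
    case (Suc m)
    define j where "j = K - Suc m"
    have j: "K - m = Suc j" "j < K" using Suc.prems by (auto simp: j_def)
    then have split: "{j..<K} = insert j {Suc j..<K}" by auto
    have "(\<Prod>k\<in>{j..<K}. ?a k) * homology_order bd (image_plus C D r) D j
        = (?a j * homology_order bd (image_plus C D r) D j) * (\<Prod>k\<in>{Suc j..<K}. ?a k)"
      by (simp add: split mult_ac)
    also have "\<dots> \<le> (?b j * homology_order bd (image_plus C D r') D (Suc j)) * (\<Prod>k\<in>{Suc j..<K}. ?a k)"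
      by (intro mult_right_mono floyd_step) simp
    also have "\<dots> = ?b j * ((\<Prod>k\<in>{Suc j..<K}. ?a k) * homology_order bd (image_plus C D r') D (Suc j))"
      by (simp add: mult_ac)
    also have "\<dots> \<le> ?b j * (\<Prod>k\<in>{Suc j..<K}. ?b k)"
      using Suc j by (intro mult_left_mono) auto
    finally have 1: "(\<Prod>k\<in>{j..<K}. ?a k) * homology_order bd (image_plus C D r) D j \<le> (\<Prod>k\<in>{j..<K}. ?b k)"
      by (simp add: split)
    have "(\<Prod>k\<in>{j..<K}. ?a k) * homology_order bd (image_plus C D r') D j
        = (?a j * homology_order bd (image_plus C D r') D j) * (\<Prod>k\<in>{Suc j..<K}. ?a k)"
      by (simp add: split mult_ac)
    also have "\<dots> \<le> (?b j * homology_order bd (image_plus C D r) D (Suc j)) * (\<Prod>k\<in>{Suc j..<K}. ?a k)"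
      by (intro mult_right_mono f.floyd_step) simp
    also have "\<dots> = ?b j * ((\<Prod>k\<in>{Suc j..<K}. ?a k) * homology_order bd (image_plus C D r) D (Suc j))"
      by (simp add: mult_ac)
    also have "\<dots> \<le> ?b j * (\<Prod>k\<in>{Suc j..<K}. ?b k)"
      using Suc j by (intro mult_left_mono) auto
    finally have 2: "(\<Prod>k\<in>{j..<K}. ?a k) * homology_order bd (image_plus C D r') D j \<le> (\<Prod>k\<in>{j..<K}. ?b k)"
      by (simp add: split)
    show ?case using 1 2 by (simp add: j_def)
  qed
  from this[of K] have le: "(\<Prod>k<K. ?a k) * homology_order bd (image_plus C D r) D 0 \<le> (\<Prod>k<K. ?b k)"
    by (simp add: lessThan_atLeast0)
  have "(\<Prod>k<K. ?a k) * 1 \<le> (\<Prod>k<K. ?a k) * homology_order bd (image_plus C D r) D 0"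
    by (intro mult_left_mono E.homology_order_pos) simp
  then show ?thesis using le by simp
qed

end

text \<open>If \<open>H(D, P) \<rightarrow> H(C, P)\<close> is injective, the long exact sequence of the triple splits.\<close>

lemma homology_order_triple:
  assumes "complex_pair bd C D" "complex_pair bd D P" "complex_pair bd C P"
    and inj: "\<And>x. x \<in> rel_cycles bd D P k \<Longrightarrow> x \<in> rel_boundaries bd C P k \<Longrightarrow> x \<in> rel_boundaries bd D P k"
    and inj': "\<And>x. x \<in> rel_cycles bd D P (k - 1) \<Longrightarrow> x \<in> rel_boundaries bd C P (k - 1) \<Longrightarrow>
                 x \<in> rel_boundaries bd D P (k - 1)"
  shows "homology_order bd C P k = homology_order bd D P k * homology_order bd C D k"
proof -
  interpret CD: complex_pair bd C D by fact
  interpret DP: complex_pair bd D P by fact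
  interpret CP: complex_pair bd C P by fact
  let ?Z = "rel_cycles bd C P k" and ?B = "rel_boundaries bd C P k"
  \<comment> \<open>On the level of cycles, the kernel of H_k(C, P) \<rightarrow> H_k(C, D), that
    is, the image of H_k(D, P).\<close>
  define M where "M = ?Z \<inter> rel_boundaries bd C D k"
  have M: "ab_subgroup M" unfolding M_def ab_subgroup_def
    using ab_subgroup_0[OF CP.sub_rel_cycles] ab_subgroup_0[OF CD.sub_rel_boundaries]
      ab_subgroup_diff[OF CP.sub_rel_cycles] ab_subgroup_diff[OF CD.sub_rel_boundaries] by blast
  have BM: "?B \<subseteq> M" unfolding M_def
    using CP.rel_boundaries_le_rel_cycles DP.D_C unfolding rel_boundaries_def by blast
  have DM: "rel_cycles bd D P k \<subseteq> M"
  proof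
    fix x assume "x \<in> rel_cycles bd D P k"
    then have "x \<in> D k" "bd k x \<in> P (k - 1)" by (auto simp: rel_cycles_def)
    then show "x \<in> M" unfolding M_def rel_cycles_def rel_boundaries_def
      using CD.D_C CD.C_simps(1)[of "Suc k"] by (auto intro!: bexI[of _ 0])
  qed
  have 1: "homology_order bd D P k \<le> quotient_order M ?B"
    unfolding homology_order_def
  proof (rule quotient_order_le[OF DP.sub_rel_boundaries CP.sub_rel_boundaries, where f = id])
    show "id t \<in> M" if "t \<in> rel_cycles bd D P k" for t using that DM by auto
    show "s - t \<in> rel_boundaries bd D P k"
      if "s \<in> rel_cycles bd D P k" "t \<in> rel_cycles bd D P k" "id s - id t \<in> ?B" for s t
      using that inj ab_subgroup_diff[OF DP.sub_rel_cycles] by simp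
  qed
  have "\<exists>y\<in>C (Suc k). x - bd (Suc k) y \<in> D k" if "x \<in> M" for x
    using that unfolding M_def rel_boundaries_def by blast
  then obtain c where c: "\<And>x. x \<in> M \<Longrightarrow> c x \<in> C (Suc k) \<and> x - bd (Suc k) (c x) \<in> D k" by metis
  have 2: "quotient_order M ?B \<le> homology_order bd D P k"
    unfolding homology_order_def
  proof (rule quotient_order_le[OF CP.sub_rel_boundaries DP.sub_rel_boundaries, where f = "\<lambda>x. x - bd (Suc k) (c x)"])
    fix x assume x: "x \<in> M"
    then show "x - bd (Suc k) (c x) \<in> rel_cycles bd D P k"
      using c[OF x] CD.bd_bd by (auto simp: M_def rel_cycles_def CD.bd_diff)
  next
    fix s t assume st: "s \<in> M" "t \<in> M"
      "(s - bd (Suc k) (c s)) - (t - bd (Suc k) (c t)) \<in> rel_boundaries bd D P k"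
    then obtain e where e: "e \<in> D (Suc k)" "(s - bd (Suc k) (c s)) - (t - bd (Suc k) (c t)) - bd (Suc k) e \<in> P k"
      unfolding rel_boundaries_def by blast
    have eq: "bd (Suc k) (c s - c t + e) = bd (Suc k) (c s) - bd (Suc k) (c t) + bd (Suc k) e"
      by (simp add: CD.bd_diff CD.bd_add)
    have "(s - bd (Suc k) (c s)) - (t - bd (Suc k) (c t)) - bd (Suc k) e = s - t - bd (Suc k) (c s - c t + e)"
      by (simp only: eq) (simp add: algebra_simps)
    with e(2) have "s - t - bd (Suc k) (c s - c t + e) \<in> P k" by (simp only:)
    moreover have "c s - c t + e \<in> C (Suc k)"
      using c[OF st(1)] c[OF st(2)] CD.D_C[OF e(1)] by (simp add: CD.C_simps)
    ultimately show "s - t \<in> ?B" unfolding rel_boundaries_def by blast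
  qed
  have 3: "quotient_order ?Z M \<le> homology_order bd C D k"
    unfolding homology_order_def
  proof (rule quotient_order_le[OF M CD.sub_rel_boundaries, where f = id])
    show "id t \<in> rel_cycles bd C D k" if "t \<in> ?Z" for t
      using that DP.D_C by (auto simp: rel_cycles_def)
    show "s - t \<in> M" if "s \<in> ?Z" "t \<in> ?Z" "id s - id t \<in> rel_boundaries bd C D k" for s t
      using that ab_subgroup_diff[OF CP.sub_rel_cycles] by (auto simp: M_def)
  qed
  \<comment> \<open>Surjectivity of H_k(C, P) \<rightarrow> H_k(C, D): the boundary of x bounds in
    C, hence already in D by \<open>inj'\<close>, so the connecting homomorphism is zero.\<close>
  have lift: "\<exists>z\<in>?Z. x - z \<in> D k" if x: "x \<in> rel_cycles bd C D k" for x
  proof (cases "k = 0")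
    case True
    have "0 \<in> P 0" by (rule DP.D_simps(1))
    then show ?thesis using x True CD.D_simps(1) by (intro bexI[of _ x]) (auto simp: rel_cycles_def CD.bd_0)
  next
    case False
    then obtain j where k: "k = Suc j" using not0_implies_Suc by blast
    have xC: "x \<in> C (Suc j)" "bd (Suc j) x \<in> D j" using x by (auto simp: rel_cycles_def k)
    then have "bd j (bd (Suc j) x) = 0" by (simp add: CD.bd_bd)
    then have "bd (Suc j) x \<in> rel_cycles bd D P (k - 1)"
      using xC by (simp add: rel_cycles_def k DP.D_simps)
    moreover have "bd (Suc j) x \<in> rel_boundaries bd C P (k - 1)"
      unfolding rel_boundaries_def using xC by (auto simp: k DP.D_simps intro!: bexI[of _ x])
    ultimately obtain e where e: "e \<in> D (Suc j)" "bd (Suc j) x - bd (Suc j) e \<in> P j"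
      using inj'[of "bd (Suc j) x"] unfolding rel_boundaries_def by (auto simp: k)
    then have "x - e \<in> ?Z" using xC CD.C_simps CD.D_C by (simp add: rel_cycles_def k CD.bd_diff)
    then show ?thesis using e k by (intro bexI[of _ "x - e"]) auto
  qed
  then obtain z where z: "\<And>x. x \<in> rel_cycles bd C D k \<Longrightarrow> z x \<in> ?Z \<and> x - z x \<in> D k" by metis
  have DB: "D k \<subseteq> rel_boundaries bd C D k"
    using CD.D_rel_boundaries by blast
  have 4: "homology_order bd C D k \<le> quotient_order ?Z M"
    unfolding homology_order_def
  proof (rule quotient_order_le[OF CD.sub_rel_boundaries M, where f = z])
    show "z t \<in> ?Z" if "t \<in> rel_cycles bd C D k" for t using z that by blast
    fix s t assume st: "s \<in> rel_cycles bd C D k" "t \<in> rel_cycles bd C D k" "z s - z t \<in> M"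
    have "(s - z s) - (t - z t) \<in> rel_boundaries bd C D k" using z st DB CD.D_simps(2) by blast
    moreover have "z s - z t \<in> rel_boundaries bd C D k" using st unfolding M_def by blast
    ultimately have "((s - z s) - (t - z t)) + (z s - z t) \<in> rel_boundaries bd C D k"
      using ab_subgroup_add[OF CD.sub_rel_boundaries] by blast
    then show "s - t \<in> rel_boundaries bd C D k" by (simp add: algebra_simps)
  qed
  have MZ: "M \<subseteq> ?Z" unfolding M_def by blast
  have "homology_order bd C P k = quotient_order ?Z M * quotient_order M ?B"
    unfolding homology_order_def by (rule quotient_order_mult[OF CP.sub_rel_boundaries M CP.sub_rel_cycles BM MZ])
  moreover have "quotient_order M ?B = homology_order bd D P k" using 1 2 by (rule order_antisym[rotated])
  moreover have "quotient_order ?Z M = homology_order bd C D k" using 3 4 by (rule order_antisym)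
  ultimately show ?thesis by (simp add: mult.commute)
qed

section \<open>Singular chains modulo a prime\<close>

abbreviation lookup where "lookup \<equiv> Poly_Mapping.lookup"
abbreviation keys where "keys \<equiv> Poly_Mapping.keys"

definition frag_restrict :: "'x set \<Rightarrow> ('x \<Rightarrow>\<^sub>0 int) \<Rightarrow> ('x \<Rightarrow>\<^sub>0 int)"
  where "frag_restrict S = frag_extend (\<lambda>f. if f \<in> S then frag_of f else 0)"

lemma lookup_frag_restrict: "lookup (frag_restrict S c) f = (if f \<in> S then lookup c f else 0)"
proof -
  have "keys c \<subseteq> UNIV" by simp
  then show ?thesis unfolding frag_restrict_def
    by (induction c rule: frag_induction) (auto simp: frag_extend_diff lookup_minus)
qed

lemma keys_frag_restrict: "keys (frag_restrict S c) = keys c \<inter> S"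
  by (auto simp: in_keys_iff lookup_frag_restrict split: if_splits)

lemma frag_restrict_diff: "frag_restrict S (c - d) = frag_restrict S c - frag_restrict S d"
  by (simp add: frag_restrict_def frag_extend_diff)

lemma frag_cmul_exists:
  assumes "\<And>f. m dvd lookup c f"
  obtains e where "c = frag_cmul m e" "keys e \<subseteq> keys c"
proof
  let ?e = "Poly_Mapping.map (\<lambda>x. x div m) c"
  show "c = frag_cmul m ?e"
    by (rule poly_mapping_eqI) (use assms in \<open>auto simp: Poly_Mapping.map.rep_eq when_def\<close>)
  show "keys ?e \<subseteq> keys c"
    by (auto simp: in_keys_iff Poly_Mapping.map.rep_eq when_def)
qed

text \<open>A singleton family describes a subspace, a family {U, W} the small chains of excision.
  For the empty family no simplex is small, which makes the chains modulo p below consist of the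
  multiples of p.\<close>

definition small :: "nat \<Rightarrow> 'a set set \<Rightarrow> ((nat \<Rightarrow> real) \<Rightarrow> 'a) \<Rightarrow> bool"
  where "small k \<U> f \<longleftrightarrow> (\<exists>U\<in>\<U>. f ` standard_simplex k \<subseteq> U)"

text \<open>
  A chain modulo \<open>p\<close> is represented by an integral chain; \<open>mod_chains p X \<U>\<close> consists of those
  whose reduction modulo \<open>p\<close> is supported on simplices lying in a member of \<open>\<U>\<close>.
\<close>

definition mod_chains :: "nat \<Rightarrow> 'a topology \<Rightarrow> 'a set set \<Rightarrow> 'a chain family"
  where "mod_chains p X \<U> k =
    {c. singular_chain k X c \<and> (\<forall>f. \<not> small k \<U> f \<longrightarrow> int p dvd lookup c f)}"

lemma mod_chainsD: "c \<in> mod_chains p X \<U> k \<Longrightarrow> singular_chain k X c"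
  by (simp add: mod_chains_def)

lemma lookup_nonsingular: "singular_chain k X c \<Longrightarrow> \<not> singular_simplex k X f \<Longrightarrow> lookup c f = 0"
  by (auto simp: singular_chain_def in_keys_iff)

lemma mod_chainsI:
  assumes "singular_chain k X c"
    and "\<And>f. singular_simplex k X f \<Longrightarrow> \<not> small k \<U> f \<Longrightarrow> int p dvd lookup c f"
  shows "c \<in> mod_chains p X \<U> k"
proof -
  have "int p dvd lookup c f" if "\<not> small k \<U> f" for f
    using assms(2)[OF _ that] lookup_nonsingular[OF assms(1), of f] by (cases "singular_simplex k X f") auto
  then show ?thesis using assms(1) by (simp add: mod_chains_def)
qed

lemma sub_mod_chains: "ab_subgroup (mod_chains p X \<U> k)"
  by (auto simp: ab_subgroup_def mod_chains_def singular_chain_diff lookup_minus)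

lemma mod_chains_mono:
  "(\<And>f. small k \<U> f \<Longrightarrow> small k \<V> f) \<Longrightarrow> mod_chains p X \<U> k \<subseteq> mod_chains p X \<V> k"
  by (auto simp: mod_chains_def)

lemma cmul_mod_chains: "singular_chain k X c \<Longrightarrow> frag_cmul (int p) c \<in> mod_chains p X \<U> k"
  by (simp add: mod_chains_def singular_chain_cmul)

lemma small_mod_chains:
  "singular_chain k X c \<Longrightarrow> (\<And>f. f \<in> keys c \<Longrightarrow> small k \<U> f) \<Longrightarrow> c \<in> mod_chains p X \<U> k"
proof (rule mod_chainsI)
  assume small: "\<And>f. f \<in> keys c \<Longrightarrow> small k \<U> f"
  fix f assume "\<not> small k \<U> f"
  then have "f \<notin> keys c" using small by blast
  then show "int p dvd lookup c f" by (simp add: in_keys_iff)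
qed

text \<open>Brings results on integral chains to bear on chains modulo p: the first summand really
  consists of small simplices, and the second one lies in every family of
  \<open>mod_chains\<close>.\<close>

lemma mod_chains_split:
  assumes "c \<in> mod_chains p X \<U> k"
  obtains a e where "c = a + frag_cmul (int p) e" "singular_chain k X a" "singular_chain k X e"
    "keys a \<subseteq> keys c" "keys e \<subseteq> keys c" "\<And>f. f \<in> keys a \<Longrightarrow> small k \<U> f"
proof -
  let ?a = "frag_restrict (Collect (small k \<U>)) c"
  have "int p dvd lookup (c - ?a) f" for f
    using assms by (auto simp: lookup_minus lookup_frag_restrict mod_chains_def)
  then obtain e where e: "c - ?a = frag_cmul (int p) e" "keys e \<subseteq> keys (c - ?a)"
    using frag_cmul_exists by blast
  have "keys (c - ?a) \<subseteq> keys c" by (auto simp: in_keys_iff lookup_minus lookup_frag_restrict split: if_splits)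
  with e have ke: "keys e \<subseteq> keys c" by blast
  with assms have "singular_chain k X e" by (auto simp: mod_chains_def singular_chain_def)
  moreover have "singular_chain k X ?a" using assms by (auto simp: mod_chains_def singular_chain_def keys_frag_restrict)
  moreover have "c = ?a + frag_cmul (int p) e" using e(1) by (simp add: algebra_simps)
  moreover have "keys ?a \<subseteq> keys c" "\<And>f. f \<in> keys ?a \<Longrightarrow> small k \<U> f" by (auto simp: keys_frag_restrict)
  ultimately show thesis using that ke by blast
qed

lemma keys_chain_boundary:
  assumes "g \<in> keys (chain_boundary k c)"
  obtains f i where "f \<in> keys c" "i \<le> k" "k > 0" "g = singular_face k i f"
proof -
  have k: "k > 0" using assms by (cases k) (auto simp: chain_boundary_def)
  let ?b = "\<lambda>f. \<Sum>i\<le>k. frag_cmul ((-1) ^ i) (frag_of (singular_face k i f))"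
  have "g \<in> (\<Union>f\<in>keys c. keys (?b f))"
    using assms k keys_frag_extend[of ?b c] by (auto simp: chain_boundary_def)
  then obtain f where f: "f \<in> keys c" "g \<in> keys (?b f)" by blast
  then obtain i where "i \<le> k" "g \<in> keys (frag_cmul ((-1) ^ i) (frag_of (singular_face k i f)))"
    using keys_sum[of "\<lambda>i. frag_cmul ((-1) ^ i) (frag_of (singular_face k i f))" "{..k}"] by auto
  then show thesis using that f k by auto
qed

lemma image_singular_face:
  assumes "k > 0" "i \<le> k"
  shows "singular_face k i f ` standard_simplex (k - 1) \<subseteq> f ` standard_simplex k"
  using simplical_face_in_standard_simplex[of k i] assms by (auto simp: singular_face_def)

lemma small_singular_face: "k > 0 \<Longrightarrow> i \<le> k \<Longrightarrow> small k \<U> f \<Longrightarrow> small (k - 1) \<U> (singular_face k i f)"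
  unfolding small_def using order_trans[OF image_singular_face[of k i f]] by auto

lemma chain_boundary_mod_chains:
  assumes "c \<in> mod_chains p X \<U> k"
  shows "chain_boundary k c \<in> mod_chains p X \<U> (k - 1)"
proof -
  obtain a e where ae: "c = a + frag_cmul (int p) e" "singular_chain k X a" "singular_chain k X e"
    "\<And>f. f \<in> keys a \<Longrightarrow> small k \<U> f"
    using mod_chains_split[OF assms] by metis
  have "chain_boundary k a \<in> mod_chains p X \<U> (k - 1)"
  proof (rule small_mod_chains)
    show "singular_chain (k - 1) X (chain_boundary k a)" using singular_chain_boundary[OF ae(2)] by simp
    fix g assume "g \<in> keys (chain_boundary k a)"
    then obtain f i where "f \<in> keys a" "i \<le> k" "k > 0" "g = singular_face k i f" by (rule keys_chain_boundary)
    then show "small (k - 1) \<U> g" using ae(4) small_singular_face by metis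
  qed
  moreover have "frag_cmul (int p) (chain_boundary k e) \<in> mod_chains p X \<U> (k - 1)"
    using singular_chain_boundary[OF ae(3)] by (intro cmul_mod_chains) simp
  ultimately show ?thesis using ab_subgroup_add[OF sub_mod_chains] ae(1)
    by (simp add: chain_boundary_add chain_boundary_cmul)
qed

lemma chain_boundary_boundary_Suc: "singular_chain (Suc k) X c \<Longrightarrow> chain_boundary k (chain_boundary (Suc k) c) = 0"
  using chain_boundary_boundary[of "Suc k" X c] by simp

lemma mod_chains_pair:
  assumes "\<And>k f. small k \<V> f \<Longrightarrow> small k \<U> f"
  shows "complex_pair chain_boundary (mod_chains p X \<U>) (mod_chains p X \<V>)"
proof
  show "chain_boundary k (x - y) = chain_boundary k x - chain_boundary k y" for k and x y :: "'a chain"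
    by (rule chain_boundary_diff)
  show "chain_boundary 0 x = 0" for x :: "'a chain" by (simp add: chain_boundary_def)
  show "x \<in> mod_chains p X \<U> (Suc k) \<Longrightarrow> chain_boundary k (chain_boundary (Suc k) x) = 0" for k x
    by (blast intro: chain_boundary_boundary_Suc mod_chainsD)
  show "mod_chains p X \<V> k \<subseteq> mod_chains p X \<U> k" for k
    by (rule mod_chains_mono) (rule assms)
qed (use sub_mod_chains chain_boundary_mod_chains in \<open>auto simp del: One_nat_def\<close>)

section \<open>The operators 1 - g and 1 + g + ... + g^(p - 1) on singular chains\<close>

locale mod_p_action =
  fixes p :: nat and X :: "'a topology" and \<gamma> :: "'a \<Rightarrow> 'a"
  assumes prime_p: "prime p" and cont_\<gamma>: "continuous_map X X \<gamma>"
    and \<gamma>_p: "x \<in> topspace X \<Longrightarrow> (\<gamma> ^^ p) x = x"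
begin

lemma p_pos: "p > 0"
  using prime_p prime_gt_0_nat by blast

lemma cont_pow: "continuous_map X X (\<gamma> ^^ i)"
  by (induction i) (auto simp: cont_\<gamma> simp del: o_apply intro: continuous_map_compose)

lemma pow_mod:
  assumes "x \<in> topspace X"
  shows "(\<gamma> ^^ (i mod p)) x = (\<gamma> ^^ i) x"
proof -
  have "(\<gamma> ^^ (p * j)) x = x" for j
  proof (induction j)
    case (Suc j)
    then show ?case using \<gamma>_p[OF assms] by (simp add: funpow_add)
  qed simp
  then have "(\<gamma> ^^ (i mod p + p * (i div p))) x = (\<gamma> ^^ (i mod p)) x"
    by (simp only: funpow_add comp_apply)
  then show ?thesis by simp
qed

definition act :: "nat \<Rightarrow> nat \<Rightarrow> 'a chain \<Rightarrow> 'a chain"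
  where "act k i = chain_map k (\<gamma> ^^ i)"

definition move :: "nat \<Rightarrow> nat \<Rightarrow> ((nat \<Rightarrow> real) \<Rightarrow> 'a) \<Rightarrow> (nat \<Rightarrow> real) \<Rightarrow> 'a"
  where "move k i = simplex_map k (\<gamma> ^^ i)"

definition \<tau> :: "nat \<Rightarrow> 'a chain \<Rightarrow> 'a chain"
  where "\<tau> k c = c - act k 1 c"

text \<open>The exponents p - i make \<open>lookup_\<sigma>\<close> a plain sum over the translates
  \<open>move k i f\<close>, as a coefficient is pulled back along the inverse.
  \<open>\<sigma>_alt\<close> gives the usual order of summation.\<close>

definition \<sigma> :: "nat \<Rightarrow> 'a chain \<Rightarrow> 'a chain"
  where "\<sigma> k c = (\<Sum>i<p. act k (p - i) c)"

lemma act_diff: "act k i (c - d) = act k i c - act k i d"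
  by (simp add: act_def chain_map_diff)

lemma act_add: "act k i (c + d) = act k i c + act k i d"
  by (simp add: act_def chain_map_add)

lemma act_zero [simp]: "act k i 0 = 0"
  by (simp add: act_def)

lemma act_sum: "finite I \<Longrightarrow> act k i (sum f I) = (\<Sum>j\<in>I. act k i (f j))"
  by (simp add: act_def chain_map_sum o_def)

lemma act_act: "act k i (act k j c) = act k (i + j) c"
  by (simp add: act_def funpow_add chain_map_compose)

lemma act_p: "singular_chain k X c \<Longrightarrow> act k p c = c"
  unfolding act_def by (rule chain_map_id_gen) (auto simp: \<gamma>_p)

lemma act_0: "singular_chain k X c \<Longrightarrow> act k 0 c = c"
  unfolding act_def by (rule chain_map_id_gen) auto

lemma singular_act: "singular_chain k X c \<Longrightarrow> singular_chain k X (act k i c)"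
  unfolding act_def using singular_chain_chain_map cont_pow by blast

lemma bd_act: "singular_chain k X c \<Longrightarrow> chain_boundary k (act k i c) = act (k - 1) i (chain_boundary k c)"
  unfolding act_def by (simp add: chain_boundary_chain_map)

lemma singular_move: "singular_simplex k X f \<Longrightarrow> singular_simplex k X (move k i f)"
  unfolding move_def using singular_simplex_simplex_map cont_pow by blast

lemma move_move: "move k i (move k j f) = move k (i + j) f"
  by (simp add: move_def funpow_add simplex_map_compose)

lemma move_mod: "singular_simplex k X f \<Longrightarrow> move k (i mod p) f = move k i f"
  unfolding move_def by (rule simplex_map_eq) (auto simp: pow_mod)

lemma move_p: "singular_simplex k X f \<Longrightarrow> move k p f = f"
  unfolding move_def by (rule simplex_map_id_gen) (auto simp: \<gamma>_p)

lemma move_0: "singular_simplex k X f \<Longrightarrow> move k 0 f = f"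
  unfolding move_def by (rule simplex_map_id_gen) auto

lemma move_inverse: "singular_simplex k X f \<Longrightarrow> i \<le> p \<Longrightarrow> move k (p - i) (move k i f) = f"
  by (simp add: move_move move_p)

lemma move_inverse': "singular_simplex k X f \<Longrightarrow> i \<le> p \<Longrightarrow> move k i (move k (p - i) f) = f"
  by (simp add: move_move move_p)

lemma lookup_act:
  assumes "singular_chain k X c" "singular_simplex k X f" "i \<le> p"
  shows "lookup (act k i c) f = lookup c (move k (p - i) f)"
  using assms(1) unfolding singular_chain_def
proof (induction c rule: frag_induction)
  case (one g)
  then have g: "singular_simplex k X g" by simp
  have "move k i g = f \<longleftrightarrow> g = move k (p - i) f"
    using move_inverse[OF g assms(3)] move_inverse'[OF assms(2,3)] by auto
  then show ?case by (auto simp: act_def move_def)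
qed (auto simp: act_diff lookup_minus)

lemma lookup_act':
  assumes "singular_chain k X c" "singular_simplex k X f" "i \<le> p"
  shows "lookup (act k (p - i) c) f = lookup c (move k i f)"
  using lookup_act[OF assms(1,2), of "p - i"] assms(3) by simp

lemma \<sigma>_alt: "singular_chain k X c \<Longrightarrow> \<sigma> k c = (\<Sum>i<p. act k i c)"
proof -
  assume c: "singular_chain k X c"
  have "\<sigma> k c = (\<Sum>i<p. act k (Suc (p - Suc i)) c)"
    unfolding \<sigma>_def by (intro sum.cong) (auto simp: Suc_diff_Suc)
  also have "\<dots> = (\<Sum>i<p. act k (Suc i) c)"
    by (rule sum.nat_diff_reindex)
  also have "\<dots> = (\<Sum>i<p. act k i c)"
    using sum.lessThan_Suc_shift[of "\<lambda>i. act k i c" p] sum.lessThan_Suc[of "\<lambda>i. act k i c" p]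
    by (simp add: act_p[OF c] act_0[OF c])
  finally show ?thesis .
qed

lemma lookup_\<sigma>:
  "singular_chain k X c \<Longrightarrow> singular_simplex k X f \<Longrightarrow> lookup (\<sigma> k c) f = (\<Sum>i<p. lookup c (move k i f))"
  unfolding \<sigma>_def by (simp add: lookup_sum lookup_act')

lemma lookup_\<tau>:
  "singular_chain k X c \<Longrightarrow> singular_simplex k X f \<Longrightarrow>
    lookup (\<tau> k c) f = lookup c f - lookup c (move k (p - 1) f)"
  unfolding \<tau>_def using p_pos by (simp add: lookup_minus lookup_act)

lemma \<tau>_diff: "\<tau> k (c - d) = \<tau> k c - \<tau> k d"
  by (simp add: \<tau>_def act_diff)

lemma \<sigma>_diff: "\<sigma> k (c - d) = \<sigma> k c - \<sigma> k d"
  by (simp add: \<sigma>_def act_diff sum_subtractf)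

lemma singular_\<sigma>: "singular_chain k X c \<Longrightarrow> singular_chain k X (\<sigma> k c)"
  by (simp add: \<sigma>_def singular_act singular_chain_sum)

lemma bd_\<tau>: "singular_chain k X c \<Longrightarrow> chain_boundary k (\<tau> k c) = \<tau> (k - 1) (chain_boundary k c)"
  by (simp add: \<tau>_def chain_boundary_diff bd_act)

lemma bd_\<sigma>: "singular_chain k X c \<Longrightarrow> chain_boundary k (\<sigma> k c) = \<sigma> (k - 1) (chain_boundary k c)"
  by (simp add: \<sigma>_def chain_boundary_sum bd_act)

lemma \<tau>_\<sigma>: "singular_chain k X c \<Longrightarrow> \<tau> k (\<sigma> k c) = 0"
proof -
  assume c: "singular_chain k X c"
  have "act k 1 (\<sigma> k c) = (\<Sum>i<p. act k (Suc i) c)"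
    by (simp add: \<sigma>_alt[OF c] act_sum act_act)
  also have "\<dots> = (\<Sum>i<p. act k i c)"
    using sum.lessThan_Suc_shift[of "\<lambda>i. act k i c" p] sum.lessThan_Suc[of "\<lambda>i. act k i c" p]
    by (simp add: act_p[OF c] act_0[OF c])
  finally show ?thesis by (simp add: \<tau>_def \<sigma>_alt[OF c])
qed

lemma \<sigma>_\<tau>: "singular_chain k X c \<Longrightarrow> \<sigma> k (\<tau> k c) = 0"
proof -
  assume c: "singular_chain k X c"
  have "\<sigma> k (act k 1 c) = (\<Sum>i<p. act k (Suc i) c)"
    by (simp add: \<sigma>_alt[OF singular_act[OF c]] act_act)
  also have "\<dots> = (\<Sum>i<p. act k i c)"
    using sum.lessThan_Suc_shift[of "\<lambda>i. act k i c" p] sum.lessThan_Suc[of "\<lambda>i. act k i c" p]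
    by (simp add: act_p[OF c] act_0[OF c])
  finally show ?thesis by (simp add: \<tau>_def \<sigma>_diff \<sigma>_alt[OF c])
qed

definition invariant :: "'a set set \<Rightarrow> bool"
  where "invariant \<U> \<longleftrightarrow> (\<forall>U\<in>\<U>. \<gamma> ` U \<subseteq> U)"

lemma small_move:
  assumes "invariant \<U>" "small k \<U> f"
  shows "small k \<U> (move k i f)"
proof -
  obtain U where U: "U \<in> \<U>" "f ` standard_simplex k \<subseteq> U" using assms by (auto simp: small_def)
  have "(\<gamma> ^^ i) x \<in> U" if "x \<in> U" for x
    using that assms(1) U(1) by (induction i) (auto simp: invariant_def)
  then have "move k i f ` standard_simplex k \<subseteq> U" using U by (auto simp: move_def simplex_map_def)
  then show ?thesis using U by (auto simp: small_def)
qed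

lemma small_move_iff:
  assumes "invariant \<U>" "singular_simplex k X f" "i \<le> p"
  shows "small k \<U> (move k i f) \<longleftrightarrow> small k \<U> f"
  using small_move[OF assms(1), of k f i] small_move[OF assms(1), of k "move k i f" "p - i"]
    move_inverse[OF assms(2,3)] by auto

lemma act_mod_chains:
  assumes "invariant \<U>" "c \<in> mod_chains p X \<U> k" "i \<le> p"
  shows "act k i c \<in> mod_chains p X \<U> k"
proof (rule mod_chainsI)
  show "singular_chain k X (act k i c)" using assms mod_chainsD singular_act by blast
  fix f assume f: "singular_simplex k X f" "\<not> small k \<U> f"
  then have "\<not> small k \<U> (move k (p - i) f)" using small_move_iff[OF assms(1) f(1)] by simp
  then show "int p dvd lookup (act k i c) f"
    using assms lookup_act[OF mod_chainsD f(1) assms(3)] by (auto simp: mod_chains_def)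
qed

lemma \<tau>_mod_chains: "invariant \<U> \<Longrightarrow> c \<in> mod_chains p X \<U> k \<Longrightarrow> \<tau> k c \<in> mod_chains p X \<U> k"
  unfolding \<tau>_def using p_pos by (intro ab_subgroup_diff[OF sub_mod_chains] act_mod_chains) auto

lemma \<sigma>_mod_chains: "invariant \<U> \<Longrightarrow> c \<in> mod_chains p X \<U> k \<Longrightarrow> \<sigma> k c \<in> mod_chains p X \<U> k"
  unfolding \<sigma>_def by (intro ab_subgroup_sum[OF sub_mod_chains] act_mod_chains) auto

definition fixed_set :: "'a set"
  where "fixed_set = {x \<in> topspace X. \<gamma> x = x}"

text \<open>As i is invertible modulo p, \<gamma> agrees at x with a power of \<gamma>^i. This is
  how primality makes every orbit either a single point or free.\<close>

lemma fixed_set_pow: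
  assumes "x \<in> topspace X" "(\<gamma> ^^ i) x = x" "0 < i" "i < p"
  shows "x \<in> fixed_set"
proof -
  have "coprime i p" using assms(3,4) prime_p by (meson coprime_commute nat_dvd_not_less prime_imp_coprime_nat)
  then obtain a b where ab: "a * i = b * p + 1"
    using bezout_nat[of i p] assms(3) by (auto simp: mult.commute)
  have "(\<gamma> ^^ (a * i)) x = x"
  proof (induction a)
    case (Suc a)
    then show ?case using assms(2) by (simp add: funpow_add)
  qed simp
  moreover have "(\<gamma> ^^ (a * i)) x = (\<gamma> ^^ ((a * i) mod p)) x" using pow_mod[OF assms(1)] by simp
  moreover have "(a * i) mod p = 1" using prime_gt_1_nat[OF prime_p] unfolding ab by (simp add: mod_Suc)
  ultimately show ?thesis using assms(1) by (simp add: fixed_set_def)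
qed

end

text \<open>
  The simplices of the pair not lying in \<open>\<V>\<close> form a free \<open>\<int>/p\<close>-set with system of representatives
  \<open>R\<close>.
\<close>

locale free_pair = mod_p_action +
  fixes \<U> \<V> :: "'a set set" and R :: "nat \<Rightarrow> ((nat \<Rightarrow> real) \<Rightarrow> 'a) set"
  assumes inv_\<U>: "invariant \<U>" and inv_\<V>: "invariant \<V>"
    and small_\<V>_\<U>: "small k \<V> f \<Longrightarrow> small k \<U> f"
    and representative: "singular_simplex k X f \<Longrightarrow> small k \<U> f \<Longrightarrow> \<not> small k \<V> f \<Longrightarrow>
           \<exists>!i. i < p \<and> move k i f \<in> R k"
    and R_sub: "f \<in> R k \<Longrightarrow> singular_simplex k X f \<and> small k \<U> f \<and> \<not> small k \<V> f"
begin

sublocale complex_pair chain_boundary "mod_chains p X \<U>" "mod_chains p X \<V>"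
  by (rule mod_chains_pair) (rule small_\<V>_\<U>)

text \<open>The coefficients of c at those f for which \<open>move k i f\<close> is a
  representative, transported to the representatives. \<open>decomposition\<close> puts c together
  again from these parts.\<close>

definition part :: "nat \<Rightarrow> nat \<Rightarrow> 'a chain \<Rightarrow> 'a chain"
  where "part k i c = frag_restrict (R k) (act k i c)"

lemma singular_part: "singular_chain k X c \<Longrightarrow> singular_chain k X (part k i c)"
  using R_sub by (auto simp: part_def singular_chain_def keys_frag_restrict)

lemma lookup_part:
  assumes "singular_chain k X c" "singular_simplex k X f" "i < p"
  shows "lookup (act k (p - i) (part k i c)) f = (if move k i f \<in> R k then lookup c f else 0)"
  using assms move_inverse[OF assms(2), of i]
  by (simp add: lookup_act' singular_part) (simp add: part_def lookup_frag_restrict lookup_act singular_move)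

lemma sum_unique:
  assumes "\<exists>!i. i < p \<and> P i" "i < p" "P i"
  shows "(\<Sum>j<p. if P j then g j else (0::int)) = g i"
proof -
  have "(\<Sum>j<p. if P j then g j else 0) = (\<Sum>j<p. if j = i then g j else 0)"
    using assms by (intro sum.cong) auto
  then show ?thesis using assms(2) by simp
qed

lemma decomposition:
  assumes c: "c \<in> mod_chains p X \<U> k"
  shows "c - (\<Sum>i<p. act k (p - i) (part k i c)) \<in> mod_chains p X \<V> k"
proof (rule mod_chainsI)
  have sc: "singular_chain k X c" using c by (rule mod_chainsD)
  then show "singular_chain k X (c - (\<Sum>i<p. act k (p - i) (part k i c)))"
    by (intro singular_chain_diff singular_chain_sum singular_act singular_part)
  fix f assume f: "singular_simplex k X f" "\<not> small k \<V> f"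
  have eq: "lookup (c - (\<Sum>i<p. act k (p - i) (part k i c))) f
      = lookup c f - (\<Sum>i<p. if move k i f \<in> R k then lookup c f else 0)"
    by (simp add: lookup_minus lookup_sum lookup_part[OF sc f(1)])
  show "int p dvd lookup (c - (\<Sum>i<p. act k (p - i) (part k i c))) f"
  proof (cases "small k \<U> f")
    case True
    then have ex: "\<exists>!i. i < p \<and> move k i f \<in> R k" using representative f by blast
    then obtain i where "i < p" "move k i f \<in> R k" by blast
    then show ?thesis using sum_unique[OF ex, of i "\<lambda>_. lookup c f"] by (simp add: eq)
  next
    case False
    then have "\<not> small k \<U> (move k i f)" if "i < p" for i
      using small_move_iff[OF inv_\<U> f(1)] that by simp
    then have "move k i f \<notin> R k" if "i < p" for i using R_sub that by blast
    then have "lookup (c - (\<Sum>i<p. act k (p - i) (part k i c))) f = lookup c f" by (simp add: eq)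
    then show ?thesis using c False by (simp add: mod_chains_def)
  qed
qed

text \<open>If \<tau> c vanishes outside \<V>, the coefficients of c are constant modulo p along
  each free orbit, so c is \<sigma> of its restriction to the representatives.\<close>

lemma exact_\<tau>_imp:
  assumes c: "c \<in> mod_chains p X \<U> k" and \<tau>: "\<tau> k c \<in> mod_chains p X \<V> k"
  shows "c \<in> image_plus (mod_chains p X \<U>) (mod_chains p X \<V>) \<sigma> k"
proof -
  have sc: "singular_chain k X c" using c by (rule mod_chainsD)
  define e where "e = frag_restrict (R k) c"
  have se: "singular_chain k X e" using sc by (auto simp: e_def singular_chain_def keys_frag_restrict)
  have "e \<in> mod_chains p X \<U> k"
    by (rule small_mod_chains[OF se]) (use R_sub in \<open>auto simp: e_def keys_frag_restrict\<close>)
  moreover have "c - \<sigma> k e \<in> mod_chains p X \<V> k"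
  proof (rule mod_chainsI)
    show "singular_chain k X (c - \<sigma> k e)" by (intro singular_chain_diff singular_\<sigma> sc se)
    fix f assume f: "singular_simplex k X f" "\<not> small k \<V> f"
    have eq: "lookup (c - \<sigma> k e) f
        = lookup c f - (\<Sum>i<p. if move k i f \<in> R k then lookup c (move k i f) else 0)"
      by (simp add: lookup_minus lookup_\<sigma>[OF se f(1)]) (simp add: e_def lookup_frag_restrict)
    show "int p dvd lookup (c - \<sigma> k e) f"
    proof (cases "small k \<U> f")
      case True
      then have ex: "\<exists>!i. i < p \<and> move k i f \<in> R k" using representative f by blast
      then obtain i where i: "i < p" "move k i f \<in> R k" by blast
      have "int p dvd lookup c f - lookup c (move k j f)" if "j < p" for j
        using that
      proof (induction j)
        case 0
        then show ?case using f by (simp add: move_0)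
      next
        case (Suc j)
        have s: "singular_simplex k X (move k (Suc j) f)" using f singular_move by blast
        have "\<not> small k \<V> (move k (Suc j) f)" using small_move_iff[OF inv_\<V> f(1)] Suc.prems f by simp
        then have "int p dvd lookup (\<tau> k c) (move k (Suc j) f)" using \<tau> by (simp add: mod_chains_def)
        moreover have "move k (p - 1) (move k (Suc j) f) = move k j f"
        proof -
          have "move k (p - 1) (move k (Suc j) f) = move k (p + j) f"
            using p_pos by (simp add: move_move)
          also have "\<dots> = move k j f" using move_mod[OF f(1), of "p + j"] move_mod[OF f(1), of j] by simp
          finally show ?thesis .
        qed
        ultimately have "int p dvd lookup c (move k (Suc j) f) - lookup c (move k j f)"
          by (simp add: lookup_\<tau>[OF sc s] del: One_nat_def)
        then have "int p dvd (lookup c f - lookup c (move k j f)) - (lookup c (move k (Suc j) f) - lookup c (move k j f))"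
          using Suc.IH Suc.prems dvd_diff Suc_lessD by blast
        then show ?case by simp
      qed
      then show ?thesis using sum_unique[OF ex i, of "\<lambda>j. lookup c (move k j f)"] i by (simp add: eq)
    next
      case False
      then have "\<not> small k \<U> (move k i f)" if "i < p" for i
        using small_move_iff[OF inv_\<U> f(1)] that by simp
      then have "move k i f \<notin> R k" if "i < p" for i using R_sub that by blast
      then have "lookup (c - \<sigma> k e) f = lookup c f" by (simp add: eq)
      then show ?thesis using c False by (simp add: mod_chains_def)
    qed
  qed
  ultimately show ?thesis by (auto simp: image_plus_def)
qed

lemma \<tau>_telescope:
  assumes "singular_chain k X c"
  shows "\<tau> k (\<Sum>j<m. act k j c) = c - act k m c"
proof (induction m)
  case 0
  then show ?case using assms by (simp add: \<tau>_def act_0)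
next
  case (Suc m)
  have "\<tau> k (\<Sum>j<Suc m. act k j c) = \<tau> k (\<Sum>j<m. act k j c) + (act k m c - act k (Suc m) c)"
    by (simp add: \<tau>_def act_add act_act)
  then show ?case using Suc by simp
qed

text \<open>Write c as the sum of translates of its parts, up to \<V>. By
  \<open>\<tau>_telescope\<close> a translate differs from the part itself by an explicit image
  under \<tau>; these make up \<open>e\<close>. What remains is the sum of the parts, which is the
  restriction of \<sigma> c to the representatives and so vanishes modulo p.\<close>

lemma exact_\<sigma>_imp:
  assumes c: "c \<in> mod_chains p X \<U> k" and \<sigma>: "\<sigma> k c \<in> mod_chains p X \<V> k"
  shows "c \<in> image_plus (mod_chains p X \<U>) (mod_chains p X \<V>) \<tau> k"
proof -
  have sc: "singular_chain k X c" using c by (rule mod_chainsD)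
  define e where "e = - (\<Sum>i<p. \<Sum>j<p - i. act k j (part k i c))"
  have part: "part k i c \<in> mod_chains p X \<U> k" for i
    by (rule small_mod_chains[OF singular_part[OF sc]]) (use R_sub in \<open>auto simp: part_def keys_frag_restrict\<close>)
  have "e \<in> mod_chains p X \<U> k"
    unfolding e_def by (intro ab_subgroup_minus[OF sub_mod_chains] ab_subgroup_sum[OF sub_mod_chains]
        act_mod_chains inv_\<U> part) auto
  moreover have "c - \<tau> k e \<in> mod_chains p X \<V> k"
  proof -
    have "\<tau> k e = - (\<Sum>i<p. \<tau> k (\<Sum>j<p - i. act k j (part k i c)))"
      by (simp add: e_def \<tau>_def act_sum sum_subtractf act_diff[of k _ 0, simplified])
    also have "\<dots> = (\<Sum>i<p. act k (p - i) (part k i c)) - (\<Sum>i<p. part k i c)"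
      by (simp add: \<tau>_telescope singular_part[OF sc] sum_subtractf)
    finally have eq: "c - \<tau> k e = (c - (\<Sum>i<p. act k (p - i) (part k i c))) + (\<Sum>i<p. part k i c)"
      by simp
    have "(\<Sum>i<p. part k i c) \<in> mod_chains p X \<V> k"
    proof (rule mod_chainsI)
      show "singular_chain k X (\<Sum>i<p. part k i c)" by (intro singular_chain_sum singular_part sc)
      fix f assume f: "singular_simplex k X f" "\<not> small k \<V> f"
      have "lookup (\<Sum>i<p. part k i c) f = (if f \<in> R k then lookup (\<sigma> k c) f else 0)"
        by (simp add: lookup_sum part_def lookup_frag_restrict \<sigma>_alt[OF sc])
      then show "int p dvd lookup (\<Sum>i<p. part k i c) f"
        using \<sigma> f(2) by (simp add: mod_chains_def)
    qed
    then show ?thesis unfolding eq using decomposition[OF c] ab_subgroup_add[OF sub_mod_chains] by blast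
  qed
  ultimately show ?thesis by (auto simp: image_plus_def)
qed

sublocale smith_pair chain_boundary "mod_chains p X \<U>" "mod_chains p X \<V>" \<tau> \<sigma>
proof
  show "(\<tau> k x \<in> mod_chains p X \<V> k) = (x \<in> image_plus (mod_chains p X \<U>) (mod_chains p X \<V>) \<sigma> k)"
    if x: "x \<in> mod_chains p X \<U> k" for k x
  proof
    assume "x \<in> image_plus (mod_chains p X \<U>) (mod_chains p X \<V>) \<sigma> k"
    then obtain c where c: "c \<in> mod_chains p X \<U> k" "x - \<sigma> k c \<in> mod_chains p X \<V> k"
      unfolding image_plus_def by blast
    then have "\<tau> k (x - \<sigma> k c) \<in> mod_chains p X \<V> k" using \<tau>_mod_chains inv_\<V> by blast
    then show "\<tau> k x \<in> mod_chains p X \<V> k" using \<tau>_\<sigma>[OF mod_chainsD[OF c(1)]] by (simp add: \<tau>_diff)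
  qed (use exact_\<tau>_imp x in blast)
  show "(\<sigma> k x \<in> mod_chains p X \<V> k) = (x \<in> image_plus (mod_chains p X \<U>) (mod_chains p X \<V>) \<tau> k)"
    if x: "x \<in> mod_chains p X \<U> k" for k x
  proof
    assume "x \<in> image_plus (mod_chains p X \<U>) (mod_chains p X \<V>) \<tau> k"
    then obtain c where c: "c \<in> mod_chains p X \<U> k" "x - \<tau> k c \<in> mod_chains p X \<V> k"
      unfolding image_plus_def by blast
    then have "\<sigma> k (x - \<tau> k c) \<in> mod_chains p X \<V> k" using \<sigma>_mod_chains inv_\<V> by blast
    then show "\<sigma> k x \<in> mod_chains p X \<V> k" using \<sigma>_\<tau>[OF mod_chainsD[OF c(1)]] by (simp add: \<sigma>_diff)
  qed (use exact_\<sigma>_imp x in blast)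
  show "chain_boundary k (\<tau> k x) = \<tau> (k - 1) (chain_boundary k x)"
    if "x \<in> mod_chains p X \<U> k" for k x using that bd_\<tau> mod_chainsD by blast
  show "chain_boundary k (\<sigma> k x) = \<sigma> (k - 1) (chain_boundary k x)"
    if "x \<in> mod_chains p X \<U> k" for k x using that bd_\<sigma> mod_chainsD by blast
qed (rule \<tau>_diff \<sigma>_diff \<tau>_mod_chains[OF inv_\<U>] \<sigma>_mod_chains[OF inv_\<U>]
      \<tau>_mod_chains[OF inv_\<V>] \<sigma>_mod_chains[OF inv_\<V>]; assumption)+

end

context mod_p_action
begin

text \<open>One simplex is chosen from every orbit. A simplex equal to one of its nontrivial
  translates has all its points in the fixed set, by \<open>fixed_set_pow\<close>, and is small for
  \<V> by assumption \<open>F\<close>; hence the remaining orbits are free.\<close>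

lemma free_pairI:
  assumes \<U>: "invariant \<U>" and \<V>: "invariant \<V>" and le: "\<And>k f. small k \<V> f \<Longrightarrow> small k \<U> f"
    and F: "\<And>k f. f ` standard_simplex k \<subseteq> fixed_set \<Longrightarrow> small k \<U> f \<Longrightarrow> small k \<V> f"
  shows "\<exists>R. free_pair p X \<gamma> \<U> \<V> R"
proof -
  define N where "N k = {f. singular_simplex k X f \<and> small k \<U> f \<and> \<not> small k \<V> f}" for k
  define orb where "orb k f = (\<lambda>i. move k i f) ` {..<p}" for k f
  define R where "R k = {f \<in> N k. f = (SOME g. g \<in> orb k f)}" for k
  have move_N: "move k i f \<in> N k" if "f \<in> N k" "i \<le> p" for k i f
  proof -
    have f: "singular_simplex k X f" using that by (simp add: N_def)
    show ?thesis
      using that small_move_iff[OF \<U> f] small_move_iff[OF \<V> f] singular_move[OF f] by (simp add: N_def)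
  qed
  have orb_eq: "orb k (move k i f) = orb k f" if "f \<in> N k" for k i f
  proof
    have f: "singular_simplex k X f" using that by (simp add: N_def)
    show "orb k (move k i f) \<subseteq> orb k f"
    proof
      fix g assume "g \<in> orb k (move k i f)"
      then obtain j where "g = move k (j + i) f" by (auto simp: orb_def move_move)
      then have "g = move k ((j + i) mod p) f" using move_mod[OF f] by simp
      then show "g \<in> orb k f" using p_pos by (auto simp: orb_def)
    qed
    show "orb k f \<subseteq> orb k (move k i f)"
    proof
      fix g assume "g \<in> orb k f"
      then obtain j where j: "g = move k j f" "j < p" by (auto simp: orb_def)
      \<comment> \<open>Modulo p the factor p - 1 is -1, so l stands for j - i.\<close>
      define l where "l = (j + (p - 1) * i) mod p"
      have "move k l (move k i f) = move k ((l + i) mod p) f" using move_mod[OF f] by (simp add: move_move)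
      also have "(l + i) mod p = (j + (p - 1) * i + i) mod p" by (simp add: l_def mod_simps)
      also have "\<dots> = (j + p * i) mod p" using p_pos by (cases p) (simp_all add: algebra_simps)
      also have "\<dots> = j" using j by simp
      finally have "g = move k l (move k i f)" using j by simp
      then show "g \<in> orb k (move k i f)" using p_pos by (auto simp: orb_def l_def)
    qed
  qed
  have inj: "i = j" if "f \<in> N k" "i < p" "j < p" "move k i f = move k j f" "i \<le> j" for k f i j
  proof (rule ccontr)
    assume "i \<noteq> j"
    have f: "singular_simplex k X f" "small k \<U> f" "\<not> small k \<V> f" using that(1) by (auto simp: N_def)
    have "move k (p - i) (move k i f) = move k (p - i) (move k j f)" using that by simp
    moreover have "p - i + j = p + (j - i)" using that by simp
    ultimately have "f = move k (p + (j - i)) f"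
      using that(2) move_inverse[OF f(1), of i] by (metis less_imp_le move_move)
    then have eq: "f = move k (j - i) f"
      using move_mod[OF f(1), of "p + (j - i)"] move_mod[OF f(1), of "j - i"] by simp
    have "f ` standard_simplex k \<subseteq> fixed_set"
    proof (rule image_subsetI)
      fix x assume x: "x \<in> standard_simplex k"
      then have "f x = (\<gamma> ^^ (j - i)) (f x)" using fun_cong[OF eq, of x] by (simp add: move_def simplex_map_def)
      moreover have "f x \<in> topspace X"
        using f(1) x by (auto simp: singular_simplex_def continuous_map_def topspace_standard_simplex)
      ultimately show "f x \<in> fixed_set" using fixed_set_pow[of "f x" "j - i"] that \<open>i \<noteq> j\<close> by simp
    qed
    then show False using F f by blast
  qed
  show ?thesis
  proof (intro exI[of _ R] free_pair.intro free_pair_axioms.intro)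
    show "mod_p_action p X \<gamma>" by (rule mod_p_action_axioms)
    show "f \<in> R k \<Longrightarrow> singular_simplex k X f \<and> small k \<U> f \<and> \<not> small k \<V> f" for f k
      by (simp add: R_def N_def)
    fix k f assume "singular_simplex k X f" "small k \<U> f" "\<not> small k \<V> f"
    then have f: "f \<in> N k" by (simp add: N_def)
    have "move k 0 f \<in> orb k f" using p_pos by (auto simp: orb_def)
    then have "(SOME g. g \<in> orb k f) \<in> orb k f" by (rule someI[where P = "\<lambda>g. g \<in> orb k f"])
    then obtain i where i: "i < p" "(SOME g. g \<in> orb k f) = move k i f" by (auto simp: orb_def)
    have "move k i f \<in> R k" using i move_N[OF f] orb_eq[OF f] by (simp add: R_def)
    moreover have "j = i" if "j < p" "move k j f \<in> R k" for j
    proof -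
      have "move k j f = move k i f" using that i orb_eq[OF f] by (simp add: R_def)
      then show ?thesis using inj[OF f, of i j] inj[OF f, of j i] that i by (metis nat_le_linear)
    qed
    ultimately show "\<exists>!i. i < p \<and> move k i f \<in> R k" using i by blast
  qed (use \<U> \<V> le in auto)
qed

end

section \<open>Excision and free orbits\<close>

lemma small_singleton: "small k {Y} f \<longleftrightarrow> f ` standard_simplex k \<subseteq> Y"
  by (simp add: small_def)

lemma small_pair: "small k {U, W} f \<longleftrightarrow> f ` standard_simplex k \<subseteq> U \<or> f ` standard_simplex k \<subseteq> W"
  by (auto simp: small_def)

lemma singular_chain_in_mod_chains:
  "singular_chain k (subtopology X Y) c \<Longrightarrow> c \<in> mod_chains p X {Y} k"
  by (rule small_mod_chains) (auto simp: singular_chain_subtopology small_singleton)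

lemma mod_chains_Int:
  "c \<in> mod_chains p X {U} k \<Longrightarrow> c \<in> mod_chains p X {W} k \<Longrightarrow> c \<in> mod_chains p X {U \<inter> W} k"
  unfolding mod_chains_def small_singleton by blast

lemma mod_chains_refine:
  assumes "\<And>U. U \<in> \<U> \<Longrightarrow> \<exists>V\<in>\<V>. U \<subseteq> V"
  shows "c \<in> mod_chains p X \<U> k \<Longrightarrow> c \<in> mod_chains p X \<V> k"
proof -
  have "small k \<U> f \<Longrightarrow> small k \<V> f" for f :: "(nat \<Rightarrow> real) \<Rightarrow> 'a"
    using assms unfolding small_def by (meson order_trans)
  then show "c \<in> mod_chains p X \<U> k \<Longrightarrow> c \<in> mod_chains p X \<V> k"
    using mod_chains_mono[of k \<U> \<V>] by blast
qed

text \<open>The kernel of r(Y / A) \<rightarrow> r(Y / B) is r(B / A): if r y lies in B, exactness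
  over B gives y = r' c + b, and r r' = 0 leaves r y = r b. Acyclicity therefore passes from the two
  outer complexes to r(Y / A).\<close>

lemma image_filtration:
  assumes "smith_pair bd Y B r r'" "complex_pair bd B A"
    and r_A: "\<And>k x. x \<in> B k \<Longrightarrow> r k x \<in> B k"
    and rr': "\<And>k x. x \<in> Y k \<Longrightarrow> r k (r' k x) = 0"
    and 1: "acyclic_at bd (image_plus B A r) A k"
    and 2: "acyclic_at bd (image_plus Y B r) B k"
  shows "acyclic_at bd (image_plus Y A r) A k"
proof (rule acyclic_atI)
  interpret YB: smith_pair bd Y B r r' by fact
  interpret BA: complex_pair bd B A by fact
  fix x assume x: "x \<in> image_plus Y A r k" "bd k x \<in> A (k - 1)"
  obtain y where y: "y \<in> Y k" "x - r k y \<in> A k" using x(1) unfolding image_plus_def by blast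
  have "x \<in> image_plus Y B r k" using y BA.D_C unfolding image_plus_def by blast
  then obtain z where z: "z \<in> image_plus Y B r (Suc k)" "x - bd (Suc k) z \<in> B k"
    using acyclic_atD[OF 2] BA.D_C[OF x(2)] by blast
  obtain y' where y': "y' \<in> Y (Suc k)" "z - r (Suc k) y' \<in> B (Suc k)"
    using z(1) unfolding image_plus_def by blast
  define v where "v = x - bd (Suc k) (r (Suc k) y')"
  have "(x - bd (Suc k) z) + bd (Suc k) (z - r (Suc k) y') \<in> B k"
    using z(2) YB.bd_Suc_D[OF y'(2)] YB.D_simps(3) by blast
  then have vB: "v \<in> B k" by (simp add: v_def YB.bd_diff)
  have rb: "bd (Suc k) (r (Suc k) y') = r k (bd (Suc k) y')" using YB.bd_r[OF y'(1)] by simp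
  have veq: "v - (x - r k y) = r k (y - bd (Suc k) y')" by (simp add: v_def rb YB.r_diff)
  have yY: "y - bd (Suc k) y' \<in> Y k" using YB.C_simps(2)[OF y(1) YB.bd_Suc_C[OF y'(1)]] .
  have "r k (y - bd (Suc k) y') \<in> B k"
    using YB.D_simps(2)[OF vB BA.D_C[OF y(2)]] by (simp only: veq)
  then obtain c where c: "c \<in> Y k" "y - bd (Suc k) y' - r' k c \<in> B k"
    using YB.exact_r[OF yY] unfolding image_plus_def by blast
  have "v - r k (y - bd (Suc k) y' - r' k c) = x - r k y"
  proof -
    have "v - r k (y - bd (Suc k) y' - r' k c) = v - (r k (y - bd (Suc k) y') - r k (r' k c))"
      by (simp only: YB.r_diff)
    also have "\<dots> = v - (v - (x - r k y))" by (simp only: rr'[OF c(1)] veq) simp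
    finally show ?thesis by simp
  qed
  then have "v - r k (y - bd (Suc k) y' - r' k c) \<in> A k" using y(2) by (simp only:)
  then have vE: "v \<in> image_plus B A r k" using c(2) unfolding image_plus_def by blast
  have "bd (Suc k) (r (Suc k) y') = r k (bd (Suc k) y')" by (rule rb)
  have "bd k v = bd k x" by (simp add: v_def YB.bd_diff YB.bd_bd YB.r_C y'(1))
  then have "bd k v \<in> A (k - 1)" using x(2) by simp
  then obtain w where w: "w \<in> image_plus B A r (Suc k)" "v - bd (Suc k) w \<in> A k"
    using acyclic_atD[OF 1 vE] by blast
  obtain b where b: "b \<in> B (Suc k)" "w - r (Suc k) b \<in> A (Suc k)"
    using w(1) unfolding image_plus_def by blast
  have "(r (Suc k) y' + w) - r (Suc k) (y' + b) \<in> A (Suc k)" using b(2) by (simp add: YB.r_add)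
  moreover have "y' + b \<in> Y (Suc k)" using YB.C_simps(3)[OF y'(1) YB.D_C[OF b(1)]] .
  ultimately have "r (Suc k) y' + w \<in> image_plus Y A r (Suc k)" unfolding image_plus_def by blast
  moreover have "x - bd (Suc k) (r (Suc k) y' + w) \<in> A k"
    using w(2) by (simp add: v_def YB.bd_add algebra_simps)
  ultimately show "\<exists>y\<in>image_plus Y A r (Suc k). x - bd (Suc k) y \<in> A k" by blast
qed

lemma keys_cmul_eq: "m \<noteq> 0 \<Longrightarrow> keys (frag_cmul m c) = keys c"
  by (auto simp: in_keys_iff)

text \<open>The part of the universal coefficient theorem needed here: without \<open>p\<close>-torsion, cycles modulo \<open>p\<close> lift.\<close>

lemma lift_mod_cycle:
  assumes p: "p > 0" and YY': "Y \<subseteq> Y'"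
    and torsion_free: "\<And>e. k > 0 \<Longrightarrow> singular_relcycle (k - 1) (subtopology X Y') Y e \<Longrightarrow>
           singular_relboundary (k - 1) (subtopology X Y') Y (frag_cmul (int p) e) \<Longrightarrow>
           singular_relboundary (k - 1) (subtopology X Y') Y e"
    and c: "c \<in> mod_chains p X {Y'} k" "chain_boundary k c \<in> mod_chains p X {Y} (k - 1)"
  obtains b w where "singular_relcycle k (subtopology X Y') Y b" "singular_chain k X w" "c = b + frag_cmul (int p) w"
proof -
  let ?Z = "subtopology X Y'" and ?S = "subtopology (subtopology X Y') Y"
  have S: "?S = subtopology X Y" using YY' by (simp add: subtopology_subtopology Int_absorb1)
  obtain a e where ae: "c = a + frag_cmul (int p) e" "singular_chain k X a" "singular_chain k X e"
    "\<And>f. f \<in> keys a \<Longrightarrow> small k {Y'} f"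
    using mod_chains_split[OF c(1)] by metis
  have aZ: "singular_chain k ?Z a" using ae by (auto simp: singular_chain_subtopology small_singleton)
  have "chain_boundary k a = chain_boundary k c - frag_cmul (int p) (chain_boundary k e)"
    by (simp add: ae(1) chain_boundary_add chain_boundary_cmul)
  moreover have "frag_cmul (int p) (chain_boundary k e) \<in> mod_chains p X {Y} (k - 1)"
    using singular_chain_boundary[OF ae(3)] by (intro cmul_mod_chains) simp
  ultimately have "chain_boundary k a \<in> mod_chains p X {Y} (k - 1)"
    using ab_subgroup_diff[OF sub_mod_chains c(2)] by metis
  then obtain y e' where ye: "chain_boundary k a = y + frag_cmul (int p) e'"
    "singular_chain (k - 1) X y" "singular_chain (k - 1) X e'" "keys y \<subseteq> keys (chain_boundary k a)"
    "keys e' \<subseteq> keys (chain_boundary k a)" "\<And>f. f \<in> keys y \<Longrightarrow> small (k - 1) {Y} f"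
    using mod_chains_split by metis
  have baZ: "singular_chain (k - 1) ?Z (chain_boundary k a)" using singular_chain_boundary[OF aZ] by simp
  then have e'Z: "singular_chain (k - 1) ?Z e'" using ye(5) by (auto simp: singular_chain_def)
  have yS: "singular_chain (k - 1) (subtopology X Y) y"
    using ye(2,6) by (auto simp: singular_chain_subtopology small_singleton)
  \<comment> \<open>The multiple p e' bounds relative to Y and e' is a relative cycle, so e' bounds
    some f by torsion-freeness; then a - p f is the integral relative cycle looked for. In degree 0
    the boundary of a is 0, which puts e' into Y, and f = 0 works.\<close>
  obtain f where f: "singular_chain k ?Z f" "singular_chain (k - 1) (subtopology X Y) (e' - chain_boundary k f)"
  proof (cases "k = 0")
    case True
    have "singular_chain 0 (subtopology X Y) e'"
    proof -
      have "frag_cmul (int p) e' = - y" using ye(1) True by (simp add: chain_boundary_def add_eq_0_iff)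
      moreover have "keys (- y) = keys y" by simp
      ultimately have "keys e' = keys y" using keys_cmul_eq[of "int p" e'] p by simp
      then show ?thesis using yS True by (simp add: singular_chain_def)
    qed
    then show ?thesis using that[of 0] True by simp
  next
    case False
    then obtain j where k: "k = Suc j" using not0_implies_Suc by blast
    have "chain_boundary j (chain_boundary k a) = 0" using chain_boundary_boundary_Suc ae(2) k by blast
    then have "frag_cmul (int p) (chain_boundary j e') = - chain_boundary j y"
      using ye(1) by (simp add: chain_boundary_add chain_boundary_cmul add_eq_0_iff)
    moreover have "keys (- chain_boundary j y) = keys (chain_boundary j y)" by simp
    ultimately have "keys (chain_boundary j e') = keys (chain_boundary j y)"
      using keys_cmul_eq[of "int p" "chain_boundary j e'"] p by simp
    moreover have "singular_chain (j - 1) ?S (chain_boundary j y)"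
      using singular_chain_boundary[of j "subtopology X Y" y] yS k S by simp
    ultimately have "singular_chain (j - 1) ?S (chain_boundary j e')" by (simp add: singular_chain_def)
    then have "singular_relcycle j ?Z Y e'" using e'Z k by (simp add: singular_relcycle)
    moreover have "singular_relboundary j ?Z Y (frag_cmul (int p) e')"
    proof -
      have "chain_boundary (Suc j) a + (- y) = frag_cmul (int p) e'" using ye(1) k by simp
      moreover have "singular_chain j ?S (- y)" using yS k S by (simp add: singular_chain_minus)
      ultimately show ?thesis using aZ k unfolding singular_relboundary by blast
    qed
    ultimately have "singular_relboundary j ?Z Y e'" using torsion_free[of e'] k by simp
    then obtain f d where fd: "singular_chain (Suc j) ?Z f" "singular_chain j ?S d" "chain_boundary (Suc j) f + d = e'"
      unfolding singular_relboundary by blast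
    then have "e' - chain_boundary k f = d" by (simp add: k flip: fd(3))
    then show ?thesis using that[of f] fd k S by simp
  qed
  define b where "b = a - frag_cmul (int p) f"
  have "chain_boundary k b = y + frag_cmul (int p) (e' - chain_boundary k f)"
    using ye(1) by (intro poly_mapping_eqI)
      (simp add: b_def chain_boundary_diff chain_boundary_cmul lookup_add lookup_minus algebra_simps)
  moreover have "singular_chain (k - 1) (subtopology X Y) (y + frag_cmul (int p) (e' - chain_boundary k f))"
    using yS f(2) by (simp add: singular_chain_add singular_chain_cmul)
  ultimately have "singular_relcycle k ?Z Y b"
    using aZ f(1) S by (simp add: singular_relcycle b_def singular_chain_diff singular_chain_cmul)
  moreover have "singular_chain k X (f + e)"
    using f(1) ae(3) by (simp add: singular_chain_subtopology singular_chain_add)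
  moreover have "c = b + frag_cmul (int p) (f + e)"
    by (simp add: ae(1) b_def frag_cmul_distrib2)
  ultimately show thesis by (rule that)
qed

text \<open>\<open>lift_mod_cycle\<close> replaces a cycle modulo p by an integral one, and that one
  bounds. The degree k - 1 enters through the Tor term of the universal coefficient theorem.\<close>

lemma acyclic_mod_from_integral:
  assumes p: "p > 0" and YY': "Y \<subseteq> Y'"
    and torsion_free: "\<And>e. k > 0 \<Longrightarrow> singular_relcycle (k - 1) (subtopology X Y') Y e \<Longrightarrow>
           singular_relboundary (k - 1) (subtopology X Y') Y (frag_cmul (int p) e) \<Longrightarrow>
           singular_relboundary (k - 1) (subtopology X Y') Y e"
    and int: "\<And>c. singular_relcycle k (subtopology X Y') Y c \<Longrightarrow> singular_relboundary k (subtopology X Y') Y c"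
  shows "acyclic_at chain_boundary (mod_chains p X {Y'}) (mod_chains p X {Y}) k"
proof (rule acyclic_atI)
  let ?Z = "subtopology X Y'" and ?S = "subtopology (subtopology X Y') Y"
  have S: "?S = subtopology X Y" using YY' by (simp add: subtopology_subtopology Int_absorb1)
  fix c assume c: "c \<in> mod_chains p X {Y'} k" "chain_boundary k c \<in> mod_chains p X {Y} (k - 1)"
  obtain b w where b: "singular_relcycle k ?Z Y b" "singular_chain k X w" "c = b + frag_cmul (int p) w"
  proof (rule lift_mod_cycle[OF p YY' _ c])
    show "singular_relboundary (k - 1) ?Z Y e" if "k > 0" "singular_relcycle (k - 1) ?Z Y e"
      "singular_relboundary (k - 1) ?Z Y (frag_cmul (int p) e)" for e
      using that by (rule torsion_free)
  qed
  obtain g d where gd: "singular_chain (Suc k) ?Z g" "singular_chain k ?S d" "chain_boundary (Suc k) g + d = b"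
    using int[OF b(1)] unfolding singular_relboundary by blast
  have "c - chain_boundary (Suc k) g = d + frag_cmul (int p) w" using gd(3) b(3) by (simp add: algebra_simps)
  moreover have "d \<in> mod_chains p X {Y} k" using gd(2) S by (intro singular_chain_in_mod_chains) simp
  ultimately have "c - chain_boundary (Suc k) g \<in> mod_chains p X {Y} k"
    using cmul_mod_chains[OF b(2)] ab_subgroup_add[OF sub_mod_chains] by metis
  then show "\<exists>y\<in>mod_chains p X {Y'} (Suc k). c - chain_boundary (Suc k) y \<in> mod_chains p X {Y} k"
    using gd(1) singular_chain_in_mod_chains by blast
qed

lemma trivial_relative_homology_imp_relboundary:
  assumes "trivial_group (relative_homology_group (int k) X S)" "singular_relcycle k X S c"
  shows "singular_relboundary k X S c"
proof -
  have "homologous_rel_set k X S c \<in> carrier (relative_homology_group (int k) X S)"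
    using assms(2) by (simp add: carrier_relative_homology_group)
  then have "homologous_rel_set k X S c = \<one>\<^bsub>relative_homology_group (int k) X S\<^esub>"
    using assms(1) by (auto simp: trivial_group_def)
  then show ?thesis by (simp add: homologous_rel_set_eq_relboundary)
qed

text \<open>Sufficiently many subdivisions make a chain small. The homotopy h from subdivision to
  the identity is one for all spaces simultaneously, so it sends simplices of U to chains of U and
  likewise for W. Therefore it preserves the small chains, in particular the boundary of the given
  relative cycle.\<close>

lemma excision_acyclic:
  assumes U: "openin (subtopology X Y) U" and W: "openin (subtopology X Y) W"
    and cover: "topspace X \<inter> Y \<subseteq> U \<union> W"
  shows "acyclic_at chain_boundary (mod_chains p X {Y}) (mod_chains p X {U, W}) k"
proof (rule acyclic_atI)
  let ?Z = "subtopology X Y"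
  fix c assume c: "c \<in> mod_chains p X {Y} k" "chain_boundary k c \<in> mod_chains p X {U, W} (k - 1)"
  obtain a e where ae: "c = a + frag_cmul (int p) e" "singular_chain k X a" "singular_chain k X e"
    "\<And>f. f \<in> keys a \<Longrightarrow> small k {Y} f"
    using mod_chains_split[OF c(1)] by metis
  have aZ: "singular_chain k ?Z a" using ae by (auto simp: singular_chain_subtopology small_singleton)
  have "chain_boundary k a = chain_boundary k c - frag_cmul (int p) (chain_boundary k e)"
    by (simp add: ae(1) chain_boundary_add chain_boundary_cmul)
  moreover have "frag_cmul (int p) (chain_boundary k e) \<in> mod_chains p X {U, W} (k - 1)"
    using singular_chain_boundary[OF ae(3)] by (intro cmul_mod_chains) simp
  ultimately have ba: "chain_boundary k a \<in> mod_chains p X {U, W} (k - 1)"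
    using ab_subgroup_diff[OF sub_mod_chains c(2)] by metis
  obtain n where n: "\<And>m f. n \<le> m \<Longrightarrow> f \<in> keys ((singular_subdivision k ^^ m) a) \<Longrightarrow>
      \<exists>V\<in>{U, W}. f \<in> standard_simplex k \<rightarrow> V"
    by (rule sufficient_iterated_singular_subdivision_exists[OF _ _ aZ, of "{U, W}"]) (use U W cover in auto)
  obtain h where h: "\<And>p. h p 0 = (0 :: 'a chain)" "\<And>p c1 c2. h p (c1 - c2) = h p c1 - h p c2"
    "\<And>p X c. singular_chain p X c \<Longrightarrow> singular_chain (Suc p) X (h p c)"
    "\<And>p X c. singular_chain p X c \<Longrightarrow>
        chain_boundary (Suc p) (h p c) + h (p - Suc 0) (chain_boundary p c) = (singular_subdivision p ^^ n) c - c"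
    by (rule chain_homotopic_iterated_singular_subdivision[of n]) blast
  have singular_sd: "singular_chain k Z ((singular_subdivision k ^^ m) a)" if "singular_chain k Z a" for m Z
    using that by (induction m) (auto intro: singular_chain_singular_subdivision)
  have 1: "(singular_subdivision k ^^ n) a \<in> mod_chains p X {U, W} k"
    by (rule small_mod_chains[OF singular_sd[OF ae(2)]]) (use n[OF order_refl] in \<open>auto simp: small_pair\<close>)
  have h_neg: "h q (- c) = - h q c" for q c using h(2)[of q 0 c] h(1) by simp
  have h_add: "h q (c1 + c2) = h q c1 + h q c2" for q c1 c2
    using h(2)[of q c1 "- c2"] by (simp add: h_neg)
  have h_cmul: "h q (frag_cmul (int m) d) = frag_cmul (int m) (h q d)" for q m d
    by (induction m) (simp_all add: h(1) frag_cmul_distrib h_add)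
  have h_small: "h q d \<in> mod_chains p X {U, W} (Suc q)" if d: "d \<in> mod_chains p X {U, W} q" for q d
  proof -
    obtain u v where uv: "d = u + frag_cmul (int p) v" "singular_chain q X u" "singular_chain q X v"
      "\<And>f. f \<in> keys u \<Longrightarrow> small q {U, W} f"
      using mod_chains_split[OF d] by metis
    have "keys u \<subseteq> {f. singular_simplex q X f \<and> small q {U, W} f}"
      using uv(2,4) by (auto simp: singular_chain_def)
    then have "h q u \<in> mod_chains p X {U, W} (Suc q)"
    proof (induction u rule: frag_induction)
      case zero
      then show ?case using h(1) ab_subgroup_0[OF sub_mod_chains] by simp
    next
      case (one f)
      then obtain V where V: "V \<in> {U, W}" "singular_chain q (subtopology X V) (frag_of f)"
        by (auto simp: small_def singular_chain_of singular_simplex_subtopology)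
      from h(3)[OF V(2)] have "h q (frag_of f) \<in> mod_chains p X {V} (Suc q)"
        by (rule singular_chain_in_mod_chains)
      then show ?case by (rule mod_chains_refine[rotated]) (use V(1) in auto)
    next
      case (diff a b)
      then show ?case using h(2) ab_subgroup_diff[OF sub_mod_chains] by simp
    qed
    moreover have "h q (frag_cmul (int p) v) \<in> mod_chains p X {U, W} (Suc q)"
      using h(3)[OF uv(3)] by (simp add: h_cmul cmul_mod_chains)
    ultimately show ?thesis using ab_subgroup_add[OF sub_mod_chains] by (simp add: uv(1) h_add)
  qed
  have 2: "h (k - 1) (chain_boundary k a) \<in> mod_chains p X {U, W} k"
  proof (cases "k = 0")
    case True
    then show ?thesis using h(1) ab_subgroup_0[OF sub_mod_chains] by (simp add: chain_boundary_def)
  next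
    case False
    then show ?thesis using h_small[OF ba] by simp
  qed
  have "c - chain_boundary (Suc k) (- h k a)
      = (singular_subdivision k ^^ n) a - h (k - 1) (chain_boundary k a) + frag_cmul (int p) e"
    using h(4)[OF ae(2)] by (simp add: ae(1) chain_boundary_minus algebra_simps)
  then have "c - chain_boundary (Suc k) (- h k a) \<in> mod_chains p X {U, W} k"
    using 1 2 cmul_mod_chains[OF ae(3)] ab_subgroup_add[OF sub_mod_chains] ab_subgroup_diff[OF sub_mod_chains]
    by metis
  moreover have "- h k a \<in> mod_chains p X {Y} (Suc k)"
    using h(3)[OF aZ] by (intro singular_chain_in_mod_chains) (simp add: singular_chain_minus)
  ultimately show "\<exists>y\<in>mod_chains p X {Y} (Suc k). c - chain_boundary (Suc k) y \<in> mod_chains p X {U, W} k"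
    by blast
qed

lemma mod_chains_pair_split:
  assumes "c \<in> mod_chains p X {U, W} k"
  obtains u w where "c = u + w" "u \<in> mod_chains p X {U} k" "w \<in> mod_chains p X {W} k"
proof -
  let ?u = "frag_restrict {f. f ` standard_simplex k \<subseteq> U} c"
  have sc: "singular_chain k X c" using assms by (rule mod_chainsD)
  then have su: "singular_chain k X ?u" by (auto simp: singular_chain_def keys_frag_restrict)
  have "?u \<in> mod_chains p X {U} k"
    by (rule small_mod_chains[OF su]) (auto simp: small_singleton keys_frag_restrict)
  moreover have "c - ?u \<in> mod_chains p X {W} k"
    using assms by (intro mod_chainsI singular_chain_diff sc su)
      (auto simp: mod_chains_def small_pair small_singleton lookup_minus lookup_frag_restrict)
  ultimately show thesis using that[of ?u "c - ?u"] by simp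
qed

text \<open>The second isomorphism theorem: (C(U) + C(W)) / C(W) is C(U) / C(U \<inter> W).\<close>

lemma acyclic_excised:
  assumes "acyclic_at chain_boundary (mod_chains p X {U}) (mod_chains p X {U \<inter> W}) k"
  shows "acyclic_at chain_boundary (mod_chains p X {U, W}) (mod_chains p X {W}) k"
proof (rule acyclic_atI)
  fix x assume x: "x \<in> mod_chains p X {U, W} k" "chain_boundary k x \<in> mod_chains p X {W} (k - 1)"
  obtain u w where uw: "x = u + w" "u \<in> mod_chains p X {U} k" "w \<in> mod_chains p X {W} k"
    using mod_chains_pair_split[OF x(1)] .
  have "chain_boundary k u = chain_boundary k x - chain_boundary k w" by (simp add: uw(1) chain_boundary_add)
  then have "chain_boundary k u \<in> mod_chains p X {W} (k - 1)"
    using ab_subgroup_diff[OF sub_mod_chains x(2) chain_boundary_mod_chains[OF uw(3)]] by simp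
  then have "chain_boundary k u \<in> mod_chains p X {U \<inter> W} (k - 1)"
    using mod_chains_Int[OF chain_boundary_mod_chains[OF uw(2)]] by blast
  then obtain d where d: "d \<in> mod_chains p X {U} (Suc k)" "u - chain_boundary (Suc k) d \<in> mod_chains p X {U \<inter> W} k"
    using acyclic_atD[OF assms uw(2)] by blast
  have "u - chain_boundary (Suc k) d \<in> mod_chains p X {W} k"
    by (rule mod_chains_refine[OF _ d(2)]) auto
  then have "(u - chain_boundary (Suc k) d) + w \<in> mod_chains p X {W} k"
    using uw(3) ab_subgroup_add[OF sub_mod_chains] by blast
  then have "x - chain_boundary (Suc k) d \<in> mod_chains p X {W} k" by (simp add: uw(1) algebra_simps)
  moreover have "d \<in> mod_chains p X {U, W} (Suc k)"
    by (rule mod_chains_refine[OF _ d(1)]) auto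
  ultimately show "\<exists>y\<in>mod_chains p X {U, W} (Suc k). x - chain_boundary (Suc k) y \<in> mod_chains p X {W} k"
    by blast
qed

text \<open>
  If the simplices of \<open>U\<close> are the free orbit of those of \<open>U0\<close>, then \<open>\<sigma> C(U, U \<inter> W)\<close> is
  a copy of \<open>C(U0, U0 \<inter> W)\<close>.
\<close>

lemma (in mod_p_action) acyclic_\<sigma>_free_orbit:
  assumes R: "R = (\<lambda>k. {f. singular_simplex k X f \<and> small k {U0} f \<and> \<not> small k {W} f})"
    and free: "free_pair p X \<gamma> {U, W} {W} R" and "U0 \<subseteq> U"
    and ac: "acyclic_at chain_boundary (mod_chains p X {U0}) (mod_chains p X {U0 \<inter> W}) k"
  shows "acyclic_at chain_boundary (image_plus (mod_chains p X {U, W}) (mod_chains p X {W}) \<sigma>) (mod_chains p X {W}) k"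
proof (rule acyclic_atI)
  interpret free_pair p X \<gamma> "{U, W}" "{W}" R by fact
  \<comment> \<open>The map \<sigma> is injective on C(U0) modulo W. For f in U0 outside W, the
    other translates of f lie outside U0, so modulo p the coefficient of \<sigma> z at f is that of
    z.\<close>
  have reflect: "z \<in> mod_chains p X {W} j"
    if z: "z \<in> mod_chains p X {U0} j" "\<sigma> j z \<in> mod_chains p X {W} j" for z j
  proof (rule mod_chainsI)
    show sz: "singular_chain j X z" using z mod_chainsD by blast
    fix f assume f: "singular_simplex j X f" "\<not> small j {W} f"
    show "int p dvd lookup z f"
    proof (cases "small j {U0} f")
      case True
      then have fR: "f \<in> R j" using f by (simp add: R)
      have "small j {U, W} f" using True \<open>U0 \<subseteq> U\<close> by (auto simp: small_pair small_singleton)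
      then have ex: "\<exists>!i. i < p \<and> move j i f \<in> R j" using representative f by blast
      have "int p dvd lookup z (move j i f)" if "i < p" "i \<noteq> 0" for i
      proof -
        have "move j 0 f \<in> R j" using fR f by (simp add: move_0)
        then have "move j i f \<notin> R j" using ex that p_pos by blast
        moreover have "\<not> small j {W} (move j i f)" using small_move_iff[OF inv_\<V> f(1)] f(2) that by simp
        ultimately have "\<not> small j {U0} (move j i f)" using f(1) singular_move by (auto simp: R)
        then show ?thesis using z(1) by (simp add: mod_chains_def)
      qed
      then have "int p dvd (\<Sum>i\<in>{..<p} - {0}. lookup z (move j i f))" by (intro dvd_sum) auto
      moreover have "(\<Sum>i<p. lookup z (move j i f)) = lookup z (move j 0 f) + (\<Sum>i\<in>{..<p} - {0}. lookup z (move j i f))"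
        using p_pos by (intro sum.remove) auto
      moreover have "int p dvd (\<Sum>i<p. lookup z (move j i f))"
        using z(2) f lookup_\<sigma>[OF sz f(1)] by (auto simp: mod_chains_def)
      ultimately have "int p dvd lookup z (move j 0 f)" by (metis dvd_add_left_iff)
      then show ?thesis using f(1) by (simp add: move_0)
    next
      case False
      then show ?thesis using z(1) by (simp add: mod_chains_def)
    qed
  qed
  fix x assume x: "x \<in> image_plus (mod_chains p X {U, W}) (mod_chains p X {W}) \<sigma> k"
    "chain_boundary k x \<in> mod_chains p X {W} (k - 1)"
  obtain y where y: "y \<in> mod_chains p X {U, W} k" "x - \<sigma> k y \<in> mod_chains p X {W} k"
    using x(1) unfolding image_plus_def by blast
  have sy: "singular_chain k X y" using y mod_chainsD by blast
  have R0: "f \<in> R k \<Longrightarrow> small k {U0} f" for f by (simp add: R)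
  \<comment> \<open>Since \<sigma> is constant along translates, collecting all parts of y on the
    representatives leaves \<sigma> y unchanged modulo W, while y' lies in C(U0).\<close>
  define y' where "y' = (\<Sum>i<p. part k i y)"
  have y': "y' \<in> mod_chains p X {U0} k" unfolding y'_def
    by (intro ab_subgroup_sum[OF sub_mod_chains] small_mod_chains singular_part sy)
      (use R0 in \<open>auto simp: part_def keys_frag_restrict\<close>)
  have \<sigma>_add: "\<sigma> j (c + d) = \<sigma> j c + \<sigma> j d" for j c d
    by (simp add: \<sigma>_def act_add sum.distrib)
  have \<sigma>_sum: "\<sigma> j (\<Sum>i<m. f i) = (\<Sum>i<m. \<sigma> j (f i))" for j f and m :: nat
    by (induction m) (simp_all add: \<sigma>_add, simp add: \<sigma>_def)
  have \<sigma>_act: "\<sigma> k (act k i c) = \<sigma> k c" if "singular_chain k X c" for c i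
  proof (induction i)
    case 0
    then show ?case using that by (simp add: act_0)
  next
    case (Suc i)
    have "\<sigma> k (\<tau> k (act k i c)) = 0" using \<sigma>_\<tau> singular_act that by blast
    then show ?case using Suc by (simp add: \<tau>_def \<sigma>_diff act_act)
  qed
  have "\<sigma> k (y - (\<Sum>i<p. act k (p - i) (part k i y))) \<in> mod_chains p X {W} k"
    using decomposition[OF y(1)] \<sigma>_mod_chains inv_\<V> by blast
  then have "\<sigma> k y - \<sigma> k y' \<in> mod_chains p X {W} k"
    by (simp add: \<sigma>_diff \<sigma>_sum \<sigma>_act singular_part sy y'_def)
  then have xy': "x - \<sigma> k y' \<in> mod_chains p X {W} k"
    using y(2) ab_subgroup_diff_trans[OF sub_mod_chains] by blast
  have sy': "singular_chain k X y'" using y' mod_chainsD by blast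
  have "chain_boundary k x - chain_boundary k (x - \<sigma> k y') \<in> mod_chains p X {W} (k - 1)"
    using ab_subgroup_diff[OF sub_mod_chains x(2) chain_boundary_mod_chains[OF xy']] .
  then have "\<sigma> (k - 1) (chain_boundary k y') \<in> mod_chains p X {W} (k - 1)"
    using bd_\<sigma>[OF sy'] by (simp add: chain_boundary_diff)
  then have "chain_boundary k y' \<in> mod_chains p X {W} (k - 1)"
    using reflect[OF chain_boundary_mod_chains[OF y']] by blast
  then have "chain_boundary k y' \<in> mod_chains p X {U0 \<inter> W} (k - 1)"
    using mod_chains_Int[OF chain_boundary_mod_chains[OF y']] by blast
  then obtain d where d: "d \<in> mod_chains p X {U0} (Suc k)" "y' - chain_boundary (Suc k) d \<in> mod_chains p X {U0 \<inter> W} k"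
    using acyclic_atD[OF ac y'] by blast
  have "y' - chain_boundary (Suc k) d \<in> mod_chains p X {W} k"
    by (rule mod_chains_refine[OF _ d(2)]) auto
  then have "(x - \<sigma> k y') + \<sigma> k (y' - chain_boundary (Suc k) d) \<in> mod_chains p X {W} k"
    using xy' \<sigma>_mod_chains[OF inv_\<V>] ab_subgroup_add[OF sub_mod_chains] by blast
  then have "x - chain_boundary (Suc k) (\<sigma> (Suc k) d) \<in> mod_chains p X {W} k"
    using bd_\<sigma>[OF mod_chainsD[OF d(1)]] by (simp add: \<sigma>_diff)
  moreover have "d \<in> mod_chains p X {U, W} (Suc k)"
    by (rule mod_chains_refine[OF _ d(1)]) (use \<open>U0 \<subseteq> U\<close> in auto)
  ultimately show "\<exists>y\<in>image_plus (mod_chains p X {U, W}) (mod_chains p X {W}) \<sigma> (Suc k).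
      x - chain_boundary (Suc k) y \<in> mod_chains p X {W} k"
    by (intro bexI[of _ "\<sigma> (Suc k) d"])
      (auto simp: image_plus_def ab_subgroup_0[OF sub_mod_chains] intro!: bexI[of _ d])
qed


section \<open>Chains of a disjoint union of open sets\<close>

lemma connectedin_disjoint_open_cases:
  assumes K: "connectedin X K" and \<E>: "\<And>e. e \<in> \<E> \<Longrightarrow> openin X e" "pairwise disjnt \<E>"
    and "K \<subseteq> \<Union>\<E>" "K \<noteq> {}"
  shows "\<exists>e\<in>\<E>. K \<subseteq> e"
proof -
  obtain x e where x: "x \<in> K" "e \<in> \<E>" "x \<in> e" using assms(4,5) by blast
  have "openin X (\<Union>(\<E> - {e}))" using \<E>(1) by blast
  moreover have "K \<subseteq> e \<union> \<Union>(\<E> - {e})" using assms(4) by blast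
  moreover have "e \<inter> \<Union>(\<E> - {e}) \<inter> K = {}"
    using \<E>(2) x(2) by (auto simp: pairwise_def disjnt_def)
  ultimately have *: "\<Union>(\<E> - {e}) \<inter> K = {}"
    using K \<E>(1)[OF x(2)] x unfolding connectedin by blast
  have "K \<subseteq> e"
  proof
    fix y assume y: "y \<in> K"
    then obtain e' where "e' \<in> \<E>" "y \<in> e'" using assms(4) by (meson UnionE subsetD)
    then show "y \<in> e" using * y by (cases "e' = e") auto
  qed
  then show ?thesis using x(2) by blast
qed

lemma connectedin_singular_simplex:
  "singular_simplex k X f \<Longrightarrow> connectedin X (f ` standard_simplex k)"
  unfolding singular_simplex_def
  by (rule connectedin_continuous_map_image) (auto simp: connectedin_subtopology connectedin_standard_simplex)

lemma singular_simplex_disjoint_open: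
  assumes "\<And>e. e \<in> \<E> \<Longrightarrow> openin X e" "pairwise disjnt \<E>" "topspace X = \<Union>\<E>"
    "singular_simplex k X f"
  shows "\<exists>!e. e \<in> \<E> \<and> f ` standard_simplex k \<subseteq> e"
proof -
  have ne: "f ` standard_simplex k \<noteq> {}" using nonempty_standard_simplex by blast
  obtain e where e: "e \<in> \<E>" "f ` standard_simplex k \<subseteq> e"
    using connectedin_disjoint_open_cases[OF connectedin_singular_simplex[OF assms(4)] assms(1) assms(2) _ ne]
      connectedin_subset_topspace[OF connectedin_singular_simplex[OF assms(4)]] assms(3) by metis
  have uniq: "e' = e" if e': "e' \<in> \<E>" "f ` standard_simplex k \<subseteq> e'" for e'
  proof -
    obtain y where "y \<in> f ` standard_simplex k" using ne by (meson ex_in_conv)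
    then obtain x where "x \<in> e" "x \<in> e'" using e'(2) e(2) by (meson subsetD)
    then have "\<not> disjnt e e'" by (auto simp: disjnt_iff)
    then show ?thesis using pairwiseD[OF assms(2) e(1) e'(1)] by metis
  qed
  show ?thesis
  proof (rule ex1I[of _ e])
    show "e \<in> \<E> \<and> f ` standard_simplex k \<subseteq> e" using e by (rule conjI)
    show "e' = e" if "e' \<in> \<E> \<and> f ` standard_simplex k \<subseteq> e'" for e'
      using that by (elim conjE) (rule uniq)
  qed
qed

lemma singular_relboundary_sum:
  "finite I \<Longrightarrow> (\<And>i. i \<in> I \<Longrightarrow> singular_relboundary k X S (f i)) \<Longrightarrow> singular_relboundary k X S (sum f I)"
  by (induction I rule: finite_induct) (auto intro: singular_relboundary_add)

text \<open>A simplex is connected and so lies in exactly one member of \<E>. Restricting a chain to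
  one member commutes with the boundary, and a chain meets only finitely many members, so the
  bounding chains can be added even for infinite \<E>.\<close>

lemma relboundary_disjoint_union:
  assumes \<E>: "\<And>e. e \<in> \<E> \<Longrightarrow> openin X e" "pairwise disjnt \<E>" "topspace X = \<Union>\<E>"
    and each: "\<And>e c. e \<in> \<E> \<Longrightarrow> singular_relcycle k (subtopology X e) S c \<Longrightarrow> singular_relboundary k (subtopology X e) S c"
    and c: "singular_relcycle k X S c"
  shows "singular_relboundary k X S c"
proof -
  define In where "In j e = {f. f ` standard_simplex j \<subseteq> e}" for j and e :: "'a set"
  have unique: "\<exists>!e. e \<in> \<E> \<and> f ` standard_simplex j \<subseteq> e" if "singular_simplex j X f" for j f
    using singular_simplex_disjoint_open[OF _ \<E>(2,3) that] \<E>(1) by blast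
  have sc: "singular_chain k X c" "singular_chain (k - 1) (subtopology X S) (chain_boundary k c)"
    using c by (auto simp: singular_relcycle)
  define g where "g f = (THE e. e \<in> \<E> \<and> f ` standard_simplex k \<subseteq> e)" for f
  have g: "g f \<in> \<E>" "f ` standard_simplex k \<subseteq> g f" if "singular_simplex k X f" for f
    using theI'[OF unique[OF that]] by (auto simp: g_def)
  have g_eq: "g f = e" if "singular_simplex k X f" "e \<in> \<E>" "f ` standard_simplex k \<subseteq> e" for f e
    using unique[OF that(1)] that g[OF that(1)] by blast
  have kc: "singular_simplex k X f" if "f \<in> keys c" for f using that sc(1) by (auto simp: singular_chain_def)
  let ?F = "g ` keys c"
  have F: "?F \<subseteq> \<E>" using g kc by blast
  have c_eq: "c = (\<Sum>e\<in>?F. frag_restrict (In k e) c)"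
  proof (rule poly_mapping_eqI)
    fix f
    show "lookup c f = lookup (\<Sum>e\<in>?F. frag_restrict (In k e) c) f"
    proof (cases "f \<in> keys c")
      case True
      have "(\<Sum>e\<in>?F. lookup (frag_restrict (In k e) c) f) = (\<Sum>e\<in>?F. if e = g f then lookup c f else 0)"
        using g g_eq kc[OF True] F by (intro sum.cong) (auto simp: lookup_frag_restrict In_def)
      also have "\<dots> = lookup c f" using True by simp
      finally show ?thesis by (simp add: lookup_sum)
    next
      case False
      then have "lookup c f = 0" by (simp add: in_keys_iff)
      then show ?thesis by (simp add: lookup_sum lookup_frag_restrict cong: if_cong)
    qed
  qed
  have bd_restrict: "chain_boundary k (frag_restrict (In k e) a) = frag_restrict (In (k - 1) e) (chain_boundary k a)"
    if e: "e \<in> \<E>" and a: "singular_chain k X a" for e a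
    using a unfolding singular_chain_def
  proof (induction a rule: frag_induction)
    case zero
    then show ?case by (simp add: frag_restrict_def)
  next
    case (one f)
    then have f: "singular_simplex k X f" by simp
    show ?case
    proof (cases "k = 0")
      case True
      then show ?thesis by (simp add: chain_boundary_def frag_restrict_def)
    next
      case False
      \<comment> \<open>A face lies in the member of \<E> containing the whole simplex, and by
        disjointness in no other.\<close>
      have face: "singular_face k i f \<in> In (k - 1) e \<longleftrightarrow> f \<in> In k e" if "i \<le> k" for i
      proof
        assume "f \<in> In k e"
        then show "singular_face k i f \<in> In (k - 1) e"
          using image_singular_face[of k i f] False that unfolding In_def by blast
      next
        assume fe: "singular_face k i f \<in> In (k - 1) e"
        have "singular_simplex (k - 1) X (singular_face k i f)"
          using singular_simplex_singular_face[OF f, of i] False that by simp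
        moreover have "singular_face k i f ` standard_simplex (k - 1) \<subseteq> g f"
          using image_singular_face[of k i f] g(2)[OF f] False that by blast
        ultimately have "g f = e" using unique[of "k - 1" "singular_face k i f"] g(1)[OF f] fe e
          unfolding In_def by blast
        then show "f \<in> In k e" using g(2)[OF f] by (simp add: In_def)
      qed
      have "frag_restrict (In (k - 1) e) (chain_boundary k (frag_of f))
          = (\<Sum>i\<le>k. frag_cmul ((-1) ^ i) (frag_restrict (In (k - 1) e) (frag_of (singular_face k i f))))"
        using False by (simp add: chain_boundary_of frag_restrict_def frag_extend_sum frag_extend_cmul o_def)
      also have "\<dots> = (if f \<in> In k e then chain_boundary k (frag_of f) else 0)"
        using False face by (simp add: frag_restrict_def chain_boundary_of)
      finally show ?thesis by (simp add: frag_restrict_def)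
    qed
  next
    case (diff a b)
    then show ?case by (simp add: frag_restrict_diff chain_boundary_diff)
  qed
  have "singular_relboundary k X S (frag_restrict (In k e) c)" if "e \<in> ?F" for e
  proof -
    have e: "e \<in> \<E>" using that F by blast
    have "singular_chain k (subtopology X e) (frag_restrict (In k e) c)"
      using kc by (auto simp: singular_chain_def keys_frag_restrict singular_simplex_subtopology In_def)
    moreover have "singular_chain (k - 1) (subtopology (subtopology X e) S) (chain_boundary k (frag_restrict (In k e) c))"
      using sc(2) unfolding bd_restrict[OF e sc(1)]
      by (auto simp: singular_chain_def keys_frag_restrict singular_simplex_subtopology In_def)
    ultimately have "singular_relcycle k (subtopology X e) S (frag_restrict (In k e) c)"
      by (simp add: singular_relcycle)
    then have "singular_relboundary k (subtopology X e) S (frag_restrict (In k e) c)" using each e by blast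
    then obtain d a where "singular_chain (Suc k) (subtopology X e) d"
      "singular_chain k (subtopology (subtopology X e) S) a" "chain_boundary (Suc k) d + a = frag_restrict (In k e) c"
      unfolding singular_relboundary by blast
    moreover from this have "singular_chain (Suc k) X d" "singular_chain k (subtopology X S) a"
      by (auto simp: singular_chain_subtopology)
    ultimately show ?thesis unfolding singular_relboundary by blast
  qed
  then show ?thesis by (subst c_eq) (intro singular_relboundary_sum, auto)
qed

section \<open>The effect of attaching free cells\<close>

lemma (in mod_p_action) free_pair_exists:
  assumes inv: "invariant \<U>" "invariant \<V>"
    and refine: "\<And>V. V \<in> \<V> \<Longrightarrow> \<exists>U\<in>\<U>. V \<subseteq> U" and fixV: "V0 \<in> \<V>" "fixed_set \<subseteq> V0"
  obtains R where "free_pair p X \<gamma> \<U> \<V> R"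
proof -
  have "small k \<U> f" if "small k \<V> f" for k and f :: "(nat \<Rightarrow> real) \<Rightarrow> 'a"
    using that refine unfolding small_def by (meson order_trans)
  moreover have "small k \<V> f" if "f ` standard_simplex k \<subseteq> fixed_set" for k f
    using that fixV unfolding small_def by (meson order_trans)
  ultimately show thesis using free_pairI[OF inv] that by blast
qed

text \<open>
  \<open>Y'\<close> arises from \<open>Y\<close> by attaching free cells; \<open>W\<close> is \<open>Y'\<close> without the centres of these cells and
  \<open>U\<close> is the union of the open cells, those in \<open>U0\<close> representing the orbits.
\<close>

lemma (in mod_p_action) acyclic_attach:
  assumes YW: "Y \<subseteq> W" "W \<subseteq> Y'" "U \<subseteq> Y'" "Y' \<subseteq> topspace X" and fixY: "fixed_set \<subseteq> Y"
    and inv: "invariant {Y'}" "invariant {Y}" "invariant {W}" "invariant {U}"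
    and op: "openin (subtopology X Y') U" "openin (subtopology X Y') W" "Y' \<subseteq> U \<union> W"
    and retract: "\<And>k. acyclic_at chain_boundary (mod_chains p X {W}) (mod_chains p X {Y}) k"
    and U0: "\<And>i. i < p \<Longrightarrow> openin (subtopology X U) ((\<gamma> ^^ i) ` U0)"
      "\<And>i j. i < p \<Longrightarrow> j < p \<Longrightarrow> i \<noteq> j \<Longrightarrow> disjnt ((\<gamma> ^^ i) ` U0) ((\<gamma> ^^ j) ` U0)"
      "U = (\<Union>i<p. (\<gamma> ^^ i) ` U0)"
    and cells: "\<And>k. k \<ge> K \<Longrightarrow> acyclic_at chain_boundary (mod_chains p X {U}) (mod_chains p X {U \<inter> W}) k"
      "\<And>k. k \<ge> K \<Longrightarrow> acyclic_at chain_boundary (mod_chains p X {U0}) (mod_chains p X {U0 \<inter> W}) k"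
    and k: "k > K"
  shows "acyclic_at chain_boundary (image_plus (mod_chains p X {Y'}) (mod_chains p X {Y}) \<tau>) (mod_chains p X {Y}) k"
    and "acyclic_at chain_boundary (image_plus (mod_chains p X {Y'}) (mod_chains p X {Y}) \<sigma>) (mod_chains p X {Y}) k"
proof -
  let ?C = "mod_chains p X" and ?E = "\<lambda>A B r. image_plus (mod_chains p X A) (mod_chains p X B) r"
  have U0_sub: "U0 \<subseteq> U"
    using U0(3) p_pos by (auto intro!: bexI[of _ 0])
  have U0_top: "U0 \<subseteq> topspace X" using U0_sub YW by blast
  have inv_UW: "invariant {U, W}" using inv by (auto simp: invariant_def)
  define R where "R = (\<lambda>k. {f. singular_simplex k X f \<and> small k {U0} f \<and> \<not> small k {W} f})"
  have pow_inv: "(\<gamma> ^^ i) ` ((\<gamma> ^^ j) ` U0) = (\<gamma> ^^ ((i + j) mod p)) ` U0" for i j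
  proof -
    have "(\<gamma> ^^ i) ((\<gamma> ^^ j) x) = (\<gamma> ^^ ((i + j) mod p)) x" if "x \<in> U0" for x
      using pow_mod[of x "i + j"] U0_top that by (auto simp: funpow_add)
    then show ?thesis by (auto simp: image_image)
  qed
  \<comment> \<open>A simplex of U is connected, hence contained in exactly one of the disjoint open
    translates of U0, and exactly one power of \<gamma> carries that translate back to U0.\<close>
  have free: "free_pair p X \<gamma> {U, W} {W} R"
  proof (intro free_pair.intro free_pair_axioms.intro)
    show "mod_p_action p X \<gamma>" by (rule mod_p_action_axioms)
    show "small k {W} f \<Longrightarrow> small k {U, W} f" for k f by (simp add: small_pair small_singleton)
    show "f \<in> R k \<Longrightarrow> singular_simplex k X f \<and> small k {U, W} f \<and> \<not> small k {W} f" for f k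
      using U0_sub by (auto simp: R_def small_pair small_singleton)
    fix k f assume f: "singular_simplex k X f" "small k {U, W} f" "\<not> small k {W} f"
    then have fU: "f ` standard_simplex k \<subseteq> U" by (simp add: small_pair small_singleton)
    then have fsU: "singular_simplex k (subtopology X U) f" using f by (simp add: singular_simplex_subtopology)
    have ne: "standard_simplex k \<noteq> {}" by (rule nonempty_standard_simplex)
    have ftop: "f x \<in> topspace X" if "x \<in> standard_simplex k" for x using fU YW that by blast
    have "\<exists>e\<in>(\<lambda>i. (\<gamma> ^^ i) ` U0) ` {..<p}. f ` standard_simplex k \<subseteq> e"
    proof (rule connectedin_disjoint_open_cases[OF connectedin_singular_simplex[OF fsU]])
      show "pairwise disjnt ((\<lambda>i. (\<gamma> ^^ i) ` U0) ` {..<p})"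
        using U0(2) unfolding pairwise_def by blast
      show "f ` standard_simplex k \<subseteq> \<Union>((\<lambda>i. (\<gamma> ^^ i) ` U0) ` {..<p})" using fU U0(3) by simp
      show "f ` standard_simplex k \<noteq> {}" using ne by simp
      show "openin (subtopology X U) e" if "e \<in> (\<lambda>i. (\<gamma> ^^ i) ` U0) ` {..<p}" for e
        using that U0(1) by (elim imageE) simp
    qed
    then obtain i where i: "i < p" "f ` standard_simplex k \<subseteq> (\<gamma> ^^ i) ` U0" by auto
    have img: "move k j f ` standard_simplex k = (\<gamma> ^^ j) ` f ` standard_simplex k" for j
      unfolding image_image by (rule image_cong) (simp_all add: move_def simplex_map_def)
    \<comment> \<open>The reduction modulo p matters for i = 0, where p - i is not below p.\<close>
    define j where "j = (p - i) mod p"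
    have j: "j < p" using p_pos by (simp add: j_def)
    have "(j + i) mod p = 0" using i by (simp add: j_def mod_simps)
    then have "(\<gamma> ^^ j) ` ((\<gamma> ^^ i) ` U0) = U0" using pow_inv[of j i] by simp
    then have mj: "move k j f ` standard_simplex k \<subseteq> U0"
      unfolding img using image_mono[OF i(2), of "\<gamma> ^^ j"] by simp
    have nW: "\<not> small k {W} (move k l f)" if "l < p" for l
      using small_move_iff[OF inv(3) f(1)] f(3) that by simp
    have "move k j f \<in> R k" using mj nW[OF j] singular_move[OF f(1)] by (simp add: R_def small_singleton)
    moreover have "l = j" if l: "l < p" "move k l f \<in> R k" for l
    proof -
      have ml: "(\<gamma> ^^ l) ` f ` standard_simplex k \<subseteq> U0" using l img by (simp add: R_def small_singleton)
      have bk: "f ` standard_simplex k \<subseteq> (\<gamma> ^^ ((p - l) mod p)) ` U0"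
      proof
        fix y assume y: "y \<in> f ` standard_simplex k"
        then have "(\<gamma> ^^ (p - l)) ((\<gamma> ^^ l) y) = (\<gamma> ^^ (p - l + l)) y" by (simp add: funpow_add)
        also have "\<dots> = y" using \<gamma>_p[of y] y ftop l by auto
        finally have "(\<gamma> ^^ (p - l)) ((\<gamma> ^^ l) y) = y" .
        moreover have "(\<gamma> ^^ l) y \<in> U0" using ml imageI[OF y, of "\<gamma> ^^ l"] by (rule subsetD)
        moreover from this have "(\<gamma> ^^ ((p - l) mod p)) ((\<gamma> ^^ l) y) = (\<gamma> ^^ (p - l)) ((\<gamma> ^^ l) y)"
          using pow_mod U0_top by blast
        ultimately show "y \<in> (\<gamma> ^^ ((p - l) mod p)) ` U0" by (metis imageI)
      qed
      have lt: "(p - l) mod p < p" using p_pos by simp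
      have "(p - l) mod p = i"
      proof (rule ccontr)
        assume "(p - l) mod p \<noteq> i"
        then have dj: "disjnt ((\<gamma> ^^ ((p - l) mod p)) ` U0) ((\<gamma> ^^ i) ` U0)"
          using U0(2)[OF lt i(1)] by blast
        obtain t where "t \<in> standard_simplex k" using ne by (meson ex_in_conv)
        then have "f t \<in> f ` standard_simplex k" by (rule imageI)
        then show False using dj subsetD[OF bk] subsetD[OF i(2)] unfolding disjnt_iff by metis
      qed
      then have "j = (p - (p - l) mod p) mod p" by (simp add: j_def)
      also have "\<dots> = l" using l by (cases "l = 0") auto
      finally show ?thesis by simp
    qed
    ultimately show "\<exists>!i. i < p \<and> move k i f \<in> R k" using j by blast
  qed (use inv inv_UW in auto)
  interpret UW: free_pair p X \<gamma> "{U, W}" "{W}" R by (rule free)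
  have \<sigma>_UW: "acyclic_at chain_boundary (?E {U, W} {W} \<sigma>) (?C {W}) k" if "k \<ge> K" for k
    using acyclic_\<sigma>_free_orbit[OF R_def free U0_sub cells(2)[OF that]] .
  \<comment> \<open>For \<tau> the acyclicity in degree k is drawn from that for \<sigma> in degree
    k - 1; this is why the conclusion asks for k > K.\<close>
  have \<tau>_UW: "acyclic_at chain_boundary (?E {U, W} {W} \<tau>) (?C {W}) k" if "k > K" for k
    using UW.acyclic_image_up[OF acyclic_excised[OF cells(1)], of k] \<sigma>_UW[of "k - 1"] that by simp
  \<comment> \<open>The chains are filtered by Y, W, {U, W}, Y'. The bottom quotient is acyclic by
    the retraction and the top one by excision, in all degrees, so the large degree is needed only
    for the middle quotient. \<open>image_filtration\<close> assembles the three.\<close>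
  obtain R1 where "free_pair p X \<gamma> {Y'} {U, W} R1"
    by (rule free_pair_exists[of "{Y'}" "{U, W}" W]) (use inv inv_UW YW fixY in auto)
  then interpret Y'UW: free_pair p X \<gamma> "{Y'}" "{U, W}" R1 .
  have cov: "topspace X \<inter> Y' \<subseteq> U \<union> W" using op(3) by blast
  note Y'UW_acyclic = Y'UW.acyclic_image[OF excision_acyclic[OF op(1,2) cov]]
  obtain R2 where "free_pair p X \<gamma> {W} {Y} R2"
    by (rule free_pair_exists[of "{W}" "{Y}" Y]) (use inv inv_UW YW fixY in auto)
  then interpret WY: free_pair p X \<gamma> "{W}" "{Y}" R2 .
  note WY_acyclic = WY.acyclic_image[OF retract]
  obtain R3 where "free_pair p X \<gamma> {Y'} {W} R3"
    by (rule free_pair_exists[of "{Y'}" "{W}" W]) (use inv inv_UW YW fixY in auto)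
  then interpret Y'W: free_pair p X \<gamma> "{Y'}" "{W}" R3 .
  have zero: "\<tau> j (\<sigma> j x) = 0" "\<sigma> j (\<tau> j x) = 0" if "x \<in> ?C A j" for A j x
    using \<tau>_\<sigma> \<sigma>_\<tau> mod_chainsD[OF that] by blast+
  have "acyclic_at chain_boundary (?E {Y'} {W} \<tau>) (?C {W}) k"
    by (rule image_filtration[OF Y'UW.smith_pair_axioms UW.complex_pair_axioms])
      (use Y'UW.r_D zero \<tau>_UW[OF k] Y'UW_acyclic in auto)
  then show "acyclic_at chain_boundary (?E {Y'} {Y} \<tau>) (?C {Y}) k"
    by (intro image_filtration[OF Y'W.smith_pair_axioms WY.complex_pair_axioms])
      (use Y'W.r_D zero WY_acyclic in auto)
  have "acyclic_at chain_boundary (?E {Y'} {W} \<sigma>) (?C {W}) k"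
    by (rule image_filtration[OF Y'UW.swap UW.complex_pair_axioms])
      (use Y'UW.r'_D zero \<sigma>_UW[of k] k Y'UW_acyclic in auto)
  then show "acyclic_at chain_boundary (?E {Y'} {Y} \<sigma>) (?C {Y}) k"
    by (intro image_filtration[OF Y'W.swap WY.complex_pair_axioms])
      (use Y'W.r'_D zero WY_acyclic in auto)
qed

section \<open>Discs\<close>

definition norm_sq :: "nat \<Rightarrow> (nat \<Rightarrow> real) \<Rightarrow> real"
  where "norm_sq n v = (\<Sum>i<n. (v i)\<^sup>2)"

definition disc :: "nat \<Rightarrow> (nat \<Rightarrow> real) set"
  where "disc n = {v. (\<forall>i\<ge>n. v i = 0) \<and> norm_sq n v \<le> 1}"

definition origin :: "nat \<Rightarrow> real"
  where "origin = (\<lambda>i. 0)"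

lemma powertop_real_eq_euclidean: "powertop_real UNIV = euclidean"
  by (rule euclidean_product_topology)

lemma unit_disc_eq: "unit_disc n = top_of_set (disc n)"
  unfolding unit_disc_def Euclidean_space_def powertop_real_eq_euclidean subtopology_subtopology
  by (rule arg_cong[where f = "subtopology euclidean"]) (auto simp: disc_def norm_sq_def)

lemma topspace_unit_disc: "topspace (unit_disc n) = disc n"
  by (simp add: unit_disc_eq)

lemma disc_interior_eq: "disc_interior n = {v \<in> disc n. norm_sq n v < 1}"
  by (simp add: disc_interior_def topspace_unit_disc norm_sq_def)

lemma disc_boundary_eq: "disc_boundary n = {v \<in> disc n. norm_sq n v = 1}"
  by (simp add: disc_boundary_def topspace_unit_disc norm_sq_def)

lemma disc_interior_Un_boundary: "disc_interior n \<union> disc_boundary n = disc n"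
  by (auto simp: disc_interior_eq disc_boundary_eq disc_def)

lemma norm_sq_nonneg: "norm_sq n v \<ge> 0"
  by (simp add: norm_sq_def sum_nonneg)

lemma norm_sq_scale: "norm_sq n (\<lambda>i. c * v i) = c\<^sup>2 * norm_sq n v"
  by (simp add: norm_sq_def power_mult_distrib sum_distrib_left)

lemma origin_disc_interior: "origin \<in> disc_interior n"
  by (simp add: disc_interior_eq disc_def origin_def norm_sq_def)

lemma norm_sq_pos:
  assumes "v \<in> disc n" "v \<noteq> origin"
  shows "norm_sq n v > 0"
proof -
  obtain i where "v i \<noteq> 0" using assms(2) by (auto simp: origin_def)
  moreover from this have "\<not> n \<le> i" using assms(1) by (auto simp: disc_def)
  ultimately have "i < n" "v i \<noteq> 0" by simp_all
  then show ?thesis unfolding norm_sq_def using \<open>v i \<noteq> 0\<close> by (intro sum_pos2[of _ i]) auto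
qed

lemma continuous_on_coordinate: "continuous_on S (\<lambda>v::nat \<Rightarrow> real. v i)"
  by (rule continuous_on_subset[OF continuous_on_product_coordinates]) simp

lemma continuous_on_norm_sq [continuous_intros]:
  "continuous_on S f \<Longrightarrow> continuous_on S (\<lambda>x. norm_sq n (f x))"
  unfolding norm_sq_def
  by (intro continuous_intros) (rule continuous_on_compose2[OF continuous_on_coordinate[of UNIV]], auto)

lemma continuous_map_top_of_setI:
  "continuous_on A f \<Longrightarrow> (\<And>x. x \<in> A \<Longrightarrow> f x \<in> B) \<Longrightarrow> continuous_map (top_of_set A) (top_of_set B) f"
  by (auto simp: continuous_map_in_subtopology)

text \<open>A closed subset of the product of the intervals [-1, 1], which is compact by Tychonoff's
  theorem.\<close>

lemma compact_space_unit_disc: "compact_space (unit_disc n)"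
proof -
  let ?B = "PiE UNIV (\<lambda>_. {-1..1}) :: (nat \<Rightarrow> real) set"
  have "compactin (powertop_real UNIV) ?B" by (simp add: compactin_PiE)
  then have "compact ?B" by (simp add: powertop_real_eq_euclidean)
  moreover have "closed (disc n)"
  proof -
    have "closed {v::nat \<Rightarrow> real. i \<ge> n \<longrightarrow> v i = 0}" for i
      by (cases "i \<ge> n") (simp_all add: closed_Collect_eq continuous_on_coordinate)
    moreover have "closed {v. norm_sq n v \<le> 1}"
      by (intro closed_Collect_le continuous_intros)
    ultimately show ?thesis unfolding disc_def
      by (auto intro!: closed_Collect_conj closed_Collect_all)
  qed
  moreover have "disc n \<subseteq> ?B"
  proof
    fix v assume v: "v \<in> disc n"
    have "\<bar>v i\<bar> \<le> 1" for i
    proof (cases "i < n")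
      case True
      then have "(v i)\<^sup>2 \<le> norm_sq n v" unfolding norm_sq_def by (intro member_le_sum) auto
      also have "\<dots> \<le> 1" using v by (simp add: disc_def)
      finally show ?thesis by (simp add: abs_square_le_1)
    qed (use v in \<open>simp add: disc_def\<close>)
    then show "v \<in> ?B" by (auto simp: abs_le_iff minus_le_iff)
  qed
  ultimately have "compact (disc n)" by (metis Int_absorb1 compact_Int_closed)
  then show ?thesis by (simp add: unit_disc_eq compact_space_subtopology)
qed

text \<open>The segment from the radial projection v / |v| at t = 0 to v itself at t = 1. It stays
  away from the origin and is constant for v on the boundary sphere.\<close>

definition push_out :: "nat \<Rightarrow> real \<times> (nat \<Rightarrow> real) \<Rightarrow> nat \<Rightarrow> real"
  where "push_out n = (\<lambda>(t, v) i. (t + (1 - t) / sqrt (norm_sq n v)) * v i)"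

lemma norm_sq_push_out:
  assumes "norm_sq n v > 0"
  shows "norm_sq n (push_out n (t, v)) = (t * sqrt (norm_sq n v) + (1 - t))\<^sup>2"
proof -
  have "norm_sq n (push_out n (t, v)) = (t + (1 - t) / sqrt (norm_sq n v))\<^sup>2 * (sqrt (norm_sq n v))\<^sup>2"
    using norm_sq_nonneg[of n v] by (simp add: push_out_def norm_sq_scale)
  also have "\<dots> = ((t + (1 - t) / sqrt (norm_sq n v)) * sqrt (norm_sq n v))\<^sup>2"
    by (simp add: power_mult_distrib)
  also have "(t + (1 - t) / sqrt (norm_sq n v)) * sqrt (norm_sq n v) = t * sqrt (norm_sq n v) + (1 - t)"
    using assms by (simp add: field_simps)
  finally show ?thesis .
qed

lemma push_out_disc:
  assumes v: "v \<in> disc n" "v \<noteq> origin" and t: "t \<in> {0..1}"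
  shows "push_out n (t, v) \<in> disc n - {origin}"
proof -
  let ?r = "sqrt (norm_sq n v)"
  have pos: "norm_sq n v > 0" using norm_sq_pos v by blast
  have r: "0 < ?r" "?r \<le> 1" using pos v by (auto simp: disc_def)
  have s: "t * ?r + (1 - t) \<le> 1" "t * ?r + (1 - t) > 0"
  proof -
    show "t * ?r + (1 - t) \<le> 1" using mult_left_mono[OF r(2), of t] t by simp
    have "t * ?r \<ge> 0" using r t by simp
    moreover have "t * ?r > 0" if "t > 0" using r that by simp
    ultimately show "t * ?r + (1 - t) > 0" using t by (cases "t > 0") auto
  qed
  then have "norm_sq n (push_out n (t, v)) \<le> 1" "norm_sq n (push_out n (t, v)) > 0"
    unfolding norm_sq_push_out[OF pos] by (auto simp: power_le_one)
  moreover have "\<forall>i\<ge>n. push_out n (t, v) i = 0" using v by (simp add: push_out_def disc_def)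
  moreover have "norm_sq n origin = 0" by (simp add: norm_sq_def origin_def)
  ultimately show ?thesis by (auto simp: disc_def)
qed

lemma push_out_1: "push_out n (1, v) = v"
  by (simp add: push_out_def)

lemma push_out_0:
  assumes "v \<in> disc n" "v \<noteq> origin"
  shows "push_out n (0, v) \<in> disc_boundary n"
  using push_out_disc[OF assms, of 0] norm_sq_push_out[OF norm_sq_pos[OF assms], of 0]
  by (simp add: disc_boundary_eq)

lemma push_out_boundary: "v \<in> disc_boundary n \<Longrightarrow> push_out n (t, v) = v"
  by (simp add: push_out_def disc_boundary_eq)

lemma continuous_on_push_out: "continuous_on ({0..1} \<times> (disc n - {origin})) (push_out n)"
proof (rule continuous_on_coordinatewise_then_product)
  fix i
  have "sqrt (norm_sq n (snd x)) \<noteq> 0" if "x \<in> {0..1} \<times> (disc n - {origin})" for x :: "real \<times> (nat \<Rightarrow> real)"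
    using norm_sq_pos[of "snd x" n] that by force
  then show "continuous_on ({0..1} \<times> (disc n - {origin})) (\<lambda>x. push_out n x i)"
    unfolding push_out_def case_prod_beta
    by (intro continuous_intros continuous_on_compose2[OF continuous_on_coordinate[of UNIV]]) auto
qed

text \<open>The points t v with t < 1 are interior and tend to v.\<close>

lemma disc_subset_closure_interior: "disc n \<subseteq> unit_disc n closure_of disc_interior n"
proof
  fix v assume v: "v \<in> disc n"
  let ?s = "\<lambda>t::real. \<lambda>i. t * v i"
  have s_disc: "?s t \<in> disc n" if "t \<in> {0..1}" for t
  proof -
    have "t\<^sup>2 * norm_sq n v \<le> 1 * 1"
      using that v norm_sq_nonneg[of n v] by (intro mult_mono) (auto simp: disc_def power_le_one)
    then show ?thesis using v by (simp add: disc_def norm_sq_scale)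
  qed
  have s_int: "?s t \<in> disc_interior n" if "t \<in> {0..<1}" for t
  proof -
    have "t\<^sup>2 * norm_sq n v \<le> t\<^sup>2 * 1" using v by (intro mult_left_mono) (auto simp: disc_def)
    also have "\<dots> < 1" using that by (simp add: power_less_one_iff)
    finally show ?thesis using s_disc[of t] that by (simp add: disc_interior_eq norm_sq_scale)
  qed
  have "continuous_on {0..1} ?s"
    by (rule continuous_on_coordinatewise_then_product) (intro continuous_intros)
  then have "continuous_map (top_of_set {0..1}) (unit_disc n) ?s"
    using s_disc by (auto simp: unit_disc_eq continuous_map_in_subtopology)
  from continuous_map_image_closure_subset[OF this, of "{0..<1}"]
  have "?s ` (top_of_set {0..1} closure_of {0..<1}) \<subseteq> unit_disc n closure_of (?s ` {0..<1})" .
  moreover have "1 \<in> top_of_set {0..1::real} closure_of {0..<1}"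
    by (simp add: closure_of_subtopology Int_absorb1 atLeastLessThan_subseteq_atLeastAtMost_iff)
  ultimately have "?s 1 \<in> unit_disc n closure_of (?s ` {0..<1})" by blast
  moreover have "unit_disc n closure_of (?s ` {0..<1}) \<subseteq> unit_disc n closure_of disc_interior n"
    using s_int by (intro closure_of_mono) auto
  ultimately show "v \<in> unit_disc n closure_of disc_interior n" by auto
qed

lemma unit_disc_interior_eq: "subtopology (unit_disc n) (disc_interior n) = top_of_set (disc_interior n)"
  unfolding unit_disc_eq subtopology_subtopology
  by (rule arg_cong[where f = "subtopology euclidean"]) (auto simp: disc_interior_eq)

lemma contractible_disc_interior: "contractible_space (subtopology (unit_disc n) (disc_interior n))"
proof -
  let ?h = "\<lambda>(t::real, v::nat \<Rightarrow> real) i. (1 - t) * v i"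
  have int: "?h (t, v) \<in> disc_interior n" if "t \<in> {0..1}" "v \<in> disc_interior n" for t v
  proof -
    have "(1 - t)\<^sup>2 * norm_sq n v \<le> 1 * norm_sq n v"
      using that norm_sq_nonneg[of n v] by (intro mult_right_mono) (auto simp: power_le_one)
    then show ?thesis using that by (auto simp: disc_interior_eq disc_def norm_sq_scale)
  qed
  have cont: "continuous_on ({0..1} \<times> disc_interior n) ?h"
  proof (rule continuous_on_coordinatewise_then_product)
    show "continuous_on ({0..1} \<times> disc_interior n) (\<lambda>x. ?h x i)" for i
      unfolding case_prod_beta
      by (intro continuous_intros continuous_on_compose2[OF continuous_on_coordinate[of UNIV]]) auto
  qed
  have "homotopic_with (\<lambda>x. True) (top_of_set (disc_interior n)) (top_of_set (disc_interior n)) id (\<lambda>x. origin)"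
    unfolding homotopic_with_def
  proof (intro exI[of _ ?h] conjI)
    show "continuous_map (prod_topology (top_of_set {0..1}) (top_of_set (disc_interior n))) (top_of_set (disc_interior n)) ?h"
      unfolding prod_topology_subtopology_eu
    proof (rule continuous_map_top_of_setI[OF cont])
      fix x :: "real \<times> (nat \<Rightarrow> real)"
      assume "x \<in> {0..1} \<times> disc_interior n"
      then show "?h x \<in> disc_interior n" using int[of "fst x" "snd x"] by (cases x) simp
    qed
  qed (simp_all add: origin_def)
  then show ?thesis unfolding contractible_space_def unit_disc_interior_eq by blast
qed

text \<open>The unit sphere is not inside the open disc, so it is embedded with radius 1/2. The
  homotopy \<open>?h\<close> runs along the segment from v / (2 |v|) at t = 0 to v at t = 1.\<close>

lemma punctured_disc_homotopy_equivalent: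
  "top_of_set (disc_interior (Suc n) - {origin}) homotopy_equivalent_space nsphere n"
proof -
  let ?N = "Suc n" and ?S = "{v. (\<Sum>i\<le>n. (v i)\<^sup>2) = 1 \<and> (\<forall>i>n. v i = 0)} :: (nat \<Rightarrow> real) set"
  have sphere: "nsphere n = top_of_set ?S" by (simp add: nsphere powertop_real_eq_euclidean)
  have mem: "v \<in> ?S \<longleftrightarrow> v \<in> disc_boundary ?N" for v
    by (auto simp: disc_boundary_eq disc_def norm_sq_def lessThan_Suc_atMost Suc_le_eq)
  let ?D = "disc_interior ?N - {origin}"
  let ?f = "\<lambda>v i. v i / 2 :: real" and ?g = "\<lambda>v. push_out ?N (0, v)"
  have D: "v \<in> disc ?N - {origin}" if "v \<in> ?D" for v using that by (auto simp: disc_interior_eq)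
  have half: "?f v \<in> ?D" if "v \<in> ?S" for v
  proof -
    have "norm_sq ?N v = 1" using that unfolding mem disc_boundary_eq by simp
    then have "norm_sq ?N (?f v) = 1 / 4"
      using norm_sq_scale[of ?N "1/2" v] by (simp add: power2_eq_square)
    moreover have "norm_sq ?N origin = 0" by (simp add: norm_sq_def origin_def)
    ultimately show ?thesis using that by (auto simp: mem disc_boundary_eq disc_interior_eq disc_def)
  qed
  have f: "continuous_map (nsphere n) (top_of_set ?D) ?f"
  proof -
    have "continuous_on ?S ?f"
      by (intro continuous_on_coordinatewise_then_product continuous_intros continuous_on_coordinate)  auto
    then show ?thesis using half by (auto simp: sphere continuous_map_in_subtopology)
  qed
  have g_cont: "continuous_on ?D ?g"
    by (rule continuous_on_compose2[OF continuous_on_push_out]) (use D in \<open>auto intro!: continuous_intros\<close>)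
  have g: "continuous_map (top_of_set ?D) (nsphere n) ?g"
    using g_cont push_out_0 D mem by (auto simp: sphere continuous_map_in_subtopology)
  have gf: "?g (?f v) = v" if "v \<in> ?S" for v
  proof -
    have "norm_sq ?N v = 1" using that unfolding mem disc_boundary_eq by simp
    then have "norm_sq ?N (?f v) = (1 / 2)\<^sup>2"
      using norm_sq_scale[of ?N "1/2" v] by (simp add: power2_eq_square)
    then have s: "sqrt (norm_sq ?N (?f v)) = 1 / 2" by (simp only: real_sqrt_abs)
    show ?thesis by (simp only: push_out_def case_prod_conv s) simp
  qed
  have 1: "homotopic_with (\<lambda>x. True) (nsphere n) (nsphere n) (?g \<circ> ?f) id"
  proof (rule homotopic_with_equal)
    show "continuous_map (nsphere n) (nsphere n) (?g \<circ> ?f)" by (rule continuous_map_compose[OF f g])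
    show "(?g \<circ> ?f) v = id v" if "v \<in> topspace (nsphere n)" for v
      using that gf[of v] by (simp add: sphere)
  qed simp_all
  let ?h = "\<lambda>(t, v) i. (t + (1 - t) / (2 * sqrt (norm_sq ?N v))) * v i"
  have h_D: "?h (t, v) \<in> ?D" if t: "t \<in> {0..1}" and v: "v \<in> ?D" for t v
  proof -
    let ?r = "sqrt (norm_sq ?N v)"
    have pos: "norm_sq ?N v > 0" using norm_sq_pos D v by blast
    have r: "0 < ?r" "?r < 1" using pos v by (auto simp: disc_interior_eq)
    have s: "t * ?r + (1 - t) / 2 < 1" "t * ?r + (1 - t) / 2 > 0"
    proof -
      show "t * ?r + (1 - t) / 2 < 1"
      proof (cases "t > 0")
        case True
        have "t * ?r < t" using mult_strict_left_mono[OF r(2) True] by simp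
        then show ?thesis using t by (simp add: field_simps)
      qed (use t in simp)
      have "t * ?r \<ge> 0" using r t by simp
      moreover have "t * ?r > 0" if "t > 0" using r that by simp
      ultimately show "t * ?r + (1 - t) / 2 > 0" using t by (cases "t > 0") (auto intro: add_pos_nonneg)
    qed
    have "norm_sq ?N (?h (t, v)) = (t + (1 - t) / (2 * ?r))\<^sup>2 * ?r\<^sup>2"
      using pos by (simp add: norm_sq_scale)
    also have "\<dots> = ((t + (1 - t) / (2 * ?r)) * ?r)\<^sup>2"
      by (simp add: power_mult_distrib)
    also have "(t + (1 - t) / (2 * ?r)) * ?r = t * ?r + (1 - t) / 2"
      using r by (simp add: field_simps)
    finally have eq: "norm_sq ?N (?h (t, v)) = (t * ?r + (1 - t) / 2)\<^sup>2" .
    have "(t * ?r + (1 - t) / 2)\<^sup>2 < 1" using s by (intro power_less_one_iff[THEN iffD2]) linarith+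
    moreover have "(t * ?r + (1 - t) / 2)\<^sup>2 > 0" using s(2) by (rule zero_less_power)
    ultimately have "norm_sq ?N (?h (t, v)) < 1" "norm_sq ?N (?h (t, v)) > 0" by (simp_all only: eq)
    moreover have "norm_sq ?N origin = 0" by (simp add: norm_sq_def origin_def)
    ultimately have "?h (t, v) \<noteq> origin" "norm_sq ?N (?h (t, v)) < 1" by auto
    moreover have "\<forall>i\<ge>?N. ?h (t, v) i = 0" using v by (auto simp: disc_interior_eq disc_def)
    ultimately show ?thesis by (auto simp: disc_interior_eq disc_def)
  qed
  have h_cont: "continuous_on ({0..1} \<times> ?D) ?h"
  proof (rule continuous_on_coordinatewise_then_product)
    fix i
    have "sqrt (norm_sq ?N (snd x)) \<noteq> 0" if "x \<in> {0..1} \<times> ?D" for x :: "real \<times> (nat \<Rightarrow> real)"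
      using norm_sq_pos[of "snd x" ?N] D that by force
    then show "continuous_on ({0..1} \<times> ?D) (\<lambda>x. ?h x i)"
      unfolding case_prod_beta
      by (intro continuous_intros continuous_on_compose2[OF continuous_on_coordinate[of UNIV]]) auto
  qed
  have 2: "homotopic_with (\<lambda>x. True) (top_of_set ?D) (top_of_set ?D) (?f \<circ> ?g) id"
    unfolding homotopic_with_def
  proof (intro exI[of _ ?h] conjI)
    show "continuous_map (prod_topology (top_of_set {0..1}) (top_of_set ?D)) (top_of_set ?D) ?h"
      unfolding prod_topology_subtopology_eu
    proof (rule continuous_map_top_of_setI[OF h_cont])
      fix x :: "real \<times> (nat \<Rightarrow> real)"
      assume "x \<in> {0..1} \<times> ?D"
      then show "?h x \<in> ?D" using h_D[of "fst x" "snd x"] by (cases x) simp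
    qed
  qed (simp_all add: push_out_def mult.commute)
  show ?thesis unfolding homotopy_equivalent_space_def using f g 1 2 by blast
qed

text \<open>As the disc is contractible, H_j of the pair is the reduced H_{j-1} of the sphere of
  dimension n - 1. For n = 0 the punctured disc is empty, and j \<ge> 1 avoids the only nonzero
  group of a point.\<close>

lemma trivial_homology_disc_punctured:
  assumes "j \<ge> n + 1"
  shows "trivial_group (relative_homology_group (int j) (subtopology (unit_disc n) (disc_interior n)) (disc_interior n - {origin}))"
proof (cases n)
  case 0
  have "v = origin" if "v \<in> disc_interior 0" for v using that by (auto simp: disc_interior_eq disc_def origin_def)
  then have e: "disc_interior n - {origin} = {}" using 0 by blast
  have "trivial_group (reduced_homology_group (int j) (subtopology (unit_disc n) (disc_interior n)))"
    using contractible_disc_interior trivial_reduced_homology_group_contractible_space by blast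
  then show ?thesis using assms unfolding e by (simp add: un_reduced_homology_group)
next
  case (Suc m)
  let ?X = "subtopology (unit_disc n) (disc_interior n)" and ?S = "disc_interior n - {origin}"
  have S: "subtopology ?X ?S = top_of_set (disc_interior (Suc m) - {origin})"
    by (simp add: unit_disc_interior_eq subtopology_subtopology Suc Int_absorb1)
  \<comment> \<open>Any nonzero interior point would do; it shows that the subspace is nonempty, as
    the isomorphism for contractible spaces requires.\<close>
  have "(\<lambda>i. if i = 0 then 1/2 else 0) \<in> topspace ?X \<inter> ?S"
  proof -
    have "norm_sq n (\<lambda>i. if i = 0 then 1/2 else 0) = 1/4"
      unfolding Suc norm_sq_def sum.lessThan_Suc_shift by (simp add: power2_eq_square)
    moreover have "(\<lambda>i. if i = 0 then 1/2 else 0) \<noteq> origin" by (auto simp: origin_def fun_eq_iff)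
    ultimately show ?thesis using Suc by (auto simp: topspace_unit_disc disc_interior_eq disc_def)
  qed
  then have ne: "topspace ?X \<inter> ?S \<noteq> {}" by blast
  have 1: "relative_homology_group (int j) ?X ?S \<cong> reduced_homology_group (int j - 1) (subtopology ?X ?S)"
    by (rule isomorphic_group_relative_homology_of_contractible[OF contractible_disc_interior ne])
  have 2: "reduced_homology_group (int j - 1) (subtopology ?X ?S) \<cong> reduced_homology_group (int j - 1) (nsphere m)"
    unfolding S by (rule homotopy_equivalent_space_imp_isomorphic_reduced_homology_groups[OF punctured_disc_homotopy_equivalent])
  have "trivial_group (reduced_homology_group (int j - 1) (nsphere m))"
    using assms Suc by (intro reduced_homology_group_nsphere(2)) auto
  then show ?thesis
    using isomorphic_group_triviality[OF iso_trans[OF 1 2] group_relative_homology_group group_reduced_homology_group] by blast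
qed

section \<open>Attaching cells\<close>

text \<open>The slices over the summands are open in the product, so continuity may be tested on
  each of them. With Z the unit interval this serves homotopies defined cell by cell.\<close>

lemma continuous_map_from_prod_sum:
  assumes "\<And>i. i \<in> I \<Longrightarrow> continuous_map (prod_topology Z (X i)) W (\<lambda>(z, x). g (z, (i, x)))"
  shows "continuous_map (prod_topology Z (sum_topology X I)) W g"
proof (rule pasting_lemma[where T = "\<lambda>i. topspace Z \<times> ({i} \<times> topspace (X i))" and f = "\<lambda>_. g" and I = I])
  fix i assume i: "i \<in> I"
  let ?S = "sum_topology X I" and ?T = "{i} \<times> topspace (X i)"
  have "{x. (j, x) \<in> ?T} = (if j = i then topspace (X i) else {})" for j by auto
  then have op: "openin ?S ?T" using i by (auto simp: openin_sum_topology)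
  then show "openin (prod_topology Z ?S) (topspace Z \<times> ?T)" by (simp add: openin_prod_Times_iff)
  have snd: "continuous_map (subtopology ?S ?T) (X i) snd"
    unfolding continuous_map_def
  proof (intro conjI allI impI)
    fix U assume U: "openin (X i) U"
    have "{x. (j, x) \<in> {i} \<times> U} = (if j = i then U else {})" for j by auto
    then have "openin ?S ({i} \<times> U)" using i U openin_subset[OF U] by (auto simp: openin_sum_topology)
    moreover have "{x \<in> topspace (subtopology ?S ?T). snd x \<in> U} = ?T \<inter> ({i} \<times> U)"
      using i openin_subset[OF U] by auto
    ultimately show "openin (subtopology ?S ?T) {x \<in> topspace (subtopology ?S ?T). snd x \<in> U}"
      by (simp add: openin_subtopology_Int2)
  qed auto
  have "continuous_map (prod_topology Z (subtopology ?S ?T)) (prod_topology Z (X i)) (\<lambda>x. (fst x, snd (snd x)))"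
    by (intro continuous_map_pairedI continuous_map_fst continuous_map_compose[OF continuous_map_snd snd, unfolded o_def])
  from continuous_map_compose[OF this assms[OF i]]
  have "continuous_map (prod_topology Z (subtopology ?S ?T)) W (\<lambda>x. g (fst x, (i, snd (snd x))))"
    by (simp add: o_def)
  then have "continuous_map (prod_topology Z (subtopology ?S ?T)) W g"
    by (rule continuous_map_eq) auto
  then show "continuous_map (subtopology (prod_topology Z ?S) (topspace Z \<times> ?T)) W g"
    by (simp add: subtopology_Times)
qed (auto simp: topspace_prod_topology)

section \<open>CW-complexes and their subcomplexes\<close>

locale cw =
  fixes X :: "'a topology" and E :: "nat \<Rightarrow> 'a set set"
  assumes cw: "CW_complex X E"
begin

lemma hausdorff: "Hausdorff_space X"
  using cw by (simp add: CW_complex_def)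

lemma cells_cover: "(\<Union>n. \<Union>(E n)) = topspace X"
  using cw by (simp add: CW_complex_def)

lemma cell_subset: "e \<in> E n \<Longrightarrow> e \<subseteq> topspace X"
  using cells_cover by blast

lemma cell_unique:
  assumes "d \<in> E m" "e \<in> E n" "x \<in> d" "x \<in> e"
  shows "m = n" "d = e"
proof -
  have "(m, d) \<noteq> (n, e) \<longrightarrow> d \<inter> e = {}" using cw assms(1,2) unfolding CW_complex_def by metis
  then show "m = n" "d = e" using assms(3,4) by auto
qed

lemma char_map_exists: "e \<in> E n \<Longrightarrow> \<exists>\<Phi>. characteristic_map X E n e \<Phi>"
  using cw by (simp add: CW_complex_def)

lemma weak_topology:
  "A \<subseteq> topspace X \<Longrightarrow> (\<And>n e. e \<in> E n \<Longrightarrow> closedin X (A \<inter> X closure_of e)) \<Longrightarrow> closedin X A"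
  using cw by (simp add: CW_complex_def)

lemma char_continuous: "characteristic_map X E n e \<Phi> \<Longrightarrow> continuous_map (unit_disc n) X \<Phi>"
  by (simp add: characteristic_map_def)

lemma char_homeo:
  "characteristic_map X E n e \<Phi> \<Longrightarrow> homeomorphic_map (subtopology (unit_disc n) (disc_interior n)) (subtopology X e) \<Phi>"
  by (simp add: characteristic_map_def)

lemma interior_topspace: "topspace (subtopology (unit_disc n) (disc_interior n)) = disc_interior n"
  by (auto simp: topspace_unit_disc disc_interior_eq)

lemma char_interior:
  assumes "characteristic_map X E n e \<Phi>" "e \<in> E n"
  shows "\<Phi> ` disc_interior n = e"
  using homeomorphic_imp_surjective_map[OF char_homeo[OF assms(1)]] cell_subset[OF assms(2)]
  by (simp add: interior_topspace Int_absorb1 del: topspace_subtopology) (simp add: Int_absorb1)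

lemma char_inj: "characteristic_map X E n e \<Phi> \<Longrightarrow> inj_on \<Phi> (disc_interior n)"
  using homeomorphic_imp_injective_map[OF char_homeo] interior_topspace by metis

text \<open>The open disc is dense in the closed one, which gives one inclusion. The image of the
  closed disc is compact, hence closed in a Hausdorff space, which gives the other.\<close>

lemma char_image:
  assumes \<Phi>: "characteristic_map X E n e \<Phi>" "e \<in> E n"
  shows "\<Phi> ` disc n = X closure_of e"
proof
  have "\<Phi> ` (unit_disc n closure_of disc_interior n) \<subseteq> X closure_of (\<Phi> ` disc_interior n)"
    using char_continuous[OF \<Phi>(1)] by (rule continuous_map_image_closure_subset)
  then show "\<Phi> ` disc n \<subseteq> X closure_of e"
    using disc_subset_closure_interior[of n] char_interior[OF \<Phi>] by auto
  have "compactin X (\<Phi> ` disc n)"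
    using image_compactin[OF _ char_continuous[OF \<Phi>(1)]] compact_space_unit_disc[of n]
    by (simp add: compact_space_def topspace_unit_disc)
  then have "closedin X (\<Phi> ` disc n)" using compactin_imp_closedin hausdorff by blast
  moreover have "e \<subseteq> \<Phi> ` disc n"
    using char_interior[OF \<Phi>] disc_interior_Un_boundary[of n] by blast
  ultimately show "X closure_of e \<subseteq> \<Phi> ` disc n" by (simp add: closure_of_minimal)
qed

lemma char_boundary:
  assumes \<Phi>: "characteristic_map X E n e \<Phi>" and v: "v \<in> disc_boundary n"
  obtains m d where "m < n" "d \<in> E m" "\<Phi> v \<in> d"
proof -
  obtain F where "F \<subseteq> (\<Union>m<n. E m)" "\<Phi> ` disc_boundary n \<subseteq> \<Union>F"
    using \<Phi> unfolding characteristic_map_def by blast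
  then show thesis using v that by blast
qed

lemma closure_finite:
  assumes e: "e \<in> E n"
  shows "\<exists>F. finite F \<and> (\<forall>d\<in>F. \<exists>m<n. d \<in> E m) \<and> X closure_of e \<subseteq> e \<union> \<Union>F"
proof -
  obtain \<Phi> where \<Phi>: "characteristic_map X E n e \<Phi>" using char_map_exists[OF e] by blast
  then obtain F where F: "finite F" "F \<subseteq> (\<Union>m<n. E m)" "\<Phi> ` disc_boundary n \<subseteq> \<Union>F"
    unfolding characteristic_map_def by blast
  have "X closure_of e = \<Phi> ` disc_interior n \<union> \<Phi> ` disc_boundary n"
    using char_image[OF \<Phi> e] disc_interior_Un_boundary[of n] by (metis image_Un)
  then have "X closure_of e \<subseteq> e \<union> \<Union>F" using char_interior[OF \<Phi> e] F(3) by auto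
  moreover have "\<exists>m<n. d \<in> E m" if "d \<in> F" for d using F(2) that by blast
  ultimately show ?thesis using F(1) by blast
qed

text \<open>A subcomplex as a set of points: since the cells cover X, the closure condition also
  makes Y a union of cells.\<close>

definition subcomplex :: "'a set \<Rightarrow> bool"
  where "subcomplex Y \<longleftrightarrow> Y \<subseteq> topspace X \<and> (\<forall>n. \<forall>e\<in>E n. e \<inter> Y \<noteq> {} \<longrightarrow> X closure_of e \<subseteq> Y)"

lemma subcomplexD: "subcomplex Y \<Longrightarrow> e \<in> E n \<Longrightarrow> x \<in> e \<Longrightarrow> x \<in> Y \<Longrightarrow> X closure_of e \<subseteq> Y"
  unfolding subcomplex_def by blast

lemma subcomplex_topspace: "subcomplex Y \<Longrightarrow> Y \<subseteq> topspace X"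
  unfolding subcomplex_def by blast

lemma cell_closure: "e \<in> E n \<Longrightarrow> e \<subseteq> X closure_of e"
  by (simp add: closure_of_subset cell_subset)

lemma subcomplex_cell:
  assumes "subcomplex Y" "x \<in> Y"
  obtains n e where "e \<in> E n" "x \<in> e" "e \<subseteq> Y" "X closure_of e \<subseteq> Y"
proof -
  have "x \<in> (\<Union>n. \<Union>(E n))" using assms subcomplex_topspace cells_cover by blast
  then obtain n e where e: "e \<in> E n" "x \<in> e" by blast
  then have "X closure_of e \<subseteq> Y" using subcomplexD assms by blast
  then show thesis using that e cell_closure by blast
qed

text \<open>A closed cell of X meets Y within finitely many cells, and those meeting Y have their
  closures in Y. So the weak topology can be tested on the cells of Y alone.\<close>

lemma closedin_subcomplex:
  assumes Y: "subcomplex Y" and A: "A \<subseteq> Y"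
    and closed: "\<And>n e. e \<in> E n \<Longrightarrow> e \<subseteq> Y \<Longrightarrow> closedin X (A \<inter> X closure_of e)"
  shows "closedin X A"
proof (rule weak_topology)
  show "A \<subseteq> topspace X" using A subcomplex_topspace[OF Y] by blast
  fix n e assume e: "e \<in> E n"
  obtain F where F: "finite F" "\<And>d. d \<in> F \<Longrightarrow> \<exists>m<n. d \<in> E m" "X closure_of e \<subseteq> e \<union> \<Union>F"
    using closure_finite[OF e] by blast
  let ?G = "{d \<in> insert e F. d \<subseteq> Y}"
  have G: "\<exists>m. d \<in> E m" if "d \<in> ?G" for d using that e F(2) by blast
  have eq: "A \<inter> X closure_of e = (\<Union>d\<in>?G. A \<inter> X closure_of d \<inter> X closure_of e)"
  proof
    show "A \<inter> X closure_of e \<subseteq> (\<Union>d\<in>?G. A \<inter> X closure_of d \<inter> X closure_of e)"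
    proof
      fix x assume x: "x \<in> A \<inter> X closure_of e"
      then obtain d where d: "d \<in> insert e F" "x \<in> d" using F(3) by blast
      obtain m where m: "d \<in> E m" using d(1) e F(2) by blast
      have "X closure_of d \<subseteq> Y" using subcomplexD[OF Y m d(2)] x A by blast
      then have "d \<subseteq> Y" "x \<in> X closure_of d" using cell_closure[OF m] d(2) by blast+
      then show "x \<in> (\<Union>d\<in>?G. A \<inter> X closure_of d \<inter> X closure_of e)" using x d(1) by blast
    qed
  qed blast
  have "closedin X (A \<inter> X closure_of d \<inter> X closure_of e)" if "d \<in> ?G" for d
    using G[OF that] closed that by (blast intro: closedin_Int closedin_closure_of)
  then show "closedin X (A \<inter> X closure_of e)"
    unfolding eq using F(1) by (intro closedin_Union) auto
qed

lemma subcomplex_closed: "subcomplex Y \<Longrightarrow> closedin X Y"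
proof (rule closedin_subcomplex)
  fix n e assume "subcomplex Y" "e \<in> E n" "e \<subseteq> Y"
  then have "Y \<inter> X closure_of e = X closure_of e"
  proof (cases "e = {}")
    case False
    then obtain x where "x \<in> e" by blast
    then have "X closure_of e \<subseteq> Y" using subcomplexD \<open>subcomplex Y\<close> \<open>e \<in> E n\<close> \<open>e \<subseteq> Y\<close> by blast
    then show ?thesis by blast
  qed simp
  then show "closedin X (Y \<inter> X closure_of e)" by simp
qed auto

text \<open>The weak topology as a quotient topology. In this form it is compatible with the product
  with an interval, from which the continuity of \<open>deform\<close> will follow.\<close>

lemma subcomplex_quotient_map:
  assumes Y: "subcomplex Y" and I: "I = {(n, e). e \<in> E n \<and> e \<subseteq> Y}"
    and \<Phi>: "\<And>n e. (n, e) \<in> I \<Longrightarrow> characteristic_map X E n e (\<Phi> (n, e))"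
  shows "quotient_map (sum_topology (\<lambda>c. unit_disc (fst c)) I) (subtopology X Y) (\<lambda>(c, v). \<Phi> c v)"
proof -
  let ?J = "sum_topology (\<lambda>c. unit_disc (fst c)) I" and ?q = "\<lambda>(c, v). \<Phi> c v"
  have clY: "X closure_of e \<subseteq> Y" if "(n, e) \<in> I" for n e
  proof -
    have e: "e \<in> E n" "e \<subseteq> Y" using that I by auto
    have "e \<noteq> {}" using char_interior[OF \<Phi>[OF that] e(1)] origin_disc_interior by blast
    then show ?thesis using subcomplexD[OF Y e(1)] e(2) by blast
  qed
  have img: "\<Phi> c ` disc (fst c) = X closure_of (snd c)" if "c \<in> I" for c
  proof -
    obtain m e where c: "c = (m, e)" by fastforce
    then have "e \<in> E m" "(m, e) \<in> I" using that I by auto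
    then show ?thesis using char_image[OF \<Phi>] c by simp
  qed
  have top: "topspace ?J = Sigma I (\<lambda>c. disc (fst c))" by (auto simp: topspace_unit_disc)
  have cont: "continuous_map (unit_disc (fst c)) (subtopology X Y) (\<Phi> c)" if "c \<in> I" for c
  proof -
    have "continuous_map (unit_disc (fst c)) X (\<Phi> c)" using char_continuous[OF \<Phi>, of "fst c" "snd c"] that by simp
    moreover have "\<Phi> c ` disc (fst c) \<subseteq> Y" using img[OF that] clY[of "fst c" "snd c"] that by simp
    ultimately show ?thesis by (auto simp: continuous_map_in_subtopology topspace_unit_disc)
  qed
  show ?thesis
    unfolding quotient_map_closedin
  proof (intro conjI allI impI)
    show "?q ` topspace ?J = topspace (subtopology X Y)"
    proof
      show "?q ` topspace ?J \<subseteq> topspace (subtopology X Y)"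
      proof
        fix x assume "x \<in> ?q ` topspace ?J"
        then obtain c v where cv: "c \<in> I" "v \<in> disc (fst c)" "x = \<Phi> c v" unfolding top by auto
        then have "x \<in> X closure_of (snd c)" using img by blast
        then have "x \<in> Y" using clY[of "fst c" "snd c"] cv(1) by auto
        then show "x \<in> topspace (subtopology X Y)" using subcomplex_topspace[OF Y] by auto
      qed
      show "topspace (subtopology X Y) \<subseteq> ?q ` topspace ?J"
      proof
        fix x assume "x \<in> topspace (subtopology X Y)"
        then have "x \<in> Y" by simp
        then obtain n e where e: "e \<in> E n" "x \<in> e" "e \<subseteq> Y" using subcomplex_cell[OF Y] by metis
        then have c: "(n, e) \<in> I" using I by auto
        then have "x \<in> \<Phi> (n, e) ` disc n" using img[OF c] cell_closure[OF e(1)] e(2) by auto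
        then show "x \<in> ?q ` topspace ?J" unfolding top using c by force
      qed
    qed
    fix U assume U: "U \<subseteq> topspace (subtopology X Y)"
    have pre: "{v. (c, v) \<in> {x \<in> topspace ?J. ?q x \<in> U}} = {v \<in> disc (fst c). \<Phi> c v \<in> U}" if "c \<in> I" for c
      using that unfolding top by auto
    have sub: "{x \<in> topspace ?J. ?q x \<in> U} \<subseteq> Sigma I (topspace \<circ> (\<lambda>c. unit_disc (fst c)))"
      by auto
    have "closedin ?J {x \<in> topspace ?J. ?q x \<in> U} \<longleftrightarrow>
        (\<forall>c\<in>I. closedin (unit_disc (fst c)) {v \<in> disc (fst c). \<Phi> c v \<in> U})"
      unfolding closedin_sum_topology using sub pre by simp
    also have "\<dots> \<longleftrightarrow> closedin (subtopology X Y) U"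
    proof
      assume "closedin (subtopology X Y) U"
      then show "\<forall>c\<in>I. closedin (unit_disc (fst c)) {v \<in> disc (fst c). \<Phi> c v \<in> U}"
        using closedin_continuous_map_preimage[OF cont] by (simp add: topspace_unit_disc)
    next
      assume cl: "\<forall>c\<in>I. closedin (unit_disc (fst c)) {v \<in> disc (fst c). \<Phi> c v \<in> U}"
      have "closedin X U"
      proof (rule closedin_subcomplex[OF Y])
        show "U \<subseteq> Y" using U by simp
        fix n e assume e: "e \<in> E n" "e \<subseteq> Y"
        then have c: "(n, e) \<in> I" using I by simp
        have "compactin (unit_disc n) {v \<in> disc n. \<Phi> (n, e) v \<in> U}"
          using closedin_compact_space[OF compact_space_unit_disc, of n] cl c by force
        then have "compactin X (\<Phi> (n, e) ` {v \<in> disc n. \<Phi> (n, e) v \<in> U})"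
          using image_compactin char_continuous[OF \<Phi>[OF c]] by blast
        then have "closedin X (\<Phi> (n, e) ` {v \<in> disc n. \<Phi> (n, e) v \<in> U})"
          using compactin_imp_closedin hausdorff by blast
        moreover have "\<Phi> (n, e) ` {v \<in> disc n. \<Phi> (n, e) v \<in> U} = U \<inter> X closure_of e"
          using img[OF c] by auto
        ultimately show "closedin X (U \<inter> X closure_of e)" by simp
      qed
      then show "closedin (subtopology X Y) U" using U by (simp add: closedin_subset_topspace)
    qed
    finally show "closedin ?J {x \<in> topspace ?J. ?q x \<in> U} = closedin (subtopology X Y) U" .
  qed
qed

text \<open>A cell meeting the remainder either lies in Y, together with its closure, or is an
  n-cell of T outside T', whose closure adds only points of cells of lower dimension. Neither
  closure meets T'. Passing to complements shows that unions of cells of T are open in Y'.\<close>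

lemma subcomplex_Diff_cells:
  assumes "subcomplex Y" "subcomplex Y'" "Y' \<subseteq> Y \<union> \<Union>T" "T \<subseteq> E n" "Y \<inter> \<Union>T = {}" "Y \<subseteq> Y'" "T' \<subseteq> T"
  shows "subcomplex (Y' - \<Union>T')"
  unfolding subcomplex_def
proof (intro conjI allI ballI impI)
  show "Y' - \<Union>T' \<subseteq> topspace X" using subcomplex_topspace assms(2) by blast
  fix m e assume e: "e \<in> E m" "e \<inter> (Y' - \<Union>T') \<noteq> {}"
  then obtain x where x: "x \<in> e" "x \<in> Y'" "x \<notin> \<Union>T'" by blast
  have clY': "X closure_of e \<subseteq> Y'" using subcomplexD[OF assms(2) e(1) x(1,2)] .
  have "y \<notin> d" if y: "y \<in> X closure_of e" and d: "d \<in> T'" for y d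
  proof
    assume yd: "y \<in> d"
    have dE: "d \<in> E n" using d assms by blast
    show False
    proof (cases "x \<in> Y")
      case True
      then have "X closure_of e \<subseteq> Y" using subcomplexD[OF assms(1) e(1) x(1)] by blast
      then show ?thesis using y yd d assms(5,7) by blast
    next
      case False
      then obtain d' where d': "d' \<in> T" "x \<in> d'" using x(2) assms(3) by blast
      then have "m = n" "e = d'" using cell_unique[OF e(1) _ x(1) d'(2)] assms(4) by blast+
      obtain F where F: "\<And>d. d \<in> F \<Longrightarrow> \<exists>m'<m. d \<in> E m'" "X closure_of e \<subseteq> e \<union> \<Union>F"
        using closure_finite[OF e(1)] by blast
      show ?thesis
      proof (cases "y \<in> e")
        case True
        then have "d = e" using cell_unique(2)[OF dE e(1) yd] by blast
        then show ?thesis using x d by blast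
      next
        case False
        then obtain d'' where "d'' \<in> F" "y \<in> d''" using F(2) y by blast
        then obtain m' where "m' < m" "d'' \<in> E m'" using F(1) by blast
        then show ?thesis using cell_unique(1)[OF dE _ yd \<open>y \<in> d''\<close>] \<open>m = n\<close> by blast
      qed
    qed
  qed
  then show "X closure_of e \<subseteq> Y' - \<Union>T'" using clY' by blast
qed

end

section \<open>Attaching cells of a single dimension\<close>

locale attaching = cw +
  fixes Y Y' :: "'a set" and n :: nat and T :: "'a set set" and \<Psi> :: "'a set \<Rightarrow> (nat \<Rightarrow> real) \<Rightarrow> 'a"
  assumes Y: "subcomplex Y" and Y': "subcomplex Y'" and T: "T \<subseteq> E n"
    and Y'_eq: "Y' = Y \<union> \<Union>T" and YT: "Y \<inter> \<Union>T = {}"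
    and \<Psi>: "e \<in> T \<Longrightarrow> characteristic_map X E n e (\<Psi> e)"
begin

definition W :: "'a set"
  where "W = Y' - (\<lambda>e. \<Psi> e origin) ` T"

lemma T_E: "e \<in> T \<Longrightarrow> e \<in> E n"
  using T by blast

lemma centre: "e \<in> T \<Longrightarrow> \<Psi> e origin \<in> e"
  using char_interior[OF \<Psi> T_E] origin_disc_interior by blast

lemma openin_cells: "T' \<subseteq> T \<Longrightarrow> openin (subtopology X Y') (\<Union>T')"
proof -
  assume T': "T' \<subseteq> T"
  have "closedin X (Y' - \<Union>T')"
    by (rule subcomplex_closed[OF subcomplex_Diff_cells[OF Y Y' _ T YT _ T']]) (use Y'_eq in auto)
  then have "closedin (subtopology X Y') (Y' - \<Union>T')" by (simp add: closedin_subset_topspace)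
  moreover have "topspace (subtopology X Y') - (Y' - \<Union>T') = \<Union>T'"
    using T' Y'_eq subcomplex_topspace[OF Y'] by auto
  ultimately show ?thesis by (metis openin_diff openin_topspace)
qed

lemma \<Psi>_boundary:
  assumes e: "e \<in> T" and v: "v \<in> disc_boundary n"
  shows "\<Psi> e v \<in> Y"
proof -
  have "v \<in> disc n" using v disc_interior_Un_boundary by blast
  then have "\<Psi> e v \<in> X closure_of e" using char_image[OF \<Psi>[OF e] T_E[OF e]] by blast
  moreover have "X closure_of e \<subseteq> Y'"
    using subcomplexD[OF Y' T_E[OF e] centre[OF e]] centre[OF e] e Y'_eq by blast
  ultimately have "\<Psi> e v \<in> Y \<union> \<Union>T" using Y'_eq by blast
  moreover have "\<Psi> e v \<notin> \<Union>T"
  proof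
    assume "\<Psi> e v \<in> \<Union>T"
    then obtain d where d: "d \<in> T" "\<Psi> e v \<in> d" by blast
    obtain m d' where "m < n" "d' \<in> E m" "\<Psi> e v \<in> d'" using char_boundary[OF \<Psi>[OF e] v] .
    then show False using cell_unique(1)[OF T_E[OF d(1)] _ d(2)] by blast
  qed
  ultimately show ?thesis by blast
qed

lemma Y_subset_W: "Y \<subseteq> W"
  unfolding W_def using Y'_eq YT centre by blast

lemma \<Psi>_W_iff:
  assumes e: "e \<in> T" and v: "v \<in> disc n"
  shows "\<Psi> e v \<in> W \<longleftrightarrow> v \<noteq> origin"
proof
  show "\<Psi> e v \<in> W \<Longrightarrow> v \<noteq> origin" using e by (auto simp: W_def)
  assume "v \<noteq> origin"
  show "\<Psi> e v \<in> W"
  proof (cases "v \<in> disc_interior n")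
    case True
    then have ev: "\<Psi> e v \<in> e" using char_interior[OF \<Psi>[OF e] T_E[OF e]] by blast
    have "\<Psi> e v \<noteq> \<Psi> d origin" if "d \<in> T" for d
    proof
      assume eq: "\<Psi> e v = \<Psi> d origin"
      then have "e = d" using cell_unique(2)[OF T_E[OF e] T_E[OF that] ev] centre[OF that] by simp
      then have "v = origin"
        using inj_onD[OF char_inj[OF \<Psi>[OF e]]] eq True origin_disc_interior by blast
      then show False using \<open>v \<noteq> origin\<close> by blast
    qed
    moreover have "\<Psi> e v \<in> Y'" using ev e Y'_eq by blast
    ultimately show ?thesis unfolding W_def by blast
  next
    case False
    then have "v \<in> disc_boundary n" using v disc_interior_Un_boundary by blast
    then show ?thesis using \<Psi>_boundary[OF e] Y_subset_W by blast
  qed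
qed

lemma cell_Int_W: "e \<in> T \<Longrightarrow> e \<inter> W = \<Psi> e ` (disc_interior n - {origin})"
proof -
  assume e: "e \<in> T"
  have "e = \<Psi> e ` disc_interior n" using char_interior[OF \<Psi>[OF e] T_E[OF e]] by simp
  moreover have "v \<in> disc n" if "v \<in> disc_interior n" for v using that disc_interior_Un_boundary by blast
  ultimately show ?thesis using \<Psi>_W_iff[OF e] by (auto 4 3)
qed

text \<open>By closure-finiteness a closed cell contains only finitely many centres, so the set of
  all centres is closed in the weak topology.\<close>

lemma openin_W: "openin (subtopology X Y') W"
proof -
  let ?P = "(\<lambda>e. \<Psi> e origin) ` T"
  have "closedin X ?P"
  proof (rule weak_topology)
    show "?P \<subseteq> topspace X" using centre T_E cell_subset by blast
    fix m e assume e: "e \<in> E m"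
    obtain F where F: "finite F" "\<And>d. d \<in> F \<Longrightarrow> \<exists>m'<m. d \<in> E m'" "X closure_of e \<subseteq> e \<union> \<Union>F"
      using closure_finite[OF e] by blast
    have "?P \<inter> X closure_of e \<subseteq> (\<lambda>d. \<Psi> d origin) ` insert e F"
    proof
      fix x assume x: "x \<in> ?P \<inter> X closure_of e"
      then obtain d where d: "d \<in> T" "x = \<Psi> d origin" by blast
      obtain d' where d': "d' \<in> insert e F" "x \<in> d'" using x F(3) by blast
      then obtain m' where "d' \<in> E m'" using e F(2) by blast
      then have "d = d'" using cell_unique(2)[OF T_E[OF d(1)] _ _ d'(2)] centre[OF d(1)] d(2) by blast
      then show "x \<in> (\<lambda>d. \<Psi> d origin) ` insert e F" using d d' by blast
    qed
    then have "finite (?P \<inter> X closure_of e)" using F(1) finite_subset by blast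
    moreover have "?P \<inter> X closure_of e \<subseteq> topspace X"
      using closure_of_subset_topspace[of X e] by (rule order_trans[OF Int_lower2])
    ultimately show "closedin X (?P \<inter> X closure_of e)"
      using hausdorff by (meson Hausdorff_imp_t1_space t1_space_closedin_finite)
  qed
  then have "closedin (subtopology X Y') (Y' \<inter> ?P)" by (metis closedin_subtopology inf_commute)
  moreover have "W = topspace (subtopology X Y') - Y' \<inter> ?P"
    using subcomplex_topspace[OF Y'] by (auto simp: W_def)
  ultimately show ?thesis by (metis openin_diff openin_topspace)
qed

lemma cell_homology_trivial:
  assumes e: "e \<in> T" and j: "j \<ge> n + 1"
  shows "trivial_group (relative_homology_group (int j) (subtopology X e) (e \<inter> W))"
proof -
  have sub: "disc_interior n - {origin} \<subseteq> topspace (subtopology (unit_disc n) (disc_interior n))"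
    by (simp only: interior_topspace) blast
  have "relative_homology_group (int j) (subtopology (unit_disc n) (disc_interior n)) (disc_interior n - {origin})
      \<cong> relative_homology_group (int j) (subtopology X e) (e \<inter> W)"
    by (rule is_isoI[OF homeomorphic_map_relative_homology_iso[OF char_homeo[OF \<Psi>[OF e]] sub]])
      (simp add: cell_Int_W[OF e])
  then show ?thesis
    using isomorphic_group_triviality[OF _ group_relative_homology_group group_relative_homology_group]
      trivial_homology_disc_punctured[OF j] by blast
qed

text \<open>The integral homology of the pair vanishes from degree n + 1 on. Reduction modulo p
  looks at the degrees k and k - 1, whence the bound n + 2.\<close>

lemma cells_acyclic:
  assumes p: "p > 0" and T': "T' \<subseteq> T" and k: "k \<ge> n + 2"
  shows "acyclic_at chain_boundary (mod_chains p X {\<Union>T'}) (mod_chains p X {\<Union>T' \<inter> W}) k"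
proof -
  have top: "topspace (subtopology X (\<Union>T')) = \<Union>T'" proof -
    have "e \<subseteq> topspace X" if "e \<in> T'" for e using that T' T_E cell_subset by blast
    then have "\<Union>T' \<subseteq> topspace X" by (rule Union_least)
    then show ?thesis by (simp add: Int_absorb1)
  qed
  have sub: "subtopology (subtopology X (\<Union>T')) e = subtopology X e" if "e \<in> T'" for e
    using that by (simp add: subtopology_subtopology Int_absorb1 Sup_upper)
  have bounds: "singular_relboundary j (subtopology X (\<Union>T')) (\<Union>T' \<inter> W) c"
    if j: "j \<ge> n + 1" and c: "singular_relcycle j (subtopology X (\<Union>T')) (\<Union>T' \<inter> W) c" for j c
  proof (rule relboundary_disjoint_union[OF _ _ top _ c])
    fix e assume e: "e \<in> T'"
    have "openin (subtopology X Y') e" using openin_cells[of "{e}"] e T' by auto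
    then have "openin (subtopology (subtopology X Y') (\<Union>T')) e"
      using e by (metis Sup_upper openin_subset_topspace_eq openin_subtopology_Int2 inf.absorb_iff2)
    moreover have "Y' \<inter> \<Union>T' = \<Union>T'" using T' Y'_eq by blast
    ultimately show "openin (subtopology X (\<Union>T')) e" by (simp add: subtopology_subtopology)
    fix c assume c: "singular_relcycle j (subtopology (subtopology X (\<Union>T')) e) (\<Union>T' \<inter> W) c"
    have eW: "topspace (subtopology X e) \<inter> (\<Union>T' \<inter> W) = topspace (subtopology X e) \<inter> (e \<inter> W)"
      using e by auto
    have "singular_relcycle j (subtopology X e) (topspace (subtopology X e) \<inter> (\<Union>T' \<inter> W)) c"
      using c unfolding sub[OF e] singular_relcycle_restrict .
    then have "singular_relcycle j (subtopology X e) (e \<inter> W) c"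
      unfolding eW singular_relcycle_restrict .
    with j have "singular_relboundary j (subtopology X e) (e \<inter> W) c"
      using trivial_relative_homology_imp_relboundary[OF cell_homology_trivial] e T' by blast
    then have "singular_relboundary j (subtopology X e) (topspace (subtopology X e) \<inter> (e \<inter> W)) c"
      unfolding singular_relboundary_restrict .
    then have "singular_relboundary j (subtopology X e) (\<Union>T' \<inter> W) c"
      unfolding eW[symmetric] singular_relboundary_restrict .
    then show "singular_relboundary j (subtopology (subtopology X (\<Union>T')) e) (\<Union>T' \<inter> W) c"
      unfolding sub[OF e] .
  next
    show "pairwise disjnt T'"
    proof (rule pairwiseI)
      fix d e assume de: "d \<in> T'" "e \<in> T'" "d \<noteq> e"
      then have "d \<in> E n" "e \<in> E n" using T' T by auto
      then show "disjnt d e" unfolding disjnt_iff using cell_unique(2) de(3) by metis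
    qed
  qed
  show ?thesis
  proof (rule acyclic_mod_from_integral[OF p])
    show "\<Union>T' \<inter> W \<subseteq> \<Union>T'" by blast
    show "singular_relboundary (k - 1) (subtopology X (\<Union>T')) (\<Union>T' \<inter> W) e"
      if "singular_relcycle (k - 1) (subtopology X (\<Union>T')) (\<Union>T' \<inter> W) e" for e
      using bounds[OF _ that] k by simp
    show "singular_relboundary k (subtopology X (\<Union>T')) (\<Union>T' \<inter> W) c"
      if "singular_relcycle k (subtopology X (\<Union>T')) (\<Union>T' \<inter> W) c" for c
      using bounds[OF _ that] k by simp
  qed
qed

text \<open>Pushes the punctured cells of T radially onto their boundaries. On W this is a
  deformation retraction onto Y, traversed from the retraction at t = 0 to the identity at t =
  1.\<close>

definition deform :: "real \<times> 'a \<Rightarrow> 'a"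
  where "deform = (\<lambda>(t, x). if x \<in> Y then x
      else (let e = (THE e. e \<in> T \<and> x \<in> e)
            in \<Psi> e (push_out n (t, inv_into (disc_interior n) (\<Psi> e) x))))"

text \<open>The formula extends to the closed disc: a boundary point is sent into Y, where
  \<open>deform\<close> is constant, and \<open>push_out\<close> is constant there too.\<close>

lemma deform_\<Psi>:
  assumes e: "e \<in> T" and v: "v \<in> disc n"
  shows "deform (t, \<Psi> e v) = \<Psi> e (push_out n (t, v))"
proof (cases "v \<in> disc_interior n")
  case True
  then have ev: "\<Psi> e v \<in> e" using char_interior[OF \<Psi>[OF e] T_E[OF e]] by blast
  then have "\<Psi> e v \<notin> Y" using YT e by blast
  moreover have "(THE e'. e' \<in> T \<and> \<Psi> e v \<in> e') = e"
  proof (rule the_equality)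
    show "e' = e" if "e' \<in> T \<and> \<Psi> e v \<in> e'" for e'
      using cell_unique(2)[OF T_E T_E[OF e] _ ev] that by blast
  qed (use e ev in blast)
  moreover have "inv_into (disc_interior n) (\<Psi> e) (\<Psi> e v) = v"
    using inv_into_f_f[OF char_inj[OF \<Psi>[OF e]] True] .
  ultimately show ?thesis by (simp add: deform_def)
next
  case False
  then have b: "v \<in> disc_boundary n" using v disc_interior_Un_boundary by blast
  then show ?thesis using \<Psi>_boundary[OF e b] by (simp add: deform_def push_out_boundary)
qed

lemma W_cases:
  assumes "x \<in> W"
  obtains "x \<in> Y" | e v where "e \<in> T" "v \<in> disc n" "v \<noteq> origin" "x = \<Psi> e v"
proof (cases "x \<in> Y")
  case False
  moreover have "x \<in> Y'" using assms unfolding W_def by blast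
  ultimately obtain e where e: "e \<in> T" "x \<in> e" using Y'_eq by blast
  then obtain v where v: "v \<in> disc_interior n" "x = \<Psi> e v"
    using char_interior[OF \<Psi>[OF e(1)] T_E[OF e(1)]] by blast
  then have "v \<in> disc n" using disc_interior_Un_boundary by blast
  moreover from this have "v \<noteq> origin" using \<Psi>_W_iff[OF e(1)] v assms by blast
  ultimately show thesis using that(2) e v by blast
qed (use that in blast)

text \<open>W is open in Y', so the quotient map from the sum of discs restricts to a quotient map
  onto W. Its product with the compact Hausdorff interval is again a quotient map, and upstairs
  \<open>deform\<close> is given on each disc either by \<open>push_out\<close> or by the
  projection.\<close>

lemma continuous_deform:
  "continuous_map (prod_topology (top_of_set {0..1::real}) (subtopology X W)) (subtopology X W) deform"
proof -
  define I where "I = {(m, e). e \<in> E m \<and> e \<subseteq> Y'}"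
  \<comment> \<open>On T the maps \<Psi> are kept, because \<open>deform\<close> is expressed
    through them; for the other cells any characteristic map will do.\<close>
  define \<Phi> where "\<Phi> c = (if fst c = n \<and> snd c \<in> T then \<Psi> (snd c)
      else (SOME \<Phi>. characteristic_map X E (fst c) (snd c) \<Phi>))" for c
  have \<Phi>: "characteristic_map X E m e (\<Phi> (m, e))" if "(m, e) \<in> I" for m e
  proof (cases "m = n \<and> e \<in> T")
    case True
    then show ?thesis using \<Psi> by (simp add: \<Phi>_def)
  next
    case False
    have "\<exists>\<Phi>. characteristic_map X E m e \<Phi>" using char_map_exists that by (simp add: I_def)
    then have "characteristic_map X E m e (SOME \<Phi>. characteristic_map X E m e \<Phi>)" by (rule someI_ex)
    then show ?thesis using False by (auto simp: \<Phi>_def)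
  qed
  let ?J = "sum_topology (\<lambda>c. unit_disc (fst c)) I" and ?q = "\<lambda>(c, v). \<Phi> c v"
  have q: "quotient_map ?J (subtopology X Y') ?q"
    by (rule subcomplex_quotient_map[OF Y' I_def \<Phi>])
  define D where "D c = {v \<in> disc (fst c). \<Phi> c v \<in> W}" for c
  have pre: "{x \<in> topspace ?J. ?q x \<in> W} = Sigma I D"
    by (auto simp: D_def topspace_unit_disc)
  have WY': "W \<subseteq> Y'" by (auto simp: W_def)
  have q': "quotient_map (sum_topology (\<lambda>c. subtopology (unit_disc (fst c)) (D c)) I) (subtopology X W) ?q"
    using quotient_map_restriction[OF q pre] openin_W WY'
    by (simp add: subtopology_sum_topology subtopology_subtopology Int_absorb1)
  have "quotient_map (prod_topology (top_of_set {0..1::real}) (sum_topology (\<lambda>c. subtopology (unit_disc (fst c)) (D c)) I))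
      (prod_topology (top_of_set {0..1::real}) (subtopology X W)) (\<lambda>(x, y). (x, ?q y))"
  proof (rule quotient_map_prod_right[OF _ _ q'])
    have "compact_space (top_of_set {0..1::real})" by (simp add: compact_space_subtopology)
    then show "locally_compact_space (top_of_set {0..1::real})" by (rule compact_imp_locally_compact_space)
    show "Hausdorff_space (top_of_set {0..1::real}) \<or> regular_space (top_of_set {0..1::real})"
      by (simp add: Hausdorff_space_subtopology)
  qed
  moreover have "continuous_map (prod_topology (top_of_set {0..1::real}) (sum_topology (\<lambda>c. subtopology (unit_disc (fst c)) (D c)) I))
      (subtopology X W) (deform \<circ> (\<lambda>(x, y). (x, ?q y)))"
  proof (rule continuous_map_from_prod_sum)
    fix c assume c: "c \<in> I"
    obtain m e where me: "c = (m, e)" "e \<in> E m" "e \<subseteq> Y'" using c by (auto simp: I_def)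
    have \<Phi>c: "continuous_map (unit_disc m) X (\<Phi> c)" using char_continuous[OF \<Phi>] c me by simp
    have eq: "(\<lambda>(z, x). (deform \<circ> (\<lambda>(x, y). (x, ?q y))) (z, c, x)) = (\<lambda>(z, v). deform (z, \<Phi> c v))"
      by auto
    have "continuous_map (prod_topology (top_of_set {0..1::real}) (subtopology (unit_disc (fst c)) (D c)))
        (subtopology X W) (\<lambda>(z, v). deform (z, \<Phi> c v))"
    proof (cases "m = n \<and> e \<in> T")
      case True
      then have \<Phi>\<Psi>: "\<Phi> c = \<Psi> e" by (simp add: \<Phi>_def me)
      have D: "D c = disc n - {origin}" unfolding D_def \<Phi>\<Psi> using \<Psi>_W_iff[of e] True by (auto simp: me)
      have disc: "subtopology (unit_disc (fst c)) (D c) = top_of_set (disc n - {origin})"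
        unfolding D using True by (simp add: me unit_disc_eq subtopology_subtopology Int_absorb1 Diff_subset)
      have "continuous_map (top_of_set ({0..1} \<times> (disc n - {origin}))) (top_of_set (disc n - {origin})) (push_out n)"
        by (rule continuous_map_top_of_setI[OF continuous_on_push_out]) (use push_out_disc in force)
      moreover have "continuous_map (top_of_set (disc n - {origin})) (subtopology X W) (\<Psi> e)"
      proof -
        have "continuous_map (top_of_set (disc n)) X (\<Psi> e)" using \<Phi>c True by (simp add: \<Phi>\<Psi> unit_disc_eq)
        then have "continuous_map (subtopology (top_of_set (disc n)) (disc n - {origin})) X (\<Psi> e)"
          by (rule continuous_map_from_subtopology)
        then have "continuous_map (top_of_set (disc n - {origin})) X (\<Psi> e)"
          by (simp add: subtopology_subtopology Int_absorb1 Diff_subset)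
        then show ?thesis using \<Psi>_W_iff True by (auto simp: continuous_map_in_subtopology)
      qed
      ultimately have "continuous_map (top_of_set ({0..1} \<times> (disc n - {origin}))) (subtopology X W) (\<Psi> e \<circ> push_out n)"
        by (rule continuous_map_compose)
      then show ?thesis unfolding disc prod_topology_subtopology_eu
        by (rule continuous_map_eq) (use deform_\<Psi> True in \<open>auto simp: \<Phi>\<Psi>\<close>)
    next
      case False
      \<comment> \<open>A cell of Y' other than the attached ones lies in Y, where the deformation
        is constant in time.\<close>
      have "e \<subseteq> Y"
      proof
        fix x assume x: "x \<in> e"
        show "x \<in> Y"
        proof (rule ccontr)
          assume "x \<notin> Y"
          then obtain d where "d \<in> T" "x \<in> d" using x me(3) Y'_eq by blast
          then have "m = n" "e = d" using cell_unique[OF me(2) T_E x] by blast+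
          then show False using False \<open>d \<in> T\<close> by blast
        qed
      qed
      moreover have "e \<noteq> {}"
        using char_interior[OF \<Phi> me(2)] origin_disc_interior c me by blast
      ultimately have cl: "X closure_of e \<subseteq> Y" using subcomplexD[OF Y me(2)] by blast
      have in_Y: "\<Phi> c v \<in> Y" if "v \<in> disc m" for v
        using char_image[OF \<Phi> me(2)] cl that c me by blast
      have "continuous_map (subtopology (unit_disc m) (D c)) X (\<Phi> c)"
        using \<Phi>c by (rule continuous_map_from_subtopology)
      then have "continuous_map (subtopology (unit_disc m) (D c)) (subtopology X W) (\<Phi> c)"
        using in_Y Y_subset_W by (auto simp: continuous_map_in_subtopology topspace_unit_disc)
      then have "continuous_map (prod_topology (top_of_set {0..1::real}) (subtopology (unit_disc m) (D c))) (subtopology X W) (\<Phi> c \<circ> snd)"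
        by (rule continuous_map_compose[OF continuous_map_snd])
      then show ?thesis unfolding me(1) fst_conv
        by (rule continuous_map_eq) (use in_Y in \<open>auto simp: deform_def topspace_unit_disc me(1)\<close>)
    qed
    then show "continuous_map (prod_topology (top_of_set {0..1::real}) (subtopology (unit_disc (fst c)) (D c)))
        (subtopology X W) (\<lambda>(z, x). (deform \<circ> (\<lambda>(x, y). (x, ?q y))) (z, c, x))"
      unfolding eq .
  qed
  ultimately show ?thesis by (rule continuous_compose_quotient_map)
qed

lemma retract_homology_trivial: "trivial_group (relative_homology_group j (subtopology X W) Y)"
proof (rule trivial_relative_homology_group_alt)
  let ?f = "\<lambda>x. deform (0, x)"
  have deform_Y: "deform (t, x) = x" if "x \<in> Y" for t x using that by (simp add: deform_def)
  have f_Y: "?f x \<in> Y" if "x \<in> W" for x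
    using that
  proof (cases rule: W_cases)
    case 1
    then show ?thesis by (simp add: deform_Y)
  next
    case (2 e v)
    then show ?thesis using \<Psi>_boundary[OF 2(1) push_out_0] by (simp add: deform_\<Psi>)
  qed
  have one: "deform (1, x) = x" if "x \<in> W" for x
    using that by (cases rule: W_cases) (simp_all add: deform_Y deform_\<Psi> push_out_1)
  have top: "topspace (subtopology X W) = W" using subcomplex_topspace[OF Y'] by (auto simp: W_def)
  show hom: "homotopic_with (\<lambda>k. k ` Y \<subseteq> Y) (subtopology X W) (subtopology X W) ?f id"
  proof (rule homotopic_with[THEN iffD2])
    show "(h ` Y \<subseteq> Y) = (k ` Y \<subseteq> Y)" if "\<And>x. x \<in> topspace (subtopology X W) \<Longrightarrow> h x = k x" for h k :: "'a \<Rightarrow> 'a"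
    proof -
      have "h ` Y = k ` Y" by (rule image_cong) (use that Y_subset_W top in auto)
      then show ?thesis by simp
    qed
    show "\<exists>h. continuous_map (prod_topology (top_of_set {0..1::real}) (subtopology X W)) (subtopology X W) h \<and>
        (\<forall>x\<in>topspace (subtopology X W). h (0, x) = ?f x) \<and> (\<forall>x\<in>topspace (subtopology X W). h (1, x) = id x) \<and>
        (\<forall>t\<in>{0..1::real}. (\<lambda>x. h (t, x)) ` Y \<subseteq> Y)"
    proof (intro exI[of _ deform] conjI ballI)
      show "(\<lambda>x. deform (t, x)) ` Y \<subseteq> Y" for t using deform_Y by auto
    qed (use continuous_deform one top in simp_all)
  qed
  have "continuous_map (subtopology X W) (subtopology X W) ?f"
    using homotopic_with_imp_continuous_maps[OF hom] by blast
  then show "continuous_map (subtopology X W) (subtopology (subtopology X W) Y) ?f"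
    using f_Y top by (auto simp: continuous_map_in_subtopology)
qed

lemma retract_acyclic:
  assumes "p > 0"
  shows "acyclic_at chain_boundary (mod_chains p X {W}) (mod_chains p X {Y}) k"
  by (rule acyclic_mod_from_integral[OF assms Y_subset_W])
    (rule trivial_relative_homology_imp_relboundary[OF retract_homology_trivial], assumption)+

end

section \<open>Cyclic groups acting on CW-complexes\<close>

lemma (in cw) subcomplex_Un:
  assumes "subcomplex Y" "subcomplex Z"
  shows "subcomplex (Y \<union> Z)"
  unfolding subcomplex_def
proof (intro conjI allI ballI impI)
  show "Y \<union> Z \<subseteq> topspace X" using assms subcomplex_topspace by simp
  fix n e assume e: "e \<in> E n" "e \<inter> (Y \<union> Z) \<noteq> {}"
  then obtain x where x: "x \<in> e" "x \<in> Y \<or> x \<in> Z" by blast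
  then show "X closure_of e \<subseteq> Y \<union> Z"
    using subcomplexD[OF assms(1) e(1) x(1)] subcomplexD[OF assms(2) e(1) x(1)] by blast
qed

text \<open>The skeleton of dimension n - 1. The shift makes \<open>below 0\<close> empty and lets
  the attachment of n-cells lead from \<open>below n\<close> to
  \<open>below (Suc n)\<close>.\<close>

definition (in cw) below :: "nat \<Rightarrow> 'a set"
  where "below n = (\<Union>m<n. \<Union>(E m))"

lemma (in cw) below_Suc: "below (Suc n) = below n \<union> \<Union>(E n)"
  unfolding below_def lessThan_Suc by blast

lemma (in cw) below_iff: "e \<in> E n \<Longrightarrow> x \<in> e \<Longrightarrow> x \<in> below m \<longleftrightarrow> n < m"
  unfolding below_def using cell_unique(1) by blast

lemma (in cw) subcomplex_below: "subcomplex (below n)"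
  unfolding subcomplex_def
proof (intro conjI allI ballI impI)
  show "below n \<subseteq> topspace X" unfolding below_def using cells_cover by blast
  fix m e assume e: "e \<in> E m" "e \<inter> below n \<noteq> {}"
  then have "m < n" using below_iff by blast
  obtain F where F: "\<forall>d\<in>F. \<exists>m'<m. d \<in> E m'" "X closure_of e \<subseteq> e \<union> \<Union>F"
    using closure_finite[OF e(1)] by blast
  have "e \<subseteq> below n" unfolding below_def using e(1) \<open>m < n\<close> by blast
  moreover have "d \<subseteq> below n" if "d \<in> F" for d
  proof -
    obtain m' where "m' < m" "d \<in> E m'" using F(1) \<open>d \<in> F\<close> by blast
    then have "m' \<in> {..<n}" using \<open>m < n\<close> by simp
    then have "\<Union>(E m') \<subseteq> below n" unfolding below_def by (rule UN_upper)
    then show ?thesis using \<open>d \<in> E m'\<close> by blast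
  qed
  ultimately show "X closure_of e \<subseteq> below n" using F(2) by blast
qed

lemma (in cw) cell_nonempty: "e \<in> E n \<Longrightarrow> e \<noteq> {}"
  using char_map_exists char_interior origin_disc_interior by blast

lemma openin_subtopology_shrink:
  assumes "openin (subtopology X Y) S" "S \<subseteq> Z" "Z \<subseteq> Y"
  shows "openin (subtopology X Z) S"
proof -
  obtain U where "openin X U" "S = U \<inter> Y" using assms(1) by (auto simp: openin_subtopology)
  moreover from this have "S = U \<inter> Z" using assms(2,3) by blast
  ultimately show ?thesis by (auto simp: openin_subtopology)
qed

lemma (in cw) openin_cell: "e \<in> E n \<Longrightarrow> openin (subtopology X (\<Union>(E n))) e"
proof -
  assume e: "e \<in> E n"
  interpret attaching X E "below n" "below (Suc n)" n "E n" "\<lambda>e. SOME \<Phi>. characteristic_map X E n e \<Phi>"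
  proof
    show "below n \<inter> \<Union>(E n) = {}" using below_iff by blast
    show "characteristic_map X E n e (SOME \<Phi>. characteristic_map X E n e \<Phi>)" if "e \<in> E n" for e
      using char_map_exists[OF that] by (rule someI_ex)
  qed (rule subcomplex_below below_Suc order_refl)+
  have "openin (subtopology X (below (Suc n))) e" using openin_cells[of "{e}"] e by simp
  moreover have "e \<subseteq> \<Union>(E n)" "\<Union>(E n) \<subseteq> below (Suc n)" using e below_Suc by blast+
  ultimately show ?thesis by (rule openin_subtopology_shrink)
qed

lemma (in cw) connectedin_cell: "e \<in> E n \<Longrightarrow> connectedin X e"
proof -
  assume e: "e \<in> E n"
  obtain \<Phi> where \<Phi>: "characteristic_map X E n e \<Phi>" using char_map_exists[OF e] by blast
  have "connected_space (subtopology (unit_disc n) (disc_interior n))"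
    using contractible_disc_interior contractible_imp_connected_space by blast
  moreover have "disc_interior n \<subseteq> topspace (unit_disc n)" by (auto simp: topspace_unit_disc disc_interior_eq)
  ultimately have "connectedin (unit_disc n) (disc_interior n)" by (simp add: connectedin_def)
  then show ?thesis using connectedin_continuous_map_image[OF char_continuous[OF \<Phi>]] char_interior[OF \<Phi> e] by metis
qed

section \<open>The permutation of the cells by the generator\<close>

locale cyclic_cw = mod_p_action p X \<gamma> + cw X E
  for p and X :: "'a topology" and \<gamma> :: "'a \<Rightarrow> 'a" and E :: "nat \<Rightarrow> 'a set set" +
  assumes cellular: "\<gamma> ` below n \<subseteq> below n"
    and pointwise: "e \<in> E n \<Longrightarrow> \<gamma> ` e = e \<Longrightarrow> x \<in> e \<Longrightarrow> \<gamma> x = x"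
begin

lemma pow_p_minus_1: "x \<in> topspace X \<Longrightarrow> (\<gamma> ^^ (p - 1)) (\<gamma> x) = x" "x \<in> topspace X \<Longrightarrow> \<gamma> ((\<gamma> ^^ (p - 1)) x) = x"
proof -
  have p: "p = Suc (p - 1)" using p_pos by simp
  assume x: "x \<in> topspace X"
  show "\<gamma> ((\<gamma> ^^ (p - 1)) x) = x" using \<gamma>_p[OF x] by (subst (asm) p) simp
  show "(\<gamma> ^^ (p - 1)) (\<gamma> x) = x" using \<gamma>_p[OF x] by (subst (asm) p) (simp add: funpow_swap1)
qed

lemma pow_below: "x \<in> below n \<Longrightarrow> (\<gamma> ^^ i) x \<in> below n"
  using cellular by (induction i) auto

lemma \<gamma>_top: "x \<in> topspace X \<Longrightarrow> \<gamma> x \<in> topspace X"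
  using cont_\<gamma> by (auto simp: continuous_map_def)

text \<open>The inverse of \<gamma> is its power with exponent p - 1 and preserves the skeleta too,
  so \<gamma> cannot lower the dimension of the cell containing a point.\<close>

lemma \<gamma>_layer:
  assumes "x \<in> \<Union>(E n)"
  shows "\<gamma> x \<in> \<Union>(E n)"
proof -
  have top: "x \<in> topspace X" using assms cells_cover by blast
  have "\<gamma> x \<in> below (Suc n)" using assms cellular[of "Suc n"] below_Suc by blast
  moreover have "\<gamma> x \<notin> below n"
  proof
    assume "\<gamma> x \<in> below n"
    then have "(\<gamma> ^^ (p - 1)) (\<gamma> x) \<in> below n" by (rule pow_below)
    then have "x \<in> below n" by (simp only: pow_p_minus_1(1)[OF top])
    then show False using assms below_iff by blast
  qed
  ultimately show ?thesis using below_Suc by blast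
qed

text \<open>Cells are connected, and the n-cells are disjoint and open in their union, which
  \<gamma> preserves. So the image of one cell cannot be spread over several.\<close>

lemma cell_image_subset:
  assumes "e \<in> E n"
  shows "\<exists>e'\<in>E n. (\<gamma> ^^ i) ` e \<subseteq> e'"
proof (induction i)
  case 0
  then show ?case using assms by auto
next
  case (Suc i)
  then obtain e' where e': "e' \<in> E n" "(\<gamma> ^^ i) ` e \<subseteq> e'" by blast
  have "\<exists>d\<in>E n. \<gamma> ` e' \<subseteq> d"
  proof (rule connectedin_disjoint_open_cases)
    show layer: "\<gamma> ` e' \<subseteq> \<Union>(E n)" using \<gamma>_layer e'(1) by blast
    have "connectedin X (\<gamma> ` e')" using connectedin_continuous_map_image[OF cont_\<gamma> connectedin_cell[OF e'(1)]] .
    then show "connectedin (subtopology X (\<Union>(E n))) (\<gamma> ` e')" using layer by (simp add: connectedin_subtopology)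
    show "pairwise disjnt (E n)"
    proof (rule pairwiseI)
      fix d e assume de: "d \<in> E n" "e \<in> E n" "d \<noteq> e"
      then show "disjnt d e" unfolding disjnt_iff using cell_unique(2) by metis
    qed
    show "\<gamma> ` e' \<noteq> {}" using cell_nonempty[OF e'(1)] by simp
  qed (rule openin_cell)
  then obtain d where "d \<in> E n" "\<gamma> ` e' \<subseteq> d" by blast
  moreover have "(\<gamma> ^^ Suc i) ` e \<subseteq> \<gamma> ` e'" using e'(2) by auto
  ultimately show ?case by (meson order_trans)
qed

lemma \<gamma>_cell:
  assumes e: "e \<in> E n"
  shows "\<gamma> ` e \<in> E n"
proof -
  obtain e' where e': "e' \<in> E n" "\<gamma> ` e \<subseteq> e'" using cell_image_subset[OF e, of 1] by auto
  obtain e'' where e'': "e'' \<in> E n" "(\<gamma> ^^ (p - 1)) ` e' \<subseteq> e''" using cell_image_subset[OF e'(1)] by blast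
  obtain x where x: "x \<in> e" using cell_nonempty[OF e] by blast
  have "(\<gamma> ^^ (p - 1)) (\<gamma> x) \<in> e''" using x e'(2) e''(2) by blast
  then have "x \<in> e''" using pow_p_minus_1(1) cell_subset[OF e] x by (metis subsetD)
  then have eq: "e'' = e" using cell_unique(2)[OF e''(1) e] x by blast
  have "e' \<subseteq> \<gamma> ` e"
  proof
    fix y assume y: "y \<in> e'"
    then have "(\<gamma> ^^ (p - 1)) y \<in> e" using e''(2) eq by blast
    moreover have "\<gamma> ((\<gamma> ^^ (p - 1)) y) = y" using pow_p_minus_1(2) cell_subset[OF e'(1)] y by blast
    ultimately show "y \<in> \<gamma> ` e" by (metis imageI)
  qed
  then show ?thesis using e' by (metis subset_antisym)
qed

lemma pow_cell: "e \<in> E n \<Longrightarrow> (\<gamma> ^^ i) ` e \<in> E n"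
proof (induction i)
  case (Suc i)
  have "(\<gamma> ^^ Suc i) ` e = \<gamma> ` ((\<gamma> ^^ i) ` e)" by (simp add: image_comp)
  then show ?case using \<gamma>_cell[OF Suc.IH[OF Suc.prems]] by simp
qed simp

lemma pow_image_mod:
  assumes "S \<subseteq> topspace X"
  shows "(\<gamma> ^^ i) ` ((\<gamma> ^^ j) ` S) = (\<gamma> ^^ ((i + j) mod p)) ` S"
proof -
  have "(\<gamma> ^^ i) ((\<gamma> ^^ j) x) = (\<gamma> ^^ ((i + j) mod p)) x" if "x \<in> S" for x
    using pow_mod[of x "i + j"] assms that by (auto simp: funpow_add)
  then show ?thesis by (auto simp: image_image)
qed

lemma homeo_\<gamma>: "homeomorphic_map X X \<gamma>"
proof (rule homeomorphic_maps_imp_map)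
  show "homeomorphic_maps X X \<gamma> (\<gamma> ^^ (p - 1))"
    unfolding homeomorphic_maps_def using cont_\<gamma> cont_pow pow_p_minus_1 by blast
qed

lemma char_\<gamma>:
  assumes \<Phi>: "characteristic_map X E n e \<Phi>" and e: "e \<in> E n"
  shows "characteristic_map X E n (\<gamma> ` e) (\<gamma> \<circ> \<Phi>)"
  unfolding characteristic_map_def
proof (intro conjI)
  show "continuous_map (unit_disc n) X (\<gamma> \<circ> \<Phi>)"
    using continuous_map_compose[OF char_continuous[OF \<Phi>] cont_\<gamma>] .
  obtain F where F: "finite F" "F \<subseteq> (\<Union>m<n. E m)" "\<Phi> ` disc_boundary n \<subseteq> \<Union>F"
    using \<Phi> unfolding characteristic_map_def by blast
  show "\<exists>F. finite F \<and> F \<subseteq> (\<Union>m<n. E m) \<and> (\<gamma> \<circ> \<Phi>) ` disc_boundary n \<subseteq> \<Union>F"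
  proof (intro exI[of _ "(\<lambda>d. \<gamma> ` d) ` F"] conjI)
    show "(\<lambda>d. \<gamma> ` d) ` F \<subseteq> (\<Union>m<n. E m)" using F(2) \<gamma>_cell by blast
    have "(\<gamma> \<circ> \<Phi>) ` disc_boundary n \<subseteq> \<gamma> ` \<Union>F"
      unfolding image_comp[symmetric] using F(3) by (rule image_mono)
    then show "(\<gamma> \<circ> \<Phi>) ` disc_boundary n \<subseteq> \<Union>((\<lambda>d. \<gamma> ` d) ` F)" by blast
  qed (use F(1) in simp)
  have "homeomorphic_map (subtopology X e) (subtopology X (\<gamma> ` e)) \<gamma>"
    by (rule homeomorphic_map_subtopologies[OF homeo_\<gamma>])
      (use cell_subset[OF e] cell_subset[OF \<gamma>_cell[OF e]] in \<open>simp add: Int_absorb1\<close>)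
  then show "homeomorphic_map (subtopology (unit_disc n) (disc_interior n)) (subtopology X (\<gamma> ` e)) (\<gamma> \<circ> \<Phi>)"
    using homeomorphic_map_compose[OF char_homeo[OF \<Phi>]] by blast
qed

lemma char_pow:
  assumes \<Phi>: "characteristic_map X E n e \<Phi>" and e: "e \<in> E n"
  shows "characteristic_map X E n ((\<gamma> ^^ i) ` e) ((\<gamma> ^^ i) \<circ> \<Phi>)"
proof (induction i)
  case 0
  then show ?case using \<Phi> by simp
next
  case (Suc i)
  have "characteristic_map X E n (\<gamma> ` ((\<gamma> ^^ i) ` e)) (\<gamma> \<circ> ((\<gamma> ^^ i) \<circ> \<Phi>))"
    by (rule char_\<gamma>[OF Suc pow_cell[OF e]])
  moreover have "(\<gamma> ^^ Suc i) ` e = \<gamma> ` ((\<gamma> ^^ i) ` e)" "(\<gamma> ^^ Suc i) \<circ> \<Phi> = \<gamma> \<circ> ((\<gamma> ^^ i) \<circ> \<Phi>)"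
    by (simp_all add: image_comp o_assoc)
  ultimately show ?case by (simp only:)
qed

text \<open>A cell with a fixed point is mapped to itself, as cells are disjoint, and is then fixed
  pointwise. Its closure is fixed as well, since the fixed set is closed in a Hausdorff
  space.\<close>

lemma subcomplex_fixed_set: "subcomplex fixed_set"
  unfolding subcomplex_def
proof (intro conjI allI ballI impI)
  show "fixed_set \<subseteq> topspace X" by (auto simp: fixed_set_def)
  fix n e assume e: "e \<in> E n" "e \<inter> fixed_set \<noteq> {}"
  then obtain x where x: "x \<in> e" "\<gamma> x = x" by (auto simp: fixed_set_def)
  then have "x \<in> \<gamma> ` e" by (metis imageI)
  then have "\<gamma> ` e = e" using cell_unique(2)[OF \<gamma>_cell[OF e(1)] e(1)] x by blast
  then have "e \<subseteq> fixed_set" using pointwise[OF e(1)] cell_subset[OF e(1)] by (auto simp: fixed_set_def)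
  moreover have "closedin X fixed_set"
    using closedin_continuous_maps_eq[OF hausdorff cont_\<gamma> continuous_map_id] by (simp add: fixed_set_def)
  ultimately show "X closure_of e \<subseteq> fixed_set" by (rule closure_of_minimal)
qed

lemma pow_fixed_set: "x \<in> fixed_set \<Longrightarrow> (\<gamma> ^^ i) x = x"
  by (induction i) (auto simp: fixed_set_def)

text \<open>Starting from the whole fixed point set means that each step attaches free cells only,
  and that every stage contains the fixed simplices, as \<open>free_pairI\<close> requires.\<close>

definition stage :: "nat \<Rightarrow> 'a set"
  where "stage n = fixed_set \<union> below n"

definition free_cells :: "nat \<Rightarrow> 'a set set"
  where "free_cells n = {e \<in> E n. e \<inter> fixed_set = {}}"

lemma free_cells_E: "e \<in> free_cells n \<Longrightarrow> e \<in> E n"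
  by (simp add: free_cells_def)

lemma subcomplex_stage: "subcomplex (stage n)"
  unfolding stage_def using subcomplex_Un subcomplex_fixed_set subcomplex_below by blast

lemma stage_Suc: "stage (Suc n) = stage n \<union> \<Union>(free_cells n)"
proof -
  have "e \<subseteq> fixed_set" if "e \<in> E n" "e \<notin> free_cells n" for e
    using that subcomplexD[OF subcomplex_fixed_set that(1)] cell_closure[OF that(1)] by (auto simp: free_cells_def)
  then show ?thesis unfolding stage_def below_Suc free_cells_def by blast
qed

lemma stage_free_cells: "stage n \<inter> \<Union>(free_cells n) = {}"
  unfolding stage_def free_cells_def using below_iff by blast

text \<open>The argument of \<open>fixed_set_pow\<close> for cells: i is invertible modulo p, so
  \<gamma> itself preserves e and hence fixes it pointwise.\<close>

lemma free_cell_free: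
  assumes e: "e \<in> free_cells n" and "(\<gamma> ^^ i) ` e = e" "0 < i" "i < p"
  shows False
proof -
  have eE: "e \<in> E n" and eX: "e \<subseteq> topspace X" using e free_cells_E cell_subset by blast+
  have "coprime i p" using assms(3,4) prime_p by (meson coprime_commute nat_dvd_not_less prime_imp_coprime_nat)
  then obtain a b where ab: "a * i = b * p + 1"
    using bezout_nat[of i p] assms(3) by (auto simp: mult.commute)
  have "(\<gamma> ^^ (a * i)) ` e = e" for a
  proof (induction a)
    case (Suc a)
    have "(\<gamma> ^^ (Suc a * i)) ` e = (\<gamma> ^^ i) ` ((\<gamma> ^^ (a * i)) ` e)" by (simp add: funpow_add image_comp)
    then show ?case using Suc assms(2) by simp
  qed simp
  moreover have "(a * i) mod p = 1" using prime_gt_1_nat[OF prime_p] unfolding ab by (simp add: mod_Suc)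
  ultimately have "(\<gamma> ^^ 1) ` e = e" using pow_image_mod[OF eX, of "a * i" 0] by simp
  then have "\<gamma> ` e = e" by simp
  then have "e \<subseteq> fixed_set" using pointwise[OF eE] eX by (auto simp: fixed_set_def)
  then show False using e cell_nonempty[OF eE] by (auto simp: free_cells_def)
qed

lemma inverse_mod_exists: "\<exists>j<p. (j + i) mod p = 0"
proof (cases "i mod p = 0")
  case True
  then show ?thesis using p_pos by (intro exI[of _ 0]) simp
next
  case False
  have "(p - i mod p + i) mod p = (p - i mod p + i mod p) mod p" by (simp add: mod_simps)
  also have "p - i mod p + i mod p = p" using p_pos by (simp add: less_imp_le)
  finally show ?thesis using False p_pos by (intro exI[of _ "p - i mod p"]) simp
qed

lemma pow_free_cell:
  assumes e: "e \<in> free_cells n"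
  shows "(\<gamma> ^^ i) ` e \<in> free_cells n"
proof -
  have eE: "e \<in> E n" and eX: "e \<subseteq> topspace X" using e free_cells_E cell_subset by blast+
  have "(\<gamma> ^^ i) ` e \<inter> fixed_set = {}"
  proof (rule ccontr)
    assume "(\<gamma> ^^ i) ` e \<inter> fixed_set \<noteq> {}"
    then obtain x where x: "x \<in> e" "(\<gamma> ^^ i) x \<in> fixed_set" by blast
    obtain j where "(j + i) mod p = 0" using inverse_mod_exists[of i] by metis
    then have "(\<gamma> ^^ j) ((\<gamma> ^^ i) x) = x" using pow_mod[of x "j + i"] x(1) eX by (auto simp: funpow_add)
    then have "x \<in> fixed_set" using pow_fixed_set[OF x(2)] x(2) by simp
    then show False using e x(1) by (auto simp: free_cells_def)
  qed
  then show ?thesis using pow_cell[OF eE] by (simp add: free_cells_def)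
qed

text \<open>The choice is made from the set of all translates, which is the same for every cell of
  an orbit. So the result depends on the orbit only.\<close>

definition orbit_rep :: "'a set \<Rightarrow> 'a set"
  where "orbit_rep e = (SOME d. d \<in> (\<lambda>i. (\<gamma> ^^ i) ` e) ` {..<p})"

lemma orbit_rep:
  assumes e: "e \<in> free_cells n"
  shows "orbit_rep e \<in> free_cells n" "\<exists>i<p. e = (\<gamma> ^^ i) ` orbit_rep e"
    "orbit_rep ((\<gamma> ^^ j) ` e) = orbit_rep e"
proof -
  have eX: "e \<subseteq> topspace X" using e free_cells_E cell_subset by blast
  note inv = inverse_mod_exists
  have "(\<gamma> ^^ 0) ` e \<in> (\<lambda>i. (\<gamma> ^^ i) ` e) ` {..<p}" using p_pos by blast
  then have "orbit_rep e \<in> (\<lambda>i. (\<gamma> ^^ i) ` e) ` {..<p}"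
    unfolding orbit_rep_def by (rule someI[where P = "\<lambda>d. d \<in> (\<lambda>i. (\<gamma> ^^ i) ` e) ` {..<p}"])
  then obtain i where i: "i < p" "orbit_rep e = (\<gamma> ^^ i) ` e" by blast
  then show "orbit_rep e \<in> free_cells n" using pow_free_cell[OF e] by simp
  obtain j' where j': "j' < p" "(j' + i) mod p = 0" using inv[of i] by metis
  then have "(\<gamma> ^^ j') ` orbit_rep e = e" using pow_image_mod[OF eX, of j' i] i by simp
  then show "\<exists>i<p. e = (\<gamma> ^^ i) ` orbit_rep e" using j' by metis
  have "(\<lambda>i. (\<gamma> ^^ i) ` ((\<gamma> ^^ j) ` e)) ` {..<p} = (\<lambda>i. (\<gamma> ^^ i) ` e) ` {..<p}"
  proof
    show "(\<lambda>i. (\<gamma> ^^ i) ` ((\<gamma> ^^ j) ` e)) ` {..<p} \<subseteq> (\<lambda>i. (\<gamma> ^^ i) ` e) ` {..<p}"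
      unfolding pow_image_mod[OF eX] using p_pos by auto
    show "(\<lambda>i. (\<gamma> ^^ i) ` e) ` {..<p} \<subseteq> (\<lambda>i. (\<gamma> ^^ i) ` ((\<gamma> ^^ j) ` e)) ` {..<p}"
    proof
      fix d assume "d \<in> (\<lambda>i. (\<gamma> ^^ i) ` e) ` {..<p}"
      then obtain l where l: "l < p" "d = (\<gamma> ^^ l) ` e" by blast
      obtain m where m: "(m + j) mod p = 0" using inv[of j] by metis
      have "((l + m) mod p + j) mod p = (l + (m + j) mod p) mod p" by (simp add: mod_simps add.assoc)
      also have "\<dots> = l" using l m by simp
      finally have "d = (\<gamma> ^^ ((l + m) mod p)) ` ((\<gamma> ^^ j) ` e)" unfolding pow_image_mod[OF eX] using l by simp
      then show "d \<in> (\<lambda>i. (\<gamma> ^^ i) ` ((\<gamma> ^^ j) ` e)) ` {..<p}" using p_pos by simp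
    qed
  qed
  then show "orbit_rep ((\<gamma> ^^ j) ` e) = orbit_rep e" by (simp add: orbit_rep_def)
qed

lemma orbit_index_unique:
  assumes d: "d \<in> free_cells n" and "i < p" "j < p" "(\<gamma> ^^ i) ` d = (\<gamma> ^^ j) ` d"
  shows "i = j"
proof (rule ccontr)
  assume ij: "i \<noteq> j"
  have dX: "d \<subseteq> topspace X" using d free_cells_E cell_subset by blast
  have wlog: False if ij: "i < j" "j < p" and eq: "(\<gamma> ^^ i) ` d = (\<gamma> ^^ j) ` d" for i j
  proof -
    have "(\<gamma> ^^ (p - i)) ` ((\<gamma> ^^ i) ` d) = (\<gamma> ^^ (p - i)) ` ((\<gamma> ^^ j) ` d)" using eq by simp
    then have "(\<gamma> ^^ ((p - i + i) mod p)) ` d = (\<gamma> ^^ ((p - i + j) mod p)) ` d" by (simp only: pow_image_mod[OF dX])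
    moreover have "p - i + i = p" "p - i + j = p + (j - i)" using ij by simp_all
    moreover have "(p + (j - i)) mod p = j - i" unfolding mod_add_self1 using ij by simp
    ultimately have "(\<gamma> ^^ (j - i)) ` d = d" by (metis funpow_0 image_cong image_ident mod_self)
    moreover have "0 < j - i" "j - i < p" using ij by auto
    ultimately show False by (rule free_cell_free[OF d])
  qed
  then show False using ij assms(2-4) by (metis nat_neq_iff)
qed

text \<open>The characteristic maps of the representatives are carried to the other cells of each
  orbit by powers of \<gamma>. This makes the set of centres, and with it W, invariant, so that
  \<open>acyclic_attach\<close> applies. Its K is the bound n + 2 of
  \<open>cells_acyclic\<close>.\<close>

lemma stage_step:
  assumes k: "k > n + 2"
  shows "acyclic_at chain_boundary (image_plus (mod_chains p X {stage (Suc n)}) (mod_chains p X {stage n}) \<tau>)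
      (mod_chains p X {stage n}) k"
    and "acyclic_at chain_boundary (image_plus (mod_chains p X {stage (Suc n)}) (mod_chains p X {stage n}) \<sigma>)
      (mod_chains p X {stage n}) k"
proof -
  let ?T = "free_cells n"
  define \<Phi> where "\<Phi> d = (SOME \<Phi>. characteristic_map X E n d \<Phi>)" for d
  define ix where "ix e = (SOME i. i < p \<and> e = (\<gamma> ^^ i) ` orbit_rep e)" for e
  define \<Psi> where "\<Psi> e = (\<gamma> ^^ ix e) \<circ> \<Phi> (orbit_rep e)" for e
  have \<Phi>: "characteristic_map X E n d (\<Phi> d)" if "d \<in> E n" for d
    unfolding \<Phi>_def using char_map_exists[OF that] by (rule someI_ex)
  have ix: "ix e < p" "e = (\<gamma> ^^ ix e) ` orbit_rep e" if "e \<in> ?T" for e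
    using someI_ex[OF orbit_rep(2)[OF that]] by (simp_all only: ix_def)
  have \<Psi>: "characteristic_map X E n e (\<Psi> e)" if "e \<in> ?T" for e
  proof -
    have "orbit_rep e \<in> E n" using orbit_rep(1)[OF that] free_cells_E by blast
    then have "characteristic_map X E n ((\<gamma> ^^ ix e) ` orbit_rep e) (\<Psi> e)"
      unfolding \<Psi>_def by (intro char_pow \<Phi>)
    then show ?thesis using ix(2)[OF that] by simp
  qed
  interpret attaching X E "stage n" "stage (Suc n)" n ?T \<Psi>
  proof
    show "?T \<subseteq> E n" using free_cells_E by blast
  qed (rule subcomplex_stage stage_Suc stage_free_cells \<Psi>; assumption?)+
  define U0 where "U0 = \<Union>(orbit_rep ` ?T)"
  have centres: "(\<lambda>e. \<Psi> e origin) ` ?T = {(\<gamma> ^^ i) (\<Phi> d origin) | i d. i < p \<and> d \<in> orbit_rep ` ?T}"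
  proof (intro equalityI subsetI)
    fix x assume "x \<in> (\<lambda>e. \<Psi> e origin) ` ?T"
    then obtain e where "e \<in> ?T" "x = \<Psi> e origin" by blast
    then show "x \<in> {(\<gamma> ^^ i) (\<Phi> d origin) | i d. i < p \<and> d \<in> orbit_rep ` ?T}"
      using ix(1) unfolding \<Psi>_def by auto
  next
    fix x assume "x \<in> {(\<gamma> ^^ i) (\<Phi> d origin) | i d. i < p \<and> d \<in> orbit_rep ` ?T}"
    then obtain i e where e: "e \<in> ?T" "i < p" "x = (\<gamma> ^^ i) (\<Phi> (orbit_rep e) origin)" by blast
    \<comment> \<open>The cell containing this translate of a centre; freeness of the orbit forces
      its index to be i, so the translate is the centre chosen by \<Psi>.\<close>
    define e' where "e' = (\<gamma> ^^ i) ` orbit_rep e"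
    have r: "orbit_rep e \<in> ?T" using orbit_rep(1) e(1) by blast
    have e': "e' \<in> ?T" unfolding e'_def by (rule pow_free_cell[OF r])
    obtain l where l: "l < p" "e = (\<gamma> ^^ l) ` orbit_rep e" using orbit_rep(2)[OF e(1)] by blast
    have re': "orbit_rep e' = orbit_rep e"
      using orbit_rep(3)[OF r, of i] orbit_rep(3)[OF r, of l] l(2) unfolding e'_def by simp
    have "(\<gamma> ^^ ix e') ` orbit_rep e = e'" using ix(2)[OF e', symmetric] unfolding re' .
    then have "(\<gamma> ^^ ix e') ` orbit_rep e = (\<gamma> ^^ i) ` orbit_rep e" using e'_def by (rule trans)
    then have "ix e' = i" by (rule orbit_index_unique[OF r ix(1)[OF e'] e(2)])
    then have "x = \<Psi> e' origin" using e(3) re' by (simp add: \<Psi>_def)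
    then show "x \<in> (\<lambda>e. \<Psi> e origin) ` ?T" using e' by blast
  qed
  have centres_top: "\<Phi> d origin \<in> topspace X" if "d \<in> orbit_rep ` ?T" for d
  proof -
    have "d \<in> E n" using that orbit_rep(1) free_cells_E by blast
    then show ?thesis using char_interior[OF \<Phi>] origin_disc_interior cell_subset by blast
  qed
  have invS: "\<gamma> ` stage m \<subseteq> stage m" for m
    using cellular[of m] by (auto simp: stage_def fixed_set_def)
  have invW: "\<gamma> ` W \<subseteq> W"
  proof
    fix y assume "y \<in> \<gamma> ` W"
    then obtain x where x: "x \<in> W" "y = \<gamma> x" by blast
    have xX: "x \<in> topspace X" using x(1) subcomplex_topspace[OF Y'] by (auto simp: W_def)
    have "y \<notin> (\<lambda>e. \<Psi> e origin) ` ?T"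
    proof
      assume "y \<in> (\<lambda>e. \<Psi> e origin) ` ?T"
      then obtain i d where id: "i < p" "d \<in> orbit_rep ` ?T" "y = (\<gamma> ^^ i) (\<Phi> d origin)" unfolding centres by blast
      have "x = (\<gamma> ^^ (p - 1)) y" using pow_p_minus_1(1)[OF xX] x(2) by simp
      also have "\<dots> = (\<gamma> ^^ ((p - 1 + i) mod p)) (\<Phi> d origin)"
        using pow_mod[OF centres_top[OF id(2)], of "p - 1 + i"] by (simp add: id(3) funpow_add)
      finally have "x \<in> (\<lambda>e. \<Psi> e origin) ` ?T" unfolding centres using p_pos id(2) by fastforce
      then show False using x(1) by (auto simp: W_def)
    qed
    moreover have "y \<in> stage (Suc n)" using x invS[of "Suc n"] by (auto simp: W_def)
    ultimately show "y \<in> W" by (simp add: W_def)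
  qed
  have U_eq: "\<Union>?T = (\<Union>i<p. (\<gamma> ^^ i) ` U0)"
  proof
    show "\<Union>?T \<subseteq> (\<Union>i<p. (\<gamma> ^^ i) ` U0)"
    proof
      fix x assume "x \<in> \<Union>?T"
      then obtain e where e: "e \<in> ?T" "x \<in> e" by blast
      then have "x \<in> (\<gamma> ^^ ix e) ` orbit_rep e" using ix(2) by blast
      then show "x \<in> (\<Union>i<p. (\<gamma> ^^ i) ` U0)" using ix(1)[OF e(1)] e(1) unfolding U0_def by blast
    qed
    show "(\<Union>i<p. (\<gamma> ^^ i) ` U0) \<subseteq> \<Union>?T"
      unfolding U0_def using pow_free_cell[OF orbit_rep(1)] by blast
  qed
  have invU: "\<gamma> ` \<Union>?T \<subseteq> \<Union>?T" using pow_free_cell[of _ n 1] by auto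
  have pow_U0: "(\<gamma> ^^ i) ` U0 = \<Union>((\<lambda>d. (\<gamma> ^^ i) ` d) ` orbit_rep ` ?T)" for i
    unfolding U0_def by blast
  have top: "\<Union>?T \<subseteq> stage (Suc n)" using stage_Suc by blast
  \<comment> \<open>From here on the hypotheses of \<open>acyclic_attach\<close> are collected, to
    be matched literally at the end.\<close>
  have "stage n \<subseteq> W" by (rule Y_subset_W)
  have "W \<subseteq> stage (Suc n)" by (auto simp: W_def)
  have "\<Union>?T \<subseteq> stage (Suc n)" by (rule top)
  have "stage (Suc n) \<subseteq> topspace X" by (rule subcomplex_topspace[OF Y'])
  have "fixed_set \<subseteq> stage n" by (simp add: stage_def)
  have "invariant {stage (Suc n)}" using invS by (simp add: invariant_def)
  have "invariant {stage n}" using invS by (simp add: invariant_def)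
  have "invariant {W}" using invW by (simp add: invariant_def)
  have "invariant {\<Union>?T}" using invU by (simp add: invariant_def)
  have "openin (subtopology X (stage (Suc n))) (\<Union>?T)" by (rule openin_cells) simp
  have "openin (subtopology X (stage (Suc n))) W" by (rule openin_W)
  have "stage (Suc n) \<subseteq> \<Union>?T \<union> W" using Y_subset_W stage_Suc by blast
  have "acyclic_at chain_boundary (mod_chains p X {W}) (mod_chains p X {stage n}) k" for k
    by (rule retract_acyclic[OF p_pos])
  have "openin (subtopology X (\<Union>?T)) ((\<gamma> ^^ i) ` U0)" if "i < p" for i
  proof -
    have sub: "(\<lambda>d. (\<gamma> ^^ i) ` d) ` orbit_rep ` ?T \<subseteq> ?T" using pow_free_cell[OF orbit_rep(1)] by blast
    then have "openin (subtopology X (stage (Suc n))) ((\<gamma> ^^ i) ` U0)"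
      unfolding pow_U0 by (rule openin_cells)
    then show ?thesis
    proof (rule openin_subtopology_shrink[OF _ _ top])
      show "(\<gamma> ^^ i) ` U0 \<subseteq> \<Union>?T" unfolding pow_U0 using sub by (rule Union_mono)
    qed
  qed
  have "disjnt ((\<gamma> ^^ i) ` U0) ((\<gamma> ^^ j) ` U0)" if ij: "i < p" "j < p" "i \<noteq> j" for i j
    unfolding disjnt_iff
  proof (intro allI notI)
    fix x assume "x \<in> (\<gamma> ^^ i) ` U0 \<and> x \<in> (\<gamma> ^^ j) ` U0"
    then obtain d e where de: "d \<in> ?T" "e \<in> ?T" "x \<in> (\<gamma> ^^ i) ` orbit_rep d" "x \<in> (\<gamma> ^^ j) ` orbit_rep e"
      unfolding U0_def by blast
    have r: "orbit_rep d \<in> ?T" "orbit_rep e \<in> ?T" using orbit_rep(1) de by blast+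
    have eq: "(\<gamma> ^^ i) ` orbit_rep d = (\<gamma> ^^ j) ` orbit_rep e"
      using cell_unique(2)[OF pow_cell pow_cell de(3,4)] r free_cells_E by blast
    have rr: "orbit_rep (orbit_rep c) = orbit_rep c" if c: "c \<in> ?T" for c
      using orbit_rep(3)[OF orbit_rep(1)[OF c], of "ix c"] ix(2)[OF c] by simp
    have "orbit_rep (orbit_rep d) = orbit_rep (orbit_rep e)"
      using orbit_rep(3)[OF r(1), of i] orbit_rep(3)[OF r(2), of j] eq by simp
    then have "orbit_rep d = orbit_rep e" using rr de by simp
    then show False using orbit_index_unique[OF r(1) ij(1,2)] eq ij(3) by simp
  qed
  have "\<Union>?T = (\<Union>i<p. (\<gamma> ^^ i) ` U0)" by (rule U_eq)
  have "acyclic_at chain_boundary (mod_chains p X {\<Union>?T}) (mod_chains p X {\<Union>?T \<inter> W}) k" if "k \<ge> n + 2" for k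
    using cells_acyclic[OF p_pos _ that, of ?T] by blast
  have "acyclic_at chain_boundary (mod_chains p X {U0}) (mod_chains p X {U0 \<inter> W}) k" if "k \<ge> n + 2" for k
    unfolding U0_def by (rule cells_acyclic[OF p_pos _ that]) (use orbit_rep(1) in blast)
  note k
  show "acyclic_at chain_boundary (image_plus (mod_chains p X {stage (Suc n)}) (mod_chains p X {stage n}) \<tau>)
      (mod_chains p X {stage n}) k"
    by (rule acyclic_attach(1)[where W = W and U = "\<Union>?T" and U0 = U0 and K = "n + 2"]; fact)
  show "acyclic_at chain_boundary (image_plus (mod_chains p X {stage (Suc n)}) (mod_chains p X {stage n}) \<sigma>)
      (mod_chains p X {stage n}) k"
    by (rule acyclic_attach(2)[where W = W and U = "\<Union>?T" and U0 = U0 and K = "n + 2"]; fact)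
qed

lemma fixed_pair:
  assumes "fixed_set \<subseteq> Y" "fixed_set \<subseteq> Z" "Z \<subseteq> Y" "\<gamma> ` Y \<subseteq> Y" "\<gamma> ` Z \<subseteq> Z"
  obtains R where "free_pair p X \<gamma> {Y} {Z} R"
  by (rule free_pair_exists[of "{Y}" "{Z}" Z]) (use assms in \<open>auto simp: invariant_def\<close>)

text \<open>\<open>image_filtration\<close> adds one stage at a time. A degree above the bound for
  the last stage is above the bounds for all earlier ones.\<close>

lemma stage_acyclic:
  "k > n + 2 \<Longrightarrow>
    acyclic_at chain_boundary (image_plus (mod_chains p X {stage n}) (mod_chains p X {fixed_set}) \<tau>) (mod_chains p X {fixed_set}) k \<and>
    acyclic_at chain_boundary (image_plus (mod_chains p X {stage n}) (mod_chains p X {fixed_set}) \<sigma>) (mod_chains p X {fixed_set}) k"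
proof (induction n)
  case 0
  \<comment> \<open>Here the pair is (D, D), whose quotient is zero.\<close>
  have "stage 0 = fixed_set" by (simp add: stage_def below_def)
  have inv: "invariant {fixed_set}" by (auto simp: invariant_def fixed_set_def)
  let ?D = "mod_chains p X {fixed_set}"
  have "acyclic_at chain_boundary (image_plus ?D ?D r) ?D k"
    if r: "\<And>x. x \<in> ?D k \<Longrightarrow> r k x \<in> ?D k" and r0: "r (Suc k) 0 = 0" for r
  proof (rule acyclic_atI)
    fix x assume "x \<in> image_plus ?D ?D r k"
    then obtain c where "c \<in> ?D k" "x - r k c \<in> ?D k" unfolding image_plus_def by blast
    then have "(x - r k c) + r k c \<in> ?D k" using r ab_subgroup_add[OF sub_mod_chains] by blast
    then have "x - chain_boundary (Suc k) 0 \<in> ?D k" by simp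
    moreover have "0 \<in> image_plus ?D ?D r (Suc k)"
      unfolding image_plus_def using r0 ab_subgroup_0[OF sub_mod_chains]
      by (intro CollectI bexI[of _ 0]) simp_all
    ultimately show "\<exists>y\<in>image_plus ?D ?D r (Suc k). x - chain_boundary (Suc k) y \<in> ?D k" by blast
  qed
  then show ?case using \<tau>_mod_chains[OF inv] \<sigma>_mod_chains[OF inv]
    by (simp add: \<open>stage 0 = fixed_set\<close> \<tau>_def \<sigma>_def)
next
  case (Suc n)
  have inv: "\<gamma> ` stage m \<subseteq> stage m" for m using cellular[of m] by (auto simp: stage_def fixed_set_def)
  have sub: "stage n \<subseteq> stage (Suc n)" "fixed_set \<subseteq> stage m" "\<gamma> ` fixed_set \<subseteq> fixed_set" for m
    using stage_Suc by (auto simp: stage_def fixed_set_def)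
  obtain R where "free_pair p X \<gamma> {stage (Suc n)} {stage n} R" by (rule fixed_pair[OF sub(2) sub(2) sub(1) inv inv])
  then interpret YB: free_pair p X \<gamma> "{stage (Suc n)}" "{stage n}" R .
  obtain R' where "free_pair p X \<gamma> {stage n} {fixed_set} R'" by (rule fixed_pair[OF sub(2) order_refl sub(2) inv sub(3)])
  then interpret BA: free_pair p X \<gamma> "{stage n}" "{fixed_set}" R' .
  have k: "k > n + 2" using Suc.prems by simp
  have zero: "\<tau> j (\<sigma> j x) = 0" "\<sigma> j (\<tau> j x) = 0" if "x \<in> mod_chains p X A j" for A j x
    using \<tau>_\<sigma> \<sigma>_\<tau> mod_chainsD[OF that] by blast+
  show ?case
  proof
    show "acyclic_at chain_boundary (image_plus (mod_chains p X {stage (Suc n)}) (mod_chains p X {fixed_set}) \<tau>) (mod_chains p X {fixed_set}) k"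
      by (rule image_filtration[OF YB.smith_pair_axioms BA.complex_pair_axioms])
        (use YB.r_D zero Suc.IH[OF k] stage_step[OF k] in auto)
    show "acyclic_at chain_boundary (image_plus (mod_chains p X {stage (Suc n)}) (mod_chains p X {fixed_set}) \<sigma>) (mod_chains p X {fixed_set}) k"
      by (rule image_filtration[OF YB.swap BA.complex_pair_axioms])
        (use YB.r'_D zero Suc.IH[OF k] stage_step[OF k] in auto)
  qed
qed

text \<open>X is \<open>stage (Suc N)\<close>, so N + 3 is the bound n + 2 of
  \<open>stage_acyclic\<close> for n = N + 1.\<close>

lemma high_acyclic:
  assumes dim: "\<And>n. n > N \<Longrightarrow> E n = {}" and k: "k > N + 3"
  shows "acyclic_at chain_boundary (image_plus (mod_chains p X {topspace X}) (mod_chains p X {fixed_set}) \<tau>) (mod_chains p X {fixed_set}) k"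
    and "acyclic_at chain_boundary (image_plus (mod_chains p X {topspace X}) (mod_chains p X {fixed_set}) \<sigma>) (mod_chains p X {fixed_set}) k"
proof -
  have "topspace X \<subseteq> below (Suc N)"
  proof
    fix x assume "x \<in> topspace X"
    then have "x \<in> (\<Union>n. \<Union>(E n))" using cells_cover by simp
    then obtain n e where e: "e \<in> E n" "x \<in> e" by blast
    then have "n \<le> N" using dim[of n] by (metis empty_iff leI)
    then show "x \<in> below (Suc N)" using below_iff[OF e] by simp
  qed
  then have "stage (Suc N) = topspace X"
    using subcomplex_topspace[OF subcomplex_stage[of "Suc N"]] by (auto simp: stage_def)
  then show "acyclic_at chain_boundary (image_plus (mod_chains p X {topspace X}) (mod_chains p X {fixed_set}) \<tau>) (mod_chains p X {fixed_set}) k"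
    "acyclic_at chain_boundary (image_plus (mod_chains p X {topspace X}) (mod_chains p X {fixed_set}) \<sigma>) (mod_chains p X {fixed_set}) k"
    using stage_acyclic[of "Suc N" k] k by simp_all
qed

end

section \<open>Orders of homology groups modulo a prime\<close>

lemma ecard_image_cong:
  assumes "\<And>s t. s \<in> T \<Longrightarrow> t \<in> T \<Longrightarrow> F s = F t \<longleftrightarrow> G s = G t"
  shows "ecard (F ` T) = ecard (G ` T)"
proof (rule ecard_bij)
  show "bij_betw (\<lambda>a. G (inv_into T F a)) (F ` T) (G ` T)"
    unfolding bij_betw_def
  proof
    have inv: "inv_into T F (F t) \<in> T" "F (inv_into T F (F t)) = F t" if "t \<in> T" for t
      using that by (simp_all add: inv_into_into f_inv_into_f)
    have G: "G (inv_into T F (F t)) = G t" if "t \<in> T" for t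
      using assms[OF inv(1)[OF that] that] inv(2)[OF that] by simp
    show "inj_on (\<lambda>a. G (inv_into T F a)) (F ` T)"
      using G assms by (auto intro!: inj_onI)
    show "(\<lambda>a. G (inv_into T F a)) ` F ` T = G ` T"
      using G by (force simp: image_iff)
  qed
qed

lemma mod_chains_empty: "mod_chains p X {{}} = mod_chains p X {}"
proof -
  have "standard_simplex k \<noteq> {}" for k by (metis nonempty_standard_simplex)
  then show ?thesis by (auto simp: mod_chains_def small_def fun_eq_iff)
qed

lemma mod_chains_empty_iff: "c \<in> mod_chains p X {} k \<longleftrightarrow> singular_chain k X c \<and> (\<forall>f. int p dvd lookup c f)"
  by (simp add: mod_chains_def small_def)

lemma mod_chains_topspace_iff: "c \<in> mod_chains p X {topspace X} k \<longleftrightarrow> singular_chain k X c"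
  using singular_chain_in_mod_chains[of k X "topspace X" c p] mod_chainsD by auto

text \<open>The tensor term of the universal coefficient theorem: the multiples of g by 0, ..., p -
  1 represent the classes. If m g bounds modulo p, then m g - p w bounds integrally for a relative
  cycle w. As w is homologous to some multiple j g, freeness gives m = p j.\<close>

lemma cyclic_mod_order:
  assumes p: "p > 0" and YY': "Y \<subseteq> Y'"
    and torsion_free: "\<And>e. k > 0 \<Longrightarrow> singular_relcycle (k - 1) (subtopology X Y') Y e \<Longrightarrow>
           singular_relboundary (k - 1) (subtopology X Y') Y (frag_cmul (int p) e) \<Longrightarrow>
           singular_relboundary (k - 1) (subtopology X Y') Y e"
    and g: "singular_relcycle k (subtopology X Y') Y g"
    and gen: "\<And>b. singular_relcycle k (subtopology X Y') Y b \<Longrightarrow>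
           \<exists>m. singular_relboundary k (subtopology X Y') Y (b - frag_cmul m g)"
    and free: "\<And>m. singular_relboundary k (subtopology X Y') Y (frag_cmul m g) \<Longrightarrow> m = 0"
  shows "homology_order chain_boundary (mod_chains p X {Y'}) (mod_chains p X {Y}) k = enat p"
proof -
  let ?Z = "subtopology X Y'" and ?S = "subtopology (subtopology X Y') Y"
  let ?C = "mod_chains p X {Y'}" and ?D = "mod_chains p X {Y}"
  have S: "?S = subtopology X Y" using YY' by (simp add: subtopology_subtopology Int_absorb1)
  interpret complex_pair chain_boundary ?C ?D
    by (rule mod_chains_pair) (use YY' in \<open>auto simp: small_singleton\<close>)
  let ?T = "rel_cycles chain_boundary ?C ?D k" and ?B = "rel_boundaries chain_boundary ?C ?D k"
  have rel: "c \<in> ?T" if "singular_relcycle k ?Z Y c" for c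
    using that S by (auto simp: rel_cycles_def singular_relcycle intro: singular_chain_in_mod_chains)
  have relb: "c + frag_cmul (int p) w \<in> ?B" if c: "singular_relboundary k ?Z Y c" and w: "singular_chain k X w" for c w
  proof -
    obtain y d where yd: "singular_chain (Suc k) ?Z y" "singular_chain k ?S d" "chain_boundary (Suc k) y + d = c"
      using c unfolding singular_relboundary by blast
    have "c + frag_cmul (int p) w - chain_boundary (Suc k) y = d + frag_cmul (int p) w"
      by (simp flip: yd(3))
    moreover have "d + frag_cmul (int p) w \<in> ?D k"
      using yd(2) S by (intro D_simps cmul_mod_chains w singular_chain_in_mod_chains) simp
    ultimately have "c + frag_cmul (int p) w - chain_boundary (Suc k) y \<in> ?D k" by (simp only:)
    then show ?thesis unfolding rel_boundaries_def using singular_chain_in_mod_chains[OF yd(1)] by blast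
  qed
  \<comment> \<open>The auxiliary m' allows differences i - j of either sign, with m their absolute
    value.\<close>
  have mult: "m = 0" if mm: "0 \<le> m" "m < int p" "frag_cmul m' g \<in> ?B" "m' = m \<or> m' = - m" for m m'
  proof -
    obtain y where y: "y \<in> ?C (Suc k)" "frag_cmul m' g - chain_boundary (Suc k) y \<in> ?D k"
      using mm(3) unfolding rel_boundaries_def by blast
    obtain a e where ae: "y = a + frag_cmul (int p) e" "singular_chain (Suc k) X a" "singular_chain (Suc k) X e"
        "\<And>f. f \<in> keys a \<Longrightarrow> small (Suc k) {Y'} f"
      using mod_chains_split[OF y(1)] by metis
    obtain u v where uv: "frag_cmul m' g - chain_boundary (Suc k) y = u + frag_cmul (int p) v"
        "singular_chain k X u" "singular_chain k X v" "\<And>f. f \<in> keys u \<Longrightarrow> small k {Y} f"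
      using mod_chains_split[OF y(2)] by metis
    define w where "w = v + chain_boundary (Suc k) e"
    have aZ: "singular_chain (Suc k) ?Z a" using ae by (auto simp: singular_chain_subtopology small_singleton)
    have uS: "singular_chain k (subtopology X Y) u" using uv by (auto simp: singular_chain_subtopology small_singleton)
    then have uZ: "singular_chain k ?Z u" using YY' by (auto simp: singular_chain_subtopology)
    have gZ: "singular_chain k ?Z g" "singular_chain (k - 1) ?S (chain_boundary k g)"
      using g by (auto simp: singular_relcycle)
    have eq: "frag_cmul (int p) w = frag_cmul m' g - chain_boundary (Suc k) a - u"
    proof -
      have "chain_boundary (Suc k) y = chain_boundary (Suc k) a + frag_cmul (int p) (chain_boundary (Suc k) e)"
        by (simp add: ae(1) chain_boundary_add chain_boundary_cmul)
      then have "frag_cmul m' g = u + frag_cmul (int p) v + (chain_boundary (Suc k) a + frag_cmul (int p) (chain_boundary (Suc k) e))"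
        using uv(1) by (simp add: algebra_simps)
      then show ?thesis by (simp add: w_def frag_cmul_distrib2)
    qed
    \<comment> \<open>The chains w and p w have the same support, and so have their boundaries;
      hence w is a relative cycle because p w is one.\<close>
    have "singular_chain k ?Z (chain_boundary (Suc k) a)" using singular_chain_boundary[OF aZ] by simp
    then have "singular_chain k ?Z (frag_cmul (int p) w)"
      unfolding eq using gZ uZ by (intro singular_chain_diff singular_chain_cmul)
    then have wZ: "singular_chain k ?Z w" using keys_cmul_eq[of "int p" w] p by (simp add: singular_chain_def)
    have "chain_boundary k (chain_boundary (Suc k) a) = 0" using chain_boundary_boundary_Suc ae(2) by blast
    then have "frag_cmul (int p) (chain_boundary k w) = frag_cmul m' (chain_boundary k g) - chain_boundary k u"
      using arg_cong[OF eq, of "chain_boundary k"] by (simp add: chain_boundary_diff chain_boundary_cmul)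
    moreover have "singular_chain (k - 1) ?S (chain_boundary k u)" using singular_chain_boundary uS S by auto
    ultimately have "singular_chain (k - 1) ?S (frag_cmul (int p) (chain_boundary k w))"
      using gZ by (simp add: singular_chain_diff singular_chain_cmul)
    then have "singular_chain (k - 1) ?S (chain_boundary k w)"
      using keys_cmul_eq[of "int p" "chain_boundary k w"] p by (simp add: singular_chain_def)
    then have "singular_relcycle k ?Z Y w" using wZ by (simp add: singular_relcycle)
    then obtain j where j: "singular_relboundary k ?Z Y (w - frag_cmul j g)" using gen by blast
    have "singular_relboundary k ?Z Y (frag_cmul m' g - frag_cmul (int p) w)"
    proof -
      have "chain_boundary (Suc k) a + u = frag_cmul m' g - frag_cmul (int p) w" by (simp add: eq)
      then show ?thesis unfolding singular_relboundary using aZ uS S by metis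
    qed
    moreover have "singular_relboundary k ?Z Y (frag_cmul (int p) (w - frag_cmul j g))"
      using j by (rule singular_relboundary_cmul)
    ultimately have "singular_relboundary k ?Z Y
        (frag_cmul m' g - frag_cmul (int p) w + frag_cmul (int p) (w - frag_cmul j g))"
      by (rule singular_relboundary_add)
    moreover have "frag_cmul m' g - frag_cmul (int p) w + frag_cmul (int p) (w - frag_cmul j g) = frag_cmul (m' - int p * j) g"
      by (rule poly_mapping_eqI) (simp add: lookup_add lookup_minus algebra_simps)
    ultimately have "singular_relboundary k ?Z Y (frag_cmul (m' - int p * j) g)" by (simp only:)
    then have "m' = int p * j" using free by fastforce
    then have "int p dvd m" using mm(4) by (metis dvd_minus_iff dvd_triv_left)
    then show ?thesis using mm(1,2) zdvd_not_zless[of m "int p"] by linarith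
  qed
  have "ab_coset ?B ` ?T = (\<lambda>m. ab_coset ?B (frag_cmul (int m) g)) ` {..<p}"
  proof (intro subset_antisym subsetI)
    fix z assume "z \<in> ab_coset ?B ` ?T"
    then obtain c where c: "c \<in> ?T" "z = ab_coset ?B c" by blast
    then have c': "c \<in> ?C k" "chain_boundary k c \<in> ?D (k - 1)" by (auto simp: rel_cycles_def)
    obtain b w where b: "singular_relcycle k ?Z Y b" "singular_chain k X w" "c = b + frag_cmul (int p) w"
    proof (rule lift_mod_cycle[OF p YY' _ c'])
      show "singular_relboundary (k - 1) ?Z Y e" if "k > 0" "singular_relcycle (k - 1) ?Z Y e"
        "singular_relboundary (k - 1) ?Z Y (frag_cmul (int p) e)" for e
        using that by (rule torsion_free)
    qed
    obtain m where m: "singular_relboundary k ?Z Y (b - frag_cmul m g)" using gen[OF b(1)] by blast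
    have gX: "singular_chain k X g" using g by (auto simp: singular_relcycle singular_chain_subtopology)
    have "c - frag_cmul (m mod int p) g = (b - frag_cmul m g) + frag_cmul (int p) (w + frag_cmul (m div int p) g)"
    proof (rule poly_mapping_eqI)
      fix f
      have "m * lookup g f = int p * (m div int p) * lookup g f + m mod int p * lookup g f"
        by (metis distrib_right mult_div_mod_eq)
      then show "lookup (c - frag_cmul (m mod int p) g) f =
          lookup ((b - frag_cmul m g) + frag_cmul (int p) (w + frag_cmul (m div int p) g)) f"
        by (simp add: b(3) lookup_add lookup_minus algebra_simps)
    qed
    then have "c - frag_cmul (m mod int p) g \<in> ?B"
      using relb[OF m, of "w + frag_cmul (m div int p) g"] b(2) gX by (simp add: singular_chain_add singular_chain_cmul)
    then have "z = ab_coset ?B (frag_cmul (int (nat (m mod int p))) g)"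
      using p c(2) by (simp add: ab_coset_eq_iff[OF sub_rel_boundaries])
    moreover have "nat (m mod int p) < p" using p by (simp add: nat_less_iff)
    ultimately show "z \<in> (\<lambda>m. ab_coset ?B (frag_cmul (int m) g)) ` {..<p}" by blast
  next
    fix z assume "z \<in> (\<lambda>m. ab_coset ?B (frag_cmul (int m) g)) ` {..<p}"
    then obtain m where "z = ab_coset ?B (frag_cmul (int m) g)" by blast
    moreover have "frag_cmul (int m) g \<in> ?T" using g by (intro rel singular_relcycle_cmul)
    ultimately show "z \<in> ab_coset ?B ` ?T" by blast
  qed
  moreover have "inj_on (\<lambda>m. ab_coset ?B (frag_cmul (int m) g)) {..<p}"
  proof (rule inj_onI)
    fix i j assume ij: "i \<in> {..<p}" "j \<in> {..<p}" "ab_coset ?B (frag_cmul (int i) g) = ab_coset ?B (frag_cmul (int j) g)"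
    then have "frag_cmul (int i) g - frag_cmul (int j) g \<in> ?B" by (simp add: ab_coset_eq_iff[OF sub_rel_boundaries])
    moreover have "frag_cmul (int i) g - frag_cmul (int j) g = frag_cmul (int i - int j) g"
      by (rule poly_mapping_eqI) (simp add: lookup_minus algebra_simps)
    ultimately have "frag_cmul (int i - int j) g \<in> ?B" by (simp only:)
    then have "\<bar>int i - int j\<bar> = 0" using ij(1,2) by (intro mult[of _ "int i - int j"]) auto
    then show "i = j" by simp
  qed
  ultimately show ?thesis
    by (simp add: homology_order_def quotient_order_def ecard_def card_image)
qed


lemma mult_homologous_rel_set:
  "homologous_rel_set k X S a \<otimes>\<^bsub>relative_homology_group (int k) X S\<^esub> homologous_rel_set k X S b
    = homologous_rel_set k X S (a + b)"
  unfolding mult_relative_homology_group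
proof (intro subset_antisym subsetI)
  fix x assume "x \<in> (\<Union>r\<in>homologous_rel_set k X S a. \<Union>s\<in>homologous_rel_set k X S b. {r + s})"
  then obtain r s where rs: "singular_relboundary k X S (a - r)" "singular_relboundary k X S (b - s)" "x = r + s"
    by (auto simp: homologous_rel_def)
  have "(a - r) + (b - s) = a + b - x" using rs(3) by simp
  then have "singular_relboundary k X S (a + b - x)" using singular_relboundary_add[OF rs(1,2)] by (simp only:)
  then show "x \<in> homologous_rel_set k X S (a + b)" by (simp add: homologous_rel_def)
next
  fix x assume "x \<in> homologous_rel_set k X S (a + b)"
  then have "singular_relboundary k X S (a + b - x)" by (simp add: homologous_rel_def)
  moreover have "a + b - x = b - (x - a)" by simp
  ultimately have "singular_relboundary k X S (b - (x - a))" by (simp only:)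
  then have "a \<in> homologous_rel_set k X S a" "x - a \<in> homologous_rel_set k X S b" "x = a + (x - a)"
    by (auto simp: homologous_rel_def)
  then show "x \<in> (\<Union>r\<in>homologous_rel_set k X S a. \<Union>s\<in>homologous_rel_set k X S b. {r + s})" by blast
qed

text \<open>Translates the isomorphism with the integers to chains, as
  \<open>cyclic_mod_order\<close> needs it: g is a cycle whose class is sent to 1.\<close>

lemma infinite_cyclic_relcycle:
  assumes "relative_homology_group (int k) X S \<cong> integer_group"
  obtains g where "singular_relcycle k X S g"
    "\<And>b. singular_relcycle k X S b \<Longrightarrow> \<exists>m. singular_relboundary k X S (b - frag_cmul m g)"
    "\<And>m. singular_relboundary k X S (frag_cmul m g) \<Longrightarrow> m = 0"
proof -
  let ?G = "relative_homology_group (int k) X S"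
  obtain h where h: "h \<in> iso ?G integer_group" using assms by (auto simp: is_iso_def)
  define \<psi> where "\<psi> b = h (homologous_rel_set k X S b)" for b
  have inj: "inj_on h (carrier ?G)" and surj: "h ` carrier ?G = UNIV" using h by (auto simp: iso_def bij_betw_def)
  have carr: "homologous_rel_set k X S b \<in> carrier ?G" if "singular_relcycle k X S b" for b
    using that by (simp add: carrier_relative_homology_group)
  have add: "\<psi> (a + b) = \<psi> a + \<psi> b" if "singular_relcycle k X S a" "singular_relcycle k X S b" for a b
    using hom_mult[of h ?G integer_group, OF _ carr[OF that(1)] carr[OF that(2)]] h
    by (simp add: iso_def \<psi>_def mult_homologous_rel_set)
  have diff: "\<psi> (a - b) = \<psi> a - \<psi> b" if "singular_relcycle k X S a" "singular_relcycle k X S b" for a b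
    using add[OF singular_relcycle_diff[OF that] that(2)] by simp
  have zero: "\<psi> 0 = 0" using diff[of 0 0] by simp
  have zero_iff: "\<psi> b = 0 \<longleftrightarrow> singular_relboundary k X S b" if b: "singular_relcycle k X S b" for b
  proof -
    have "\<psi> b = \<psi> 0 \<longleftrightarrow> homologous_rel_set k X S b = homologous_rel_set k X S 0"
      unfolding \<psi>_def using inj_on_eq_iff[OF inj carr[OF b] carr[of 0]] by simp
    moreover have "homologous_rel_set k X S (0::'a chain) = singular_relboundary_set k X S"
      by (simp add: homologous_rel_set_eq_relboundary)
    ultimately show ?thesis by (simp add: zero homologous_rel_set_eq_relboundary)
  qed
  obtain g where g: "singular_relcycle k X S g" "\<psi> g = 1"
  proof -
    have "1 \<in> h ` carrier ?G" using surj by simp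
    then show ?thesis using that by (auto simp: carrier_relative_homology_group \<psi>_def)
  qed
  have cmul: "\<psi> (frag_cmul m g) = m" for m
  proof (induction m rule: int_induct[where k = 0])
    case (step1 i)
    have "frag_cmul (i + 1) g = frag_cmul i g + g" by (simp add: frag_cmul_distrib)
    then show ?case using add[OF singular_relcycle_cmul[OF g(1)] g(1)] step1 g(2) by simp
  next
    case (step2 i)
    have "frag_cmul (i - 1) g = frag_cmul i g - g" by (rule poly_mapping_eqI) (simp add: lookup_minus algebra_simps)
    then show ?case using diff[OF singular_relcycle_cmul[OF g(1)] g(1)] step2 g(2) by simp
  qed (simp add: zero)
  show thesis
  proof (rule that[OF g(1)])
    show "\<exists>m. singular_relboundary k X S (b - frag_cmul m g)" if b: "singular_relcycle k X S b" for b
    proof -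
      have "\<psi> (b - frag_cmul (\<psi> b) g) = 0" using diff[OF b singular_relcycle_cmul[OF g(1)]] by (simp add: cmul)
      then show ?thesis using zero_iff[OF singular_relcycle_diff[OF b singular_relcycle_cmul[OF g(1)]]] by blast
    qed
    show "m = 0" if "singular_relboundary k X S (frag_cmul m g)" for m
      using that zero_iff[OF singular_relcycle_cmul[OF g(1)], of m] cmul by simp
  qed
qed

text \<open>Integral homology that is infinite cyclic or zero in each degree is torsion-free, so
  both parts of the universal coefficient argument apply. This covers a point, and a sphere relative
  to a point.\<close>

lemma mod_order_from_integral:
  assumes p: "p > 0" and YY': "Y \<subseteq> Y'"
    and G: "\<And>k. if k \<in> K then relative_homology_group (int k) (subtopology X Y') Y \<cong> integer_group
             else trivial_group (relative_homology_group (int k) (subtopology X Y') Y)"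
  shows "homology_order chain_boundary (mod_chains p X {Y'}) (mod_chains p X {Y}) k = (if k \<in> K then enat p else 1)"
proof -
  let ?Z = "subtopology X Y'"
  interpret complex_pair chain_boundary "mod_chains p X {Y'}" "mod_chains p X {Y}"
    by (rule mod_chains_pair) (use YY' in \<open>auto simp: small_singleton\<close>)
  have torsion_free: "singular_relboundary j ?Z Y e"
    if e: "singular_relcycle j ?Z Y e" "singular_relboundary j ?Z Y (frag_cmul (int p) e)" for j e
  proof (cases "j \<in> K")
    case True
    then have "relative_homology_group (int j) ?Z Y \<cong> integer_group" using G[of j] by simp
    then obtain g where g: "singular_relcycle j ?Z Y g"
      "\<And>b. singular_relcycle j ?Z Y b \<Longrightarrow> \<exists>m. singular_relboundary j ?Z Y (b - frag_cmul m g)"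
      "\<And>m. singular_relboundary j ?Z Y (frag_cmul m g) \<Longrightarrow> m = 0"
      using infinite_cyclic_relcycle by metis
    obtain m where m: "singular_relboundary j ?Z Y (e - frag_cmul m g)" using g(2)[OF e(1)] by blast
    have "singular_relboundary j ?Z Y (frag_cmul (int p) e - frag_cmul (int p) (e - frag_cmul m g))"
      by (intro singular_relboundary_diff e(2) singular_relboundary_cmul m)
    moreover have "frag_cmul (int p) e - frag_cmul (int p) (e - frag_cmul m g) = frag_cmul (int p * m) g"
      by (rule poly_mapping_eqI) (simp add: lookup_minus algebra_simps)
    ultimately have "singular_relboundary j ?Z Y (frag_cmul (int p * m) g)" by (simp only:)
    then have "int p * m = 0" by (rule g(3))
    then have "m = 0" using p by simp
    then show ?thesis using m by simp
  next
    case False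
    then show ?thesis using G[of j] trivial_relative_homology_imp_relboundary[OF _ e(1)] by simp
  qed
  show ?thesis
  proof (cases "k \<in> K")
    case True
    then have "relative_homology_group (int k) ?Z Y \<cong> integer_group" using G[of k] by simp
    then obtain g where g: "singular_relcycle k ?Z Y g"
      "\<And>b. singular_relcycle k ?Z Y b \<Longrightarrow> \<exists>m. singular_relboundary k ?Z Y (b - frag_cmul m g)"
      "\<And>m. singular_relboundary k ?Z Y (frag_cmul m g) \<Longrightarrow> m = 0"
      using infinite_cyclic_relcycle by metis
    have "homology_order chain_boundary (mod_chains p X {Y'}) (mod_chains p X {Y}) k = enat p"
      by (rule cyclic_mod_order[OF p YY' _ g(1)]) (use torsion_free g(2,3) in auto)
    then show ?thesis using True by simp
  next
    case False
    then have triv: "trivial_group (relative_homology_group (int k) ?Z Y)" using G[of k] by simp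
    have "acyclic_at chain_boundary (mod_chains p X {Y'}) (mod_chains p X {Y}) k"
      by (rule acyclic_mod_from_integral[OF p YY'])
        (use torsion_free trivial_relative_homology_imp_relboundary[OF triv] in auto)
    then show ?thesis using False by (simp add: homology_order_eq_1_iff)
  qed
qed

section \<open>Homology of subspaces, points and spheres modulo p\<close>

definition mod_homology_order :: "nat \<Rightarrow> 'a topology \<Rightarrow> nat \<Rightarrow> enat"
  where "mod_homology_order p X k =
    homology_order chain_boundary (mod_chains p X {topspace X}) (mod_chains p X {}) k"

text \<open>A member of \<open>mod_chains p X {Y}\<close> may still contain multiples of p on
  simplices outside Y. Cutting these off changes it only by a multiple of p and gives a chain of the
  subspace.\<close>

lemma subtopology_mod_order:
  assumes Y: "Y \<subseteq> topspace X"
  shows "homology_order chain_boundary (mod_chains p X {Y}) (mod_chains p X {}) k = mod_homology_order p (subtopology X Y) k"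
proof -
  let ?Z = "subtopology X Y"
  have top: "topspace ?Z = Y" using Y by auto
  interpret X: complex_pair chain_boundary "mod_chains p X {Y}" "mod_chains p X {}"
    by (rule mod_chains_pair) (auto simp: small_def)
  interpret Z: complex_pair chain_boundary "mod_chains p ?Z {topspace ?Z}" "mod_chains p ?Z {}"
    by (rule mod_chains_pair) (auto simp: small_def)
  have sub: "singular_chain j ?Z c \<Longrightarrow> singular_chain j X c" for j c by (simp add: singular_chain_subtopology)
  have Z_iff: "singular_chain j ?Z c \<longleftrightarrow> singular_chain j X c \<and> (\<forall>f\<in>keys c. small j {Y} f)" for j c
    by (auto simp: singular_chain_subtopology small_singleton)
  let ?s = "\<lambda>j c. frag_restrict (Collect (small j {Y})) c"
  have s: "singular_chain j ?Z (?s j c)" "c - ?s j c \<in> mod_chains p X {} j" if c: "c \<in> mod_chains p X {Y} j" for j c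
  proof -
    show "singular_chain j ?Z (?s j c)"
      unfolding Z_iff using mod_chainsD[OF c] by (auto simp: keys_frag_restrict singular_chain_def)
    then have "singular_chain j X (c - ?s j c)" using mod_chainsD[OF c] sub by (intro singular_chain_diff) auto
    then show "c - ?s j c \<in> mod_chains p X {} j"
      using c by (auto simp: mod_chains_empty_iff lookup_minus lookup_frag_restrict mod_chains_def)
  qed
  have Z_P: "c \<in> mod_chains p ?Z {} j \<longleftrightarrow> singular_chain j ?Z c \<and> c \<in> mod_chains p X {} j" for j c
    using sub by (auto simp: mod_chains_empty_iff)
  have Z_top: "c \<in> mod_chains p ?Z {topspace X \<inter> Y} j \<longleftrightarrow> singular_chain j ?Z c" for c j
    using mod_chains_topspace_iff[of c p ?Z j] by simp
  have Z_C: "singular_chain j ?Z c \<Longrightarrow> c \<in> mod_chains p X {Y} j" for j c by (rule singular_chain_in_mod_chains)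
  have bdZ: "singular_chain (j - 1) ?Z (chain_boundary j c)" if "singular_chain j ?Z c" for j c
    using singular_chain_boundary[OF that] by simp
  show ?thesis
  proof (rule order_antisym)
    show "mod_homology_order p ?Z k \<le> homology_order chain_boundary (mod_chains p X {Y}) (mod_chains p X {}) k"
      unfolding mod_homology_order_def homology_order_def
    proof (rule quotient_order_le[OF Z.sub_rel_boundaries X.sub_rel_boundaries, where f = id])
      show "id t \<in> rel_cycles chain_boundary (mod_chains p X {Y}) (mod_chains p X {}) k"
        if "t \<in> rel_cycles chain_boundary (mod_chains p ?Z {topspace ?Z}) (mod_chains p ?Z {}) k" for t
        using that Z_C mod_chainsD[of t p ?Z] by (auto simp: rel_cycles_def Z_P)
      fix s t assume st: "s \<in> rel_cycles chain_boundary (mod_chains p ?Z {topspace ?Z}) (mod_chains p ?Z {}) k"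
        "t \<in> rel_cycles chain_boundary (mod_chains p ?Z {topspace ?Z}) (mod_chains p ?Z {}) k"
        "id s - id t \<in> rel_boundaries chain_boundary (mod_chains p X {Y}) (mod_chains p X {}) k"
      then obtain y where y: "y \<in> mod_chains p X {Y} (Suc k)" "s - t - chain_boundary (Suc k) y \<in> mod_chains p X {} k"
        unfolding rel_boundaries_def by auto
      let ?y = "?s (Suc k) y"
      have "chain_boundary (Suc k) (y - ?y) \<in> mod_chains p X {} k"
        using X.bd_Suc_D[OF s(2)[OF y(1)]] .
      then have "(s - t - chain_boundary (Suc k) y) + chain_boundary (Suc k) (y - ?y) \<in> mod_chains p X {} k"
        using y(2) X.D_simps(3) by blast
      then have "s - t - chain_boundary (Suc k) ?y \<in> mod_chains p X {} k"
        by (simp add: chain_boundary_diff)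
      moreover have "singular_chain k ?Z (s - t - chain_boundary (Suc k) ?y)"
        using st(1,2) bdZ[OF s(1)[OF y(1)]] mod_chainsD[of _ p ?Z] by (intro singular_chain_diff) (auto simp: rel_cycles_def)
      ultimately have "s - t - chain_boundary (Suc k) ?y \<in> mod_chains p ?Z {} k" using Z_P by blast
      moreover have "?y \<in> mod_chains p ?Z {topspace ?Z} (Suc k)"
        using s(1)[OF y(1)] by (simp only: mod_chains_topspace_iff)
      ultimately show "s - t \<in> rel_boundaries chain_boundary (mod_chains p ?Z {topspace ?Z}) (mod_chains p ?Z {}) k"
        unfolding rel_boundaries_def by blast
    qed
  next
    show "homology_order chain_boundary (mod_chains p X {Y}) (mod_chains p X {}) k \<le> mod_homology_order p ?Z k"
      unfolding mod_homology_order_def homology_order_def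
    proof (rule quotient_order_le[OF X.sub_rel_boundaries Z.sub_rel_boundaries, where f = "?s k"])
      fix t assume t: "t \<in> rel_cycles chain_boundary (mod_chains p X {Y}) (mod_chains p X {}) k"
      then have t': "t \<in> mod_chains p X {Y} k" "chain_boundary k t \<in> mod_chains p X {} (k - 1)"
        by (auto simp: rel_cycles_def)
      have "chain_boundary k t - chain_boundary k (t - ?s k t) \<in> mod_chains p X {} (k - 1)"
        using t'(2) X.bd_D[OF s(2)[OF t'(1)]] by (intro X.D_simps)
      then have "chain_boundary k (?s k t) \<in> mod_chains p X {} (k - 1)" by (simp add: chain_boundary_diff)
      then show "?s k t \<in> rel_cycles chain_boundary (mod_chains p ?Z {topspace ?Z}) (mod_chains p ?Z {}) k"
        using s(1)[OF t'(1)] bdZ by (simp add: rel_cycles_def Z_top Z_P)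
    next
      fix u v assume uv: "u \<in> rel_cycles chain_boundary (mod_chains p X {Y}) (mod_chains p X {}) k"
        "v \<in> rel_cycles chain_boundary (mod_chains p X {Y}) (mod_chains p X {}) k"
        "?s k u - ?s k v \<in> rel_boundaries chain_boundary (mod_chains p ?Z {topspace ?Z}) (mod_chains p ?Z {}) k"
      then obtain y where y: "singular_chain (Suc k) ?Z y" "?s k u - ?s k v - chain_boundary (Suc k) y \<in> mod_chains p X {} k"
        unfolding rel_boundaries_def by (auto simp: Z_top Z_P)
      have uvC: "u \<in> mod_chains p X {Y} k" "v \<in> mod_chains p X {Y} k" using uv by (auto simp: rel_cycles_def)
      have "(?s k u - ?s k v - chain_boundary (Suc k) y) + (u - ?s k u) - (v - ?s k v) \<in> mod_chains p X {} k"
        by (rule X.D_simps(2)[OF X.D_simps(3)[OF y(2) s(2)[OF uvC(1)]] s(2)[OF uvC(2)]])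
      then have "u - v - chain_boundary (Suc k) y \<in> mod_chains p X {} k" by (simp add: algebra_simps)
      then show "u - v \<in> rel_boundaries chain_boundary (mod_chains p X {Y}) (mod_chains p X {}) k"
        unfolding rel_boundaries_def using Z_C[OF y(1)] by blast
    qed
  qed
qed

lemma point_mod_order:
  assumes p: "p > 0" and a: "a \<in> topspace X"
  shows "homology_order chain_boundary (mod_chains p X {{a}}) (mod_chains p X {}) k = (if k = 0 then enat p else 1)"
proof -
  have top: "topspace (subtopology X {a}) = {a}" using a by auto
  have "if k \<in> {0} then homology_group (int k) (subtopology X {a}) \<cong> integer_group
          else trivial_group (homology_group (int k) (subtopology X {a}))" for k
    using homology_coefficients[OF top] homology_dimension_axiom[OF top, of "int k"] by auto
  from mod_order_from_integral[OF p _ this, of k] show ?thesis by (simp add: mod_chains_empty)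
qed

text \<open>The constant map to \<open>a\<close> splits off the homology of a point.\<close>

lemma mod_order_point_pair:
  assumes a: "a \<in> topspace X" "a \<in> Y" and p: "p > 0"
  shows "homology_order chain_boundary (mod_chains p X {Y}) (mod_chains p X {}) k = (if k = 0 then enat p else 1) *
    homology_order chain_boundary (mod_chains p X {Y}) (mod_chains p X {{a}}) k"
proof -
  let ?C = "mod_chains p X {Y}" and ?D = "mod_chains p X {{a}}" and ?P = "mod_chains p X {}"
  have cont: "continuous_map X X (\<lambda>_. a)" using a by simp
  let ?c = "\<lambda>j. chain_map j (\<lambda>_. a)"
  have fix_c: "c - ?c j c \<in> ?P j" if c: "c \<in> ?D j" for c j
  proof -
    obtain u v where uv: "c = u + frag_cmul (int p) v" "singular_chain j X u" "singular_chain j X v"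
        "\<And>f. f \<in> keys u \<Longrightarrow> small j {{a}} f"
      using mod_chains_split[OF c] by metis
    have "singular_chain j (subtopology X {a}) u" using uv by (auto simp: singular_chain_subtopology small_singleton)
    then have "?c j u = u" by (rule chain_map_id_gen) auto
    then have "c - ?c j c = frag_cmul (int p) (v - ?c j v)"
      by (intro poly_mapping_eqI)
        (simp add: uv(1) chain_map_add chain_map_cmul lookup_add lookup_minus algebra_simps)
    moreover have "singular_chain j X (v - ?c j v)"
      using uv(3) singular_chain_chain_map[OF _ cont] by (intro singular_chain_diff) auto
    ultimately show ?thesis using cmul_mod_chains by metis
  qed
  have c_P: "?c j c \<in> ?P j" if c: "c \<in> ?P j" for c j
  proof -
    have "\<And>f. int p dvd lookup c f" and s: "singular_chain j X c" using c by (auto simp: mod_chains_empty_iff)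
    then obtain e where e: "c = frag_cmul (int p) e" "keys e \<subseteq> keys c" using frag_cmul_exists by metis
    then have "singular_chain j X e" using s by (auto simp: singular_chain_def)
    then show ?thesis using e(1) cmul_mod_chains[OF singular_chain_chain_map[OF _ cont]] by (simp add: chain_map_cmul)
  qed
  have c_D: "?c j c \<in> ?D j" if c: "singular_chain j X c" for c j
  proof -
    have "continuous_map X (subtopology X {a}) (\<lambda>_. a)" using a by (simp add: continuous_map_in_subtopology)
    then show ?thesis using singular_chain_chain_map[OF c] singular_chain_in_mod_chains by blast
  qed
  interpret CD: complex_pair chain_boundary ?C ?D by (rule mod_chains_pair) (use a in \<open>auto simp: small_singleton\<close>)
  interpret DP: complex_pair chain_boundary ?D ?P by (rule mod_chains_pair) (auto simp: small_def)
  interpret CP: complex_pair chain_boundary ?C ?P by (rule mod_chains_pair) (auto simp: small_def)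
  \<comment> \<open>The constant map induces a retraction of C onto D up to P. Applied to the
    bounding chain in C, it produces one in D.\<close>
  have inj: "x \<in> rel_boundaries chain_boundary ?D ?P j"
    if x: "x \<in> rel_cycles chain_boundary ?D ?P j" "x \<in> rel_boundaries chain_boundary ?C ?P j" for x j
  proof -
    obtain y where y: "y \<in> ?C (Suc j)" "x - chain_boundary (Suc j) y \<in> ?P j"
      using x(2) unfolding rel_boundaries_def by blast
    have sy: "singular_chain (Suc j) X y" using y(1) mod_chainsD by blast
    have "?c j (x - chain_boundary (Suc j) y) = ?c j x - chain_boundary (Suc j) (?c (Suc j) y)"
      using chain_boundary_chain_map[OF sy, of "\<lambda>_. a"] by (simp add: chain_map_diff)
    then have "?c j x - chain_boundary (Suc j) (?c (Suc j) y) \<in> ?P j" using c_P[OF y(2)] by simp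
    moreover have "x - ?c j x \<in> ?P j" using x(1) fix_c by (auto simp: rel_cycles_def)
    ultimately have "(x - ?c j x) + (?c j x - chain_boundary (Suc j) (?c (Suc j) y)) \<in> ?P j"
      using DP.D_simps(3) by blast
    then have "x - chain_boundary (Suc j) (?c (Suc j) y) \<in> ?P j" by simp
    then show ?thesis unfolding rel_boundaries_def using c_D[OF sy] by blast
  qed
  have "homology_order chain_boundary ?C ?P k = homology_order chain_boundary ?D ?P k * homology_order chain_boundary ?C ?D k"
    by (rule homology_order_triple[OF CD.complex_pair_axioms DP.complex_pair_axioms CP.complex_pair_axioms inj inj])
  then show ?thesis by (simp add: point_mod_order[OF p a(1)])
qed

lemma mod_homology_order_point:
  assumes "p > 0"
  shows "mod_homology_order p point_space k = (if k = 0 then enat p else 1)"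
  using point_mod_order[OF assms, of "()" point_space k]
  by (simp add: mod_homology_order_def point_space_def UNIV_unit[symmetric])

text \<open>The first factor comes from a base point, the second from the sphere relative to it. The
  product form also covers n = 0, where degree 0 has order p^2.\<close>

lemma mod_homology_order_nsphere:
  assumes p: "p > 0"
  shows "mod_homology_order p (nsphere n) k = (if k = 0 then enat p else 1) * (if k = n then enat p else 1)"
proof -
  obtain a where a: "a \<in> topspace (nsphere n)"
    using nonempty_nsphere[of n] by (metis all_not_in_conv null_topspace_iff_trivial)
  have iso: "relative_homology_group (int k) (nsphere n) {a} \<cong> reduced_homology_group (int k) (nsphere n)" for k
    by (rule isomorphic_relative_homology_by_singleton[OF a])
  have "if k \<in> {n} then relative_homology_group (int k) (subtopology (nsphere n) (topspace (nsphere n))) {a} \<cong> integer_group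
          else trivial_group (relative_homology_group (int k) (subtopology (nsphere n) (topspace (nsphere n))) {a})" for k
  proof (cases "k = n")
    case True
    then show ?thesis using iso_trans[OF iso[of n] reduced_homology_group_nsphere(1)] by simp
  next
    case False
    then have "trivial_group (reduced_homology_group (int k) (nsphere n))" using reduced_homology_group_nsphere(2) by simp
    then have "trivial_group (relative_homology_group (int k) (nsphere n) {a})"
      using isomorphic_group_triviality[OF iso[of k]] by simp
    then show ?thesis using False by simp
  qed
  from mod_order_from_integral[OF p _ this, of k] a
  have "homology_order chain_boundary (mod_chains p (nsphere n) {topspace (nsphere n)}) (mod_chains p (nsphere n) {{a}}) k
    = (if k = n then enat p else 1)" by simp
  then show ?thesis using mod_order_point_pair[OF a a p, of k] by (simp add: mod_homology_order_def)
qed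

section \<open>Homology with coefficients in a cyclic group\<close>

text \<open>Linear independence over the field with p elements, in the language of groups: since p
  is prime, the cyclic group generated by x meets the image of h trivially when x is outside
  it.\<close>

lemma (in comm_group) cyclic_extension:
  assumes p: "prime p" and exp: "\<And>x. x \<in> carrier G \<Longrightarrow> x [^] p = \<one>"
    and K: "group K" and h: "h \<in> hom K G" "inj_on h (carrier K)"
    and x: "x \<in> carrier G" "x \<notin> h ` carrier K"
  shows "\<exists>h'. h' \<in> hom (integer_mod_group p \<times>\<times> K) G \<and> inj_on h' (carrier (integer_mod_group p \<times>\<times> K))"
proof -
  interpret K: group K by (rule K)
  interpret h: group_hom K G h using h(1) K group_axioms by (simp add: group_hom_def group_hom_axioms_def)
  have p0: "p > 0" using p prime_gt_0_nat by blast
  have exp_dvd: "x [^] i = \<one>" if "int p dvd i" for i :: int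
  proof -
    obtain j where "i = int p * j" using \<open>int p dvd i\<close> by blast
    then have "x [^] i = (x [^] int p) [^] j" using x(1) by (simp add: int_pow_pow)
    then show ?thesis using exp[OF x(1)] by (simp add: int_pow_int)
  qed
  have mod: "x [^] (i mod int p) = x [^] i" for i :: int
  proof -
    have "x [^] i = x [^] (int p * (i div int p)) \<otimes> x [^] (i mod int p)"
      using x(1) by (simp flip: int_pow_mult)
    then show ?thesis using exp_dvd[of "int p * (i div int p)"] x(1) by simp
  qed
  have sub: "subgroup (h ` carrier K) G" by (rule h.img_is_subgroup)
  have notin: "int p dvd i" if i: "x [^] i \<in> h ` carrier K" for i :: int
  proof (rule ccontr)
    assume "\<not> int p dvd i"
    then have "coprime i (int p)" using p prime_imp_coprime[of "int p" i] by (simp add: coprime_commute)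
    then obtain u v where uv: "u * i + v * int p = 1" using bezout_int[of i "int p"] by auto
    have "(x [^] i) [^] u \<in> h ` carrier K" using subgroup_int_pow_closed[OF sub i] .
    moreover have "(x [^] i) [^] u = x"
    proof -
      have "x = x [^] (u * i + v * int p)" using x(1) uv by simp
      also have "\<dots> = x [^] (u * i) \<otimes> x [^] (v * int p)" using x(1) by (rule int_pow_mult)
      also have "\<dots> = (x [^] i) [^] u" using x(1) exp_dvd[of "v * int p"] by (simp add: int_pow_pow mult.commute)
      finally show ?thesis by simp
    qed
    ultimately show False using x(2) by simp
  qed
  let ?h = "\<lambda>(i, k). x [^] i \<otimes> h k" and ?R = "integer_mod_group p \<times>\<times> K"
  have hom: "?h \<in> hom ?R G"
    by (rule homI) (use x(1) in \<open>auto simp: mod int_pow_mult m_ac\<close>)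
  interpret h': group_hom ?R G ?h
    using hom DirProd_group[OF group_integer_mod_group K] group_axioms by (simp add: group_hom_def group_hom_axioms_def)
  have "inj_on ?h (carrier ?R)"
    unfolding h'.inj_on_one_iff
  proof (intro allI impI)
    show "a = \<one>\<^bsub>?R\<^esub>" if a: "a \<in> carrier ?R" "?h a = \<one>" for a
    proof -
      obtain i k where ik: "a = (i, k)" "0 \<le> i" "i < int p" "k \<in> carrier K"
        using a(1) p0 by (auto simp: carrier_integer_mod_group)
      have eq: "x [^] i \<otimes> h k = \<one>" using a(2) ik by simp
      then have "x [^] i = inv (h k)" using inv_equality[OF eq] x(1) ik(4) by simp
      then have "x [^] i = h (inv\<^bsub>K\<^esub> k)" using ik(4) by simp
      then have "x [^] i \<in> h ` carrier K" using ik(4) by (metis K.inv_closed imageI)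
      then have "int p dvd i" by (rule notin)
      then have "i = 0" using ik(2,3) zdvd_not_zless[of i "int p"] by linarith
      then have "h k = \<one>" using eq ik(4) by simp
      then have "k = \<one>\<^bsub>K\<^esub>" using h.inj_on_one_iff h(2) ik(4) by blast
      then show ?thesis using ik(1) \<open>i = 0\<close> by simp
    qed
  qed
  then show ?thesis using hom by blast
qed

definition exponent_group :: "nat \<Rightarrow> ('c, 'd) monoid_scheme \<Rightarrow> bool"
  where "exponent_group p G \<longleftrightarrow> comm_group G \<and> (\<forall>x\<in>carrier G. x [^]\<^bsub>G\<^esub> p = \<one>\<^bsub>G\<^esub>)"

text \<open>Starting from the trivial group, \<open>cyclic_extension\<close> adjoins a cyclic factor
  as long as the image is not everything, and counting decides when to stop. The innermost
  \<open>singleton_group ()\<close> is the start of this process.\<close>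

lemma exponent_group_models:
  assumes p: "prime p" and G: "exponent_group p G" and fin: "finite (carrier G)"
  shows "order G = 1 \<Longrightarrow> singleton_group () \<cong> G"
    and "order G = p \<Longrightarrow> integer_mod_group p \<times>\<times> singleton_group () \<cong> G"
    and "order G = p * p \<Longrightarrow> integer_mod_group p \<times>\<times> (integer_mod_group p \<times>\<times> singleton_group ()) \<cong> G"
proof -
  interpret comm_group G using G by (simp add: exponent_group_def)
  have exp: "\<And>x. x \<in> carrier G \<Longrightarrow> x [^]\<^bsub>G\<^esub> p = \<one>\<^bsub>G\<^esub>" using G by (simp add: exponent_group_def)
  let ?K0 = "singleton_group ()" and ?Z = "integer_mod_group p"
  let ?K1 = "?Z \<times>\<times> ?K0" let ?K2 = "?Z \<times>\<times> ?K1"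
  have p1: "p > 1" using p prime_gt_1_nat by blast
  have iso: "K \<cong> G" if h: "h \<in> hom K G" "inj_on h (carrier K)" "card (carrier K) = order G" for K and h :: "'e \<Rightarrow> 'a"
  proof -
    have "h ` carrier K \<subseteq> carrier G" using h(1) by (auto simp: hom_def)
    moreover have "card (h ` carrier K) = card (carrier G)" using card_image[OF h(2)] h(3) by (simp add: order_def)
    ultimately have "h ` carrier K = carrier G" using card_subset_eq fin by blast
    then show ?thesis using h by (auto simp: is_iso_def iso_def bij_betw_def)
  qed
  have ext: "\<exists>h'. h' \<in> hom (?Z \<times>\<times> K) G \<and> inj_on h' (carrier (?Z \<times>\<times> K))"
    if K: "group K" and h: "h \<in> hom K G" "inj_on h (carrier K)" "card (carrier K) < order G" for K and h :: "'e \<Rightarrow> 'a"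
  proof -
    have "card (h ` carrier K) < card (carrier G)" using card_image[OF h(2)] h(3) by (simp add: order_def)
    moreover have "h ` carrier K \<subseteq> carrier G" using h(1) by (auto simp: hom_def)
    ultimately obtain x where "x \<in> carrier G" "x \<notin> h ` carrier K" by (metis less_irrefl subset_antisym subsetI)
    then show ?thesis using cyclic_extension[OF p exp K h(1,2)] by blast
  qed
  have gK: "group ?K0" "group ?K1" by (simp_all add: DirProd_group)
  have cZ: "card (carrier ?Z) = p" using p1 by (simp add: carrier_integer_mod_group)
  have cK: "card (carrier ?K0) = 1" "card (carrier ?K1) = p" "card (carrier ?K2) = p * p"
    using cZ by (simp_all add: card_cartesian_product)
  have h0: "(\<lambda>_. \<one>\<^bsub>G\<^esub>) \<in> hom ?K0 G" "inj_on (\<lambda>_. \<one>\<^bsub>G\<^esub>) (carrier ?K0)" by (auto simp: hom_def)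
  show "order G = 1 \<Longrightarrow> ?K0 \<cong> G" using iso[OF h0] cK by simp
  have h1: "\<exists>h'. h' \<in> hom ?K1 G \<and> inj_on h' (carrier ?K1)" if "order G > 1"
    using ext[OF gK(1) h0] cK that by simp
  show "order G = p \<Longrightarrow> ?K1 \<cong> G" using h1 iso cK p1 by metis
  show "order G = p * p \<Longrightarrow> ?K2 \<cong> G"
  proof -
    assume o: "order G = p * p"
    moreover have "p < p * p" using p1 by simp
    ultimately obtain h where "h \<in> hom ?K1 G" "inj_on h (carrier ?K1)" using h1 p1 by (metis less_trans)
    then obtain h' where "h' \<in> hom ?K2 G" "inj_on h' (carrier ?K2)"
      using ext[OF gK(2), of h] cK(2) o \<open>p < p * p\<close> by auto
    then show ?thesis using iso[of h' ?K2] cK(3) o by simp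
  qed
qed

lemma exponent_group_iso:
  assumes p: "prime p" and G: "exponent_group p G" and H: "exponent_group p H"
    and eq: "ecard (carrier G) = ecard (carrier H)" "ecard (carrier G) \<in> {1, enat p, enat p * enat p}"
  shows "G \<cong> H"
proof -
  have fin: "finite (carrier G)" "finite (carrier H)" using eq by (auto simp: ecard_def one_enat_def split: if_splits)
  then have o: "order G = order H" "order G \<in> {1, p, p * p}"
    using eq by (auto simp: ecard_def order_def one_enat_def)
  have grp: "group (integer_mod_group p \<times>\<times> singleton_group ())" by (simp add: DirProd_group)
  then have grp': "group (integer_mod_group p \<times>\<times> (integer_mod_group p \<times>\<times> singleton_group ()))" by (simp add: DirProd_group)
  note G' = exponent_group_models[OF p G fin(1)] and H' = exponent_group_models[OF p H fin(2)]
  from o consider "order G = 1" | "order G = p" | "order G = p * p" by auto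
  then show ?thesis
  proof cases
    case 1
    then show ?thesis using iso_trans[OF group.iso_sym[OF _ G'(1)] H'(1)] o(1) by simp
  next
    case 2
    then show ?thesis using iso_trans[OF group.iso_sym[OF grp G'(2)] H'(2)] o(1) by simp
  next
    case 3
    then show ?thesis using iso_trans[OF group.iso_sym[OF grp' G'(3)] H'(3)] o(1) by simp
  qed
qed

section \<open>Chains with coefficients modulo p as reductions of integral chains\<close>

locale reduction =
  fixes p :: nat and X :: "'a topology"
  assumes p_pos: "p > 0"
begin

abbreviation Zp where "Zp \<equiv> integer_mod_group p"
abbreviation chains where "chains k \<equiv> coeff_chain_group k X Zp"

text \<open>By \<open>red_surj\<close> and \<open>red_eq_iff\<close> this reduction is onto and its
  fibres are the cosets of \<open>mod_chains p X {}\<close>. The values are the representatives used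
  by \<open>integer_mod_group\<close>, and the restricted abstraction is the extensionality of
  elements of \<open>sum_group\<close>.\<close>

definition red :: "nat \<Rightarrow> 'a chain \<Rightarrow> ((nat \<Rightarrow> real) \<Rightarrow> 'a) \<Rightarrow> int"
  where "red k c = (\<lambda>f\<in>singular_simplex_set k X. lookup c f mod int p)"

lemma carrier_chains:
  "carrier (chains k) = {x \<in> singular_simplex_set k X \<rightarrow>\<^sub>E {0..<int p}. finite {f \<in> singular_simplex_set k X. x f \<noteq> 0}}"
  unfolding coeff_chain_group_def using p_pos by (subst carrier_sum_group) (auto simp: carrier_integer_mod_group)

lemma mult_chains: "x \<otimes>\<^bsub>chains k\<^esub> y = (\<lambda>f\<in>singular_simplex_set k X. (x f + y f) mod int p)"
  by (simp add: coeff_chain_group_def)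

lemma one_chains: "\<one>\<^bsub>chains k\<^esub> = red k 0"
  by (simp add: coeff_chain_group_def red_def)

lemma comm_chains: "comm_group (chains k)"
proof (rule group.group_comm_groupI)
  show "group (chains k)" by (simp add: coeff_chain_group_def)
qed (simp add: mult_chains add.commute)

lemma red_carrier: "red k c \<in> carrier (chains k)"
proof -
  have "{f \<in> singular_simplex_set k X. red k c f \<noteq> 0} \<subseteq> keys c"
    by (auto simp: red_def in_keys_iff)
  then have "finite {f \<in> singular_simplex_set k X. red k c f \<noteq> 0}" by (rule finite_subset) simp
  then show ?thesis using p_pos by (auto simp: carrier_chains red_def)
qed

lemma red_surj:
  assumes x: "x \<in> carrier (chains k)"
  obtains c where "singular_chain k X c" "x = red k c"
proof
  let ?S = "{f \<in> singular_simplex_set k X. x f \<noteq> 0}"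
  let ?c = "\<Sum>f\<in>?S. frag_cmul (x f) (frag_of f)"
  have fin: "finite ?S" using x by (simp add: carrier_chains)
  show "singular_chain k X ?c" by (intro singular_chain_sum singular_chain_cmul) (auto simp: singular_chain_of)
  have "lookup ?c f = (if f \<in> ?S then x f else 0)" for f
    using fin by (simp add: lookup_sum lookup_frag_of if_distrib[of "\<lambda>z. x _ * z"] sum.delta cong: if_cong)
  then show "x = red k ?c"
    using x by (intro ext) (auto simp: carrier_chains red_def PiE_def extensional_def Pi_def)
qed

lemma red_add: "red k (c + d) = red k c \<otimes>\<^bsub>chains k\<^esub> red k d"
  by (auto simp: red_def mult_chains lookup_add mod_add_eq)

lemma red_eq_iff:
  assumes "singular_chain k X c" "singular_chain k X d"
  shows "red k c = red k d \<longleftrightarrow> c - d \<in> mod_chains p X {} k"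
proof
  assume eq: "red k c = red k d"
  show "c - d \<in> mod_chains p X {} k"
  proof (rule mod_chainsI[OF singular_chain_diff[OF assms]])
    fix f assume "singular_simplex k X f"
    then show "int p dvd lookup (c - d) f"
      using fun_cong[OF eq, of f] by (simp add: red_def lookup_minus mod_eq_dvd_iff)
  qed
next
  assume "c - d \<in> mod_chains p X {} k"
  then show "red k c = red k d" by (auto simp: red_def mod_chains_empty_iff lookup_minus mod_eq_dvd_iff)
qed

lemma finprod_Zp:
  "finite A \<Longrightarrow> (\<And>a. a \<in> A \<Longrightarrow> f a \<in> carrier Zp) \<Longrightarrow> finprod Zp f A = (\<Sum>a\<in>A. f a) mod int p"
proof (induction A rule: finite_induct)
  case (insert a A)
  interpret comm_group Zp by simp
  have "finprod Zp f (insert a A) = f a \<otimes>\<^bsub>Zp\<^esub> finprod Zp f A"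
    using insert.prems by (intro finprod_insert insert.hyps) blast+
  moreover have "finprod Zp f A = (\<Sum>a\<in>A. f a) mod int p" using insert.prems by (intro insert.IH) blast
  ultimately show ?case using insert.hyps by (simp add: mod_add_right_eq)
next
  case empty
  interpret comm_group Zp by simp
  show ?case using p_pos by simp
qed

text \<open>The product on the left runs over simplices whose coefficient is nonzero modulo p, the
  integral boundary over the whole support of c. The additional terms are divisible by p and vanish
  after reduction.\<close>

lemma coeff_boundary_red:
  assumes c: "singular_chain k X c"
  shows "coeff_boundary k X Zp (red k c) = red (k - 1) (chain_boundary k c)"
proof (cases "k = 0")
  case True
  then show ?thesis by (simp add: coeff_boundary_def one_chains chain_boundary_def)
next
  case False
  have "finprod Zp (\<lambda>(\<sigma>, j). red k c \<sigma> [^]\<^bsub>Zp\<^esub> ((- 1) ^ j :: int))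
         {(\<sigma>, j). singular_simplex k X \<sigma> \<and> red k c \<sigma> \<noteq> \<one>\<^bsub>Zp\<^esub> \<and> j \<le> k \<and> singular_face k j \<sigma> = g}
       = lookup (chain_boundary k c) g mod int p" for g
  proof -
    let ?K = "keys c \<times> {..k}"
    let ?Q = "{(\<sigma>, j). singular_simplex k X \<sigma> \<and> red k c \<sigma> \<noteq> \<one>\<^bsub>Zp\<^esub> \<and> j \<le> k \<and> singular_face k j \<sigma> = g}"
    let ?t = "\<lambda>x. (- 1) ^ snd x * lookup c (fst x)"
    have Q: "?Q = {x \<in> ?K. singular_face k (snd x) (fst x) = g \<and> \<not> int p dvd lookup c (fst x)}"
      using c by (auto simp: red_def singular_chain_def in_keys_iff dvd_eq_mod_eq_0)
    have carr: "z mod int p \<in> carrier Zp" for z using p_pos by (simp add: carrier_integer_mod_group)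
    have finK: "finite ?K" by simp
    then have "finite ?Q" unfolding Q by simp
    then have "finprod Zp (\<lambda>(\<sigma>, j). red k c \<sigma> [^]\<^bsub>Zp\<^esub> ((- 1) ^ j :: int)) ?Q
        = (\<Sum>(\<sigma>, j)\<in>?Q. red k c \<sigma> [^]\<^bsub>Zp\<^esub> ((- 1) ^ j :: int)) mod int p"
      by (rule finprod_Zp) (simp only: case_prod_beta int_pow_integer_mod_group carr)
    also have "(\<Sum>(\<sigma>, j)\<in>?Q. red k c \<sigma> [^]\<^bsub>Zp\<^esub> ((- 1) ^ j :: int)) = (\<Sum>x\<in>?Q. ?t x mod int p)"
    proof (rule sum.cong[OF refl])
      fix x assume "x \<in> ?Q"
      then have "red k c (fst x) = lookup c (fst x) mod int p" by (auto simp: red_def)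
      then show "(case x of (\<sigma>, j) \<Rightarrow> red k c \<sigma> [^]\<^bsub>Zp\<^esub> ((- 1) ^ j :: int)) = ?t x mod int p"
        by (simp only: case_prod_beta int_pow_integer_mod_group mod_mult_right_eq)
    qed
    also have "\<dots> = (\<Sum>x\<in>?K. if singular_face k (snd x) (fst x) = g \<and> \<not> int p dvd lookup c (fst x) then ?t x mod int p else 0)"
      unfolding Q using finK by (rule sum.inter_filter)
    also have "\<dots> = (\<Sum>x\<in>?K. (if singular_face k (snd x) (fst x) = g then ?t x else 0) mod int p)"
      by (rule sum.cong) auto
    also have "\<dots> mod int p = (\<Sum>x\<in>?K. if singular_face k (snd x) (fst x) = g then ?t x else 0) mod int p"
      by (rule mod_sum_eq)
    also have "(\<Sum>x\<in>?K. if singular_face k (snd x) (fst x) = g then ?t x else 0)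
        = (\<Sum>\<sigma>\<in>keys c. \<Sum>j\<le>k. if singular_face k j \<sigma> = g then (- 1) ^ j * lookup c \<sigma> else 0)"
      by (simp add: sum.cartesian_product case_prod_beta)
    also have "\<dots> = lookup (chain_boundary k c) g"
      using False by (auto simp: chain_boundary_def frag_extend_def lookup_sum lookup_frag_of sum_distrib_left
          intro!: sum.cong)
    finally show ?thesis .
  qed
  then show ?thesis using False unfolding red_def[of "k - 1" "chain_boundary k c"] by (simp add: coeff_boundary_def del: One_nat_def)
qed

lemma hom_coeff_boundary: "coeff_boundary k X Zp \<in> hom (chains k) (chains (k - 1))"
proof (rule homI)
  fix x assume "x \<in> carrier (chains k)"
  then obtain c where "singular_chain k X c" "x = red k c" by (rule red_surj)
  then show "coeff_boundary k X Zp x \<in> carrier (chains (k - 1))" by (simp add: coeff_boundary_red red_carrier)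
next
  fix x y assume "x \<in> carrier (chains k)" "y \<in> carrier (chains k)"
  then obtain c d where cd: "singular_chain k X c" "x = red k c" "singular_chain k X d" "y = red k d"
    using red_surj by metis
  have "x \<otimes>\<^bsub>chains k\<^esub> y = red k (c + d)" unfolding cd(2,4) red_add ..
  then have "coeff_boundary k X Zp (x \<otimes>\<^bsub>chains k\<^esub> y) = red (k - 1) (chain_boundary k c + chain_boundary k d)"
    using coeff_boundary_red[OF singular_chain_add[OF cd(1,3)]] by (simp only: chain_boundary_add)
  then show "coeff_boundary k X Zp (x \<otimes>\<^bsub>chains k\<^esub> y)
      = coeff_boundary k X Zp x \<otimes>\<^bsub>chains (k - 1)\<^esub> coeff_boundary k X Zp y"
    unfolding cd(2,4) coeff_boundary_red[OF cd(1)] coeff_boundary_red[OF cd(3)] red_add .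
qed

abbreviation cycles where "cycles k \<equiv> kernel (chains k) (chains (k - 1)) (coeff_boundary k X Zp)"
abbreviation bounds where "bounds k \<equiv> coeff_boundary (Suc k) X Zp ` carrier (chains (Suc k))"

lemma cycles_eq:
  "cycles k = red k ` rel_cycles chain_boundary (mod_chains p X {topspace X}) (mod_chains p X {}) k"
proof -
  have iff: "coeff_boundary k X Zp (red k c) = \<one>\<^bsub>chains (k - 1)\<^esub> \<longleftrightarrow> chain_boundary k c \<in> mod_chains p X {} (k - 1)"
    if "singular_chain k X c" for c
    using that singular_chain_boundary[OF that] red_eq_iff[of "k - 1" "chain_boundary k c" 0]
    by (simp add: coeff_boundary_red one_chains)
  show ?thesis
  proof (intro subset_antisym subsetI)
    fix x assume x: "x \<in> cycles k"
    then obtain c where "singular_chain k X c" "x = red k c" using red_surj by (auto simp: kernel_def)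
    then show "x \<in> red k ` rel_cycles chain_boundary (mod_chains p X {topspace X}) (mod_chains p X {}) k"
      using x iff by (auto simp: kernel_def rel_cycles_def mod_chains_topspace_iff)
  next
    fix x assume "x \<in> red k ` rel_cycles chain_boundary (mod_chains p X {topspace X}) (mod_chains p X {}) k"
    then show "x \<in> cycles k"
      using iff red_carrier by (auto simp: kernel_def rel_cycles_def mod_chains_topspace_iff)
  qed
qed

lemma bounds_eq: "x \<in> bounds k \<longleftrightarrow> (\<exists>y. singular_chain (Suc k) X y \<and> x = red k (chain_boundary (Suc k) y))"
proof -
  have 1: "coeff_boundary (Suc k) X Zp (red (Suc k) y) = red k (chain_boundary (Suc k) y)"
    if "singular_chain (Suc k) X y" for y
    using coeff_boundary_red[OF that] by simp
  show ?thesis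
  proof
    assume "x \<in> bounds k"
    then obtain z where z: "x = coeff_boundary (Suc k) X Zp z" "z \<in> carrier (chains (Suc k))" by blast
    obtain y where "singular_chain (Suc k) X y" "z = red (Suc k) y" using red_surj[OF z(2)] .
    then show "\<exists>y. singular_chain (Suc k) X y \<and> x = red k (chain_boundary (Suc k) y)" using z(1) 1 by blast
  next
    assume "\<exists>y. singular_chain (Suc k) X y \<and> x = red k (chain_boundary (Suc k) y)"
    then obtain y where y: "singular_chain (Suc k) X y" "x = red k (chain_boundary (Suc k) y)" by blast
    show "x \<in> bounds k" unfolding y(2) 1[OF y(1), symmetric] by (rule imageI[OF red_carrier])
  qed
qed

text \<open>\<open>red\<close> maps relative cycles onto cycles, and two of them have the same
  homology class exactly when they agree modulo relative boundaries; this compares the orders.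
  Exponent p is inherited from the chains, as p times a chain reduces to zero.\<close>

lemma homology_group_properties:
  shows "ecard (carrier (coeff_homology_group k X Zp)) = mod_homology_order p X k"
    and "exponent_group p (coeff_homology_group k X Zp)"
proof -
  interpret A: comm_group "chains k" by (rule comm_chains)
  let ?T = "rel_cycles chain_boundary (mod_chains p X {topspace X}) (mod_chains p X {}) k"
  let ?B = "rel_boundaries chain_boundary (mod_chains p X {topspace X}) (mod_chains p X {}) k"
  interpret C: complex_pair chain_boundary "mod_chains p X {topspace X}" "mod_chains p X {}"
    by (rule mod_chains_pair) (auto simp: small_def)
  interpret d: group_hom "chains k" "chains (k - 1)" "coeff_boundary k X Zp"
    using hom_coeff_boundary comm_chains[unfolded comm_group_def] by (simp add: group_hom_def group_hom_axioms_def)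
  interpret d': group_hom "chains (Suc k)" "chains k" "coeff_boundary (Suc k) X Zp"
    using hom_coeff_boundary[of "Suc k"] comm_chains[unfolded comm_group_def] by (simp add: group_hom_def group_hom_axioms_def)
  have sub: "subgroup (cycles k) (chains k)" by (rule d.subgroup_kernel)
  define G where "G = subgroup_generated (chains k) (cycles k)"
  interpret G: comm_group G unfolding G_def by (rule A.abelian_subgroup_generated[OF comm_chains])
  have carrier_G: "carrier G = cycles k" unfolding G_def by (rule subgroup.carrier_subgroup_generated_subgroup[OF sub])
  have "bounds k \<subseteq> cycles k"
  proof
    fix x assume "x \<in> bounds k"
    then obtain y where y: "singular_chain (Suc k) X y" "x = red k (chain_boundary (Suc k) y)" by (auto simp: bounds_eq)
    then show "x \<in> cycles k" unfolding cycles_eq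
      using singular_chain_boundary[OF y(1)] chain_boundary_boundary_Suc[OF y(1)]
      by (auto simp: rel_cycles_def mod_chains_topspace_iff C.D_simps intro!: imageI)
  qed
  then have subB: "subgroup (bounds k) G"
    unfolding G_def using d'.img_is_subgroup sub carrier_G[unfolded G_def] by (simp add: A.subgroup_subgroup_generated_iff)
  then have normal: "bounds k \<lhd> G" by (simp add: G.normal_iff_subgroup)
  have H: "coeff_homology_group k X Zp = G Mod bounds k" by (simp add: coeff_homology_group_def G_def)
  have T: "red k t \<in> carrier G" if "t \<in> ?T" for t using that unfolding carrier_G cycles_eq by (rule imageI)
  have iff: "bounds k #>\<^bsub>G\<^esub> red k s = bounds k #>\<^bsub>G\<^esub> red k t \<longleftrightarrow> ab_coset ?B s = ab_coset ?B t"
    if st: "s \<in> ?T" "t \<in> ?T" for s t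
  proof -
    have "singular_chain k X s" "singular_chain k X t"
      using st by (auto simp: rel_cycles_def mod_chains_topspace_iff)
    note sc = this
    have eq: "red k s = red k (chain_boundary (Suc k) y + t) \<longleftrightarrow> s - t - chain_boundary (Suc k) y \<in> mod_chains p X {} k"
      if y: "singular_chain (Suc k) X y" for y
    proof -
      have "singular_chain k X (chain_boundary (Suc k) y)" using singular_chain_boundary[OF y] by simp
      moreover have "s - (chain_boundary (Suc k) y + t) = s - t - chain_boundary (Suc k) y" by simp
      ultimately show ?thesis using red_eq_iff[OF sc(1) singular_chain_add[OF _ sc(2)]] by metis
    qed
    have "bounds k #>\<^bsub>G\<^esub> red k s = bounds k #>\<^bsub>G\<^esub> red k t \<longleftrightarrow> red k s \<in> bounds k #>\<^bsub>G\<^esub> red k t"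
      using G.repr_independence[OF _ T[OF st(2)] subB] G.repr_independenceD[OF subB T[OF st(1)]] by metis
    also have "\<dots> \<longleftrightarrow> (\<exists>b\<in>bounds k. red k s = b \<otimes>\<^bsub>chains k\<^esub> red k t)"
      by (auto simp: r_coset_def G_def)
    also have "\<dots> \<longleftrightarrow> (\<exists>y. singular_chain (Suc k) X y \<and> red k s = red k (chain_boundary (Suc k) y + t))"
      unfolding Bex_def bounds_eq red_add by blast
    also have "\<dots> \<longleftrightarrow> (\<exists>y. singular_chain (Suc k) X y \<and> s - t - chain_boundary (Suc k) y \<in> mod_chains p X {} k)"
      using eq by (intro ex_cong1 conj_cong refl)
    also have "\<dots> \<longleftrightarrow> s - t \<in> ?B"
      unfolding rel_boundaries_def mod_chains_topspace_iff[of _ p X, symmetric] by blast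
    also have "\<dots> \<longleftrightarrow> ab_coset ?B s = ab_coset ?B t" by (simp add: ab_coset_eq_iff C.sub_rel_boundaries)
    finally show ?thesis .
  qed
  have "carrier (coeff_homology_group k X Zp) = (\<lambda>t. bounds k #>\<^bsub>G\<^esub> red k t) ` ?T"
    unfolding H carrier_FactGroup carrier_G cycles_eq by (simp add: image_image)
  moreover have "ecard ((\<lambda>t. bounds k #>\<^bsub>G\<^esub> red k t) ` ?T) = ecard (ab_coset ?B ` ?T)"
    by (rule ecard_image_cong) (rule iff)
  ultimately show "ecard (carrier (coeff_homology_group k X Zp)) = mod_homology_order p X k"
    by (simp add: mod_homology_order_def homology_order_def quotient_order_def)
  have pow: "red k c [^]\<^bsub>chains k\<^esub> n = red k (frag_cmul (int n) c)" for c and n :: nat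
  proof (induction n)
    case (Suc n)
    have "frag_cmul (int (Suc n)) c = frag_cmul (int n) c + c"
      by (rule poly_mapping_eqI) (simp add: lookup_add algebra_simps)
    then show ?case by (simp only: red_add A.nat_pow_Suc Suc)
  qed (simp add: one_chains)
  show "exponent_group p (coeff_homology_group k X Zp)"
    unfolding exponent_group_def
  proof
    show "comm_group (coeff_homology_group k X Zp)" unfolding H by (rule G.abelian_FactGroup[OF subB])
    show "\<forall>x\<in>carrier (coeff_homology_group k X Zp). x [^]\<^bsub>coeff_homology_group k X Zp\<^esub> p = \<one>\<^bsub>coeff_homology_group k X Zp\<^esub>"
    proof
      fix x assume "x \<in> carrier (coeff_homology_group k X Zp)"
      then obtain z where z: "z \<in> carrier G" "x = bounds k #>\<^bsub>G\<^esub> z" by (auto simp: H carrier_FactGroup)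
      then have "z \<in> carrier (chains k)" using carrier_G by (simp add: kernel_def)
      then obtain c where c: "z = red k c" using red_surj by blast
      have "z [^]\<^bsub>G\<^esub> p = red k (frag_cmul (int p) c)" by (simp add: G_def pow_subgroup_generated c pow)
      also have "\<dots> = red k 0" by (auto simp: red_def)
      also have "\<dots> = \<one>\<^bsub>G\<^esub>" by (simp add: G_def one_chains)
      finally show "x [^]\<^bsub>coeff_homology_group k X Zp\<^esub> p = \<one>\<^bsub>coeff_homology_group k X Zp\<^esub>"
        unfolding H z(2) normal.FactGroup_pow[OF normal z(1)] by (simp add: G.coset_mult_one subB subgroup.subset)
    qed
  qed
qed

end

text \<open>The order \<open>p\<^sup>2\<close> is needed for the zeroth homology of the \<open>0\<close>-sphere only.\<close>

lemma isomorphic_graded_homology_iff: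
  assumes p: "prime p" and "\<And>k. mod_homology_order p Y k \<in> {1, enat p, enat p * enat p}"
  shows "isomorphic_graded_homology X Y (integer_mod_group p) \<longleftrightarrow> (\<forall>k. mod_homology_order p X k = mod_homology_order p Y k)"
proof -
  have p0: "p > 0" using p prime_gt_0_nat by blast
  interpret X: reduction p X using p0 by unfold_locales
  interpret Y: reduction p Y using p0 by unfold_locales
  have "coeff_homology_group k X (integer_mod_group p) \<cong> coeff_homology_group k Y (integer_mod_group p)
      \<longleftrightarrow> mod_homology_order p X k = mod_homology_order p Y k" for k
  proof
    assume "coeff_homology_group k X (integer_mod_group p) \<cong> coeff_homology_group k Y (integer_mod_group p)"
    then obtain h where "h \<in> iso (coeff_homology_group k X (integer_mod_group p)) (coeff_homology_group k Y (integer_mod_group p))"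
      by (auto simp: is_iso_def)
    then have "bij_betw h (carrier (coeff_homology_group k X (integer_mod_group p))) (carrier (coeff_homology_group k Y (integer_mod_group p)))"
      by (simp add: iso_def)
    then have "ecard (carrier (coeff_homology_group k X (integer_mod_group p))) = ecard (carrier (coeff_homology_group k Y (integer_mod_group p)))"
      by (rule ecard_bij)
    then show "mod_homology_order p X k = mod_homology_order p Y k"
      by (simp add: X.homology_group_properties Y.homology_group_properties)
  next
    assume "mod_homology_order p X k = mod_homology_order p Y k"
    then show "coeff_homology_group k X (integer_mod_group p) \<cong> coeff_homology_group k Y (integer_mod_group p)"
      using assms(2)[of k] by (intro exponent_group_iso[OF p X.homology_group_properties(2) Y.homology_group_properties(2)])
        (auto simp: X.homology_group_properties(1) Y.homology_group_properties(1))
  qed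
  then show ?thesis by (simp add: isomorphic_graded_homology_def)
qed

section \<open>Fixed point sets\<close>

lemma cmul_mem:
  assumes "ab_subgroup S" "z \<in> S"
  shows "frag_cmul m z \<in> S"
proof (induction m rule: int_induct[where k = 0])
  case base
  then show ?case using ab_subgroup_0[OF assms(1)] by simp
next
  case (step1 i)
  have "frag_cmul (i + 1) z = frag_cmul i z + z" by (rule poly_mapping_eqI) (simp add: lookup_add algebra_simps)
  then show ?case using ab_subgroup_add[OF assms(1) step1(2) assms(2)] by simp
next
  case (step2 i)
  have "frag_cmul (i - 1) z = frag_cmul i z - z" by (rule poly_mapping_eqI) (simp add: lookup_minus algebra_simps)
  then show ?case using ab_subgroup_diff[OF assms(1) step2(2) assms(2)] by simp
qed

text \<open>Otherwise m and p are coprime, and a Bezout combination of m z and p z would put z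
  itself into S.\<close>

lemma prime_dvd_of_cmul_mem:
  assumes p: "prime p" and S: "ab_subgroup S" and z: "z \<notin> S" "frag_cmul (int p) z \<in> S" and m: "frag_cmul m z \<in> S"
  shows "int p dvd m"
proof (rule ccontr)
  assume "\<not> int p dvd m"
  then have "coprime m (int p)" using p prime_imp_coprime[of "int p" m] by (simp add: coprime_commute)
  then obtain u v where uv: "u * m + v * int p = 1" using bezout_int[of m "int p"] by auto
  have "frag_cmul u (frag_cmul m z) + frag_cmul v (frag_cmul (int p) z) \<in> S"
    by (intro ab_subgroup_add[OF S] cmul_mem[OF S] z(2) m)
  moreover have "frag_cmul u (frag_cmul m z) + frag_cmul v (frag_cmul (int p) z) = frag_cmul (u * m + v * int p) z"
    by (rule poly_mapping_eqI) (simp add: lookup_add algebra_simps)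
  ultimately show False using z(1) uv by simp
qed

lemma inj_on_cosets:
  assumes p: "prime p" and S: "ab_subgroup S" and z: "z \<notin> S" "frag_cmul (int p) z \<in> S"
  shows "inj_on (\<lambda>i. ab_coset S (frag_cmul (int i) z)) {..<p}"
proof (rule inj_onI)
  fix i j assume ij: "i \<in> {..<p}" "j \<in> {..<p}" "ab_coset S (frag_cmul (int i) z) = ab_coset S (frag_cmul (int j) z)"
  then have "frag_cmul (int i) z - frag_cmul (int j) z \<in> S" by (simp add: ab_coset_eq_iff[OF S])
  moreover have "frag_cmul (int i) z - frag_cmul (int j) z = frag_cmul (int i - int j) z"
    by (rule poly_mapping_eqI) (simp add: lookup_minus algebra_simps)
  ultimately have "frag_cmul (int i - int j) z \<in> S" by (simp only:)
  then have "int p dvd int i - int j" by (rule prime_dvd_of_cmul_mem[OF p S z])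
  moreover have "\<bar>int i - int j\<bar> < int p" using ij(1,2) by auto
  ultimately have "int i - int j = 0" by (metis dvd_imp_le_int not_le abs_of_nat)
  then show "i = j" by simp
qed

text \<open>A nonzero class has p distinct multiples. This gap between 1 and p is what turns Floyd's
  inequality into a statement about a single degree, and it holds for infinite orders too.\<close>

lemma quotient_order_ge_p:
  assumes p: "prime p" and T: "ab_subgroup T" and S: "ab_subgroup S"
    and pT: "\<And>z. z \<in> T \<Longrightarrow> frag_cmul (int p) z \<in> S"
  shows "quotient_order T S = 1 \<or> quotient_order T S \<ge> enat p"
proof (cases "T \<subseteq> S")
  case True
  then show ?thesis using quotient_order_1_iff[OF T S] by simp
next
  case False
  then obtain z where z: "z \<in> T" "z \<notin> S" by blast
  have "ecard {..<p} \<le> quotient_order T S"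
    unfolding quotient_order_def
    by (rule ecard_inj_le[OF inj_on_cosets[OF p S z(2) pT[OF z(1)]]]) (use cmul_mem[OF T z(1)] in blast)
  then show ?thesis by (simp add: ecard_def)
qed

lemma quotient_order_p_generator:
  assumes p: "prime p" and T: "ab_subgroup T" and S: "ab_subgroup S"
    and pT: "\<And>z. z \<in> T \<Longrightarrow> frag_cmul (int p) z \<in> S"
    and order: "quotient_order T S = enat p" and z: "z \<in> T" "z \<notin> S" and t: "t \<in> T"
  obtains m :: nat where "t - frag_cmul (int m) z \<in> S"
proof -
  have fin: "finite (ab_coset S ` T)" "card (ab_coset S ` T) = p"
    using order by (auto simp: quotient_order_def ecard_def split: if_splits)
  have "(\<lambda>i. ab_coset S (frag_cmul (int i) z)) ` {..<p} \<subseteq> ab_coset S ` T"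
    using cmul_mem[OF T z(1)] by blast
  moreover have "card ((\<lambda>i. ab_coset S (frag_cmul (int i) z)) ` {..<p}) = p"
    using card_image[OF inj_on_cosets[OF p S z(2) pT[OF z(1)]]] by simp
  ultimately have "(\<lambda>i. ab_coset S (frag_cmul (int i) z)) ` {..<p} = ab_coset S ` T"
    using card_subset_eq[OF fin(1)] fin(2) by simp
  then obtain m where "ab_coset S t = ab_coset S (frag_cmul (int m) z)" using t by (metis (no_types, lifting) imageE imageI)
  then show ?thesis using that by (simp add: ab_coset_eq_iff[OF S])
qed

lemma enat_mult_left_cancel:
  "p > 0 \<Longrightarrow> enat p * x = enat p * y \<longleftrightarrow> x = y" "p > 0 \<Longrightarrow> enat p * x \<le> enat p * y \<longleftrightarrow> x \<le> y"
  by (cases x; cases y; simp add: imult_is_infinity zero_enat_def)+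

lemma enat_mult_le_eq:
  assumes "p > 0" "enat p \<le> x" "1 \<le> y" "x * y \<le> enat p"
  shows "x = enat p" "y = 1"
proof -
  obtain a where x: "x = enat a"
    using assms by (cases x; cases y) (auto simp: one_enat_def times_enat_simps split: if_splits)
  obtain b where y: "y = enat b"
    using assms x by (cases y) (auto simp: one_enat_def times_enat_simps split: if_splits)
  have ab: "p \<le> a" "1 \<le> b" "a * b \<le> p" using assms x y by (auto simp: one_enat_def)
  have "a * 1 \<le> a * b" using ab(2) by (rule mult_left_mono) simp
  then have "a = p" using ab by linarith
  moreover from this have "b = 1" using ab assms(1) by simp
  ultimately show "x = enat p" "y = 1" using x y by (simp_all add: one_enat_def)
qed

lemma prod_enat_ge_1:
  fixes f :: "'i \<Rightarrow> enat"
  assumes "\<And>k. f k \<ge> 1"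
  shows "(\<Prod>k\<in>A. f k) \<ge> 1"
proof (induction A rule: infinite_finite_induct)
  case (insert k A)
  have "1 * 1 \<le> f k * (\<Prod>k\<in>A. f k)" by (intro mult_mono assms insert.IH) simp_all
  then show ?case using insert.hyps by simp
qed simp_all

text \<open>The factor at m already uses up the whole bound p, so the product of the others is 1 and
  each of them is 1.\<close>

lemma concentrated_product:
  fixes f :: "nat \<Rightarrow> enat"
  assumes p: "p > 0" and f: "\<And>k. f k = 1 \<or> f k \<ge> enat p" and prod: "(\<Prod>k<K. f k) \<le> enat p"
    and m: "m < K" "f m \<noteq> 1" and k: "k < K"
  shows "f k = (if k = m then enat p else 1)"
proof -
  have f1: "f k \<ge> 1" for k using f[of k] p by (cases "f k") (auto simp: one_enat_def)
  have prod1: "(\<Prod>k\<in>A. f k) \<ge> 1" for A using f1 by (rule prod_enat_ge_1)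
  have fm: "enat p \<le> f m" using f[of m] m(2) by simp
  have split: "(\<Prod>k<K. f k) = f m * (\<Prod>k\<in>{..<K} - {m}. f k)" using m(1) by (simp add: prod.remove)
  note eq = enat_mult_le_eq[OF p fm prod1 prod[unfolded split]]
  show ?thesis
  proof (cases "k = m")
    case False
    then have "(\<Prod>k\<in>{..<K} - {m}. f k) = f k * (\<Prod>k\<in>{..<K} - {m} - {k}. f k)" using k by (simp add: prod.remove)
    then have "f k * 1 \<le> 1" using mult_left_mono[OF prod1, of "f k"] eq(2) by (metis zero_le)
    then show ?thesis using f1[of k] False by simp
  qed (use eq(1) in simp)
qed

context cyclic_cw
begin

abbreviation C where "C \<equiv> mod_chains p X {topspace X}"
abbreviation F where "F \<equiv> mod_chains p X {fixed_set}"
abbreviation P where "P \<equiv> mod_chains p X {}"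

lemma fixed_set_subset: "fixed_set \<subseteq> topspace X"
  by (auto simp: fixed_set_def)

lemma p_multiple_F: "singular_chain k X c \<Longrightarrow> frag_cmul (int p) c \<in> F k"
  by (rule cmul_mod_chains)

lemma act_F:
  assumes c: "c \<in> F k"
  shows "act k i c - c \<in> P k"
proof -
  obtain a e where ae: "c = a + frag_cmul (int p) e" "singular_chain k X a" "singular_chain k X e"
      "\<And>f. f \<in> keys a \<Longrightarrow> small k {fixed_set} f"
    using mod_chains_split[OF c] by metis
  have "singular_chain k (subtopology X fixed_set) a"
    using ae by (auto simp: singular_chain_subtopology small_singleton)
  then have "act k i a = a" unfolding act_def by (rule chain_map_id_gen) (simp add: pow_fixed_set)
  moreover have "act k i (frag_cmul (int p) e) = frag_cmul (int p) (act k i e)" by (simp add: act_def chain_map_cmul)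
  ultimately have "act k i c - c = frag_cmul (int p) (act k i e - e)"
    by (intro poly_mapping_eqI) (simp add: ae(1) act_add lookup_add lookup_minus algebra_simps)
  moreover have "singular_chain k X (act k i e - e)" using ae(3) by (intro singular_chain_diff singular_act)
  ultimately show ?thesis using cmul_mod_chains by metis
qed

text \<open>Where the group acts trivially, \<sigma> is thus multiplication by p, which is zero
  modulo p.\<close>

lemma \<sigma>_minus_multiple: "\<sigma> k c - frag_cmul (int p) c = (\<Sum>i<p. act k (p - i) c - c)"
  unfolding \<sigma>_def by (rule poly_mapping_eqI) (simp add: lookup_minus lookup_sum sum_subtractf)

lemma fixed_set_pair: obtains R where "free_pair p X \<gamma> {topspace X} {fixed_set} R"
  by (rule fixed_pair[of "topspace X" fixed_set]) (use \<gamma>_top in \<open>auto simp: fixed_set_def\<close>)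

text \<open>On chains of the fixed point set g is the identity up to P, so there \<tau> is zero and
  \<sigma> is multiplication by p, both zero modulo P. Outside the fixed point set all simplices
  have free orbits.\<close>

lemma floyd: "floyd_pair chain_boundary C F \<tau> \<sigma> P"
proof -
  obtain R where "free_pair p X \<gamma> {topspace X} {fixed_set} R" by (rule fixed_set_pair)
  then interpret CF: free_pair p X \<gamma> "{topspace X}" "{fixed_set}" R .
  show ?thesis
  proof (rule floyd_pair.intro[OF CF.smith_pair_axioms], unfold_locales)
    show "\<tau> k x \<in> P k" if x: "x \<in> F k" for k x
      using ab_subgroup_minus[OF sub_mod_chains act_F[OF x, of 1]] by (simp add: \<tau>_def)
    show "\<sigma> k x \<in> P k" if x: "x \<in> F k" for k x
    proof -
      have "\<sigma> k x - frag_cmul (int p) x \<in> P k"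
        unfolding \<sigma>_minus_multiple by (intro ab_subgroup_sum[OF sub_mod_chains] act_F[OF x])
      then have "(\<sigma> k x - frag_cmul (int p) x) + frag_cmul (int p) x \<in> P k"
        by (intro ab_subgroup_add[OF sub_mod_chains] cmul_mod_chains mod_chainsD[OF x])
      then show ?thesis by simp
    qed
    show "\<tau> k (\<sigma> k x) \<in> P k" "\<sigma> k (\<tau> k x) \<in> P k" if "x \<in> C k" for k x
      using mod_chainsD[OF that] ab_subgroup_0[OF sub_mod_chains] by (simp_all add: \<tau>_\<sigma> \<sigma>_\<tau>)
    show "P k \<subseteq> F k" for k by (auto simp: mod_chains_def small_def)
  qed (use sub_mod_chains chain_boundary_mod_chains in blast)+
qed

text \<open>
  The action on a group of prime order \<open>p\<close> is multiplication by some \<open>u\<close> with \<open>u ^ p \<equiv> 1\<close>, hence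
  \<open>u \<equiv> 1\<close> by Fermat's theorem.
\<close>

lemma trivial_action:
  assumes order: "homology_order chain_boundary C F n = enat p" and x: "x \<in> rel_cycles chain_boundary C F n"
  shows "act n i x - x \<in> rel_boundaries chain_boundary C F n"
proof -
  interpret floyd_pair chain_boundary C F \<tau> \<sigma> P by (rule floyd)
  let ?T = "rel_cycles chain_boundary C F n" and ?S = "rel_boundaries chain_boundary C F n"
  note S = sub_rel_boundaries[of n] and T = sub_rel_cycles[of n]
  have invC: "invariant {topspace X}" using \<gamma>_top by (auto simp: invariant_def)
  have invF: "invariant {fixed_set}" by (auto simp: invariant_def fixed_set_def)
  have p1: "1 \<le> p" using p_pos by simp
  have Tn: "singular_chain n X c" if "c \<in> ?T" for c using that mod_chainsD by (auto simp: rel_cycles_def)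
  have actT: "act n 1 c \<in> ?T" if "c \<in> ?T" for c
  proof -
    have "act n 1 c \<in> C n" "act (n - 1) 1 (chain_boundary n c) \<in> F (n - 1)"
      using that act_mod_chains[OF invC _ p1] act_mod_chains[OF invF _ p1] by (auto simp: rel_cycles_def)
    then show ?thesis using bd_act[OF Tn[OF that], of 1] by (simp add: rel_cycles_def)
  qed
  have actS: "act n 1 c \<in> ?S" if c: "c \<in> ?S" for c
  proof -
    obtain y where y: "y \<in> C (Suc n)" "c - chain_boundary (Suc n) y \<in> F n"
      using c unfolding rel_boundaries_def by blast
    have "act n 1 (c - chain_boundary (Suc n) y) \<in> F n" by (rule act_mod_chains[OF invF y(2) p1])
    moreover have "act n 1 (c - chain_boundary (Suc n) y) = act n 1 c - chain_boundary (Suc n) (act (Suc n) 1 y)"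
      using bd_act[OF mod_chainsD[OF y(1)], of 1] by (simp add: act_diff)
    ultimately have "act n 1 c - chain_boundary (Suc n) (act (Suc n) 1 y) \<in> F n" by (simp only:)
    then show ?thesis unfolding rel_boundaries_def using act_mod_chains[OF invC y(1) p1] by blast
  qed
  have pT: "frag_cmul (int p) c \<in> ?S" if "c \<in> ?T" for c
    using D_rel_boundaries[OF p_multiple_F[OF Tn[OF that]]] .
  have act_cmul: "act k i (frag_cmul m c) = frag_cmul m (act k i c)" for k i m c by (simp add: act_def chain_map_cmul)
  \<comment> \<open>The generator comes first; its powers follow by induction, since g preserves the
    relative boundaries.\<close>
  have one: "act n 1 c - c \<in> ?S" if c: "c \<in> ?T" for c
  proof (cases "?T \<subseteq> ?S")
    case True
    then show ?thesis using c actT[OF c] ab_subgroup_diff[OF S] by blast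
  next
    case False
    then obtain z where z: "z \<in> ?T" "z \<notin> ?S" by blast
    have gen: "\<exists>m::nat. t - frag_cmul (int m) z \<in> ?S" if t: "t \<in> ?T" for t
    proof (rule quotient_order_p_generator[OF prime_p T S _ order[unfolded homology_order_def] z t])
      show "frag_cmul (int p) y \<in> ?S" if "y \<in> ?T" for y using that by (rule pT)
    qed blast
    obtain u :: nat where u: "act n 1 z - frag_cmul (int u) z \<in> ?S" using gen[OF actT[OF z(1)]] by blast
    have pow: "act n i z - frag_cmul (int u ^ i) z \<in> ?S" for i
    proof (induction i)
      case 0
      then show ?case using ab_subgroup_0[OF S] act_0[OF Tn[OF z(1)]] by simp
    next
      case (Suc i)
      have "act n 1 (act n i z - frag_cmul (int u ^ i) z) + frag_cmul (int u ^ i) (act n 1 z - frag_cmul (int u) z) \<in> ?S"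
        by (intro ab_subgroup_add[OF S] actS Suc.IH cmul_mem[OF S] u)
      moreover have "act n 1 (act n i z - frag_cmul (int u ^ i) z) + frag_cmul (int u ^ i) (act n 1 z - frag_cmul (int u) z)
          = act n (Suc i) z - frag_cmul (int u ^ Suc i) z"
        by (rule poly_mapping_eqI) (simp add: act_diff act_cmul act_act lookup_add lookup_minus algebra_simps)
      ultimately show ?case by (simp only:)
    qed
    have "z - frag_cmul (int u ^ p) z \<in> ?S" using pow[of p] act_p[OF Tn[OF z(1)]] by simp
    moreover have "z - frag_cmul (int u ^ p) z = frag_cmul (1 - int u ^ p) z"
      by (rule poly_mapping_eqI) (simp add: lookup_minus algebra_simps)
    ultimately have up: "int p dvd 1 - int u ^ p"
      using prime_dvd_of_cmul_mem[OF prime_p S z(2) pT[OF z(1)]] by simp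
    have "\<not> p dvd u"
    proof
      assume "p dvd u"
      then have "int p dvd int u ^ p" using p_pos by (metis dvd_power dvd_trans int_dvd_int_iff dvd_power_same of_nat_dvd_iff)
      then have "int p dvd 1" using up by (metis dvd_diffD1 diff_add_cancel dvd_add)
      then show False using prime_p by (simp add: not_prime_unit)
    qed
    then have "[u ^ (p - 1) = 1] (mod p)" by (rule fermat_theorem[OF prime_p])
    then have "[u ^ (p - 1) * u = 1 * u] (mod p)" by (rule cong_scalar_right)
    moreover have "u ^ (p - 1) * u = u ^ p" using p_pos by (metis power_minus_mult)
    ultimately have "[u ^ p = u] (mod p)" by simp
    then have "[int (u ^ p) = int u] (mod int p)" by (simp only: cong_int_iff)
    then have "int p dvd int u ^ p - int u" by (simp add: cong_iff_dvd_diff)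
    then have "int p dvd (1 - int u ^ p) + (int u ^ p - int u)" using up by (rule dvd_add[rotated])
    then obtain v where v: "1 - int u = int p * v" by (auto elim: dvdE)
    have "act n 1 z - frag_cmul (int u) z - frag_cmul v (frag_cmul (int p) z) \<in> ?S"
      by (intro ab_subgroup_diff[OF S] u cmul_mem[OF S] pT z(1))
    moreover have "act n 1 z - frag_cmul (int u) z - frag_cmul v (frag_cmul (int p) z) = act n 1 z - z"
    proof (rule poly_mapping_eqI)
      fix f
      have "(1 - int u) * lookup z f = int p * v * lookup z f" by (simp only: v)
      then show "lookup (act n 1 z - frag_cmul (int u) z - frag_cmul v (frag_cmul (int p) z)) f = lookup (act n 1 z - z) f"
        by (simp add: lookup_minus lookup_add algebra_simps)
    qed
    ultimately have gz: "act n 1 z - z \<in> ?S" by (simp only:)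
    obtain m :: nat where m: "c - frag_cmul (int m) z \<in> ?S" using gen[OF c] by blast
    have "act n 1 (c - frag_cmul (int m) z) - (c - frag_cmul (int m) z) + frag_cmul (int m) (act n 1 z - z) \<in> ?S"
      by (intro ab_subgroup_add[OF S] ab_subgroup_diff[OF S] actS m cmul_mem[OF S] gz)
    moreover have "act n 1 (c - frag_cmul (int m) z) - (c - frag_cmul (int m) z) + frag_cmul (int m) (act n 1 z - z) = act n 1 c - c"
      by (rule poly_mapping_eqI) (simp add: act_diff act_cmul lookup_add lookup_minus algebra_simps)
    ultimately show ?thesis by (simp only:)
  qed
  show ?thesis
  proof (induction i)
    case 0
    then show ?case using ab_subgroup_0[OF S] act_0[OF Tn[OF x]] by simp
  next
    case (Suc i)
    have "act n 1 (act n i x - x) + (act n 1 x - x) \<in> ?S" by (intro ab_subgroup_add[OF S] actS Suc.IH one x)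
    moreover have "act n 1 (act n i x - x) + (act n 1 x - x) = act n (Suc i) x - x" by (simp add: act_diff act_act)
    ultimately show ?case by (simp only:)
  qed
qed

text \<open>On a single homology group of order p the action is trivial, so \<tau> and \<sigma>
  vanish on it and \<open>not_concentrated\<close> makes it zero, whereas p is not 1.\<close>

lemma relative_not_sphere:
  assumes dim: "\<And>n. n > N \<Longrightarrow> E n = {}"
  shows "\<not> (\<forall>k. homology_order chain_boundary C F k = (if k = n then enat p else 1))"
proof
  assume order: "\<forall>k. homology_order chain_boundary C F k = (if k = n then enat p else 1)"
  interpret floyd_pair chain_boundary C F \<tau> \<sigma> P by (rule floyd)
  have n: "homology_order chain_boundary C F n = enat p" using order by simp
  note S = sub_rel_boundaries[of n]
  have "acyclic_at chain_boundary C F n"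
  \<comment> \<open>The first degree covered by \<open>high_acyclic\<close>, which asks for k > N +
    3.\<close>
  proof (rule not_concentrated[where K = "N + 4"])
    show "acyclic_at chain_boundary C F k" if "k \<noteq> n" for k
      using order that homology_order_eq_1_iff[of k] by simp
    show "acyclic_at chain_boundary (image_plus C F \<tau>) F k \<and> acyclic_at chain_boundary (image_plus C F \<sigma>) F k"
      if "k \<ge> N + 4" for k
      using high_acyclic[OF dim, of N k] that by simp
    fix x assume x: "x \<in> rel_cycles chain_boundary C F n"
    then have sx: "singular_chain n X x" using mod_chainsD by (auto simp: rel_cycles_def)
    have "\<tau> n x \<in> rel_boundaries chain_boundary C F n"
      using ab_subgroup_minus[OF S trivial_action[OF n x, of 1]] by (simp add: \<tau>_def)
    moreover have "\<sigma> n x \<in> rel_boundaries chain_boundary C F n"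
    proof -
      have "\<sigma> n x - frag_cmul (int p) x \<in> rel_boundaries chain_boundary C F n"
        unfolding \<sigma>_minus_multiple by (intro ab_subgroup_sum[OF S] trivial_action[OF n x])
      then have "(\<sigma> n x - frag_cmul (int p) x) + frag_cmul (int p) x \<in> rel_boundaries chain_boundary C F n"
        using D_rel_boundaries[OF p_multiple_F[OF sx]] by (rule ab_subgroup_add[OF S])
      then show ?thesis by simp
    qed
    ultimately show "\<tau> n x \<in> rel_boundaries chain_boundary C F n \<and> \<sigma> n x \<in> rel_boundaries chain_boundary C F n" ..
  qed
  then show False using n prime_p homology_order_eq_1_iff[of n] by (simp add: one_enat_def)
qed

text \<open>Relative to a fixed point, Floyd's inequality becomes an inequality of reduced homology.\<close>

lemma fixed_point_orders:
  fixes a :: 'a and s :: "nat \<Rightarrow> enat"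
  assumes dim: "\<And>n. n > N \<Longrightarrow> E n = {}" and a: "a \<in> fixed_set"
    and s: "\<And>k. mod_homology_order p X k = (if k = 0 then enat p else 1) * s k"
  shows "\<exists>f. (\<forall>k. mod_homology_order p (subtopology X fixed_set) k = (if k = 0 then enat p else 1) * f k) \<and>
    (\<forall>k. f k = 1 \<or> f k \<ge> enat p) \<and> (\<forall>K. K > N + 3 \<longrightarrow> (\<Prod>k<K. f k) \<le> (\<Prod>k<K. s k)) \<and>
    ((\<forall>k. f k = 1) \<longrightarrow> (\<forall>k. homology_order chain_boundary C F k = s k))"
proof -
  interpret floyd_pair chain_boundary C F \<tau> \<sigma> P by (rule floyd)
  let ?A = "mod_chains p X {{a}}"
  let ?pt = "\<lambda>k::nat. if k = 0 then enat p else 1"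
  let ?f = "homology_order chain_boundary F ?A"
  have aX: "a \<in> topspace X" using a fixed_set_subset by blast
  interpret CA: complex_pair chain_boundary C ?A by (rule mod_chains_pair) (use aX in \<open>auto simp: small_singleton\<close>)
  interpret FA: complex_pair chain_boundary F ?A by (rule mod_chains_pair) (use a in \<open>auto simp: small_singleton\<close>)
  have F: "homology_order chain_boundary F P k = ?pt k * ?f k" for k
    by (rule mod_order_point_pair[OF aX a p_pos])
  have C: "homology_order chain_boundary C P k = ?pt k * homology_order chain_boundary C ?A k" for k
    by (rule mod_order_point_pair[OF aX aX p_pos])
  \<comment> \<open>The factor of the point is finite and positive, so it can be cancelled in
    \<open>enat\<close>.\<close>
  have C_s: "homology_order chain_boundary C ?A k = s k" for k
    using s[of k] C[of k] p_pos by (cases "k = 0") (simp_all add: mod_homology_order_def enat_mult_left_cancel)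
  have Cs: "homology_order chain_boundary C P k = ?pt k * s k" for k using C C_s by simp
  have high: "acyclic_at chain_boundary (image_plus C F \<tau>) F k" "acyclic_at chain_boundary (image_plus C F \<sigma>) F k"
    if "k > N + 3" for k
    using high_acyclic[OF dim, of N k] that by simp_all
  show ?thesis
  proof (intro exI[of _ ?f] conjI allI impI)
    show "mod_homology_order p (subtopology X fixed_set) k = ?pt k * ?f k" for k
      using subtopology_mod_order[OF fixed_set_subset, of p k] F[of k] by simp
    show "?f k = 1 \<or> ?f k \<ge> enat p" for k
      unfolding homology_order_def
    proof (rule quotient_order_ge_p[OF prime_p FA.sub_rel_cycles FA.sub_rel_boundaries])
      fix z assume "z \<in> rel_cycles chain_boundary F ?A k"
      then have "singular_chain k X z" using mod_chainsD by (auto simp: rel_cycles_def)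
      then show "frag_cmul (int p) z \<in> rel_boundaries chain_boundary F ?A k"
        by (intro FA.D_rel_boundaries cmul_mod_chains)
    qed
    show "(\<Prod>k<K. ?f k) \<le> (\<Prod>k<K. s k)" if K: "K > N + 3" for K
    proof -
      \<comment> \<open>The factors of the point multiply to a single p, coming from degree 0, on
        both sides of Floyd's inequality.\<close>
      have pt: "(\<Prod>k<K. ?pt k) = enat p" using K by (simp add: prod.delta)
      have "(\<Prod>k<K. ?pt k * ?f k) \<le> (\<Prod>k<K. ?pt k * s k)"
        using floyd_inequality[of K] high K by (simp add: F Cs)
      then have "enat p * (\<Prod>k<K. ?f k) \<le> enat p * (\<Prod>k<K. s k)" by (simp only: prod.distrib pt)
      then show ?thesis using p_pos by (simp add: enat_mult_left_cancel)
    qed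
    show "homology_order chain_boundary C F k = s k" if f: "\<forall>k. ?f k = 1" for k
    proof -
      \<comment> \<open>If F has the homology of its point a, the triple (C, F, a) identifies the
        orders for C relative to F with those relative to a.\<close>
      have "acyclic_at chain_boundary F ?A k" for k using f FA.homology_order_eq_1_iff by blast
      then have "homology_order chain_boundary C ?A k = ?f k * homology_order chain_boundary C F k"
        by (intro homology_order_triple[OF complex_pair_axioms FA.complex_pair_axioms CA.complex_pair_axioms])
          (auto simp: acyclic_at_def)
      then show ?thesis using f C_s by simp
    qed
  qed
qed

lemma fixed_set_empty:
  assumes "fixed_set = {}"
  shows "homology_order chain_boundary C F k = mod_homology_order p X k"
  by (simp add: assms mod_homology_order_def mod_chains_empty)

text \<open>If all f k were 1, C relative to F would have the homology of a sphere relative to a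
  point, which \<open>relative_not_sphere\<close> forbids. So some f m is at least p, and Floyd's
  inequality leaves no room for another degree.\<close>

lemma fixed_set_sphere:
  assumes dim: "\<And>n. n > N \<Longrightarrow> E n = {}" and X: "\<And>k. mod_homology_order p X k = mod_homology_order p (nsphere n) k"
    and ne: "fixed_set \<noteq> {}"
  shows "\<exists>m. \<forall>k. mod_homology_order p (subtopology X fixed_set) k = mod_homology_order p (nsphere m) k"
proof -
  let ?s = "\<lambda>k. if k = n then enat p else 1"
  obtain a where a: "a \<in> fixed_set" using ne by blast
  have X': "mod_homology_order p X k = (if k = 0 then enat p else 1) * ?s k" for k
    using X[of k] by (simp only: mod_homology_order_nsphere[OF p_pos])
  obtain f where f: "\<forall>k. mod_homology_order p (subtopology X fixed_set) k = (if k = 0 then enat p else 1) * f k"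
    "\<forall>k. f k = 1 \<or> f k \<ge> enat p" "\<forall>K. K > N + 3 \<longrightarrow> (\<Prod>k<K. f k) \<le> (\<Prod>k<K. ?s k)"
    "(\<forall>k. f k = 1) \<longrightarrow> (\<forall>k. homology_order chain_boundary C F k = ?s k)"
    using fixed_point_orders[of N a ?s, OF dim a X'] by blast
  have "\<not> (\<forall>k. f k = 1)" using relative_not_sphere[of N n, OF dim] f(4) by blast
  then obtain m where m: "f m \<noteq> 1" by blast
  have "f k = (if k = m then enat p else 1)" for k
  proof (rule concentrated_product[OF p_pos f(2)[rule_format]])
    \<comment> \<open>Large enough for Floyd's inequality and for the degrees m, k and n to occur in
      the products.\<close>
    let ?K = "Suc (N + 3 + m + k + n)"
    have "(\<Prod>j<?K. ?s j) = enat p" by (simp add: prod.delta del: prod.lessThan_Suc)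
    then show "(\<Prod>j<?K. f j) \<le> enat p" using f(3)[rule_format, of ?K] by (simp del: prod.lessThan_Suc)
  qed (use m in simp_all)
  then show ?thesis using f(1) by (auto simp: mod_homology_order_nsphere[OF p_pos])
qed

text \<open>With an empty fixed point set, C relative to F would be X itself, with a single homology
  group of order p in degree 0; this is the case n = 0 of \<open>relative_not_sphere\<close>. With a
  fixed point, Floyd's inequality bounds the product of all f k by 1.\<close>

lemma fixed_set_point:
  assumes dim: "\<And>n. n > N \<Longrightarrow> E n = {}" and X: "\<And>k. mod_homology_order p X k = mod_homology_order p point_space k"
  shows "mod_homology_order p (subtopology X fixed_set) k = mod_homology_order p point_space k"
proof -
  have X': "mod_homology_order p X k = (if k = 0 then enat p else 1)" for k
    using X[of k] by (simp only: mod_homology_order_point[OF p_pos])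
  have "fixed_set \<noteq> {}" using relative_not_sphere[of N 0, OF dim] fixed_set_empty X' by metis
  then obtain a where a: "a \<in> fixed_set" by blast
  have X'': "mod_homology_order p X k = (if k = 0 then enat p else 1) * 1" for k using X' by simp
  obtain f where f: "\<forall>k. mod_homology_order p (subtopology X fixed_set) k = (if k = 0 then enat p else 1) * f k"
    "\<forall>k. f k = 1 \<or> f k \<ge> enat p" "\<forall>K. K > N + 3 \<longrightarrow> (\<Prod>k<K. f k) \<le> (\<Prod>k<K. 1)"
    using fixed_point_orders[of N a "\<lambda>_. 1", OF dim a X''] by blast
  have f1: "f j \<ge> 1" for j using f(2)[rule_format, of j] p_pos by (cases "f j") (auto simp: one_enat_def)
  have "f k = 1"
  proof -
    let ?K = "Suc (N + 3 + k)"
    have "(\<Prod>j<?K. f j) = f k * (\<Prod>j\<in>{..<?K} - {k}. f j)" by (rule prod.remove) auto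
    moreover have "1 \<le> (\<Prod>j\<in>{..<?K} - {k}. f j)" using f1 by (rule prod_enat_ge_1)
    ultimately have "f k * 1 \<le> (\<Prod>j<?K. f j)" by (metis mult_left_mono zero_le)
    also have "\<dots> \<le> 1" using f(3)[rule_format, of ?K] by (simp del: prod.lessThan_Suc)
    finally show ?thesis using f1[of k] by simp
  qed
  then show ?thesis using f(1)[rule_format, of k] by (simp add: mod_homology_order_point[OF p_pos])
qed

end

text \<open>The powers of \<phi> 1 give the whole action, so a point fixed by the generator is fixed
  by the group. Cellularity transfers because \<open>below (Suc m)\<close> is the
  m-skeleton.\<close>

lemma cyclic_cw_of_G_CW_complex:
  assumes p: "prime p" and G: "G_CW_complex (integer_mod_group p) X E \<phi>"
  shows "cyclic_cw p X (\<phi> 1) E"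
    and "fixed_points (integer_mod_group p) X \<phi> = {x \<in> topspace X. \<phi> 1 x = x}"
proof -
  let ?Z = "integer_mod_group p"
  have p1: "p > 1" using p prime_gt_1_nat by blast
  then have carrier: "carrier ?Z = {0..<int p}" by (simp add: carrier_integer_mod_group)
  interpret group_action ?Z "topspace X" \<phi> using G by (simp add: G_CW_complex_def)
  have one: "1 \<in> carrier ?Z" using p1 by simp
  have cell: "cellular_map X E X E (\<phi> 1)" using G one by (simp add: G_CW_complex_def)
  have top: "\<phi> 1 x \<in> topspace X" if "x \<in> topspace X" for x using element_image[OF one that] by simp
  have pow: "(\<phi> 1 ^^ i) x = \<phi> (int i mod int p) x" if x: "x \<in> topspace X" for i x
  proof (induction i)
    case 0
    then show ?case using x fun_cong[OF id_eq_one, of x] by simp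
  next
    case (Suc i)
    have "int i mod int p \<in> carrier ?Z" using p1 carrier by simp
    then have "\<phi> (1 \<otimes>\<^bsub>?Z\<^esub> (int i mod int p)) x = \<phi> 1 (\<phi> (int i mod int p) x)"
      by (rule composition_rule[OF x one])
    then show ?case using Suc by (simp add: mod_add_right_eq add.commute)
  qed
  have pow_p: "(\<phi> 1 ^^ p) x = x" if x: "x \<in> topspace X" for x
    using pow[OF x, of p] fun_cong[OF id_eq_one, of x] x by simp
  interpret cw X E using G by unfold_locales (simp add: G_CW_complex_def)
  show "cyclic_cw p X (\<phi> 1) E"
  proof
    show "continuous_map X X (\<phi> 1)" using cell by (simp add: cellular_map_def)
    show "\<phi> 1 ` below n \<subseteq> below n" for n
    proof (cases n)
      case (Suc m)
      have "below (Suc m) = skeleton E m" by (simp add: below_def skeleton_def lessThan_Suc_atMost)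
      then show ?thesis using cell Suc by (simp add: cellular_map_def)
    qed (simp add: below_def)
    show "\<phi> 1 x = x" if "e \<in> E n" "\<phi> 1 ` e = e" "x \<in> e" for n e x
      using G one that unfolding G_CW_complex_def by blast
  qed (use p pow_p in auto)
  show "fixed_points ?Z X \<phi> = {x \<in> topspace X. \<phi> 1 x = x}"
  proof (intro subset_antisym subsetI)
    fix x assume "x \<in> {x \<in> topspace X. \<phi> 1 x = x}"
    then have x: "x \<in> topspace X" "\<phi> 1 x = x" by auto
    have "\<phi> g x = x" if "g \<in> carrier ?Z" for g
    proof -
      have "(\<phi> 1 ^^ i) x = x" for i by (induction i) (simp_all add: x(2))
      then show ?thesis using pow[OF x(1), of "nat g"] that carrier by (simp del: funpow.simps)
    qed
    then show "x \<in> fixed_points ?Z X \<phi>" using x by (simp add: fixed_points_def)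
  qed (use one in \<open>auto simp: fixed_points_def\<close>)
qed

theorem theorem4p1:
  fixes p :: nat and X :: "'a topology" and E :: "nat \<Rightarrow> 'a set set" and \<phi> :: "int \<Rightarrow> 'a \<Rightarrow> 'a"
  assumes "prime p"
    and "G_CW_complex (integer_mod_group p) X E \<phi>"
    and "finite_dimensional E"
  shows "((\<exists>n. isomorphic_graded_homology X (nsphere n) (integer_mod_group p)) \<longrightarrow>
            fixed_points (integer_mod_group p) X \<phi> = {} \<or>
            (\<exists>m. isomorphic_graded_homology
                   (subtopology X (fixed_points (integer_mod_group p) X \<phi>)) (nsphere m)
                   (integer_mod_group p))) \<and>
         (isomorphic_graded_homology X point_space (integer_mod_group p) \<longrightarrow>
            isomorphic_graded_homology
              (subtopology X (fixed_points (integer_mod_group p) X \<phi>)) point_space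
              (integer_mod_group p))"
proof -
  interpret cyclic_cw p X "\<phi> 1" E using cyclic_cw_of_G_CW_complex(1)[OF assms(1,2)] .
  have fixed: "fixed_points (integer_mod_group p) X \<phi> = fixed_set"
    using cyclic_cw_of_G_CW_complex(2)[OF assms(1,2)] by (simp add: fixed_set_def)
  obtain N where dim: "\<And>n. n > N \<Longrightarrow> E n = {}" using assms(3) by (auto simp: finite_dimensional_def)
  have sphere: "isomorphic_graded_homology Y (nsphere n) (integer_mod_group p) \<longleftrightarrow>
      (\<forall>k. mod_homology_order p Y k = mod_homology_order p (nsphere n) k)" for Y :: "'a topology" and n
    by (rule isomorphic_graded_homology_iff[OF assms(1)]) (simp add: mod_homology_order_nsphere[OF p_pos])
  have point: "isomorphic_graded_homology Y point_space (integer_mod_group p) \<longleftrightarrow>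
      (\<forall>k. mod_homology_order p Y k = mod_homology_order p point_space k)" for Y :: "'a topology"
    by (rule isomorphic_graded_homology_iff[OF assms(1)]) (simp add: mod_homology_order_point[OF p_pos])
  show ?thesis
    unfolding fixed sphere point
    using fixed_set_sphere[OF dim] fixed_set_point[OF dim] by blast
qed

end
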